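(* Let $k$ be a field, $M\supseteq k$ an infinite field, and $$f_{p,q}^{F_{20}}(X)=X^5+\Bigl(\frac{q^2+5pq-25}{p^2+4}-2p+2\Bigr)X^4+(p^2-p-3q+5)X^3+(q-3p+8)X^2+(p-6)X+1$$ (when $\mathrm{char}\,k\ne 2$ one may equivalently use $g^{F_{20}}_{p,r}(X)=f^{F_{20}}_{p,-(5p+8r+2p^2r)/2}(X)$). For $\mathbf{a}\in M^2$ write $L_{\mathbf{a}}=\mathrm{Spl}_Mf^{F_{20}}_{\mathbf{a}}(X)$ and $G_{\mathbf{a}}=\mathrm{Gal}(f^{F_{20}}_{\mathbf{a}}/M)$. Let $\mathbf{a},\mathbf{a}'\in M^2$ with $G_{\mathbf{a}}\cong G_{\mathbf{a}'}\cong F_{20}$, and let $\mathcal{H}_{\mathbf{a},\mathbf{a}'}(X)$ be the specialization at $(p,q,p',q')=(\mathbf{a},\mathbf{a}')$ of the degree-40 polynomial $\mathcal{H}$ of the context. Then exactly one of the following holds (listed as: GAP ID and structure of $G_{\mathbf{a},\mathbf{a}'}=\mathrm{Gal}(f^{F_{20}}_{\mathbf{a}}f^{F_{20}}_{\mathbf{a}'}/M)$; intersection; $\mathrm{DT}(\mathcal{H}_{\mathbf{a},\mathbf{a}'})$): (I-1) $[400,205]$, $F_{20}\times F_{20}$; $L_{\mathbf{a}}\cap L_{\mathbf{a}'}=M$; $40$. (I-2) $[200,42]$, $(D_5\times D_5)\rtimes C_2$; $[L_{\mathbf{a}}\cap L_{\mathbf{a}'}:M]=2$; $20^2$. (I-3)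 $[100,11]$, $(C_5\times C_5)\rtimes C_4$; $[L_{\mathbf{a}}\cap L_{\mathbf{a}'}:M]=4$; $10^4$. (I-4) $[100,12]$, $(C_5\times C_5)\rtimes C_4$; $[L_{\mathbf{a}}\cap L_{\mathbf{a}'}:M]=4$; $10^4$. (I-5) $[20,3]$, $F_{20}$; $L_{\mathbf{a}}=L_{\mathbf{a}'}$; $10^3,4^2,2$.
   Context: $F_{20}$ is the Frobenius group of order 20 (and $f^{F_{20}}_{p,q}$ is $k$-generic for it); $D_5$, $C_5$, $C_4$, $C_2$ are dihedral of order 10 and cyclic groups. Let $x,y,x',y'$ be independent indeterminates over $k$. Let $\sigma,\tau,\rho$ be the $k$-automorphisms of $k(x,y)$ with $\sigma: x\mapsto y,\ y\mapsto -(y-1)/x$; $\tau: x\mapsto x,\ y\mapsto -(x-1)/y$; $\rho: x\mapsto x/(x-1),\ y\mapsto (y-1)/(x+y-1)$, and $\sigma',\tau',\rho'$ the analogous automorphisms of $k(x',y')$, extended trivially to $k(x,y,x',y')$. Put $t=-\frac{(x-1)(y-1)(x+y-1)}{xy}$, $s=\sum_{i=0}^4\sigma^i((x-1)(y-1))$, and $s',t'$ likewise in $x',y'$; $\rho$ acts by $s\mapsto (s+5t)/t^2$, $t\mapsto -1/t$. Put $p=t-1/t$, $q=s+(s+5t)/t^2$ and $p',q'$ likewise; then $k(x,y)^{\langle\sigma,\rho\rangle}=k(p,q)$. Let $P=\sum_{i=0}^4\sigma^i(x)\sigma'^i(x')$ and $F^1_{s,t,s',t'}(X)=\prod_{h\in\langle\sigma',\tau'\rangle}(X-h(P))\in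 k(s,t,s',t')[X]$ (degree 10). Let $F^2=F^1_{\rho(s),\rho(t),s',t'}$, $F^3=F^1_{s,t,\rho'(s'),\rho'(t')}$, $F^4=F^1_{\rho(s),\rho(t),\rho'(s'),\rho'(t')}$, and $\mathcal{H}(X)=\prod_{i=1}^4F^i(X)$; its coefficients lie in $k(p,q,p',q')$. The decomposition type DT over $M$ is the multiset of degrees of irreducible factors over $M$ (exponents denote multiplicities), with the convention that if the specialized resolvent has repeated factors one first replaces the data by a Tschirnhausen transformation over $M$ making it squarefree (equivalently, DT is the multiset of orbit lengths of $G_{\mathbf{a},\mathbf{a}'}$ on the 40 cosets indexing the factors). GAP IDs refer to the SmallGroups library.
   Formalization: In (I-2) the group [200,42] is taken as the fibre product of two copies of F20 over F20/D5 = C2, a non-split extension of C2 by D5×D5: elements outside D5×D5 have order 4, so the written semidirect product (D5×D5)⋊C2 does not exist there. Parameters are assumed to satisfy p²+4≠0. *)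

theory Defs
  imports
    "HOL-Algebra.Algebraic_Closure_Type"
    "HOL-Algebra.Generated_Fields"
    "HOL-Algebra.Generated_Groups"
    "HOL-Algebra.Elementary_Groups"
    "HOL-Algebra.Bij"
    "HOL-Computational_Algebra.Squarefree"
    "HOL-Computational_Algebra.Polynomial_Factorial"
begin

section \<open>Splitting fields and Galois groups inside the algebraic closure\<close>

abbreviation ac_ring :: "'m::field alg_closure ring" where
  "ac_ring \<equiv> ring_of_type_algebra"

abbreviation base_field :: "'m::field alg_closure set" where
  "base_field \<equiv> range to_ac"

definition splitting_field :: "'m::field poly \<Rightarrow> 'm alg_closure set" where
  "splitting_field f =
     generate_field ac_ring (base_field \<union> {\<alpha>. poly (map_poly to_ac f) \<alpha> = 0})"

definition Gal :: "'m::field poly \<Rightarrow> ('m alg_closure \<Rightarrow> 'm alg_closure) monoid" where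
  "Gal f = (let L = splitting_field f; R = ac_ring\<lparr>carrier := L\<rparr> in
     (BijGroup L)\<lparr>carrier :=
        {\<phi> \<in> Bij L. \<phi> \<in> ring_hom R R \<and> (\<forall>c\<in>base_field. \<phi> c = c)}\<rparr>)"

text \<open>\<open>extension_degree n E\<close> says $[E : M] = n$ for an intermediate field \<open>E\<close>.\<close>

definition extension_degree :: "nat \<Rightarrow> 'm::field alg_closure set \<Rightarrow> bool" where
  "extension_degree n E \<longleftrightarrow> ring.dimension ac_ring n base_field E"


section \<open>The groups\<close>

definition semidirect ::
  "('a, 'c) monoid_scheme \<Rightarrow> ('b, 'd) monoid_scheme \<Rightarrow> ('b \<Rightarrow> 'a \<Rightarrow> 'a) \<Rightarrow> ('a \<times> 'b) monoid" where
  "semidirect N Q \<phi> =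
     \<lparr>carrier = carrier N \<times> carrier Q,
      monoid.mult = (\<lambda>(n, h) (n', h'). (n \<otimes>\<^bsub>N\<^esub> \<phi> h n', h \<otimes>\<^bsub>Q\<^esub> h')),
      one = (\<one>\<^bsub>N\<^esub>, \<one>\<^bsub>Q\<^esub>)\<rparr>"

abbreviation cyclic :: "nat \<Rightarrow> int monoid" where
  "cyclic n \<equiv> integer_mod_group n"

text \<open>The generator of $C_4$ acts on $C_5$ by multiplication by the primitive root 2 modulo 5.\<close>

definition F20 :: "(int \<times> int) monoid" where
  "F20 = semidirect (cyclic 5) (cyclic 4) (\<lambda>i x. (2 ^ nat i * x) mod 5)"

definition SmallGroup_400_205 :: "((int \<times> int) \<times> (int \<times> int)) monoid" where
  "SmallGroup_400_205 = F20 \<times>\<times> F20"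

text \<open>
  The subgroup $D_5 < F_{20}$ of order 10 consists of the \<open>(x, i)\<close> with \<open>i\<close> even.  The group
  [200,42] is $D_5 \times D_5$ extended by the pair $(\rho,\rho)$ of elements of order 4, i.e. the
  fibre product of two copies of $F_{20}$ over $F_{20}/D_5 \cong C_2$.  It is often described as
  $(D_5 \times D_5) \rtimes C_2$, but the extension does not split: elements outside
  $D_5 \times D_5$ have order 4.
\<close>

definition SmallGroup_200_42 :: "((int \<times> int) \<times> (int \<times> int)) monoid" where
  "SmallGroup_200_42 = (F20 \<times>\<times> F20)
     \<lparr>carrier := {(g, h). g \<in> carrier F20 \<and> h \<in> carrier F20 \<and> (even (snd g) \<longleftrightarrow> even (snd h))}\<rparr>"

text \<open>
  The generator of $C_4$ acts on $C_5 \times C_5$ by $\mathrm{diag}(2,2)$ in [100,11] and by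
  $\mathrm{diag}(2,3) = \mathrm{diag}(2,2^{-1})$ in [100,12].
\<close>

definition SmallGroup_100_11 :: "((int \<times> int) \<times> int) monoid" where
  "SmallGroup_100_11 = semidirect (cyclic 5 \<times>\<times> cyclic 5) (cyclic 4)
     (\<lambda>i (x, y). ((2 ^ nat i * x) mod 5, (2 ^ nat i * y) mod 5))"

definition SmallGroup_100_12 :: "((int \<times> int) \<times> int) monoid" where
  "SmallGroup_100_12 = semidirect (cyclic 5 \<times>\<times> cyclic 5) (cyclic 4)
     (\<lambda>i (x, y). ((2 ^ nat i * x) mod 5, (3 ^ nat i * y) mod 5))"

definition SmallGroup_20_3 :: "(int \<times> int) monoid" where
  "SmallGroup_20_3 = F20"


section \<open>The quintic polynomials\<close>

definition f_F20 :: "'m::field \<times> 'm \<Rightarrow> 'm poly" where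
  "f_F20 = (\<lambda>(p, q).
     [:1, p - 6, q - 3 * p + 8, p\<^sup>2 - p - 3 * q + 5,
       (q\<^sup>2 + 5 * p * q - 25) / (p\<^sup>2 + 4) - 2 * p + 2, 1:])"

definition g_F20 :: "'m::field \<times> 'm \<Rightarrow> 'm poly" where
  "g_F20 = (\<lambda>(p, r). f_F20 (p, - (5 * p + 8 * r + 2 * p\<^sup>2 * r) / 2))"

text \<open>The parameters at which the rational coefficients of \<open>f_F20\<close> are defined.\<close>

definition admissible :: "'m::field \<times> 'm \<Rightarrow> bool" where
  "admissible a \<longleftrightarrow> (fst a)\<^sup>2 + 4 \<noteq> 0"


section \<open>Rational functions in four indeterminates\<close>

type_synonym 'k poly4 = "'k poly poly poly poly"
type_synonym 'k ratfun4 = "'k poly4 fract"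

definition const4 :: "'k::field \<Rightarrow> 'k ratfun4" where
  "const4 c = to_fract [:[:[:[:c:]:]:]:]"

text \<open>The innermost polynomial variable is $x$, the outermost one $y'$.\<close>

definition x1 :: "'k::field ratfun4" where "x1 = to_fract [:[:[:[:0, 1:]:]:]:]"
definition y1 :: "'k::field ratfun4" where "y1 = to_fract [:[:[:0, 1:]:]:]"
definition x2 :: "'k::field ratfun4" where "x2 = to_fract [:[:0, 1:]:]"
definition y2 :: "'k::field ratfun4" where "y2 = to_fract [:0, 1:]"

definition eval_poly4 ::
  "('k::field \<Rightarrow> 'b::field) \<Rightarrow> 'b \<Rightarrow> 'b \<Rightarrow> 'b \<Rightarrow> 'b \<Rightarrow> 'k poly4 \<Rightarrow> 'b" where
  "eval_poly4 h u v u' v' P =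
     poly (map_poly (\<lambda>Q. poly (map_poly (\<lambda>R. poly (map_poly (\<lambda>S.
       poly (map_poly h S) u) R) v) Q) u') P) v'"

text \<open>
  The value of a rational function at a point $(u,v,u',v')$ of an extension field (along the
  embedding \<open>h\<close>), meaningful if some denominator of the function does not vanish there.
\<close>

definition eval_ratfun4 ::
  "('k::field \<Rightarrow> 'b::field) \<Rightarrow> 'b \<Rightarrow> 'b \<Rightarrow> 'b \<Rightarrow> 'b \<Rightarrow> 'k ratfun4 \<Rightarrow> 'b" where
  "eval_ratfun4 h u v u' v' r =
     (THE c. \<exists>n d. r = Fract n d \<and> eval_poly4 h u v u' v' d \<noteq> 0 \<and>
        c = eval_poly4 h u v u' v' n / eval_poly4 h u v u' v' d)"

text \<open>
  The automorphisms are the substitution maps.  The index 2 stands for the primed indeterminates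
  and for the automorphisms acting on them.
\<close>

definition \<sigma>1 :: "'k::field ratfun4 \<Rightarrow> 'k ratfun4" where
  "\<sigma>1 = eval_ratfun4 const4 y1 (- (y1 - 1) / x1) x2 y2"

definition \<tau>1 :: "'k::field ratfun4 \<Rightarrow> 'k ratfun4" where
  "\<tau>1 = eval_ratfun4 const4 x1 (- (x1 - 1) / y1) x2 y2"

definition \<rho>1 :: "'k::field ratfun4 \<Rightarrow> 'k ratfun4" where
  "\<rho>1 = eval_ratfun4 const4 (x1 / (x1 - 1)) ((y1 - 1) / (x1 + y1 - 1)) x2 y2"

definition \<sigma>2 :: "'k::field ratfun4 \<Rightarrow> 'k ratfun4" where
  "\<sigma>2 = eval_ratfun4 const4 x1 y1 y2 (- (y2 - 1) / x2)"

definition \<tau>2 :: "'k::field ratfun4 \<Rightarrow> 'k ratfun4" where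
  "\<tau>2 = eval_ratfun4 const4 x1 y1 x2 (- (x2 - 1) / y2)"

definition \<rho>2 :: "'k::field ratfun4 \<Rightarrow> 'k ratfun4" where
  "\<rho>2 = eval_ratfun4 const4 x1 y1 (x2 / (x2 - 1)) ((y2 - 1) / (x2 + y2 - 1))"

definition t1 :: "'k::field ratfun4" where
  "t1 = - ((x1 - 1) * (y1 - 1) * (x1 + y1 - 1) / (x1 * y1))"

definition s1 :: "'k::field ratfun4" where
  "s1 = (\<Sum>i = 0..4. (\<sigma>1 ^^ i) ((x1 - 1) * (y1 - 1)))"

definition t2 :: "'k::field ratfun4" where
  "t2 = - ((x2 - 1) * (y2 - 1) * (x2 + y2 - 1) / (x2 * y2))"

definition s2 :: "'k::field ratfun4" where
  "s2 = (\<Sum>i = 0..4. (\<sigma>2 ^^ i) ((x2 - 1) * (y2 - 1)))"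

definition p1 :: "'k::field ratfun4" where "p1 = t1 - 1 / t1"
definition q1 :: "'k::field ratfun4" where "q1 = s1 + (s1 + 5 * t1) / t1\<^sup>2"
definition p2 :: "'k::field ratfun4" where "p2 = t2 - 1 / t2"
definition q2 :: "'k::field ratfun4" where "q2 = s2 + (s2 + 5 * t2) / t2\<^sup>2"


section \<open>The resolvent of degree 40 and its specializations\<close>

definition P_inv :: "'k::field ratfun4" where
  "P_inv = (\<Sum>i = 0..4. (\<sigma>1 ^^ i) x1 * (\<sigma>2 ^^ i) x2)"

definition F1 :: "'k::field ratfun4 poly" where
  "F1 = (\<Prod>h \<in> generate (BijGroup UNIV) {\<sigma>2, \<tau>2}. [:- h P_inv, 1:])"

text \<open>
  $F^1$ has coefficients in $k(s,t,s',t')$, and $\rho$ fixes $s',t'$ while $\rho'$ fixes $s,t$.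
  So replacing $s,t$ by $\rho(s),\rho(t)$ amounts to applying $\rho$ to the coefficients.
\<close>

definition F2 :: "'k::field ratfun4 poly" where "F2 = map_poly \<rho>1 F1"
definition F3 :: "'k::field ratfun4 poly" where "F3 = map_poly \<rho>2 F1"
definition F4 :: "'k::field ratfun4 poly" where "F4 = map_poly (\<rho>1 \<circ> \<rho>2) F1"

definition H_res :: "'k::field ratfun4 poly" where
  "H_res = F1 * F2 * F3 * F4"

text \<open>
  An element of $k(p,q,p',q')$ is $R(p,q,p',q')$ for a unique rational function $R$ in four
  indeterminates, since $p,q,p',q'$ are algebraically independent; its specialization at
  $(\mathbf{a},\mathbf{a}')$ is $R(\mathbf{a},\mathbf{a}')$.
\<close>

definition specialize ::
  "('k::field \<Rightarrow> 'm::field) \<Rightarrow> 'm \<times> 'm \<Rightarrow> 'm \<times> 'm \<Rightarrow> 'k ratfun4 \<Rightarrow> 'm" where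
  "specialize \<iota> a a' c =
     eval_ratfun4 \<iota> (fst a) (snd a) (fst a') (snd a')
       (THE R. eval_ratfun4 const4 p1 q1 p2 q2 R = c)"

definition H_spec :: "('k::field \<Rightarrow> 'm::field) \<Rightarrow> 'm \<times> 'm \<Rightarrow> 'm \<times> 'm \<Rightarrow> 'm poly" where
  "H_spec \<iota> a a' = map_poly (specialize \<iota> a a') H_res"


section \<open>Decomposition types\<close>

definition factor_degrees :: "'m::field poly \<Rightarrow> nat multiset \<Rightarrow> bool" where
  "factor_degrees h D \<longleftrightarrow>
     (\<exists>A. (\<forall>g\<in>#A. Factorial_Ring.irreducible g) \<and> prod_mset A = h \<and>
          image_mset Polynomial.degree A = D)"

definition tschirnhausen :: "'m::field poly \<Rightarrow> 'm poly \<Rightarrow> bool" where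
  "tschirnhausen f g \<longleftrightarrow>
     (\<exists>u. Polynomial.degree u < Polynomial.degree f \<and>
        map_poly to_ac g =
          (\<Prod>\<alpha>\<in>#proots (map_poly to_ac f). [:- poly (map_poly to_ac u) \<alpha>, 1:]))"

definition tschirnhausen_equiv :: "'m::field poly \<Rightarrow> 'm poly \<Rightarrow> bool" where
  "tschirnhausen_equiv f g \<longleftrightarrow> tschirnhausen f g \<and> tschirnhausen g f"

text \<open>
  The decomposition type is read off after replacing the parameters by Tschirnhausen equivalent
  ones at which the resolvent is squarefree.  Such parameters must exist, and all of them
  (in particular the original ones, if the resolvent is squarefree there) must give the same
  degrees.
\<close>

definition DT ::
  "('k::field \<Rightarrow> 'm::field) \<Rightarrow> 'm \<times> 'm \<Rightarrow> 'm \<times> 'm \<Rightarrow> nat multiset \<Rightarrow> bool" where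
  "DT \<iota> a a' D \<longleftrightarrow>
     (let good = (\<lambda>b b'. admissible b \<and> admissible b' \<and>
            tschirnhausen_equiv (f_F20 a) (f_F20 b) \<and>
            tschirnhausen_equiv (f_F20 a') (f_F20 b') \<and>
            squarefree (H_spec \<iota> b b'))
      in (\<exists>b b'. good b b') \<and>
         (\<forall>b b'. good b b' \<longrightarrow> factor_degrees (H_spec \<iota> b b') D))"

definition exactly_one :: "bool list \<Rightarrow> bool" where
  "exactly_one Ps \<longleftrightarrow> (\<exists>!i. i < length Ps \<and> Ps ! i)"

end

theory Submission
  imports Defs
begin

text \<open>
  The orbit of \<open>x\<close> under \<open>\<sigma>\<close> satisfies the pentagon recurrence $x_{k-1} x_{k+1} = 1 - x_k$, and $F_{20}$ acts
  on the ten elements $x_k$ and $x_k / (x_k - 1)$ by affine permutations of the index \<open>k\<close> modulo 5.  The zeros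
  of $f_{p,q}$ are the $(x_k - 1) / x_k^2$, so a point $(u,v)$ over $\mathbf{a}$ turns the Galois group into a
  group of affine maps, and $G_{\mathbf{a},\mathbf{a}'}$ into a subdirect product of two copies of $F_{20}$.
  There are five such subgroups up to conjugation; they give the five cases, and the zeros of the resolvent are
  indexed by $\{0,1\} \times F_{20}$ with $(g, h)$ acting on the second component by $A \mapsto h A g^{-1}$.

  The coefficients of the generic resolvent are invariant under $F_{20} \times F_{20}$, hence polynomials in
  $p, q, p', q'$ and the inverses of $p^2 + 4$ and $p'^2 + 4$; so specialization commutes with evaluation at
  points.  Parameters with squarefree resolvent are found by applying a general Tschirnhausen transformation to
  the zeros and taking cross ratios of the five resulting numbers: cross ratios of five points again satisfy the
  pentagon recurrence, compatibly with $F_{20}$, and the ten functions above are linearly independent.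
\<close>

hide_const (open) Polynomials.degree Module.smult UnivPoly.coeff UnivPoly.monom Divisibility.irreducible

section \<open>Ring homomorphisms between types\<close>

text \<open>Galois theory is set up with automorphisms of the whole algebraic closure, because a
  single map has to act on two splitting fields and on points $(u,v)$ at once. In positive
  characteristic these maps may fix more than the base, so separability is carried along explicitly;
  this matters for $x_k$, known at first only as a root of $z X^2 - X + 1$ over the splitting field.
  Specializing the resolvent means evaluating rational functions in $p,q,p',q'$, whose denominators
  might vanish. Invariance inside the function field would therefore not be enough: descent is
  carried out in subrings with explicit generators, which shows that only $p^2+4$ and $p'^2+4$ occur
  as denominators, and admissibility keeps these away from 0. The decomposition type is required at
  every squarefree choice of equivalent parameters, not just at one. It depends only on the order of
  the Galois group, the two groups of order 100 having the same type, and that order is preserved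
  because Tschirnhausen equivalence preserves splitting fields.\<close>

definition rhom :: "('a::comm_ring_1 => 'b::comm_ring_1) => bool" where
  "rhom h \<longleftrightarrow> h 1 = 1 \<and> (\<forall>x y. h (x + y) = h x + h y) \<and> (\<forall>x y. h (x * y) = h x * h y)"

lemma rhomI:
  "h 1 = 1 ==> (!!x y. h (x + y) = h x + h y) ==> (!!x y. h (x * y) = h x * h y) ==> rhom h" by (simp add: rhom_def)

context
  fixes h :: "'a::comm_ring_1 => 'b::comm_ring_1"
  assumes h: "rhom h"
begin

lemma rhom_1: "h 1 = 1" and rhom_add: "h (x + y) = h x + h y" and rhom_mult: "h (x * y) = h x * h y" using h by (simp_all add: rhom_def)

lemma rhom_0: "h 0 = 0" using rhom_add[of 0 0] by simp

lemma rhom_minus: "h (- x) = - h x" using rhom_add[of x "- x"] rhom_0 by (simp add: eq_neg_iff_add_eq_0 add.commute)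

lemma rhom_diff: "h (x - y) = h x - h y" using rhom_add[of x "- y"] rhom_minus by simp

lemma rhom_power: "h (x ^ n) = h x ^ n" by (induction n) (simp_all add: rhom_1 rhom_mult)

lemma rhom_sum: "h (sum f A) = (\<Sum>a\<in>A. h (f a))" by (induction A rule: infinite_finite_induct) (simp_all add: rhom_0 rhom_add)

lemma rhom_prod: "h (prod f A) = (\<Prod>a\<in>A. h (f a))" by (induction A rule: infinite_finite_induct) (simp_all add: rhom_1 rhom_mult)

lemma rhom_of_nat: "h (of_nat n) = of_nat n" by (induction n) (simp_all add: rhom_0 rhom_1 rhom_add)

lemma rhom_numeral: "h (numeral n) = numeral n" using rhom_of_nat[of "numeral n"] by simp

lemmas rhom_simps = rhom_0 rhom_1 rhom_add rhom_mult rhom_minus rhom_diff rhom_power rhom_numeral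

lemma coeff_map_poly_rhom: "coeff (map_poly h p) n = h (coeff p n)" by (rule coeff_map_poly) (rule rhom_0)

lemma rhom_map_poly: "rhom (map_poly h)"
proof (rule rhomI)
  show "map_poly h (p + q) = map_poly h p + map_poly h q" for p q by (rule poly_eqI) (simp add: coeff_map_poly_rhom rhom_add)
  show "map_poly h (p * q) = map_poly h p * map_poly h q" for p q by (rule poly_eqI) (simp add: coeff_map_poly_rhom coeff_mult rhom_sum rhom_mult)
  show "map_poly h 1 = 1" by (rule poly_eqI) (simp add: coeff_map_poly_rhom rhom_1 rhom_0)
qed

lemma map_poly_pCons_rhom: "map_poly h (pCons a p) = pCons (h a) (map_poly h p)"
  by (rule poly_eqI) (simp add: coeff_map_poly_rhom coeff_pCons split: nat.split)

lemma poly_map_poly_rhom: "poly (map_poly h p) (h x) = h (poly p x)" by (induction p) (simp_all add: map_poly_pCons_rhom rhom_0 rhom_add rhom_mult)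

lemma rhom_poly_map_poly: "rhom (\<lambda>p. poly (map_poly h p) c)"
proof -
  note P = rhom_map_poly[unfolded rhom_def]
  show ?thesis by (rule rhomI) (use P in simp_all)
qed

end

lemma rhom_inverse:
  fixes h :: "'a::field => 'b::field"
  assumes "rhom h" shows "h (inverse x) = inverse (h x)"
proof (cases "x = 0")
  case False
  then have "h x * h (inverse x) = 1" using rhom_mult[OF assms, of x "inverse x"] rhom_1[OF assms] by simp
  then show ?thesis by (metis inverse_unique)
qed (simp add: rhom_0[OF assms])

lemma rhom_divide:
  fixes h :: "'a::field => 'b::field"
  assumes "rhom h" shows "h (x / y) = h x / h y" by (simp add: divide_inverse rhom_mult[OF assms] rhom_inverse[OF assms])

lemma rhom_eq_0_iff:
  fixes h :: "'a::field => 'b::field"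
  assumes "rhom h" shows "h x = 0 \<longleftrightarrow> x = 0"
proof
  assume "h x = 0"
  then have "h (x * inverse x) = 0" by (simp add: rhom_mult[OF assms])
  then show "x = 0" using rhom_1[OF assms] by (cases "x = 0") auto
qed (simp add: rhom_0[OF assms])

lemma rhom_eq_iff:
  fixes h :: "'a::field => 'b::field"
  assumes "rhom h" shows "h x = h y \<longleftrightarrow> x = y" using rhom_eq_0_iff[OF assms, of "x - y"] by (simp add: rhom_diff[OF assms])

lemma rhom_comp: "rhom g ==> rhom h ==> rhom (\<lambda>x. g (h x))" by (simp add: rhom_def)

lemma rhom_id: "rhom (\<lambda>x. x)" by (simp add: rhom_def)

lemma rhom_to_ac: "rhom to_ac" by (simp add: rhom_def)

lemma map_poly_to_ac_eq_iff: "map_poly to_ac p = map_poly to_ac q \<longleftrightarrow> p = q" by (auto simp: poly_eq_iff coeff_map_poly)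

section \<open>Galois theory through automorphisms of the algebraic closure\<close>

section \<open>Extending isomorphisms to the algebraic closure\<close>

text \<open>An isomorphism between subrings is represented by its graph, so that unions of chains
  are immediate.  The last condition expresses that the graph is single-valued.\<close>

definition partial_iso :: "('m::field alg_closure \<times> 'm alg_closure) set => bool" where
  "partial_iso R \<longleftrightarrow> (\<forall>c. (to_ac c, to_ac c) : R) \<and>
     (\<forall>a b c d. (a, b) : R --> (c, d) : R --> (a - c, b - d) : R \<and> (a * c, b * d) : R) \<and>
     (\<forall>b. (0, b) : R --> b = 0)"

text \<open>For the graph of an isomorphism this is the graph of the induced isomorphism of
  polynomial rings, so that a polynomial and its image travel as a pair.\<close>

definition poly_pairs :: "('a::comm_ring_1 \<times> 'a) set => ('a poly \<times> 'a poly) set" where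
  "poly_pairs R = {(p, q). \<forall>i. (coeff p i, coeff q i) : R}"

context
  fixes R :: "('m::field alg_closure \<times> 'm alg_closure) set"
  assumes R: "partial_iso R"
begin

lemma partial_iso_base: "(to_ac z, to_ac z) : R"
  and partial_iso_diff: "(a, b) : R ==> (c, d) : R ==> (a - c, b - d) : R"
  and partial_iso_mult: "(a, b) : R ==> (c, d) : R ==> (a * c, b * d) : R"
  and partial_iso_zeroD: "(0, b) : R ==> b = 0" using R by (auto simp: partial_iso_def)

lemma partial_iso_0: "(0, 0) : R" and partial_iso_1: "(1, 1) : R" using partial_iso_base[of 0] partial_iso_base[of 1] by simp_all

lemma partial_iso_add: "(a, b) : R ==> (c, d) : R ==> (a + c, b + d) : R"
  using partial_iso_diff[of a b "0 - c" "0 - d"] partial_iso_diff[OF partial_iso_0, of c d] by simp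

lemma partial_iso_sum: "(!!i. i : A ==> (f i, g i) : R) ==> (sum f A, sum g A) : R"
  by (induction A rule: infinite_finite_induct) (auto intro: partial_iso_0 partial_iso_add)

lemma partial_iso_unique: "(a, b) : R ==> (a, b') : R ==> b = b'" using partial_iso_diff[of a b a b'] partial_iso_zeroD[of "b - b'"] by simp

lemma poly_pairs_poly:
  "(p, q) : poly_pairs R ==> (a, b) : R ==> (poly p a, poly q b) : R"
proof (induction p arbitrary: q)
  case 0
  have "coeff q i = 0" for i using 0 partial_iso_zeroD by (auto simp: poly_pairs_def)
  then show ?case using partial_iso_0 by (simp add: poly_altdef)
next
  case (pCons c p)
  obtain d q' where q: "q = pCons d q'" by (cases q)
  have *: "(coeff (pCons c p) i, coeff (pCons d q') i) : R" for i using pCons.prems(1) by (simp add: q poly_pairs_def)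
  have cd: "(c, d) : R" and "(p, q') : poly_pairs R" using *[of 0] *[of "Suc _"] by (simp_all add: poly_pairs_def)
  then show ?case using pCons.IH[of q'] pCons.prems(2) by (auto simp: q intro!: partial_iso_add partial_iso_mult)
qed

lemma partial_iso_base_poly: "(a, b) : R ==> (poly (map_poly to_ac p) a, poly (map_poly to_ac p) b) : R"
  by (rule poly_pairs_poly) (auto simp: poly_pairs_def coeff_map_poly partial_iso_base)

text \<open>Inverses come for free because every element is algebraic over the base field.\<close>

lemma partial_iso_inverse:
  assumes ab: "(a, b) : R" and a: "a ~= 0"
  shows "(inverse a, inverse b) : R"
proof -
  define P where "P = (\<lambda>n. \<exists>p :: 'm poly. p ~= 0 \<and> poly (map_poly to_ac p) a = 0 \<and> degree p = n)"
  have "\<exists>n. P n" using alg_closure_algebraic[of a] unfolding P_def by metis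
  then have "P (LEAST n. P n)" by (rule LeastI_ex)
  then obtain p :: "'m poly" where p: "p ~= 0" "poly (map_poly to_ac p) a = 0" "degree p = (LEAST n. P n)" unfolding P_def by blast
  obtain c q where pq: "p = pCons c q" by (cases p)
  \<comment> \<open>Otherwise cancelling the factor $X$ would leave an annihilating polynomial of
    smaller degree.\<close>
  have c: "c ~= 0" proof
    assume "c = 0"
    then have "q ~= 0" "poly (map_poly to_ac q) a = 0" using p a by (auto simp: pq map_poly_pCons_rhom[OF rhom_to_ac])
    then have "(LEAST n. P n) \<le> degree q" by (intro Least_le) (auto simp: P_def)
    then show False using p(3) \<open>q ~= 0\<close> by (simp add: pq)
  qed
  \<comment> \<open>From $c + a q(a) = 0$ the inverse of $a$ is $-c^{-1} q(a)$, a polynomial over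
    the base in $a$, which the graph relates to the same polynomial in $b$.\<close>
  define e where "e = (\<lambda>a. to_ac (- inverse c) * poly (map_poly to_ac q) a)"
  have e: "(e a, e b) : R" unfolding e_def by (intro partial_iso_mult partial_iso_base partial_iso_base_poly ab)
  have "to_ac c + a * poly (map_poly to_ac q) a = 0" using p(2) by (simp add: pq map_poly_pCons_rhom[OF rhom_to_ac])
  then have "a * e a = 1" using c by (simp add: e_def field_simps add_eq_0_iff)
  moreover have "(a * e a, b * e b) : R" by (rule partial_iso_mult[OF ab e])
  ultimately have "b * e b = 1" using partial_iso_unique partial_iso_1 by metis
  then have "inverse a = e a" "inverse b = e b" using \<open>a * e a = 1\<close> by (simp_all add: inverse_unique)
  then show ?thesis using e by simp
qed

lemma partial_iso_zeroD': "(a, 0) : R ==> a = 0" using partial_iso_inverse[of a 0] partial_iso_mult[of "a" 0 "inverse a" 0]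
    partial_iso_unique[OF partial_iso_1, of 0] by (cases "a = 0") auto

lemma poly_pairs_diff:
  "(p, q) : poly_pairs R ==> (p', q') : poly_pairs R ==> (p - p', q - q') : poly_pairs R" by (auto simp: poly_pairs_def intro: partial_iso_diff)

lemma poly_pairs_mult:
  "(p, q) : poly_pairs R ==> (p', q') : poly_pairs R ==> (p * p', q * q') : poly_pairs R" unfolding poly_pairs_def coeff_mult mem_Collect_eq prod.case
  by (intro allI partial_iso_sum partial_iso_mult) simp_all

lemma poly_pairs_monom: "(a, b) : R ==> (monom a n, monom b n) : poly_pairs R" by (auto simp: poly_pairs_def coeff_monom partial_iso_0)

lemma poly_pairs_degree: "(p, q) : poly_pairs R ==> degree p = degree q"
proof -
  assume pq: "(p, q) : poly_pairs R"
  have "coeff p i = 0 \<longleftrightarrow> coeff q i = 0" for i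
    using pq partial_iso_zeroD[of "coeff q i"] partial_iso_zeroD'[of "coeff p i"] by (auto simp: poly_pairs_def dest: spec[of _ i])
  then show "degree p = degree q" by (simp add: degree_def)
qed

lemma poly_pairs_0: "(0, q) : poly_pairs R ==> q = 0" using partial_iso_zeroD by (auto simp: poly_pairs_def poly_eq_iff)

text \<open>Long division by a monic polynomial is run on both sides of the graph at once, so
  quotient and remainder are again related to each other.\<close>

lemma poly_pairs_division:
  assumes "(h, h') : poly_pairs R" and m: "(m, m') : poly_pairs R" "lead_coeff m = 1"
  shows "\<exists>q q' r r'. (q, q') : poly_pairs R \<and> (r, r') : poly_pairs R \<and> h = q * m + r \<and> h' = q' * m' + r' \<and>
           (r = 0 \<or> degree r < degree m)" using assms(1)
proof (induction "degree h" arbitrary: h h' rule: less_induct)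
  case less
  show ?case proof (cases "h = 0 \<or> degree h < degree m")
    case True
    have "(0, 0) : poly_pairs R" by (simp add: poly_pairs_def partial_iso_0)
    then show ?thesis using True less.prems by (intro exI[of _ 0] exI[of _ h] exI[of _ h']) auto
  next
    case False
    define d where "d = degree h - degree m"
    define q where "q = monom (lead_coeff h) d"
    define q' where "q' = monom (lead_coeff h') d"
    have "(lead_coeff h, lead_coeff h') : R" using less.prems poly_pairs_degree[OF less.prems] by (auto simp: poly_pairs_def)
    then have q: "(q, q') : poly_pairs R" unfolding q_def q'_def by (rule poly_pairs_monom)
    have m0: "m ~= 0" using m(2) by auto
    have q0: "q ~= 0" using False by (simp add: q_def monom_eq_0_iff)
    have degq: "degree (q * m) = degree h" using False m0 q0 by (simp add: degree_mult_eq) (simp add: q_def d_def degree_monom_eq)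
    have "lead_coeff (q * m) = lead_coeff h" using False m(2) unfolding lead_coeff_mult by (simp add: q_def degree_monom_eq)
    have deg: "h - q * m = 0 \<or> degree (h - q * m) < degree h" proof -
      have "coeff (h - q * m) (degree h) = 0" using \<open>lead_coeff (q * m) = lead_coeff h\<close> degq by (simp del: coeff_mult)
      moreover have "degree (h - q * m) \<le> degree h" using degq by (intro degree_diff_le) simp_all
      ultimately show ?thesis by (metis leading_coeff_0_iff order_le_less)
    qed
    have pair: "(h - q * m, h' - q' * m') : poly_pairs R" using less.prems q m(1) by (intro poly_pairs_diff poly_pairs_mult)
    show ?thesis proof (cases "h - q * m = 0")
      case True
      then have "h' - q' * m' = 0" using pair poly_pairs_0[of "h' - q' * m'"] by simp
      moreover have "(0, 0) : poly_pairs R" by (simp add: poly_pairs_def partial_iso_0)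
      ultimately show ?thesis using True q by (intro exI[of _ q] exI[of _ q'] exI[of _ 0]) simp
    next
      case False
      then have "degree (h - q * m) < degree h" using deg by simp
      from less.hyps[OF this pair] obtain s s' r r' where *: "(s, s') : poly_pairs R" "(r, r') : poly_pairs R"
        "h - q * m = s * m + r" "h' - q' * m' = s' * m' + r'" "r = 0 \<or> degree r < degree m" by (elim exE conjE) (rule that)
      have "(q + s, q' + s') : poly_pairs R" using q *(1) by (auto simp: poly_pairs_def intro: partial_iso_add)
      moreover have "h = (q + s) * m + r" "h' = (q' + s') * m' + r'" using *(3,4) by (simp_all add: algebra_simps)
      ultimately show ?thesis using *(2,5) by (intro exI conjI)
    qed
  qed
qed

lemma poly_pairs_base: "(map_poly to_ac p, map_poly to_ac p) : poly_pairs R" by (auto simp: poly_pairs_def coeff_map_poly partial_iso_base)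

text \<open>Provides the minimal polynomial of \<open>x\<close> over the domain of the graph
  together with its image. It exists because \<open>x\<close> is algebraic already over the base;
  divisibility comes from division with remainder and minimality of the degree.\<close>

lemma poly_pairs_monic_minimal:
  obtains m m' where "(m, m') : poly_pairs R" "lead_coeff m = 1" "lead_coeff m' = 1" "poly m x = 0"
    "!!h h'. (h, h') : poly_pairs R ==> poly h x = 0 ==> \<exists>q q'. (q, q') : poly_pairs R \<and> h = q * m \<and> h' = q' * m'"
proof -
  define P where "P = (\<lambda>n. \<exists>p q. (p, q) : poly_pairs R \<and> p ~= 0 \<and> poly p x = 0 \<and> degree p = n)"
  obtain p0 :: "'m poly" where "p0 ~= 0" "poly (map_poly to_ac p0) x = 0" using alg_closure_algebraic by blast
  then have "P (degree (map_poly to_ac p0))" unfolding P_def using poly_pairs_base by (metis map_poly_to_ac_eq_iff map_poly_0)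
  then have "P (LEAST n. P n)" by (rule LeastI)
  then obtain p q where p: "(p, q) : poly_pairs R" "p ~= 0" "poly p x = 0" "degree p = (LEAST n. P n)" unfolding P_def by blast
  define c d where "c = inverse (lead_coeff p)" and "d = inverse (lead_coeff q)"
  have deg: "degree p = degree q" by (rule poly_pairs_degree[OF p(1)])
  have lc: "(lead_coeff p, lead_coeff q) : R" using p(1) deg by (auto simp: poly_pairs_def)
  have lq: "lead_coeff q ~= 0" using lc p(2) partial_iso_zeroD' by fastforce
  have cd: "(c, d) : R" unfolding c_def d_def using lc p(2) by (intro partial_iso_inverse) auto
  define m m' where "m = smult c p" and "m' = smult d q"
  have m: "(m, m') : poly_pairs R" using p(1) cd by (auto simp: m_def m'_def poly_pairs_def intro: partial_iso_mult)
  have lm: "lead_coeff m = 1" "lead_coeff m' = 1" using p(2) lq by (simp_all add: m_def m'_def c_def d_def flip: leading_coeff_0_iff)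
  have mx: "poly m x = 0" using p(3) by (simp add: m_def)
  have degm: "degree m = (LEAST n. P n)" unfolding p(4)[symmetric] using p(2) by (simp add: m_def c_def)
  show thesis proof (rule that[OF m lm mx])
    fix h h' assume h: "(h, h') : poly_pairs R" "poly h x = 0"
    obtain q q' r r' where *: "(q, q') : poly_pairs R" "(r, r') : poly_pairs R" "h = q * m + r" "h' = q' * m' + r'"
      "r = 0 \<or> degree r < degree m" using poly_pairs_division[OF h(1) m lm(1)] by blast
    have "r = 0" proof (rule ccontr)
      assume r: "r ~= 0"
      have "poly r x = 0" using h(2) *(3) mx by simp
      then have "P (degree r)" using *(2) r unfolding P_def by blast
      then have "(LEAST n. P n) \<le> degree r" by (rule Least_le)
      then show False using *(5) r degm by simp
    qed
    moreover from this have "r' = 0" using *(2) poly_pairs_0[of r'] by simp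
    ultimately show "\<exists>q q'. (q, q') : poly_pairs R \<and> h = q * m \<and> h' = q' * m'"
      using *(1,3,4) by (intro exI[of _ q] exI[of _ q']) simp
  qed
qed

text \<open>The hypothesis is what makes the substitution $h(x) \<mapsto> h'(x')$
  single-valued.\<close>

lemma partial_iso_adjoin:
  assumes *: "!!h h'. (h, h') : poly_pairs R ==> poly h x = 0 ==> poly h' x' = 0"
  shows "partial_iso {(poly h x, poly h' x') | h h'. (h, h') : poly_pairs R}" (is "partial_iso ?S")
proof -
  have "(to_ac c, to_ac c) : ?S" for c using poly_pairs_base[of "[:c:]"] by (force simp: map_poly_pCons_rhom[OF rhom_to_ac])
  moreover have "(a - c, b - d) : ?S \<and> (a * c, b * d) : ?S" if abcd: "(a, b) : ?S" "(c, d) : ?S" for a b c d proof -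
    obtain h h' k k' where hk: "(h, h') : poly_pairs R" "(k, k') : poly_pairs R" "a = poly h x" "b = poly h' x'"
      "c = poly k x" "d = poly k' x'" using abcd by blast
    have "(a - c, b - d) = (poly (h - k) x, poly (h' - k') x')" "(a * c, b * d) = (poly (h * k) x, poly (h' * k') x')" using hk by simp_all
    then show ?thesis using poly_pairs_diff[OF hk(1,2)] poly_pairs_mult[OF hk(1,2)] by blast
  qed
  moreover have "b = 0" if "(0, b) : ?S" for b using that * by force
  ultimately show ?thesis unfolding partial_iso_def by blast
qed

text \<open>The simple extension step: \<open>x\<close> is sent to a root of the image of its
  minimal polynomial, and the closure contains such a root.\<close>

lemma partial_iso_extend:
  "\<exists>R'. partial_iso R' \<and> R \<subseteq> R' \<and> x : Domain R'"
proof -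
  obtain m m' where m: "(m, m') : poly_pairs R" "lead_coeff m = 1" "lead_coeff m' = 1" "poly m x = 0"
    "!!h h'. (h, h') : poly_pairs R ==> poly h x = 0 ==> \<exists>q q'. (q, q') : poly_pairs R \<and> h = q * m \<and> h' = q' * m'"
    using poly_pairs_monic_minimal[of x] by blast
  have "degree m ~= 0" proof
    assume "degree m = 0"
    then obtain c where "m = [:c:]" by (rule degree_eq_zeroE)
    then show False using m(2,4) by simp
  qed
  then have "degree m' > 0" using poly_pairs_degree[OF m(1)] by simp
  then obtain x' where x': "poly m' x' = 0" using alg_closed_imp_poly_has_root by blast
  let ?S = "{(poly h x, poly h' x') | h h'. (h, h') : poly_pairs R}"
  have "partial_iso ?S" by (rule partial_iso_adjoin) (use m(5) x' in fastforce)
  moreover have "R \<subseteq> ?S" proof safe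
    fix a b assume ab: "(a, b) : R"
    then show "\<exists>h h'. (a, b) = (poly h x, poly h' x') \<and> (h, h') : poly_pairs R"
      using poly_pairs_monom[OF ab, of 0] by (metis monom_0 poly_const_conv)
  qed
  moreover have "(x, x') : ?S" using poly_pairs_monom[OF partial_iso_1, of 1] by (auto simp: poly_monom intro!: exI[of _ "monom 1 1"])
  ultimately show ?thesis by blast
qed

end

text \<open>The automorphisms of the closure over the base. Working with these instead of individual
  Galois groups lets one map be restricted to several splitting fields and compared on their
  compositum.\<close>

definition ac_auts :: "('m::field alg_closure => 'm alg_closure) set" where
  "ac_auts = {\<phi>. rhom \<phi> \<and> bij \<phi> \<and> (\<forall>c. \<phi> (to_ac c) = to_ac c)}"

lemma ac_auts_rhom: "\<phi> : ac_auts ==> rhom \<phi>"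
  and ac_auts_bij: "\<phi> : ac_auts ==> bij \<phi>"
  and ac_auts_base: "\<phi> : ac_auts ==> \<phi> (to_ac c) = to_ac c" by (auto simp: ac_auts_def)

lemma ac_auts_map_poly: "\<phi> : ac_auts ==> map_poly \<phi> (map_poly to_ac p) = map_poly to_ac p"
  by (rule poly_eqI) (simp add: coeff_map_poly_rhom[OF ac_auts_rhom] coeff_map_poly ac_auts_base)

lemma ac_auts_poly: "\<phi> : ac_auts ==> \<phi> (poly (map_poly to_ac p) x) = poly (map_poly to_ac p) (\<phi> x)"
  using poly_map_poly_rhom[OF ac_auts_rhom] ac_auts_map_poly by metis

text \<open>Every \<open>y\<close> is a root of a nonzero polynomial over the base; the map sends
  the finite set of its roots injectively into itself, hence onto.\<close>

lemma rhom_base_surj: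
  fixes \<phi> :: "'m::field alg_closure => 'm alg_closure"
  assumes hom: "rhom \<phi>" and base: "!!c. \<phi> (to_ac c) = to_ac c"
  shows "surj \<phi>"
proof -
  have "y : range \<phi>" for y proof -
    obtain p :: "'m poly" where p: "p ~= 0" "poly (map_poly to_ac p) y = 0" using alg_closure_algebraic by blast
    define A where "A = {x. poly (map_poly to_ac p) x = 0}"
    have fin: "finite A" unfolding A_def by (rule poly_roots_finite) (metis p(1) map_poly_to_ac_eq_iff map_poly_0)
    have "map_poly \<phi> (map_poly to_ac p) = map_poly to_ac p" by (rule poly_eqI) (simp add: coeff_map_poly_rhom[OF hom] coeff_map_poly base)
    then have "\<phi> ` A \<subseteq> A" unfolding A_def using poly_map_poly_rhom[OF hom] rhom_0[OF hom] by (smt (verit) image_subsetI mem_Collect_eq)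
    moreover have "inj_on \<phi> A" using rhom_eq_iff[OF hom] by (simp add: inj_on_def)
    ultimately have "\<phi> ` A = A" using fin by (simp add: endo_inj_surj)
    then show ?thesis using p(2) A_def by blast
  qed
  then show ?thesis by blast
qed

text \<open>By Zorn's lemma there is a maximal graph above \<open>R\<close>; the simple extension
  step makes it total, and surjectivity is then automatic by \<open>rhom_base_surj\<close>.\<close>

theorem partial_iso_extends_to_ac_aut:
  assumes R: "partial_iso R"
  shows "\<exists>\<phi>\<in>ac_auts. \<forall>a b. (a, b) : R --> \<phi> a = b"
proof -
  let ?A = "{S. partial_iso S \<and> R \<subseteq> S}"
  have "\<exists>S\<in>?A. \<forall>T\<in>?A. S \<subseteq> T --> T = S" proof (rule subset_Zorn_nonempty)
    show "?A ~= {}" using R by blast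
    fix C assume C: "C ~= {}" "subset.chain ?A C"
    have iso: "partial_iso S" if "S : C" for S using C(2) that by (auto simp: subset.chain_def)
    have chain: "S \<subseteq> T \<or> T \<subseteq> S" if "S : C" "T : C" for S T using C(2) that unfolding subset_chain_def by blast
    have "partial_iso (\<Union>C)" unfolding partial_iso_def proof (intro conjI allI impI)
      show "(to_ac c, to_ac c) : \<Union>C" for c using C(1) partial_iso_base[OF iso] by blast
      show "b = 0" if "(0, b) : \<Union>C" for b using that partial_iso_zeroD[OF iso] by blast
      fix a b c d assume "(a, b) : \<Union>C" "(c, d) : \<Union>C"
      then obtain S where S: "S : C" "(a, b) : S" "(c, d) : S" using chain by blast
      show "(a - c, b - d) : \<Union>C" "(a * c, b * d) : \<Union>C"
        using partial_iso_diff[OF iso[OF S(1)] S(2,3)] partial_iso_mult[OF iso[OF S(1)] S(2,3)] S(1) by blast+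
    qed
    moreover have "R \<subseteq> \<Union>C" using C unfolding subset_chain_def by blast
    ultimately show "\<Union>C \<in> ?A" by blast
  qed
  then obtain S where S_A: "S : ?A" and S_max: "\<forall>T\<in>?A. S \<subseteq> T --> T = S" by (elim bexE)
  then have S: "partial_iso S" "R \<subseteq> S" by simp_all
  have max: "T = S" if "partial_iso T" "S \<subseteq> T" for T using S_max S(2) that by simp
  have total: "\<exists>b. (a, b) : S" for a proof -
    obtain R' where "partial_iso R'" "S \<subseteq> R'" "a : Domain R'" using partial_iso_extend[OF S(1)] by blast
    then show ?thesis using max by blast
  qed
  define \<phi> where "\<phi> a = (THE b. (a, b) : S)" for a
  have graph: "(a, b) : S \<longleftrightarrow> \<phi> a = b" for a b
    unfolding \<phi>_def using theI'[of "\<lambda>b. (a, b) : S"] total[of a] partial_iso_unique[OF S(1), of a] by blast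
  have base: "\<phi> (to_ac c) = to_ac c" for c using partial_iso_base[OF S(1)] graph by blast
  have hom: "rhom \<phi>" proof (rule rhomI)
    show "\<phi> 1 = 1" using base[of 1] by simp
    show "\<phi> (x + y) = \<phi> x + \<phi> y" "\<phi> (x * y) = \<phi> x * \<phi> y" for x y
      using partial_iso_add[OF S(1)] partial_iso_mult[OF S(1)] graph by blast+
  qed
  have "bij \<phi>" using rhom_base_surj[OF hom base] rhom_eq_iff[OF hom] by (simp add: bij_def inj_def)
  then show ?thesis using hom base graph S(2) by (intro bexI[of _ \<phi>]) (auto simp: ac_auts_def)
qed

section \<open>Fixed fields\<close>

text \<open>A subring over the base; since everything is algebraic it is a field, see
  \<open>intermediate_inverse\<close>.\<close>

definition intermediate :: "'m::field alg_closure set => bool" where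
  "intermediate K \<longleftrightarrow> range to_ac \<subseteq> K \<and> (\<forall>a\<in>K. \<forall>b\<in>K. a - b : K \<and> a * b : K)"

definition polys_over :: "'a::comm_ring_1 set => 'a poly set" where
  "polys_over K = {p. \<forall>i. coeff p i : K}"

lemma partial_iso_Id_on: "intermediate K ==> partial_iso (Id_on K)" by (auto simp: intermediate_def partial_iso_def Id_on_def)

lemma poly_pairs_Id_on: "(p, q) : poly_pairs (Id_on K) \<longleftrightarrow> p = q \<and> p : polys_over K"
  by (auto simp: poly_pairs_def polys_over_def Id_on_iff intro: poly_eqI)

context
  fixes K :: "'m::field alg_closure set"
  assumes K: "intermediate K"
begin

lemma intermediate_base: "to_ac c : K"
  and intermediate_diff: "a : K ==> b : K ==> a - b : K"
  and intermediate_mult: "a : K ==> b : K ==> a * b : K" using K by (auto simp: intermediate_def)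

lemma intermediate_0: "0 : K" and intermediate_1: "1 : K" using intermediate_base[of 0] intermediate_base[of 1] by simp_all

lemma intermediate_minus: "a : K ==> - a : K" using intermediate_diff[OF intermediate_0, of a] by simp

lemma intermediate_add: "a : K ==> b : K ==> a + b : K" using intermediate_diff[of a "- b"] intermediate_minus by simp

lemma intermediate_inverse: "a : K ==> inverse a : K" using partial_iso_inverse[OF partial_iso_Id_on[OF K], of a a] intermediate_0
  by (cases "a = 0") (auto simp: Id_on_def)

lemma intermediate_divide: "a : K ==> b : K ==> a / b : K" by (simp add: divide_inverse intermediate_mult intermediate_inverse)

lemma intermediate_sum: "(!!i. i : A ==> f i : K) ==> sum f A : K"
  by (induction A rule: infinite_finite_induct) (auto intro: intermediate_0 intermediate_add)

lemma intermediate_prod: "(!!i. i : A ==> f i : K) ==> prod f A : K"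
  by (induction A rule: infinite_finite_induct) (auto intro: intermediate_1 intermediate_mult)

lemma intermediate_power: "a : K ==> a ^ n : K" by (induction n) (auto intro: intermediate_1 intermediate_mult)

lemma intermediate_numeral: "numeral n : K" using intermediate_base[of "numeral n"] by simp

lemmas intermediate_intros = intermediate_base intermediate_0 intermediate_1 intermediate_numeral intermediate_diff
  intermediate_mult intermediate_minus intermediate_add intermediate_divide intermediate_power

lemma polys_over_poly: "p : polys_over K ==> a : K ==> poly p a : K"
  by (auto simp: poly_altdef polys_over_def intro!: intermediate_sum intermediate_mult intermediate_power)

lemma polys_over_add: "p : polys_over K ==> q : polys_over K ==> p + q : polys_over K" by (simp add: polys_over_def intermediate_add)

lemma polys_over_diff: "p : polys_over K ==> q : polys_over K ==> p - q : polys_over K" by (simp add: polys_over_def intermediate_diff)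

lemma polys_over_mult: "p : polys_over K ==> q : polys_over K ==> p * q : polys_over K"
  by (simp add: polys_over_def coeff_mult intermediate_sum intermediate_mult)

lemma polys_over_smult: "c : K ==> q : polys_over K ==> smult c q : polys_over K" by (simp add: polys_over_def intermediate_mult)

lemma polys_over_0: "0 : polys_over K" and polys_over_1: "1 : polys_over K" by (simp_all add: polys_over_def intermediate_0 intermediate_1)

lemma polys_over_pCons: "c : K ==> p : polys_over K ==> pCons c p : polys_over K" by (auto simp: polys_over_def coeff_pCons split: nat.split)

lemma polys_over_linear: "c : K ==> [:- c, 1:] : polys_over K" by (intro polys_over_pCons polys_over_0 intermediate_minus intermediate_1)

lemma polys_over_prod: "(!!i. i : A ==> f i : polys_over K) ==> prod f A : polys_over K"
  by (induction A rule: infinite_finite_induct) (auto intro: polys_over_1 polys_over_mult)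

lemma polys_over_sum: "(!!i. i : A ==> f i : polys_over K) ==> sum f A : polys_over K"
  by (induction A rule: infinite_finite_induct) (auto intro: polys_over_0 polys_over_add)

lemma polys_over_base: "map_poly to_ac p : polys_over K" by (auto simp: polys_over_def coeff_map_poly intermediate_base)

lemma of_nat_mem_intermediate: "of_nat n : K" by (induction n) (auto intro: intermediate_0 intermediate_1 intermediate_add)

lemma polys_over_pderiv: "p : polys_over K ==> pderiv p : polys_over K"
  using of_nat_mem_intermediate by (simp add: polys_over_def coeff_pderiv intermediate_mult of_nat_mem_intermediate del: of_nat_Suc)

end

lemma polys_over_mono: "p : polys_over K ==> K \<subseteq> L ==> p : polys_over L" by (auto simp: polys_over_def)

lemma polys_over_map_poly_fixed:
  assumes "rhom \<phi>" "p : polys_over K" "!!a. a : K ==> \<phi> a = a"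
  shows "map_poly \<phi> p = p" using assms by (auto simp: poly_eq_iff coeff_map_poly_rhom polys_over_def)

lemma polys_over_range_to_ac: "p : polys_over (range to_ac) \<longleftrightarrow> (\<exists>q. p = map_poly to_ac q)"
proof
  assume p: "p : polys_over (range to_ac)"
  have "p = map_poly to_ac (map_poly of_ac p)" by (rule poly_eqI) (use p in \<open>auto simp: coeff_map_poly polys_over_def to_ac_of_ac\<close>)
  then show "\<exists>q. p = map_poly to_ac q" ..
qed (auto simp: polys_over_def coeff_map_poly)

definition adjoin :: "'m::field alg_closure set => 'm alg_closure => 'm alg_closure set" where
  "adjoin K x = {poly h x | h. h : polys_over K}"

lemma intermediate_adjoin:
  assumes K: "intermediate K" shows "intermediate (adjoin K x)"
proof -
  have "to_ac c : adjoin K x" for c proof -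
    have "[:to_ac c:] : polys_over K" "poly [:to_ac c:] x = to_ac c" by (intro polys_over_pCons[OF K] polys_over_0[OF K] intermediate_base[OF K]) simp
    then show ?thesis unfolding adjoin_def by (metis (mono_tags, lifting) mem_Collect_eq)
  qed
  moreover have "a - b : adjoin K x \<and> a * b : adjoin K x" if ab: "a : adjoin K x" "b : adjoin K x" for a b proof -
    obtain h k where hk: "h : polys_over K" "k : polys_over K" "a = poly h x" "b = poly k x" using ab by (auto simp: adjoin_def)
    then have "a - b = poly (h - k) x" "a * b = poly (h * k) x" by simp_all
    then show ?thesis unfolding adjoin_def using polys_over_diff[OF K hk(1,2)] polys_over_mult[OF K hk(1,2)] by blast
  qed
  ultimately show ?thesis by (auto simp: intermediate_def)
qed

lemma subset_adjoin:
  assumes K: "intermediate K" shows "K \<subseteq> adjoin K x"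
proof
  fix c assume "c : K"
  then have "[:c:] : polys_over K" by (intro polys_over_pCons[OF K] polys_over_0[OF K])
  then show "c : adjoin K x" unfolding adjoin_def by (intro CollectI exI[of _ "[:c:]"]) simp
qed

lemma mem_adjoin:
  assumes K: "intermediate K" shows "x : adjoin K x"
proof -
  have "[:0, 1:] : polys_over K" by (intro polys_over_pCons[OF K] polys_over_0[OF K] intermediate_0[OF K] intermediate_1[OF K])
  then show ?thesis unfolding adjoin_def by (intro CollectI exI[of _ "[:0, 1:]"]) simp
qed

text \<open>A simple root of some polynomial over \<open>K\<close>. In this form the property passes
  to larger fields at once, and explicit polynomials such as the quintic can serve as
  witnesses.\<close>

definition separable_over :: "'m::field alg_closure set => 'm alg_closure => bool" where
  "separable_over K x \<longleftrightarrow> (\<exists>g \<in> polys_over K. poly g x = 0 \<and> poly (pderiv g) x ~= 0)"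

lemma card_roots_rsquarefree:
  fixes p :: "'a::alg_closed_field poly"
  assumes "p ~= 0" "!!x. poly p x = 0 ==> poly (pderiv p) x ~= 0"
  shows "card {x. poly p x = 0} = degree p"
proof -
  obtain A where A: "size A = degree p" "p = smult (lead_coeff p) (\<Prod>x\<in>#A. [:-x, 1:])"
    using alg_closed_imp_factorization[OF assms(1)] by blast
  have lc: "lead_coeff p ~= 0" using assms(1) by simp
  have roots: "poly p x = 0 \<longleftrightarrow> x \<in># A" for x
    by (subst A(2)) (simp add: lc poly_prod_mset prod_mset_zero_iff image_iff eq_commute[of x] assms(1))
  have "count A x \<le> 1" for x proof (rule ccontr)
    assume "\<not> count A x \<le> 1"
    then have "replicate_mset 2 x \<subseteq># A" by (simp add: count_le_replicate_mset_subset_eq[symmetric])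
    then obtain B where B: "A = add_mset x (add_mset x B)" by (auto simp: subset_mset.le_iff_add numeral_2_eq_2)
    define q where "q = smult (lead_coeff p) (\<Prod>x\<in>#B. [:-x, 1:])"
    have "p = [:-x, 1:] * ([:-x, 1:] * q)" by (subst A(2)) (simp only: B q_def image_mset_add_mset prod_mset.add_mset mult_smult_right)
    then have "poly p x = 0" "poly (pderiv p) x = 0" by (simp_all only: pderiv_mult poly_mult poly_add) (simp_all add: pderiv_pCons)
    then show False using assms(2) by blast
  qed
  then have "count A x = 1" if "x \<in># A" for x using that by (simp add: le_antisym Suc_le_eq)
  then have "size A = card (set_mset A)" unfolding size_multiset_overloaded_eq by simp
  then show ?thesis using A(1) roots by simp
qed

text \<open>If the minimal polynomial of \<open>x\<close> has \<open>n\<close> distinct roots, then an element \<open>h(x)\<close> with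
  \<open>deg h < n\<close> that is fixed by all conjugations takes the same value at \<open>n\<close> points, so \<open>h\<close> is
  constant.\<close>

lemma fixed_in_adjoin:
  assumes K: "intermediate K" and sep: "separable_over K x" and z: "z : adjoin K x"
    and fixed: "!!\<phi>. \<phi> : ac_auts ==> (!!a. a : K ==> \<phi> a = a) ==> \<phi> z = z"
  shows "z : K"
proof -
  note iso = partial_iso_Id_on[OF K]
  obtain m where m: "m : polys_over K" "lead_coeff m = 1" "poly m x = 0"
    and min: "!!h. h : polys_over K ==> poly h x = 0 ==> m dvd h" using poly_pairs_monic_minimal[OF iso, of x] unfolding poly_pairs_Id_on
    by (metis dvd_triv_right)
  \<comment> \<open>The automorphisms over \<open>K\<close> are transitive on the roots of the
    minimal polynomial.\<close>
  have conj: "\<exists>\<phi>\<in>ac_auts. (\<forall>a\<in>K. \<phi> a = a) \<and> \<phi> x = y" if y: "poly m y = 0" for y proof -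
    have "partial_iso {(poly h x, poly h' y) | h h'. (h, h') : poly_pairs (Id_on K)}" (is "partial_iso ?S") proof (rule partial_iso_adjoin[OF iso])
      fix h h' assume "(h, h') : poly_pairs (Id_on K)" "poly h x = 0"
      then have "h' : polys_over K" "poly h' x = 0" by (auto simp: poly_pairs_Id_on)
      then have "m dvd h'" by (rule min)
      then show "poly h' y = 0" using y by auto
    qed
    from partial_iso_extends_to_ac_aut[OF this]
    obtain \<phi> where \<phi>: "\<phi> : ac_auts" "\<forall>a b. (a, b) : ?S --> \<phi> a = b" by (elim bexE)
    have S: "(poly h x, poly h y) : ?S" if "h : polys_over K" for h using that by (auto simp: poly_pairs_Id_on)
    have "\<phi> x = y" using \<phi>(2)[rule_format, OF S[of "[:0, 1:]"]]
      by (simp add: polys_over_pCons[OF K] polys_over_0[OF K] intermediate_0[OF K] intermediate_1[OF K])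
    moreover have "\<phi> a = a" if "a : K" for a
      using \<phi>(2)[rule_format, OF S[of "[:a:]"]] that by (simp add: polys_over_pCons[OF K] polys_over_0[OF K])
    ultimately show ?thesis using \<phi>(1) by blast
  qed
  \<comment> \<open>By transitivity a multiple root anywhere would make \<open>x\<close> itself a
    multiple root of \<open>m\<close>, hence of the separable witness \<open>g\<close>, which
    \<open>m\<close> divides.\<close>
  have simple: "poly (pderiv m) y ~= 0" if y: "poly m y = 0" for y proof
    assume y': "poly (pderiv m) y = 0"
    obtain \<phi> where \<phi>: "\<phi> : ac_auts" "!!a. a : K ==> \<phi> a = a" "\<phi> x = y" using conj[OF y] by blast
    note hom = ac_auts_rhom[OF \<phi>(1)]
    have "map_poly \<phi> (pderiv m) = pderiv m" by (rule polys_over_map_poly_fixed[OF hom polys_over_pderiv[OF K m(1)] \<phi>(2)])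
    then have "\<phi> (poly (pderiv m) x) = 0" using poly_map_poly_rhom[OF hom, of "pderiv m" x] \<phi>(3) y' by simp
    then have "poly (pderiv m) x = 0" using rhom_eq_0_iff[OF hom] by blast
    moreover obtain g where g: "g : polys_over K" "poly g x = 0" "poly (pderiv g) x ~= 0" using sep by (auto simp: separable_over_def)
    moreover obtain k where "g = m * k" using min g(1,2) by (blast elim: dvdE)
    ultimately show False using m(3) by (simp add: pderiv_mult)
  qed
  have m0: "m ~= 0" using m(2) by auto
  obtain h0 where h0: "h0 : polys_over K" "z = poly h0 x" using z by (auto simp: adjoin_def)
  obtain q r where r: "r : polys_over K" "h0 = q * m + r" "r = 0 \<or> degree r < degree m"
    using poly_pairs_division[OF iso, of h0 h0 m m] h0 m unfolding poly_pairs_Id_on by blast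
  have zr: "z = poly r x" using h0 r m(3) by simp
  have "poly r y = z" if y: "poly m y = 0" for y proof -
    obtain \<phi> where \<phi>: "\<phi> : ac_auts" "!!a. a : K ==> \<phi> a = a" "\<phi> x = y" using conj[OF y] by blast
    note hom = ac_auts_rhom[OF \<phi>(1)]
    have "z = \<phi> z" using fixed[OF \<phi>(1,2)] by simp
    also have "... = poly (map_poly \<phi> r) (\<phi> x)" unfolding zr by (rule poly_map_poly_rhom[OF hom, symmetric])
    also have "map_poly \<phi> r = r" by (rule polys_over_map_poly_fixed[OF hom r(1) \<phi>(2)])
    finally show ?thesis using \<phi>(3) by simp
  qed
  then have sub: "{y. poly m y = 0} \<subseteq> {y. poly (r - [:z:]) y = 0}" by auto
  have "degree m > 0" using m(2,3) by (metis degree_eq_zeroE gr0I lead_coeff_pCons(2) poly_const_conv zero_neq_one)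
  have "r - [:z:] = 0" proof (rule ccontr)
    assume nz: "r - [:z:] ~= 0"
    have "degree m = card {y. poly m y = 0}" using card_roots_rsquarefree[OF m0 simple] by simp
    also have "... \<le> card {y. poly (r - [:z:]) y = 0}" by (rule card_mono[OF poly_roots_finite[OF nz] sub])
    also have "... \<le> degree (r - [:z:])" by (rule card_poly_roots_bound[OF nz])
    also have "... < degree m" using r(3) \<open>degree m > 0\<close> by (intro degree_diff_less) auto
    finally show False by simp
  qed
  then have "z = coeff r 0" by (metis coeff_pCons_0 eq_iff_diff_eq_0)
  then show ?thesis using r(1) by (simp add: polys_over_def)
qed

text \<open>In positive characteristic the closure may contain elements outside the base that all
  automorphisms fix (purely inseparable ones), so the last clause is a real condition on
  \<open>E\<close>.\<close>

definition galois_field :: "'m::field alg_closure set => bool" where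
  "galois_field E \<longleftrightarrow> intermediate E \<and> (\<forall>\<phi>\<in>ac_auts. \<forall>z\<in>E. \<phi> z : E) \<and>
     (\<forall>z\<in>E. (\<forall>\<phi>\<in>ac_auts. \<phi> z = z) --> z : range to_ac)"

lemma ac_auts_comp: "\<phi> : ac_auts ==> \<psi> : ac_auts ==> \<phi> \<circ> \<psi> : ac_auts"
  using bij_comp[of \<psi> \<phi>] by (auto simp: ac_auts_def rhom_def)

lemma ac_auts_id: "id : ac_auts" by (simp add: ac_auts_def rhom_def)

lemma ac_auts_inv:
  assumes "\<phi> : ac_auts" shows "inv_into UNIV \<phi> : ac_auts"
proof -
  have bij: "bij \<phi>" and hom: "rhom \<phi>" using assms by (auto simp: ac_auts_def)
  note inj = bij_is_inj[OF bij] and surj = bij_is_surj[OF bij]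
  have "rhom (inv_into UNIV \<phi>)" proof (rule rhomI)
    show "inv_into UNIV \<phi> 1 = 1" using inv_f_f[OF inj, of 1] by (simp add: rhom_1[OF hom])
    show "inv_into UNIV \<phi> (x + y) = inv_into UNIV \<phi> x + inv_into UNIV \<phi> y" for x y
      using inv_f_f[OF inj, of "inv_into UNIV \<phi> x + inv_into UNIV \<phi> y"] by (simp add: rhom_add[OF hom] surj_f_inv_f[OF surj])
    show "inv_into UNIV \<phi> (x * y) = inv_into UNIV \<phi> x * inv_into UNIV \<phi> y" for x y
      using inv_f_f[OF inj, of "inv_into UNIV \<phi> x * inv_into UNIV \<phi> y"] by (simp add: rhom_mult[OF hom] surj_f_inv_f[OF surj])
  qed
  moreover have "inv_into UNIV \<phi> (to_ac c) = to_ac c" for c using inv_f_f[OF inj, of "to_ac c"] by (simp add: ac_auts_base[OF assms])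
  ultimately show ?thesis using bij_imp_bij_inv[OF bij] by (simp add: ac_auts_def)
qed

lemma finite_orbit: "finite {\<phi> x | \<phi>. \<phi> : ac_auts}"
proof -
  obtain p :: "'a poly" where p: "p ~= 0" "poly (map_poly to_ac p) x = 0" using alg_closure_algebraic by blast
  have "{\<phi> x | \<phi>. \<phi> : ac_auts} \<subseteq> {y. poly (map_poly to_ac p) y = 0}"
    using ac_auts_poly p(2) rhom_0[OF ac_auts_rhom] by (smt (verit) mem_Collect_eq subsetI)
  then show ?thesis by (rule finite_subset) (intro poly_roots_finite, metis p(1) map_poly_to_ac_eq_iff map_poly_0)
qed

lemma galois_field_polys:
  assumes E: "galois_field E" and p: "p : polys_over E"
    and fixed: "!!\<phi>. \<phi> : ac_auts ==> map_poly \<phi> p = p"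
  obtains q where "p = map_poly to_ac q"
proof -
  have "p : polys_over (range to_ac)" unfolding polys_over_def proof (intro CollectI allI)
    fix i
    have "\<phi> (coeff p i) = coeff p i" if "\<phi> : ac_auts" for \<phi> using fixed[OF that] coeff_map_poly_rhom[OF ac_auts_rhom[OF that]] by metis
    then show "coeff p i : range to_ac" using E p by (simp add: galois_field_def polys_over_def)
  qed
  then show thesis using that polys_over_range_to_ac by blast
qed

text \<open>Lagrange interpolation through the orbit of \<open>\<eta>\<close>.\<close>

lemma stabilizer_imp_polynomial:
  assumes E: "galois_field E" and \<eta>: "\<eta> : E" and z: "z : E"
    and stab: "!!\<phi>. \<phi> : ac_auts ==> \<phi> \<eta> = \<eta> ==> \<phi> z = z"
  obtains h where "z = poly (map_poly to_ac h) \<eta>" "degree h < card {\<phi> \<eta> | \<phi>. \<phi> : ac_auts}"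
proof -
  define Orb where "Orb = {\<phi> \<eta> | \<phi>. \<phi> : ac_auts}"
  have fin: "finite Orb" unfolding Orb_def by (rule finite_orbit)
  have \<eta>O: "\<eta> : Orb" unfolding Orb_def by (intro CollectI exI[of _ id]) (simp add: ac_auts_id)
  \<comment> \<open>The prescribed value at \<phi>(\<eta>) is \<phi>(z); \<open>stab\<close> makes
    it independent of the chosen \<phi>, see \<open>Z_eq\<close>.\<close>
  define Z where "Z a = (SOME \<phi>. \<phi> : ac_auts \<and> \<phi> \<eta> = a) z" for a
  have Z_eq: "Z (\<phi> \<eta>) = \<phi> z" if \<phi>: "\<phi> : ac_auts" for \<phi> proof -
    define \<psi> where "\<psi> = (SOME \<psi>. \<psi> : ac_auts \<and> \<psi> \<eta> = \<phi> \<eta>)"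
    have \<psi>: "\<psi> : ac_auts" "\<psi> \<eta> = \<phi> \<eta>"
      using someI_ex[of "\<lambda>\<psi>. \<psi> : ac_auts \<and> \<psi> \<eta> = \<phi> \<eta>"] \<phi> unfolding \<psi>_def by blast+
    have inj: "inj \<psi>" and surj: "surj \<psi>" using ac_auts_bij[OF \<psi>(1)] by (simp_all add: bij_is_inj bij_is_surj)
    have "(inv_into UNIV \<psi> \<circ> \<phi>) z = z"
      using \<psi>(2) inv_f_f[OF inj] by (intro stab ac_auts_comp ac_auts_inv \<psi>(1) \<phi>) (simp flip: \<psi>(2))
    then have "\<phi> z = \<psi> z" using surj_f_inv_f[OF surj] by (metis comp_apply)
    then show ?thesis by (simp add: Z_def \<psi>_def)
  qed
  have OE: "a : E" if "a : Orb" for a using that E \<eta> by (auto simp: Orb_def galois_field_def)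
  have ZE: "Z a : E" if "a : Orb" for a using that E z Z_eq by (auto simp: Orb_def galois_field_def)
  have intE: "intermediate E" using E by (simp add: galois_field_def)
  define c where "c a = Z a / (\<Prod>b\<in>Orb - {a}. a - b)" for a
  define H where "H = (\<Sum>a\<in>Orb. smult (c a) (\<Prod>b\<in>Orb - {a}. [:- b, 1:]))"
  have "H : polys_over E" unfolding H_def c_def
    by (intro polys_over_sum[OF intE] polys_over_smult[OF intE] polys_over_prod[OF intE] polys_over_linear[OF intE]
        intermediate_divide[OF intE] intermediate_prod[OF intE] intermediate_diff[OF intE] ZE) (auto simp: OE)
  moreover have "map_poly \<phi> H = H" if \<phi>: "\<phi> : ac_auts" for \<phi> proof -
    note hom = ac_auts_rhom[OF \<phi>]
    have inj: "inj \<phi>" using ac_auts_bij[OF \<phi>] by (simp add: bij_is_inj)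
    have "\<phi> ` Orb \<subseteq> Orb" proof safe
      fix a assume "a : Orb"
      then obtain \<psi> where "\<psi> : ac_auts" "a = \<psi> \<eta>" by (auto simp: Orb_def)
      then show "\<phi> a : Orb" unfolding Orb_def by (intro CollectI exI[of _ "\<phi> \<circ> \<psi>"]) (simp add: ac_auts_comp[OF \<phi>])
    qed
    moreover have "inj_on \<phi> Orb" using inj by (rule inj_on_subset) simp
    ultimately have img: "\<phi> ` Orb = Orb" using fin by (intro endo_inj_surj)
    have img': "\<phi> ` (Orb - {a}) = Orb - {\<phi> a}" for a using img inj by (simp add: image_set_diff)
    have inj': "inj_on \<phi> A" for A using inj by (rule inj_on_subset) simp
    have Z\<phi>: "\<phi> (Z a) = Z (\<phi> a)" if aO: "a : Orb" for a proof -
      obtain \<psi> where \<psi>: "\<psi> : ac_auts" "a = \<psi> \<eta>" using aO by (auto simp: Orb_def)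
      show ?thesis using Z_eq[OF ac_auts_comp[OF \<phi> \<psi>(1)]] by (simp only: \<psi>(2) Z_eq[OF \<psi>(1)] comp_apply)
    qed
    have "map_poly \<phi> (smult (c a) (\<Prod>b\<in>Orb - {a}. [:- b, 1:]))
        = smult (c (\<phi> a)) (\<Prod>b\<in>Orb - {\<phi> a}. [:- b, 1:])" if a: "a : Orb" for a proof -
      have "map_poly \<phi> (smult (c a) (\<Prod>b\<in>Orb - {a}. [:- b, 1:]))
          = smult (\<phi> (c a)) (map_poly \<phi> (\<Prod>b\<in>Orb - {a}. [:- b, 1:]))"
        by (rule poly_eqI) (simp add: coeff_map_poly_rhom[OF hom] rhom_mult[OF hom])
      also have "map_poly \<phi> (\<Prod>b\<in>Orb - {a}. [:- b, 1:]) = (\<Prod>b\<in>Orb - {a}. [:- \<phi> b, 1:])"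
        by (simp add: rhom_prod[OF rhom_map_poly[OF hom]] map_poly_pCons_rhom[OF hom] rhom_minus[OF hom] rhom_1[OF hom])
      also have "... = (\<Prod>b\<in>\<phi> ` (Orb - {a}). [:- b, 1:])" by (subst prod.reindex[OF inj']) simp
      also have "\<phi> (c a) = c (\<phi> a)" proof -
        have "(\<Prod>b\<in>Orb - {\<phi> a}. \<phi> a - b) = (\<Prod>b\<in>Orb - {a}. \<phi> a - \<phi> b)"
          by (subst img'[symmetric], subst prod.reindex[OF inj']) simp
        then show ?thesis by (simp add: c_def rhom_divide[OF hom] rhom_prod[OF hom] rhom_diff[OF hom] Z\<phi>[OF a])
      qed
      finally show ?thesis by (simp add: img')
    qed
    then have "map_poly \<phi> H = (\<Sum>a\<in>Orb. smult (c (\<phi> a)) (\<Prod>b\<in>Orb - {\<phi> a}. [:- b, 1:]))"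
      by (simp add: H_def rhom_sum[OF rhom_map_poly[OF hom]])
    also have "... = (\<Sum>a\<in>\<phi> ` Orb. smult (c a) (\<Prod>b\<in>Orb - {a}. [:- b, 1:]))" by (subst sum.reindex[OF inj']) simp
    finally show ?thesis by (simp add: img H_def)
  qed
  ultimately obtain h where h: "H = map_poly to_ac h" using galois_field_polys[OF E] by blast
  have "poly H \<eta> = (\<Sum>a\<in>Orb. c a * (\<Prod>b\<in>Orb - {a}. \<eta> - b))" by (simp add: H_def poly_sum poly_prod)
  also have "... = c \<eta> * (\<Prod>b\<in>Orb - {\<eta>}. \<eta> - b)" proof -
    have "(\<Prod>b\<in>Orb - {a}. \<eta> - b) = 0" if "a : Orb - {\<eta>}" for a using that \<eta>O fin by (intro prod_zero) auto
    then have "(\<Sum>a\<in>Orb - {\<eta>}. c a * (\<Prod>b\<in>Orb - {a}. \<eta> - b)) = 0" by (intro sum.neutral) simp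
    then show ?thesis by (subst sum.remove[OF fin \<eta>O]) simp
  qed
  also have "... = Z \<eta>" proof -
    have "(\<Prod>b\<in>Orb - {\<eta>}. \<eta> - b) ~= 0" using fin by auto
    then show ?thesis by (simp add: c_def)
  qed
  also have "... = z" using Z_eq[OF ac_auts_id] by simp
  finally have val: "z = poly (map_poly to_ac h) \<eta>" by (simp add: h)
  have pos: "card Orb > 0" using fin \<eta>O card_gt_0_iff by blast
  have "degree H \<le> card Orb - 1" unfolding H_def proof (rule degree_sum_le[OF fin])
    fix a assume a: "a : Orb"
    have "degree (smult (c a) (\<Prod>b\<in>Orb - {a}. [:- b, 1:])) \<le> degree (\<Prod>b\<in>Orb - {a}. [:- b, 1:])" by (rule degree_smult_le)
    also have "... \<le> (\<Sum>b\<in>Orb - {a}. degree [:- b, 1:])"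
      using degree_prod_sum_le[of "Orb - {a}" "\<lambda>b. [:- b, 1:]"] fin by (simp add: o_def)
    also have "... = card Orb - 1" using fin a by simp
    finally show "degree (smult (c a) (\<Prod>b\<in>Orb - {a}. [:- b, 1:])) \<le> card Orb - 1" .
  qed
  moreover have "degree H = degree h" unfolding h by (rule degree_map_poly) simp
  ultimately show thesis using that[of h] val pos by (simp add: Orb_def)
qed

section \<open>Splitting fields and their Galois groups\<close>

definition generated :: "'m::field alg_closure set => 'm alg_closure set" where
  "generated S = generate_field ac_ring (range to_ac \<union> S)"

lemma ac_ring_simps:
  "carrier (ac_ring :: 'm::field alg_closure ring) = UNIV"
  "x \<oplus>\<^bsub>ac_ring\<^esub> y = x + (y :: 'm alg_closure)"
  "x \<otimes>\<^bsub>ac_ring\<^esub> y = x * (y :: 'm alg_closure)"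
  "\<one>\<^bsub>ac_ring\<^esub> = (1 :: 'm alg_closure)"
  "\<zero>\<^bsub>ac_ring\<^esub> = (0 :: 'm alg_closure)" by (simp_all add: ring_of_type_algebra_def)

lemma ac_ring_a_inv: "\<ominus>\<^bsub>ac_ring\<^esub> x = - (x :: 'm::field alg_closure)"
proof -
  interpret field "ac_ring :: 'm alg_closure ring" by (rule field_from_type_algebra)
  show ?thesis using minus_equality[of "- x" x] by (simp add: ac_ring_simps)
qed

lemma ac_ring_m_inv:
  assumes "x ~= 0" shows "inv\<^bsub>ac_ring\<^esub> x = inverse (x :: 'm::field alg_closure)"
proof -
  interpret field "ac_ring :: 'm alg_closure ring" by (rule field_from_type_algebra)
  show ?thesis using comm_inv_char[of x "inverse x"] assms by (simp add: ac_ring_simps)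
qed

lemma intermediate_generated: "intermediate (generated S)" unfolding generated_def
proof -
  let ?g = "generate_field ac_ring (range to_ac \<union> S)"
  have "a + (- b) : ?g" if "a : ?g" "b : ?g" for a b
    using generate_field.eng_add[OF that(1) generate_field.a_inv[OF that(2)]] by (simp add: ac_ring_simps ac_ring_a_inv)
  moreover have "a * b : ?g" if "a : ?g" "b : ?g" for a b using generate_field.eng_mult[OF that] by (simp add: ac_ring_simps)
  moreover have "range to_ac \<subseteq> ?g" by (auto intro: generate_field.incl)
  ultimately show "intermediate ?g" by (simp add: intermediate_def)
qed

lemma subset_generated: "S \<subseteq> generated S" by (auto simp: generated_def intro: generate_field.incl)

lemma generated_minimal:
  assumes K: "intermediate K" and "S \<subseteq> K"
  shows "generated S \<subseteq> K"
proof
  fix z assume "z : generated S"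
  then show "z : K" unfolding generated_def proof induction
    case (m_inv h)
    then show ?case using ac_ring_m_inv[of h] intermediate_inverse[OF K] by (simp add: ac_ring_simps)
  qed (use assms in \<open>auto simp: ac_ring_simps ac_ring_a_inv intro: intermediate_1[OF K] intermediate_base[OF K]
        intermediate_minus[OF K] intermediate_add[OF K] intermediate_mult[OF K]\<close>)
qed

lemma generated_mono: "S \<subseteq> generated T ==> generated S \<subseteq> generated T" by (rule generated_minimal[OF intermediate_generated])

lemma generated_empty: "generated {} = range to_ac"
proof
  have "intermediate (range to_ac)" by (auto simp: intermediate_def simp flip: to_ac_diff to_ac_mult)
  then show "generated {} \<subseteq> range to_ac" by (rule generated_minimal) simp
qed (auto simp: generated_def intro: generate_field.incl)

lemma generated_insert: "generated (insert x S) = adjoin (generated S) x"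
proof
  note g = intermediate_generated[of S]
  show "generated (insert x S) \<subseteq> adjoin (generated S) x" using subset_adjoin[OF g] mem_adjoin[OF g] subset_generated[of S]
    by (intro generated_minimal intermediate_adjoin g) blast
  show "adjoin (generated S) x \<subseteq> generated (insert x S)" proof
    fix z assume "z : adjoin (generated S) x"
    then obtain h where h: "h : polys_over (generated S)" "z = poly h x" by (auto simp: adjoin_def)
    have "generated S \<subseteq> generated (insert x S)" using subset_generated[of "insert x S"] by (intro generated_mono) blast
    then have "h : polys_over (generated (insert x S))" by (rule polys_over_mono[OF h(1)])
    then show "z : generated (insert x S)" unfolding h(2) using subset_generated[of "insert x S"]
      by (intro polys_over_poly[OF intermediate_generated]) auto
  qed
qed

text \<open>The part of \<open>galois_field\<close> that survives adjoining separable elements one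
  at a time; stability under automorphisms generally holds only once a full set of conjugates has
  been adjoined.\<close>

definition fixed_is_base :: "'m::field alg_closure set => bool" where
  "fixed_is_base E \<longleftrightarrow> (\<forall>z\<in>E. (\<forall>\<phi>\<in>ac_auts. \<phi> z = z) --> z : range to_ac)"

lemma fixed_is_base_adjoin:
  assumes "intermediate K" "fixed_is_base K" "separable_over K x"
  shows "fixed_is_base (adjoin K x)" unfolding fixed_is_base_def
proof (intro ballI impI)
  fix z assume z: "z : adjoin K x" "\<forall>\<phi>\<in>ac_auts. \<phi> z = z"
  then have "z : K" using fixed_in_adjoin[OF assms(1,3)] by blast
  then show "z : range to_ac" using assms(2) z(2) by (auto simp: fixed_is_base_def)
qed

lemma separable_over_mono: "separable_over K x ==> K \<subseteq> L ==> separable_over L x" unfolding separable_over_def using polys_over_mono by blast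

lemma fixed_is_base_generated_union:
  assumes "finite T" "fixed_is_base (generated S)" "!!x. x : T ==> separable_over (generated S) x"
  shows "fixed_is_base (generated (T \<union> S))" using assms
proof (induction T rule: finite_induct)
  case (insert x T)
  have "generated S \<subseteq> generated (T \<union> S)" using subset_generated[of "T \<union> S"] by (intro generated_mono) blast
  then have "separable_over (generated (T \<union> S)) x" using insert.prems(2) separable_over_mono by blast
  then show ?case using insert by (simp add: generated_insert fixed_is_base_adjoin[OF intermediate_generated])
qed simp

lemma fixed_is_base_generated:
  assumes "finite T" "!!x. x : T ==> separable_over (range to_ac) x"
  shows "fixed_is_base (generated T)"
proof -
  have "fixed_is_base (generated {})" unfolding generated_empty by (simp add: fixed_is_base_def)
  from fixed_is_base_generated_union[OF assms(1) this] show ?thesis using assms(2) unfolding generated_empty by simp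
qed

lemma ac_auts_generated:
  assumes \<phi>: "\<phi> : ac_auts" and S: "!!x. x : S ==> \<phi> x : generated S" and z: "z : generated S"
  shows "\<phi> z : generated S"
proof -
  note hom = ac_auts_rhom[OF \<phi>] and g = intermediate_generated[of S]
  have "intermediate {z. \<phi> z : generated S}" by (auto simp: intermediate_def ac_auts_base[OF \<phi>] rhom_diff[OF hom] rhom_mult[OF hom]
        intermediate_base[OF g] intermediate_diff[OF g] intermediate_mult[OF g])
  then have "generated S \<subseteq> {z. \<phi> z : generated S}" by (rule generated_minimal) (use S in auto)
  then show ?thesis using z by blast
qed

lemma ac_auts_eq_on_generated:
  assumes \<phi>: "\<phi> : ac_auts" and \<psi>: "\<psi> : ac_auts" and S: "!!x. x : S ==> \<phi> x = \<psi> x" and z: "z : generated S"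
  shows "\<phi> z = \<psi> z"
proof -
  note hom = ac_auts_rhom[OF \<phi>] ac_auts_rhom[OF \<psi>]
  have "intermediate {z. \<phi> z = \<psi> z}"
    by (auto simp: intermediate_def ac_auts_base[OF \<phi>] ac_auts_base[OF \<psi>] rhom_diff[OF hom(1)] rhom_mult[OF hom(1)]
       rhom_diff[OF hom(2)] rhom_mult[OF hom(2)])
  then have "generated S \<subseteq> {z. \<phi> z = \<psi> z}" by (rule generated_minimal) (use S in auto)
  then show ?thesis using z by blast
qed

lemma galois_field_generated:
  assumes "fixed_is_base (generated S)" "!!\<phi> x. \<phi> : ac_auts ==> x : S ==> \<phi> x : generated S"
  shows "galois_field (generated S)" unfolding galois_field_def
proof (intro conjI ballI)
  show "\<phi> z : generated S" if "\<phi> : ac_auts" "z : generated S" for \<phi> z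
    using that(1) assms(2)[OF that(1)] that(2) by (rule ac_auts_generated)
qed (use assms(1) intermediate_generated in \<open>simp_all add: fixed_is_base_def\<close>)

lemma splitting_field_eq: "splitting_field f = generated {x. poly (map_poly to_ac f) x = 0}" by (simp add: splitting_field_def generated_def)

lemma ac_auts_root:
  "\<phi> : ac_auts ==> poly (map_poly to_ac f) x = 0 ==> poly (map_poly to_ac f) (\<phi> x) = 0"
  using ac_auts_poly[of \<phi> f x] rhom_0[OF ac_auts_rhom, of \<phi>] by simp

lemma ac_auts_splitting_field:
  assumes \<phi>: "\<phi> : ac_auts" and z: "z : splitting_field f"
  shows "\<phi> z : splitting_field f"
proof -
  have "\<phi> x : generated {x. poly (map_poly to_ac f) x = 0}" if "x : {x. poly (map_poly to_ac f) x = 0}" for x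
    using that by (intro subsetD[OF subset_generated]) (simp add: ac_auts_root[OF \<phi>])
  from this z show ?thesis unfolding splitting_field_eq by (rule ac_auts_generated[OF \<phi>])
qed

text \<open>An automorphism of the splitting field is a partial isomorphism, so it extends to the
  closure; conversely a closure automorphism permutes the roots and restricts.\<close>

lemma carrier_Gal: "carrier (Gal f) = (\<lambda>\<psi>. restrict \<psi> (splitting_field f)) ` ac_auts" (is "_ = ?r ` _")
proof (intro equalityI subsetI)
  let ?L = "splitting_field f"
  have L: "intermediate ?L" unfolding splitting_field_eq by (rule intermediate_generated)
  {
    fix \<phi> assume "\<phi> : carrier (Gal f)"
    then have \<phi>: "\<phi> : Bij ?L" "\<phi> : ring_hom (ac_ring\<lparr>carrier := ?L\<rparr>) (ac_ring\<lparr>carrier := ?L\<rparr>)"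
      "!!c. \<phi> (to_ac c) = to_ac c" by (auto simp: Gal_def Let_def)
    have add: "\<phi> (a + b) = \<phi> a + \<phi> b" and mult: "\<phi> (a * b) = \<phi> a * \<phi> b" if "a : ?L" "b : ?L" for a b
      using that ring_hom_add[OF \<phi>(2), of a b] ring_hom_mult[OF \<phi>(2), of a b] by (simp_all add: ac_ring_simps)
    have diff: "\<phi> (a - b) = \<phi> a - \<phi> b" if "a : ?L" "b : ?L" for a b
      using add[of "a - b" b] that intermediate_diff[OF L] by (simp add: algebra_simps)
    have "partial_iso {(a, \<phi> a) | a. a : ?L}" (is "partial_iso ?R") unfolding partial_iso_def proof (intro conjI allI impI)
      show "(to_ac c, to_ac c) : ?R" for c using intermediate_base[OF L, of c] \<phi>(3)[of c] by force
      show "b = 0" if "(0, b) : ?R" for b using that \<phi>(3)[of 0] by simp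
      fix a b c d assume "(a, b) : ?R" "(c, d) : ?R"
      then have "a : ?L" "c : ?L" "b = \<phi> a" "d = \<phi> c" by auto
      then show "(a - c, b - d) : ?R" "(a * c, b * d) : ?R" using diff mult intermediate_diff[OF L, of a c] intermediate_mult[OF L, of a c] by auto
    qed
    from partial_iso_extends_to_ac_aut[OF this] obtain \<psi> where \<psi>: "\<psi> : ac_auts" "\<forall>a b. (a, b) : ?R --> \<psi> a = b"
      by (elim bexE)
    have "\<phi> = ?r \<psi>" proof (rule extensionalityI)
      show "\<phi> : extensional ?L" using \<phi>(1) by (simp add: Bij_def)
      show "\<phi> a = ?r \<psi> a" if "a : ?L" for a using that \<psi>(2) by auto
    qed simp
    then show "\<phi> : ?r ` ac_auts" using \<psi>(1) by blast
  next
    fix \<phi> assume "\<phi> : ?r ` ac_auts"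
    then obtain \<psi> where \<psi>: "\<psi> : ac_auts" "\<phi> = ?r \<psi>" by blast
    note hom = ac_auts_rhom[OF \<psi>(1)]
    have inj: "inj \<psi>" and surj: "surj \<psi>" using ac_auts_bij[OF \<psi>(1)] by (simp_all add: bij_is_inj bij_is_surj)
    have "\<psi> ` ?L = ?L" proof
      show "\<psi> ` ?L \<subseteq> ?L" using ac_auts_splitting_field[OF \<psi>(1)] by blast
      show "?L \<subseteq> \<psi> ` ?L" using ac_auts_splitting_field[OF ac_auts_inv[OF \<psi>(1)]] surj_f_inv_f[OF surj] by (metis image_eqI subsetI)
    qed
    then have "bij_betw \<psi> ?L ?L" using inj by (simp add: bij_betw_def inj_on_def)
    then have "bij_betw (?r \<psi>) ?L ?L" by (subst bij_betw_cong[of ?L "?r \<psi>" \<psi>]) simp_all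
    then have "\<phi> : Bij ?L" by (simp add: Bij_def \<psi>(2))
    moreover have "\<phi> : ring_hom (ac_ring\<lparr>carrier := ?L\<rparr>) (ac_ring\<lparr>carrier := ?L\<rparr>)"
      using ac_auts_splitting_field[OF \<psi>(1)] intermediate_1[OF L] intermediate_mult[OF L] intermediate_add[OF L]
      by (intro ring_hom_memI) (auto simp: \<psi>(2) ac_ring_simps rhom_simps[OF hom])
    moreover have "\<phi> (to_ac c) = to_ac c" for c using intermediate_base[OF L] ac_auts_base[OF \<psi>(1)] by (simp add: \<psi>(2))
    ultimately show "\<phi> : carrier (Gal f)" by (auto simp: Gal_def Let_def)
  }
qed

text \<open>Computes a Galois group from any multiplicative label \<open>c\<close> of closure
  automorphisms that distinguishes exactly the different restrictions to the splitting field. It is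
  applied to the pair of affine maps attached to two quintics.\<close>

lemma Gal_iso:
  fixes c :: "('m::field alg_closure => 'm alg_closure) => 'g" and G :: "('g, 'b) monoid_scheme"
  assumes hom: "!!\<phi> \<psi>. \<phi> : ac_auts ==> \<psi> : ac_auts ==> c (\<phi> \<circ> \<psi>) = c \<phi> \<otimes>\<^bsub>G\<^esub> c \<psi>"
    and eq: "!!\<phi> \<psi>. \<phi> : ac_auts ==> \<psi> : ac_auts ==> c \<phi> = c \<psi> \<longleftrightarrow> (\<forall>z\<in>splitting_field f. \<phi> z = \<psi> z)"
  shows "Gal f \<cong> G\<lparr>carrier := c ` ac_auts\<rparr>"
proof -
  let ?L = "splitting_field f"
  define h where "h \<phi> = c (SOME \<psi>. \<psi> : ac_auts \<and> restrict \<psi> ?L = \<phi>)" for \<phi>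
  have h: "h (restrict \<psi> ?L) = c \<psi>" if \<psi>: "\<psi> : ac_auts" for \<psi> proof -
    define \<chi> where "\<chi> = (SOME \<chi>. \<chi> : ac_auts \<and> restrict \<chi> ?L = restrict \<psi> ?L)"
    have "\<chi> : ac_auts \<and> restrict \<chi> ?L = restrict \<psi> ?L" unfolding \<chi>_def by (rule someI[of _ \<psi>]) (use \<psi> in simp)
    then have "c \<chi> = c \<psi>" using \<psi> by (simp add: eq) (metis restrict_apply')
    then show ?thesis by (simp add: h_def \<chi>_def)
  qed
  have mult: "restrict \<phi> ?L \<otimes>\<^bsub>Gal f\<^esub> restrict \<psi> ?L = restrict (\<phi> \<circ> \<psi>) ?L" if "\<phi> : ac_auts" "\<psi> : ac_auts" for \<phi> \<psi>
  proof -
    have "restrict \<phi> ?L : carrier (Gal f)" "restrict \<psi> ?L : carrier (Gal f)" using that by (simp_all add: carrier_Gal)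
    then have "restrict \<phi> ?L : Bij ?L" "restrict \<psi> ?L : Bij ?L" by (auto simp: Gal_def Let_def)
    then show ?thesis using ac_auts_splitting_field[OF that(2)] by (auto simp: Gal_def Let_def BijGroup_def compose_def restrict_def fun_eq_iff)
  qed
  have "h : iso (Gal f) (G\<lparr>carrier := c ` ac_auts\<rparr>)" proof (rule isoI)
    show "h : hom (Gal f) (G\<lparr>carrier := c ` ac_auts\<rparr>)" by (rule homI) (auto simp: carrier_Gal h mult ac_auts_comp hom)
    show "bij_betw h (carrier (Gal f)) (carrier (G\<lparr>carrier := c ` ac_auts\<rparr>))" unfolding bij_betw_def proof
      show "inj_on h (carrier (Gal f))" by (rule inj_onI) (auto simp: carrier_Gal h eq)
      show "h ` carrier (Gal f) = carrier (G\<lparr>carrier := c ` ac_auts\<rparr>)" by (simp add: carrier_Gal image_image h)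
    qed
  qed
  then show ?thesis unfolding is_iso_def by blast
qed


definition ac_orbit :: "'m::field alg_closure => 'm alg_closure set" where
  "ac_orbit x = {\<phi> x | \<phi>. \<phi> : ac_auts}"

lemma finite_ac_orbit: "finite (ac_orbit x)" unfolding ac_orbit_def by (rule finite_orbit)

lemma infinite_avoid:
  fixes A :: "'m::field alg_closure set"
  assumes "infinite (UNIV :: 'm set)" "finite A"
  obtains c where "to_ac c \<notin> A"
proof -
  have "infinite (range (to_ac :: 'm => _))" using assms(1) inj_to_ac finite_imageD by blast
  then show thesis using that assms(2) by (metis finite_subset image_subset_iff UNIV_I)
qed

text \<open>An element with an orbit of maximal size is primitive: adding a generic multiple of an
  element that it does not generate would enlarge the orbit.\<close>

lemma primitive_element:
  fixes E :: "'m::field alg_closure set"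
  assumes inf: "infinite (UNIV :: 'm set)" and E: "intermediate E"
    and fin: "finite ((\<lambda>\<phi>. restrict \<phi> E) ` ac_auts)"
  shows "\<exists>\<theta>\<in>E. \<forall>\<phi>\<in>ac_auts. \<phi> \<theta> = \<theta> --> (\<forall>z\<in>E. \<phi> z = z)"
proof -
  have bound: "card (ac_orbit x) \<le> card ((\<lambda>\<phi>. restrict \<phi> E) ` ac_auts)" if "x : E" for x proof -
    have "ac_orbit x = (\<lambda>f. f x) ` (\<lambda>\<phi>. restrict \<phi> E) ` ac_auts" using that by (auto simp: ac_orbit_def image_image)
    then show ?thesis using card_image_le[OF fin] by simp
  qed
  obtain \<theta> where \<theta>: "\<theta> : E" and max: "!!y. y : E ==> card (ac_orbit y) \<le> card (ac_orbit \<theta>)"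
    using ex_has_greatest_nat[of "\<lambda>x. x : E" 0 "\<lambda>x. card (ac_orbit x)" "Suc (card ((\<lambda>\<phi>. restrict \<phi> E) ` ac_auts))"]
      intermediate_0[OF E] bound by (auto simp: less_Suc_eq_le)
  have "\<phi> z = z" if \<phi>: "\<phi> : ac_auts" "\<phi> \<theta> = \<theta>" and z: "z : E" for \<phi> z proof (rule ccontr)
    assume ne: "\<phi> z ~= z"
    define P where "P = {(\<psi> \<theta>, \<psi> z) | \<psi>. \<psi> : ac_auts}"
    have "P \<subseteq> ac_orbit \<theta> \<times> ac_orbit z" by (auto simp: P_def ac_orbit_def)
    then have finP: "finite P" using finite_ac_orbit by (meson finite_SigmaI finite_subset)
    \<comment> \<open>The multipliers for which two different conjugate pairs $(a,b)$ would give the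
      same value $a + c b$.\<close>
    define Bad where "Bad = (\<lambda>((a, b), (a', b')). (a - a') / (b' - b)) ` (P \<times> P)"
    have "finite Bad" unfolding Bad_def using finP by simp
    then obtain c where c: "to_ac c \<notin> Bad" using infinite_avoid[OF inf] by blast
    define y where "y = \<theta> + to_ac c * z"
    have yE: "y : E" unfolding y_def by (intro intermediate_add[OF E] intermediate_mult[OF E] intermediate_base[OF E] \<theta> z)
    have inj: "inj_on (\<lambda>(a, b). a + to_ac c * b) P" proof (rule inj_onI, clarify)
      fix a b a' b' assume ab: "(a, b) : P" "(a', b') : P" "a + to_ac c * b = a' + to_ac c * b'"
      have "b = b'" proof (rule ccontr)
        assume "b ~= b'"
        have "to_ac c * (b' - b) = a - a'" using ab(3) by (simp add: algebra_simps)
        then have "to_ac c = (a - a') / (b' - b)" using \<open>b ~= b'\<close> by (simp add: eq_divide_eq)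
        then have "to_ac c : Bad" unfolding Bad_def using ab(1,2) by force
        then show False using c by blast
      qed
      then show "a = a' \<and> b = b'" using ab(3) by simp
    qed
    have "ac_orbit y = (\<lambda>(a, b). a + to_ac c * b) ` P" proof -
      have "\<psi> y = \<psi> \<theta> + to_ac c * \<psi> z" if "\<psi> : ac_auts" for \<psi>
        using that by (simp add: y_def rhom_add[OF ac_auts_rhom] rhom_mult[OF ac_auts_rhom] ac_auts_base)
      then show ?thesis unfolding ac_orbit_def P_def by (force simp: image_iff)
    qed
    then have "card P = card (ac_orbit y)" by (simp add: card_image[OF inj])
    also have "... \<le> card (ac_orbit \<theta>)" by (rule max[OF yE])
    also have "ac_orbit \<theta> = fst ` P" by (force simp: ac_orbit_def P_def image_iff)
    \<comment> \<open>Maximality gives equal sizes, so the first projection is injective on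
      \<open>P\<close>: a conjugate of \<theta> determines the accompanying conjugate of
      \<open>z\<close>.\<close>
    finally have "card (fst ` P) = card P" using card_image_le[OF finP, of fst] by simp
    then have "inj_on fst P" using finP by (rule eq_card_imp_inj_on[rotated])
    moreover have "(\<theta>, z) : P" unfolding P_def by (intro CollectI exI[of _ id]) (simp add: ac_auts_id)
    moreover have "(\<theta>, \<phi> z) : P" unfolding P_def by (intro CollectI exI[of _ \<phi>]) (simp add: \<phi>)
    ultimately show False using ne inj_onD[of fst P "(\<theta>, z)" "(\<theta>, \<phi> z)"] by simp
  qed
  then show ?thesis using \<theta> by blast
qed

text \<open>The polynomial whose roots form the \<open>H\<close>-orbit of \<theta> is fixed by
  exactly the automorphisms in \<open>H\<close>. Its value at a base element is a single number with
  the same stabilizer, as soon as that element separates this polynomial from those of the finitely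
  many other subsets of the full orbit. Inverses in \<open>H\<close> come from the finiteness of the
  orbit.\<close>

lemma exists_element_with_stabilizer:
  fixes E :: "'m::field alg_closure set"
  assumes inf: "infinite (UNIV :: 'm set)" and E: "intermediate E" and stable: "!!\<phi> z. \<phi> : ac_auts ==> z : E ==> \<phi> z : E"
    and \<theta>: "\<theta> : E" and H: "H \<subseteq> ac_auts" "!!\<phi> \<psi>. \<phi> : H ==> \<psi> : H ==> \<phi> \<circ> \<psi> : H"
      "!!\<phi>. \<phi> : ac_auts ==> \<phi> \<theta> = \<theta> ==> \<phi> : H"
  shows "\<exists>\<eta>\<in>E. \<forall>\<phi>\<in>ac_auts. \<phi> \<eta> = \<eta> \<longleftrightarrow> \<phi> : H"
proof -
  define A where "A = {\<phi> \<theta> | \<phi>. \<phi> : H}"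
  have sub: "A \<subseteq> ac_orbit \<theta>" using H(1) by (auto simp: A_def ac_orbit_def)
  then have finA: "finite A" using finite_ac_orbit finite_subset by blast
  have HA: "\<chi> ` A \<subseteq> A" if \<chi>: "\<chi> : H" for \<chi> proof safe
    fix a assume "a : A"
    then obtain \<psi> where "\<psi> : H" "a = \<psi> \<theta>" by (auto simp: A_def)
    then show "\<chi> a : A" unfolding A_def by (intro CollectI exI[of _ "\<chi> \<circ> \<psi>"]) (simp add: H(2)[OF \<chi>])
  qed
  define Q where "Q B = (\<Prod>b\<in>B. [:- b, 1:])" for B :: "'m alg_closure set"
  have roots: "poly (Q B) x = 0 \<longleftrightarrow> x : B" if "finite B" for B x using that by (auto simp: Q_def poly_prod)
  define Bad where "Bad = (\<Union>B\<in>{B. B \<subseteq> ac_orbit \<theta> \<and> B ~= A}. {x. poly (Q B - Q A) x = 0})"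
  have "finite Bad" unfolding Bad_def proof (rule finite_UN_I)
    show "finite {B. B \<subseteq> ac_orbit \<theta> \<and> B ~= A}" using finite_ac_orbit[of \<theta>] by simp
    fix B assume "B : {B. B \<subseteq> ac_orbit \<theta> \<and> B ~= A}"
    then have B: "finite B" "B ~= A" using finite_ac_orbit[of \<theta>] finite_subset by auto
    then have "Q B ~= Q A" using roots[OF B(1)] roots[OF finA] by auto
    then show "finite {x. poly (Q B - Q A) x = 0}" by (intro poly_roots_finite) simp
  qed
  then obtain c where c: "to_ac c \<notin> Bad" using infinite_avoid[OF inf] by blast
  define \<eta> where "\<eta> = poly (Q A) (to_ac c)"
  have "\<eta> : E" unfolding \<eta>_def Q_def poly_prod using \<theta> stable H(1)
    by (auto simp: A_def intro!: intermediate_prod[OF E] intermediate_diff[OF E] intermediate_base[OF E])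
  moreover have "\<phi> \<eta> = \<eta> \<longleftrightarrow> \<phi> : H" if \<phi>: "\<phi> : ac_auts" for \<phi> proof -
    note hom = ac_auts_rhom[OF \<phi>]
    have inj: "inj \<phi>" using ac_auts_bij[OF \<phi>] by (simp add: bij_is_inj)
    then have injA: "inj_on \<phi> A" by (rule inj_on_subset) simp
    have im: "\<phi> \<eta> = poly (Q (\<phi> ` A)) (to_ac c)"
      by (simp add: \<eta>_def Q_def poly_prod prod.reindex[OF injA] rhom_prod[OF hom] rhom_diff[OF hom] ac_auts_base[OF \<phi>])
    have imA: "\<phi> ` A \<subseteq> ac_orbit \<theta>" proof safe
      fix a assume "a : A"
      then obtain \<psi> where "\<psi> : ac_auts" "a = \<psi> \<theta>" using H(1) by (auto simp: A_def)
      then show "\<phi> a : ac_orbit \<theta>"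
        unfolding ac_orbit_def by (intro CollectI exI[of _ "\<phi> \<circ> \<psi>"]) (simp add: ac_auts_comp[OF \<phi>])
    qed
    show ?thesis proof
      assume "\<phi> : H"
      then have "\<phi> ` A \<subseteq> A" by (rule HA)
      then have "\<phi> ` A = A" using finA injA by (intro endo_inj_surj)
      then show "\<phi> \<eta> = \<eta>" unfolding im by (simp add: \<eta>_def)
    next
      assume "\<phi> \<eta> = \<eta>"
      then have "poly (Q (\<phi> ` A) - Q A) (to_ac c) = 0" unfolding im by (simp add: \<eta>_def)
      then have eq: "\<phi> ` A = A" using c imA unfolding Bad_def by blast
      have "id : H" by (rule H(3)[OF ac_auts_id]) simp
      then have "\<theta> : A" unfolding A_def by (intro CollectI exI[of _ id]) simp
      then obtain a where a: "a : A" "\<phi> a = \<theta>" using eq by (metis imageE)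
      then obtain \<psi> where \<psi>: "\<psi> : H" "a = \<psi> \<theta>" by (auto simp: A_def)
      have \<psi>': "\<psi> : ac_auts" using \<psi>(1) H(1) by blast
      have "\<phi> \<circ> \<psi> : H" using a \<psi> by (intro H(3) ac_auts_comp[OF \<phi> \<psi>']) simp
      have "finite A" by (rule finA)
      have inv: "inv_into UNIV \<psi> : H" proof -
        have "\<psi> ` A \<subseteq> A" by (rule HA[OF \<psi>(1)])
        moreover have "inj_on \<psi> A" using ac_auts_bij[OF \<psi>'] by (metis bij_is_inj inj_on_subset subset_UNIV)
        ultimately have "\<psi> ` A = A" using finA by (intro endo_inj_surj)
        then obtain b where b: "b : A" "\<psi> b = \<theta>" using \<open>\<theta> : A\<close> by (metis imageE)
        then obtain \<chi> where \<chi>: "\<chi> : H" "b = \<chi> \<theta>" by (auto simp: A_def)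
        have \<chi>': "\<chi> : ac_auts" using \<chi>(1) H(1) by blast
        note bij\<psi> = ac_auts_bij[OF \<psi>']
        have \<psi>\<chi>: "\<psi> \<circ> \<chi> : ac_auts" by (rule ac_auts_comp[OF \<psi>' \<chi>'])
        have "inv_into UNIV (\<psi> \<circ> \<chi>) : H" proof (rule H(3)[OF ac_auts_inv[OF \<psi>\<chi>]])
          have "(\<psi> \<circ> \<chi>) \<theta> = \<theta>" using b \<chi> by simp
          then show "inv_into UNIV (\<psi> \<circ> \<chi>) \<theta> = \<theta>" using ac_auts_bij[OF \<psi>\<chi>] by (metis bij_is_inj inv_f_f)
        qed
        then have "\<chi> \<circ> inv_into UNIV (\<psi> \<circ> \<chi>) : H" using H(2)[OF \<chi>(1)] by blast
        moreover have "\<chi> \<circ> inv_into UNIV (\<psi> \<circ> \<chi>) = inv_into UNIV \<psi>" proof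
          fix x
          have "\<psi> (\<chi> (inv_into UNIV (\<psi> \<circ> \<chi>) x)) = x"
            using surj_f_inv_f[OF bij_is_surj[OF ac_auts_bij[OF \<psi>\<chi>]], of x] by simp
          then show "(\<chi> \<circ> inv_into UNIV (\<psi> \<circ> \<chi>)) x = inv_into UNIV \<psi> x"
            using inv_f_f[OF bij_is_inj[OF bij\<psi>]] by (metis comp_apply)
        qed
        ultimately show ?thesis by simp
      qed
      have "(\<phi> \<circ> \<psi>) \<circ> inv_into UNIV \<psi> : H" by (rule H(2)[OF \<open>\<phi> \<circ> \<psi> : H\<close> inv])
      moreover have "(\<phi> \<circ> \<psi>) \<circ> inv_into UNIV \<psi> = \<phi>"
        using surj_f_inv_f[OF bij_is_surj[OF ac_auts_bij[OF \<psi>']]] by (simp add: fun_eq_iff)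
      ultimately show "\<phi> : H" by simp
    qed
  qed
  ultimately show ?thesis by blast
qed

text \<open>The powers below \<eta>$^n$ are linearly independent because a relation would have all
  \<open>n\<close> conjugates of \<eta> as roots. They are added one by one, following the inductive
  definition of \<open>dimension\<close>.\<close>

lemma extension_degree_orbit:
  fixes E :: "'m::field alg_closure set"
  assumes n: "n = card (ac_orbit \<eta>)"
    and sub: "!!h. poly (map_poly to_ac h) \<eta> : E"
    and sup: "!!z. z : E ==> \<exists>h. z = poly (map_poly to_ac h) \<eta> \<and> degree h < n"
  shows "extension_degree n E"
proof -
  interpret field "ac_ring :: 'm alg_closure ring" by (rule field_from_type_algebra)
  define V where "V j = {poly (map_poly to_ac h) \<eta> | h. h = 0 \<or> degree h < j}" for j
  have "dimension j (range to_ac) (V j)" if "j \<le> n" for j using that proof (induction j)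
    case 0
    have "V 0 = {\<zero>\<^bsub>ac_ring\<^esub>}" by (auto simp: V_def ac_ring_simps)
    then show ?case by auto
  next
    case (Suc j)
    have "\<eta> ^ j \<notin> V j" proof
      assume "\<eta> ^ j : V j"
      then obtain h where h: "\<eta> ^ j = poly (map_poly to_ac h) \<eta>" "h = 0 \<or> degree h < j" by (auto simp: V_def)
      define g where "g = Polynomial.monom 1 j - h"
      have cg: "Polynomial.coeff g j = 1" using h(2) by (auto simp: g_def coeff_eq_0)
      then have g0: "g ~= 0" by auto
      have degg: "degree g \<le> j" unfolding g_def using h(2) by (intro degree_diff_le) (auto simp: degree_monom_le)
      have mg: "map_poly to_ac g ~= 0" using g0 map_poly_to_ac_eq_iff[of g 0] by simp
      have "poly (map_poly to_ac g) \<eta> = 0" using h(1) by (simp add: g_def rhom_diff[OF rhom_map_poly[OF rhom_to_ac]] map_poly_monom poly_monom)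
      then have "ac_orbit \<eta> \<subseteq> {x. poly (map_poly to_ac g) x = 0}" using ac_auts_root by (auto simp: ac_orbit_def)
      then have "n \<le> card {x. poly (map_poly to_ac g) x = 0}" unfolding n by (rule card_mono[OF poly_roots_finite[OF mg]])
      also have "... \<le> degree (map_poly to_ac g)" by (rule card_poly_roots_bound[OF mg])
      also have "... = degree g" by (rule degree_map_poly) simp
      finally show False using degg Suc.prems by simp
    qed
    moreover have "dimension j (range to_ac) (V j)" using Suc by simp
    ultimately have "dimension (Suc j) (range to_ac) (line_extension (range to_ac) (\<eta> ^ j) (V j))"
      by (intro dimension.Suc_dim) (simp_all add: ac_ring_simps)
    moreover have "line_extension (range to_ac) (\<eta> ^ j) (V j) = V (Suc j)" proof (intro equalityI subsetI)
      fix z assume "z : line_extension (range to_ac) (\<eta> ^ j) (V j)"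
      then obtain c h where h: "z = to_ac c * \<eta> ^ j + poly (map_poly to_ac h) \<eta>" "h = 0 \<or> degree h < j"
        by (auto simp: line_extension_mem_iff V_def ac_ring_simps)
      have "z = poly (map_poly to_ac (Polynomial.monom c j + h)) \<eta>"
        by (simp add: h(1) rhom_add[OF rhom_map_poly[OF rhom_to_ac]] map_poly_monom poly_monom)
      moreover have "degree (Polynomial.monom c j + h) < Suc j" using h(2) by (intro le_imp_less_Suc degree_add_le) (auto simp: degree_monom_le)
      ultimately show "z : V (Suc j)" unfolding V_def by blast
    next
      fix z assume "z : V (Suc j)"
      then obtain h where h: "z = poly (map_poly to_ac h) \<eta>" "h = 0 \<or> degree h < Suc j" by (auto simp: V_def)
      define g where "g = h - Polynomial.monom (Polynomial.coeff h j) j"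
      have "g = 0 \<or> degree g < j" proof -
        have "Polynomial.coeff g i = 0" if "i \<ge> j" for i using that h(2) by (cases "i = j") (auto simp: g_def coeff_eq_0)
        then show ?thesis by (metis leading_coeff_0_iff linorder_not_le)
      qed
      then have "poly (map_poly to_ac g) \<eta> : V j" unfolding V_def by blast
      moreover have "z = to_ac (Polynomial.coeff h j) * \<eta> ^ j + poly (map_poly to_ac g) \<eta>"
        by (simp add: h(1) g_def rhom_diff[OF rhom_map_poly[OF rhom_to_ac]] map_poly_monom poly_monom)
      ultimately show "z : line_extension (range to_ac) (\<eta> ^ j) (V j)" by (auto simp: line_extension_mem_iff ac_ring_simps)
    qed
    ultimately show ?case by simp
  qed
  moreover have "V n = E" using sub sup by (auto simp: V_def)
  ultimately show ?thesis unfolding extension_degree_def by auto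
qed

section \<open>Irreducible factors and orbits\<close>

text \<open>A factor over the base that vanishes at \<open>x\<close> vanishes on the whole orbit, so
  it already has full degree.\<close>

lemma irreducible_orbit_polynomial:
  assumes E: "galois_field E" and x: "x : E"
  obtains g where "map_poly to_ac g = (\<Prod>a\<in>ac_orbit x. [:- a, 1:])" "irreducible g" "degree g = card (ac_orbit x)"
proof -
  have E': "intermediate E" "!!\<phi> z. \<phi> : ac_auts ==> z : E ==> \<phi> z : E" using E by (auto simp: galois_field_def)
  define Q where "Q = (\<Prod>a\<in>ac_orbit x. [:- a, 1:])"
  have "Q : polys_over E" unfolding Q_def using x E' by (intro polys_over_prod polys_over_linear) (auto simp: ac_orbit_def)
  moreover have "map_poly \<phi> Q = Q" if \<phi>: "\<phi> : ac_auts" for \<phi> proof -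
    note hom = ac_auts_rhom[OF \<phi>]
    have inj: "inj_on \<phi> (ac_orbit x)" using ac_auts_bij[OF \<phi>] by (metis bij_is_inj inj_on_subset subset_UNIV)
    have "\<phi> ` ac_orbit x \<subseteq> ac_orbit x" proof safe
      fix a assume "a : ac_orbit x"
      then obtain \<psi> where "\<psi> : ac_auts" "a = \<psi> x" by (auto simp: ac_orbit_def)
      then show "\<phi> a : ac_orbit x"
        unfolding ac_orbit_def by (intro CollectI exI[of _ "\<phi> \<circ> \<psi>"]) (simp add: ac_auts_comp[OF \<phi>])
    qed
    then have im: "\<phi> ` ac_orbit x = ac_orbit x" using finite_ac_orbit inj by (intro endo_inj_surj)
    have "map_poly \<phi> Q = (\<Prod>a\<in>ac_orbit x. [:- \<phi> a, 1:])"
      by (simp add: Q_def rhom_prod[OF rhom_map_poly[OF hom]] map_poly_pCons_rhom[OF hom] rhom_minus[OF hom] rhom_1[OF hom])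
    also have "... = (\<Prod>a\<in>\<phi> ` ac_orbit x. [:- a, 1:])" by (simp add: prod.reindex[OF inj])
    finally show ?thesis by (simp add: im Q_def)
  qed
  ultimately obtain g where g: "Q = map_poly to_ac g" by (rule galois_field_polys[OF E])
  have deg: "degree g = card (ac_orbit x)" proof -
    have "degree g = degree Q" unfolding g by (rule degree_map_poly[symmetric]) simp
    also have "... = card (ac_orbit x)" unfolding Q_def by (subst degree_prod_eq_sum_degree) auto
    finally show ?thesis .
  qed
  have xO: "x : ac_orbit x" unfolding ac_orbit_def by (intro CollectI exI[of _ id]) (simp add: ac_auts_id)
  then have pos: "degree g > 0" unfolding deg using finite_ac_orbit card_gt_0_iff by blast
  have g0: "g ~= 0" using pos by auto
  have unit: "is_unit p \<or> is_unit q" if pq: "g = p * q" for p q proof -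
    have root: "poly Q x = 0" unfolding Q_def poly_prod using finite_ac_orbit xO by (intro prod_zero) auto
    have Qpq: "Q = map_poly to_ac p * map_poly to_ac q" unfolding g pq by (rule rhom_mult[OF rhom_map_poly[OF rhom_to_ac]])
    have p0: "p ~= 0" "q ~= 0" using g0 pq by auto
    have key: "is_unit k" if r: "poly (map_poly to_ac h) x = 0" and hk: "g = h * k" "h ~= 0" "k ~= 0" for h k proof -
      have h0: "map_poly to_ac h ~= 0" using hk(2) map_poly_to_ac_eq_iff[of h 0] by simp
      have "ac_orbit x \<subseteq> {y. poly (map_poly to_ac h) y = 0}" using ac_auts_root r by (auto simp: ac_orbit_def)
      then have "degree g \<le> card {y. poly (map_poly to_ac h) y = 0}" unfolding deg by (rule card_mono[OF poly_roots_finite[OF h0]])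
      also have "... \<le> degree (map_poly to_ac h)" by (rule card_poly_roots_bound[OF h0])
      also have "... = degree h" by (rule degree_map_poly) simp
      finally have "degree k = 0" using hk by (simp add: degree_mult_eq)
      then show ?thesis using hk(3) by (auto simp: is_unit_iff_degree)
    qed
    have "poly (map_poly to_ac p) x = 0 \<or> poly (map_poly to_ac q) x = 0" using root by (simp add: Qpq)
    then show ?thesis using key[of p q] key[of q p] p0 pq by (auto simp: mult.commute)
  qed
  have "irreducible g" proof (rule Factorial_Ring.irreducibleI)
    show "\<not> is_unit g" using pos by (auto simp: is_unit_iff_degree g0)
  qed (use g0 unit in auto)
  then show thesis using that[of g] g deg Q_def by simp
qed

lemma factor_degrees_orbits:
  assumes E: "galois_field E" and I: "finite I" and X: "!!i. i : I ==> x i : E"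
    and H: "map_poly to_ac H = (\<Prod>i\<in>I. \<Prod>a\<in>ac_orbit (x i). [:- a, 1:])"
  shows "factor_degrees H (image_mset (\<lambda>i. card (ac_orbit (x i))) (mset_set I))"
proof -
  have "\<exists>g. map_poly to_ac g = (\<Prod>a\<in>ac_orbit (x i). [:- a, 1:]) \<and> irreducible g \<and> degree g = card (ac_orbit (x i))"
    if "i : I" for i using irreducible_orbit_polynomial[OF E X[OF that]] by metis
  then obtain g where g: "!!i. i : I ==> map_poly to_ac (g i) = (\<Prod>a\<in>ac_orbit (x i). [:- a, 1:])"
    "!!i. i : I ==> irreducible (g i)" "!!i. i : I ==> degree (g i) = card (ac_orbit (x i))" by metis
  have "map_poly to_ac (\<Prod>i\<in>I. g i) = map_poly to_ac H"
    unfolding H rhom_prod[OF rhom_map_poly[OF rhom_to_ac]] using g(1) by (rule prod.cong[OF refl])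
  then have "(\<Prod>i\<in>I. g i) = H" by (simp add: map_poly_to_ac_eq_iff)
  then show ?thesis unfolding factor_degrees_def using g(2,3) I by (intro exI[of _ "image_mset g (mset_set I)"])
      (auto simp: prod_unfold_prod_mset multiset.map_comp intro!: image_mset_cong)
qed

section \<open>Explicit algebra of the pentagon recurrence and of the two quintics\<close>

section \<open>The pentagon recurrence\<close>

text \<open>The nondegeneracy locus: here none of the five $x_k$ is 0 or 1, so all ten functions are
  defined and nonzero (\<open>xs_neq_0\<close>, \<open>xs_neq_1\<close>).\<close>

definition pentagon :: "'a::field => 'a => bool" where
  "pentagon u v \<longleftrightarrow> u ~= 0 \<and> v ~= 0 \<and> u ~= 1 \<and> v ~= 1 \<and> u + v ~= 1"

text \<open>The orbit of \<open>x\<close> under \<open>\<sigma>\<close>, indexed modulo 5; it satisfies $x_{k-1} x_{k+1} = 1 - x_k$.\<close>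

definition xs :: "'a::field => 'a => int => 'a" where
  "xs u v k = (if k mod 5 = 0 then u else if k mod 5 = 1 then v else if k mod 5 = 2 then (1 - v) / u
     else if k mod 5 = 3 then (u + v - 1) / (u * v) else (1 - u) / v)"

text \<open>The orbit of \<open>x\<close> under $F_{20}$; the upper index is taken modulo 2.\<close>

definition ys :: "'a::field => 'a => int => int => 'a" where
  "ys u v e k = (if even e then xs u v k else xs u v k / (xs u v k - 1))"

lemma mod5_cases:
  fixes k :: int
  obtains "k mod 5 = 0" | "k mod 5 = 1" | "k mod 5 = 2" | "k mod 5 = 3" | "k mod 5 = 4"
proof -
  have "0 \<le> k mod 5" "k mod 5 < 5" by simp_all
  then have "k mod 5 = 0 \<or> k mod 5 = 1 \<or> k mod 5 = 2 \<or> k mod 5 = 3 \<or> k mod 5 = 4" by linarith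
  then show thesis using that by (elim disjE)
qed

lemma xs_cong: "k mod 5 = l mod 5 ==> xs u v k = xs u v l" by (simp add: xs_def)

lemma ys_cong: "k mod 5 = l mod 5 ==> even e = even f ==> ys u v e k = ys u v f l" by (simp add: ys_def cong: xs_cong)

lemma xs_simps [simp]:
  "xs u v 0 = u" "xs u v 1 = v" "xs u v 2 = (1 - v) / u" "xs u v 3 = (u + v - 1) / (u * v)" "xs u v 4 = (1 - u) / v" by (simp_all add: xs_def)

lemma ys_0: "ys u v 0 k = xs u v k" and ys_1: "ys u v 1 k = xs u v k / (xs u v k - 1)" by (simp_all add: ys_def)

lemma pentagon_uv_neq: "pentagon u v ==> u + v - 1 ~= 0" "pentagon u v ==> u + v - 1 ~= u * v"
proof -
  assume p: "pentagon u v"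
  then show "u + v - 1 ~= 0" by (simp add: pentagon_def)
  have "(u - 1) * (v - 1) ~= 0" using p by (simp add: pentagon_def)
  then show "u + v - 1 ~= u * v" by (auto simp: algebra_simps)
qed

lemma xs_neq_0: "pentagon u v ==> xs u v k ~= 0" using pentagon_uv_neq[of u v] by (cases k rule: mod5_cases) (auto simp: xs_def pentagon_def)

lemma xs_neq_1: "pentagon u v ==> xs u v k ~= 1" using pentagon_uv_neq[of u v]
  by (cases k rule: mod5_cases) (auto simp: xs_def pentagon_def divide_eq_1_iff diff_eq_eq add.commute)

lemma xs_rec:
  assumes "pentagon u v"
  shows "xs u v k * xs u v (k + 2) = 1 - xs u v (k + 1)"
proof -
  have nz: "u ~= 0" "v ~= 0" using assms by (auto simp: pentagon_def)
  show ?thesis proof (cases k rule: mod5_cases)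
    case 1
    then have "(k + 1) mod 5 = 1" "(k + 2) mod 5 = 2" by presburger+
    with 1 show ?thesis using nz by (simp add: xs_def)
  next
    case 2
    then have "(k + 1) mod 5 = 2" "(k + 2) mod 5 = 3" by presburger+
    with 2 show ?thesis using nz by (simp add: xs_def field_simps)
  next
    case 3
    then have "(k + 1) mod 5 = 3" "(k + 2) mod 5 = 4" by presburger+
    with 3 show ?thesis using nz by (simp add: xs_def field_simps)
  next
    case 4
    then have "(k + 1) mod 5 = 4" "(k + 2) mod 5 = 0" by presburger+
    with 4 show ?thesis using nz by (simp add: xs_def field_simps)
  next
    case 5
    then have "(k + 1) mod 5 = 0" "(k + 2) mod 5 = 1" by presburger+
    with 5 show ?thesis using nz by (simp add: xs_def field_simps)
  qed
qed

text \<open>The recurrence gives $x_k + x_{k+1} - 1 = x_k (1 - x_{k+2})$, a product of nonzero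
  factors.\<close>

lemma pentagon_xs:
  assumes p: "pentagon u v" shows "pentagon (xs u v k) (xs u v (k + 1))"
proof -
  have "xs u v (k + 1) - 1 + xs u v k * xs u v (k + 2) = 0" using xs_rec[OF p, of k] by simp
  moreover have "xs u v k * (1 - xs u v (k + 2)) ~= 0" using xs_neq_0[OF p] xs_neq_1[OF p, of "k + 2"] by auto
  moreover have "xs u v k + xs u v (k + 1) - 1
      = (xs u v (k + 1) - 1 + xs u v k * xs u v (k + 2)) + xs u v k * (1 - xs u v (k + 2))" by (simp add: algebra_simps)
  ultimately have "xs u v k + xs u v (k + 1) ~= 1" by auto
  then show ?thesis using xs_neq_0[OF p] xs_neq_1[OF p] by (simp add: pentagon_def)
qed

text \<open>Two neighbouring values determine all others, since the recurrence can be solved forward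
  by dividing by nonzero terms. Shift, \<rho> and cross ratios are all handled by verifying the
  recurrence.\<close>

lemma xs_eqI:
  assumes p: "pentagon u v" and 0: "f 0 = u" "f 1 = v" and f: "!!k. f k * f (k + 2) = 1 - f (k + 1)"
    and per: "!!k l. k mod 5 = l mod 5 ==> f k = f l"
  shows "f k = xs u v k"
proof -
  have f2: "f 2 = xs u v 2" using f[of 0] p 0 by (simp add: pentagon_def field_simps)
  have f3: "f 3 = xs u v 3" proof -
    have "v * f 3 = v * xs u v 3" using f[of 1] xs_rec[OF p, of 1] f2 0 by (simp del: xs_simps(3-5))
    then show ?thesis using p by (simp add: pentagon_def del: xs_simps)
  qed
  have "xs u v 2 * f 4 = xs u v 2 * xs u v 4" using f[of 2] xs_rec[OF p, of 2] f2 f3 by (simp del: xs_simps)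
  then have f4: "f 4 = xs u v 4" using xs_neq_0[OF p, of 2] by (simp del: xs_simps)
  have "f k = f (k mod 5)" "xs u v k = xs u v (k mod 5)" by (rule per, simp) (rule xs_cong, simp)
  moreover have "f (k mod 5) = xs u v (k mod 5)" by (cases k rule: mod5_cases) (simp_all add: 0 f2 f3 f4 del: xs_simps(3-5))
  ultimately show ?thesis by simp
qed

lemma xs_shift:
  assumes p: "pentagon u v" shows "xs (xs u v n) (xs u v (n + 1)) k = xs u v (k + n)"
proof (rule xs_eqI[symmetric, OF pentagon_xs[OF p], where f = "\<lambda>k. xs u v (k + n)"])
  show "xs u v (k + n) * xs u v (k + 2 + n) = 1 - xs u v (k + 1 + n)" for k using xs_rec[OF p, of "k + n"] by (simp add: ac_simps)
  show "xs u v (k + n) = xs u v (l + n)" if "k mod 5 = l mod 5" for k l using that by (intro xs_cong) (metis mod_add_left_eq)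
qed (simp_all add: ac_simps)

text \<open>Put $a = x_k$, $b = x_{k+2}$, $c = x_{k+4}$. The recurrence implies $ac(b-1) =
  -(a-1)(c-1)$, which says that the numbers $x/(x-1)$ satisfy the same recurrence with the index
  doubled.\<close>

lemma xs_rho:
  assumes p: "pentagon u v"
  shows "pentagon (ys u v 1 0) (ys u v 1 2)" and "xs (ys u v 1 0) (ys u v 1 2) k = ys u v 1 (2 * k)"
proof -
  note nz = xs_neq_0[OF p] xs_neq_1[OF p]
  define w where "w = xs u v"
  have w: "w k ~= 0" "w k - 1 ~= 0" "w k ~= 1" for k using nz by (auto simp: w_def)
  have rec: "w k * w (k + 2) = 1 - w (k + 1)" for k using xs_rec[OF p] by (simp add: w_def)
  have Y: "ys u v 1 k = w k / (w k - 1)" for k by (simp add: ys_1 w_def)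
  have per: "w k = w l" if "k mod 5 = l mod 5" for k l unfolding w_def by (rule xs_cong[OF that])
  have step: "Y k * Y (k + 4) = 1 - Y (k + 2)" if "Y = (\<lambda>k. w k / (w k - 1))" for Y k proof -
    define a b c where "a = w k" and "b = w (k + 2)" and "c = w (k + 4)"
    have k5: "w (k + 5) = a" unfolding a_def by (rule per) simp
    have r3: "w (k + 3) = 1 - b * c" using rec[of "k + 2"] by (simp add: b_def c_def add.assoc)
    have r4: "w (k + 3) * a = 1 - c" using rec[of "k + 3"] k5 by (simp add: c_def add.assoc)
    have "a * b * c = a + c - 1" using r4 unfolding r3 by (simp add: algebra_simps)
    then have eq: "a * c * (b - 1) = - ((a - 1) * (c - 1))" by (simp add: algebra_simps)
    have nz: "a - 1 ~= 0" "b - 1 ~= 0" "c - 1 ~= 0" using w by (auto simp: a_def b_def c_def)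
    have "a / (a - 1) * (c / (c - 1)) = a * c * (b - 1) / ((a - 1) * (c - 1) * (b - 1))" using nz by simp
    also have "... = - 1 / (b - 1)" unfolding eq using nz by simp
    also have "... = 1 - b / (b - 1)" using nz by (simp add: field_simps)
    finally show ?thesis by (simp add: that a_def b_def c_def)
  qed
  have y: "Y k ~= 0 \<and> Y k ~= 1" if "Y = (\<lambda>k. w k / (w k - 1))" for Y k using w[of k] by (simp add: that divide_eq_eq)
  define Y where "Y = (\<lambda>k. w k / (w k - 1))"
  have "Y 2 + Y 0 ~= 1" proof
    assume "Y 2 + Y 0 = 1"
    then have "1 - Y 2 = Y 0" by (metis add_diff_cancel_left')
    then have "Y 0 * Y 4 = Y 0" using step[OF Y_def, of 0] by simp
    then show False using y[OF Y_def] by simp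
  qed
  then show pent: "pentagon (ys u v 1 0) (ys u v 1 2)" using y[OF Y_def] unfolding pentagon_def Y by (auto simp: Y_def add.commute)
  show "xs (ys u v 1 0) (ys u v 1 2) k = ys u v 1 (2 * k)" proof (rule xs_eqI[symmetric, OF pent, where f = "\<lambda>k. ys u v 1 (2 * k)"])
    show "ys u v 1 (2 * k) * ys u v 1 (2 * (k + 2)) = 1 - ys u v 1 (2 * (k + 1))" for k
      using step[OF Y_def, of "2 * k"] by (simp add: Y Y_def algebra_simps)
    show "ys u v 1 (2 * k) = ys u v 1 (2 * l)" if "k mod 5 = l mod 5" for k l using that by (intro ys_cong) (metis mod_mult_right_eq, simp)
  qed simp_all
qed

lemma ys_from_xs:
  assumes "pentagon u v" "!!k. xs u' v' k = ys u v i (m * k + n)"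
  shows "ys u' v' e k = ys u v (e + i) (m * k + n)"
proof (cases "even i")
  case True
  then show ?thesis using assms(2) by (simp add: ys_def)
next
  case False
  define a where "a = xs u v (m * k + n)"
  have a: "a ~= 0" "a ~= 1" unfolding a_def using xs_neq_0[OF assms(1)] xs_neq_1[OF assms(1)] by auto
  have x: "xs u' v' k = a / (a - 1)" using assms(2) False by (simp add: ys_def a_def)
  have "a / (a - 1) / (a / (a - 1) - 1) = a" using a by (simp add: field_simps)
  then show ?thesis using False by (simp add: ys_def x a_def[symmetric])
qed

lemma pentagon_rho_power:
  assumes p: "pentagon u v"
  shows "pentagon (ys u v (int i) 0) (ys u v (int i) (2 ^ i)) \<and>
    (\<forall>e k. ys (ys u v (int i) 0) (ys u v (int i) (2 ^ i)) e k = ys u v (e + int i) (2 ^ i * k))"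
proof (induction i)
  case 0
  then show ?case using p by (simp add: ys_0)
next
  case (Suc i)
  define u' v' where "u' = ys u v (int i) 0" and "v' = ys u v (int i) (2 ^ i)"
  have p': "pentagon u' v'" and IH: "!!e k. ys u' v' e k = ys u v (e + int i) (2 ^ i * k)" using Suc by (auto simp: u'_def v'_def)
  have eq: "ys u' v' 1 0 = ys u v (int (Suc i)) 0" "ys u' v' 1 2 = ys u v (int (Suc i)) (2 ^ Suc i)"
    using IH[of 1 0] IH[of 1 2] by (simp_all add: ac_simps)
  have x: "xs (ys u' v' 1 0) (ys u' v' 1 2) k = ys u v (int (Suc i)) (2 ^ Suc i * k + 0)" for k
    using xs_rho(2)[OF p', of k] IH[of 1 "2 * k"] by (simp add: ac_simps)
  show ?case using xs_rho(1)[OF p'] ys_from_xs[OF p, of "ys u' v' 1 0" "ys u' v' 1 2" "int (Suc i)" "2 ^ Suc i" 0, OF x] unfolding eq by simp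
qed

text \<open>A shift by \<open>n\<close> is followed by \<open>i\<close> steps of \<rho>. Evaluating
  \<open>ys\<close> at the new point is thus a reindexing at the old one, which is how group
  elements act on all later formulas.\<close>

lemma pentagon_affine:
  assumes p: "pentagon u v" and i: "i \<ge> 0"
  shows "pentagon (ys u v i n) (ys u v i (2 ^ nat i + n))"
    and "ys (ys u v i n) (ys u v i (2 ^ nat i + n)) e k = ys u v (e + i) (2 ^ nat i * k + n)"
proof -
  define u' v' where "u' = xs u v n" and "v' = xs u v (n + 1)"
  have p': "pentagon u' v'" unfolding u'_def v'_def by (rule pentagon_xs[OF p])
  have "xs u' v' k = ys u v 0 (1 * k + n)" for k unfolding u'_def v'_def by (simp add: xs_shift[OF p] ys_0)
  from ys_from_xs[OF p this] have sh: "ys u' v' e k = ys u v e (k + n)" for e k by simp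
  have i': "int (nat i) = i" using i by simp
  show "pentagon (ys u v i n) (ys u v i (2 ^ nat i + n))"
    "ys (ys u v i n) (ys u v i (2 ^ nat i + n)) e k = ys u v (e + i) (2 ^ nat i * k + n)"
    using pentagon_rho_power[OF p', of "nat i"] unfolding sh i' by (simp_all add: add.commute)
qed

section \<open>Brumer's quintic\<close>

definition tfun :: "'a::field => 'a => 'a" where
  "tfun u v = - ((u - 1) * (v - 1) * (u + v - 1) / (u * v))"

definition sfun :: "'a::field => 'a => 'a" where
  "sfun u v = (\<Sum>k\<in>{0..4}. (xs u v k - 1) * (xs u v (k + 1) - 1))"

definition pfun :: "'a::field => 'a => 'a" where
  "pfun u v = tfun u v - 1 / tfun u v"

definition qfun :: "'a::field => 'a => 'a" where
  "qfun u v = sfun u v + (sfun u v + 5 * tfun u v) / (tfun u v)\<^sup>2"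

text \<open>Brumer's generic polynomial for $D_5$; over the point $(u,v)$ its roots are the five
  $x_k$.\<close>

definition brumer :: "'a::field => 'a => 'a poly" where
  "brumer s t = [:t, s, t\<^sup>2 - t - 2 * s - 1, s - t + 3, t - 3, 1:]"

lemma atLeast0AtMost4_int: "{0..4} = {0, 1, 2, 3, 4 :: int}" by auto

text \<open>The relation $ac = 1 - b$ and its rotations collapse every triple product to degree at
  most two, and $a - 1 = -eb$ turns each summand of $s$ into a product of four roots.\<close>

lemma brumer_symmetric_functions:
  fixes a b c d e :: "'a::field"
  assumes r: "a * c = 1 - b" "b * d = 1 - c" "c * e = 1 - d" "d * a = 1 - e" "e * b = 1 - a"
    and t: "a + b + c + d + e = 3 - t" "a * b * c * d * e = - t"
    and s: "s = (a - 1) * (b - 1) + (b - 1) * (c - 1) + (c - 1) * (d - 1) + (d - 1) * (e - 1) + (e - 1) * (a - 1)"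
  shows "a*b + b*c + c*d + d*e + e*a + a*c + b*d + c*e + d*a + e*b = s - t + 3"
    and "a*b*c + b*c*d + c*d*e + d*e*a + e*a*b + a*b*d + b*c*e + c*d*a + d*e*b + e*a*c = - (t^2 - t - 2 * s - 1)"
    and "a*b*c*d + b*c*d*e + c*d*e*a + d*e*a*b + e*a*b*c = s"
proof -
  have t': "t = 3 - (a + b + c + d + e)" using t(1) by simp
  show "a*b + b*c + c*d + d*e + e*a + a*c + b*d + c*e + d*a + e*b = s - t + 3" unfolding r s t' by (simp add: algebra_simps)
  show "a*b*c + b*c*d + c*d*e + d*e*a + e*a*b + a*b*d + b*c*e + c*d*a + d*e*b + e*a*c = - (t^2 - t - 2 * s - 1)" proof -
    have q: "a*b*c = b * (1 - b)" "b*c*d = c * (1 - c)" "c*d*e = d * (1 - d)" "d*e*a = e * (1 - e)" "e*a*b = a * (1 - a)"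
      unfolding r[symmetric] by (simp_all add: mult_ac)
    have q': "a*b*d = a * (1 - c)" "b*c*e = b * (1 - d)" "c*d*a = c * (1 - e)" "d*e*b = d * (1 - a)" "e*a*c = e * (1 - b)"
      unfolding r[symmetric] by (simp_all add: mult_ac)
    have "a*b*c + b*c*d + c*d*e + d*e*a + e*a*b + a*b*d + b*c*e + c*d*a + d*e*b + e*a*c
      = b * (1 - b) + c * (1 - c) + d * (1 - d) + e * (1 - e) + a * (1 - a)
        + (a + b + c + d + e) - (a*c + b*d + c*e + d*a + e*b)" unfolding q q' by (simp add: algebra_simps)
    also have "a*c + b*d + c*e + d*a + e*b = 5 - (a + b + c + d + e)" unfolding r by simp
    finally have L: "a*b*c + b*c*d + c*d*e + d*e*a + e*a*b + a*b*d + b*c*e + c*d*a + d*e*b + e*a*c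
      = 3 * (a + b + c + d + e) - 5 - (a*a + b*b + c*c + d*d + e*e)" by (simp add: algebra_simps)
    have "(a + b + c + d + e)^2 = a*a + b*b + c*c + d*d + e*e + 2 * (a*b + b*c + c*d + d*e + e*a)
      + 2 * (a*c + b*d + c*e + d*a + e*b)" by (simp add: power2_eq_square algebra_simps)
    also have "a*c + b*d + c*e + d*a + e*b = 5 - (a + b + c + d + e)" unfolding r by simp
    finally have Q: "(a + b + c + d + e)^2 = a*a + b*b + c*c + d*d + e*e + 2 * (a*b + b*c + c*d + d*e + e*a)
      + 2 * (5 - (a + b + c + d + e))" .
    have "- (t^2 - t - 2 * s - 1) = - (9 - 6 * (a + b + c + d + e) + (a + b + c + d + e)^2 - t - 2 * s - 1)"
      unfolding t' by (simp add: power2_eq_square algebra_simps)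
    then show ?thesis unfolding L Q s t' by (simp add: algebra_simps)
  qed
  show "a*b*c*d + b*c*d*e + c*d*e*a + d*e*a*b + e*a*b*c = s" proof -
    have "a - 1 = - (e * b)" "b - 1 = - (a * c)" "c - 1 = - (b * d)" "d - 1 = - (c * e)" "e - 1 = - (d * a)" unfolding r by simp_all
    then show ?thesis unfolding s by (simp add: mult_ac add_ac)
  qed
qed

lemma xs_relations:
  assumes p: "pentagon u v"
  shows "xs u v 0 * xs u v 2 = 1 - xs u v 1" "xs u v 1 * xs u v 3 = 1 - xs u v 2" "xs u v 2 * xs u v 4 = 1 - xs u v 3"
    "xs u v 3 * xs u v 0 = 1 - xs u v 4" "xs u v 4 * xs u v 1 = 1 - xs u v 0"
    "xs u v 0 + xs u v 1 + xs u v 2 + xs u v 3 + xs u v 4 = 3 - tfun u v"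
    "xs u v 0 * xs u v 1 * xs u v 2 * xs u v 3 * xs u v 4 = - tfun u v"
proof -
  have c: "xs u v 5 = xs u v 0" "xs u v 6 = xs u v 1" by (rule xs_cong; simp)+
  show "xs u v 0 * xs u v 2 = 1 - xs u v 1" "xs u v 1 * xs u v 3 = 1 - xs u v 2" "xs u v 2 * xs u v 4 = 1 - xs u v 3"
    "xs u v 3 * xs u v 0 = 1 - xs u v 4" "xs u v 4 * xs u v 1 = 1 - xs u v 0"
    using xs_rec[OF p, of 0] xs_rec[OF p, of 1] xs_rec[OF p, of 2] xs_rec[OF p, of 3] xs_rec[OF p, of 4] c by (simp_all del: xs_simps)
  have nz: "u ~= 0" "v ~= 0" using p by (auto simp: pentagon_def)
  show "xs u v 0 + xs u v 1 + xs u v 2 + xs u v 3 + xs u v 4 = 3 - tfun u v" using nz by (simp add: tfun_def field_simps)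
  show "xs u v 0 * xs u v 1 * xs u v 2 * xs u v 3 * xs u v 4 = - tfun u v" using nz by (simp add: tfun_def field_simps)
qed

lemma sfun_expand: "sfun u v = (xs u v 0 - 1) * (xs u v 1 - 1) + (xs u v 1 - 1) * (xs u v 2 - 1) + (xs u v 2 - 1) * (xs u v 3 - 1)
  + (xs u v 3 - 1) * (xs u v 4 - 1) + (xs u v 4 - 1) * (xs u v 0 - 1)"
proof -
  have "xs u v 5 = xs u v 0" by (rule xs_cong) simp
  then show ?thesis by (simp add: sfun_def atLeast0AtMost4_int add.assoc del: xs_simps)
qed

lemma brumer_factorization:
  assumes p: "pentagon u v"
  shows "brumer (sfun u v) (tfun u v) = (\<Prod>k\<in>{0..4}. [:- xs u v k, 1:])"
proof -
  define a b c d e where abc: "a = xs u v 0" "b = xs u v 1" "c = xs u v 2" "d = xs u v 3" "e = xs u v 4"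
  note rel = xs_relations[OF p, folded abc] and sf = sfun_expand[of u v, folded abc]
  note sym = brumer_symmetric_functions[OF rel sf]
  have "(\<Prod>k\<in>{0..4}. [:- xs u v k, 1:]) = [:-a,1:] * ([:-b,1:] * ([:-c,1:] * ([:-d,1:] * [:-e,1:])))"
    by (simp add: atLeast0AtMost4_int abc del: xs_simps)
  also have "... = [:- (a*b*c*d*e), a*b*c*d + b*c*d*e + c*d*e*a + d*e*a*b + e*a*b*c,
     - (a*b*c + b*c*d + c*d*e + d*e*a + e*a*b + a*b*d + b*c*e + c*d*a + d*e*b + e*a*c),
     a*b + b*c + c*d + d*e + e*a + a*c + b*d + c*e + d*a + e*b, - (a + b + c + d + e), 1:]" by (simp add: algebra_simps)
  also have "... = brumer (sfun u v) (tfun u v)" unfolding sym rel(6) rel(7) by (simp add: brumer_def)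
  finally show ?thesis ..
qed

lemma brumer_root_iff:
  assumes p: "pentagon u v"
  shows "poly (brumer (sfun u v) (tfun u v)) x = 0 \<longleftrightarrow> (\<exists>k. x = xs u v k)"
proof -
  have "poly (brumer (sfun u v) (tfun u v)) x = 0 \<longleftrightarrow> (\<exists>k\<in>{0..4}. x = xs u v k)"
    unfolding brumer_factorization[OF p] poly_prod by (simp add: prod_zero_iff)
  also have "... \<longleftrightarrow> (\<exists>k. x = xs u v k)" proof
    assume "\<exists>k. x = xs u v k"
    then obtain k where k: "x = xs u v k" ..
    have "xs u v k = xs u v (k mod 5)" by (rule xs_cong) simp
    moreover have "k mod 5 : {0..4}" using pos_mod_bound[of 5 k] pos_mod_sign[of 5 k] by auto
    ultimately show "\<exists>k\<in>{0..4}. x = xs u v k" using k by metis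
  qed blast
  finally show ?thesis .
qed

lemma tfun_neq_0: "pentagon u v ==> tfun u v ~= 0" by (auto simp: tfun_def pentagon_def diff_eq_eq add_eq_0_iff)

lemma brumer_at_1: "poly (brumer s t) 1 = t\<^sup>2" by (simp add: brumer_def algebra_simps)

lemma brumer_linear_in_s:
  "poly (brumer s t) x - poly (brumer s' t) x = (s - s') * (x * (x - 1)\<^sup>2)" by (simp add: brumer_def algebra_simps power2_eq_square)

text \<open>For given \<open>u\<close> and \<open>t\<close>, the equation $t(u,v) = t$ is quadratic in \<open>v\<close>; its two solutions have
  the product $1 - u$.\<close>

lemma tfun_eq_iff:
  assumes "pentagon u v" "pentagon u v'"
  shows "tfun u v = tfun u v' \<longleftrightarrow> v' = v \<or> v' = (1 - u) / v"
proof -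
  have nz: "u ~= 0" "u ~= 1" "v ~= 0" "v' ~= 0" using assms by (auto simp: pentagon_def)
  have *: "tfun u w = - ((u - 1) / u) * (w + (u - 2) + (1 - u) / w)" if "w ~= 0" for w using that nz by (simp add: tfun_def field_simps)
  have "tfun u v = tfun u v' \<longleftrightarrow> v + (u - 2) + (1 - u) / v = v' + (u - 2) + (1 - u) / v'"
    unfolding *[OF nz(3)] *[OF nz(4)] using nz(1,2) by simp
  also have "... \<longleftrightarrow> (v - v') * (v * v' - (1 - u)) = 0" using nz(3,4) by (simp add: field_simps)
  also have "... \<longleftrightarrow> v' = v \<or> v' = (1 - u) / v"
    using nz(3) unfolding mult_eq_0_iff right_minus_eq by (auto simp: eq_divide_eq mult.commute)
  finally show ?thesis .
qed

text \<open>Take \<open>u\<close> as a root of the quintic with the prescribed $s,t$ and solve the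
  quadratic $t(u,v) = t$ for \<open>v\<close>. Then $s$ is right as well: the quintic is linear in
  $s$, with coefficient $u(u-1)^2$ at \<open>u\<close>, which does not vanish.\<close>

lemma exists_pentagon:
  fixes s t :: "'a::alg_closed_field"
  assumes t: "t ~= 0"
  obtains u v where "pentagon u v" "tfun u v = t" "sfun u v = s"
proof -
  have "degree (brumer s t) > 0" by (simp add: brumer_def)
  then obtain u where u: "poly (brumer s t) u = 0" using alg_closed_imp_poly_has_root by blast
  have u0: "u ~= 0" using u t by (auto simp: brumer_def)
  have u1: "u ~= 1" using u t brumer_at_1[of s t] by auto
  have "degree [:- ((u - 1)\<^sup>2), (u - 1) * (u - 2) + t * u, u - 1:] > 0" using u1 by simp
  then obtain v where "poly [:- ((u - 1)\<^sup>2), (u - 1) * (u - 2) + t * u, u - 1:] v = 0" using alg_closed_imp_poly_has_root by blast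
  then have v: "(u - 1) * (v - 1) * (u + v - 1) + t * u * v = 0" by (simp add: algebra_simps power2_eq_square)
  have "v ~= 0" using v u1 by auto
  moreover have "v ~= 1" using v u0 t by auto
  moreover have "u + v ~= 1" using v u0 t \<open>v ~= 0\<close> by auto
  ultimately have p: "pentagon u v" using u0 u1 by (simp add: pentagon_def)
  have tv: "tfun u v = t" using v u0 \<open>v ~= 0\<close> by (simp add: tfun_def field_simps add_eq_0_iff eq_neg_iff_add_eq_0)
  have "poly (brumer (sfun u v) (tfun u v)) u = 0" unfolding brumer_root_iff[OF p] by (metis xs_simps(1))
  then have "(sfun u v - s) * (u * (u - 1)\<^sup>2) = 0" using brumer_linear_in_s[of "sfun u v" t u s] u tv by simp
  then have "sfun u v = s" using u0 u1 by simp
  then show thesis using that[OF p tv] by blast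
qed

section \<open>The invariants of $F_{20}$\<close>

text \<open>For these exponents the multiplier is 1 or 4, so the index map is a rotation or
  reflection of the pentagon and merely permutes the terms of $s$ and the factors of $t$.\<close>

lemma sfun_tfun_neighbour:
  assumes p: "pentagon u v" and i: "i = 0 \<or> i = 2"
  shows "tfun (ys u v i n) (ys u v i (2 ^ nat i + n)) = tfun u v"
    and "sfun (ys u v i n) (ys u v i (2 ^ nat i + n)) = sfun u v"
proof -
  define u' v' where "u' = ys u v i n" and "v' = ys u v i (2 ^ nat i + n)"
  have p': "pentagon u' v'" unfolding u'_def v'_def by (rule pentagon_affine(1)[OF p]) (use i in auto)
  have ys': "ys u' v' e k = ys u v (e + i) (2 ^ nat i * k + n)" for e k unfolding u'_def v'_def by (rule pentagon_affine(2)[OF p]) (use i in auto)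
  define m :: int where "m = 2 ^ nat i"
  have xs': "xs u' v' k = xs u v (m * k + n)" for k using ys'[of 0 k] i by (auto simp: ys_def m_def)
  have m: "m = 1 \<or> m = 4" using i by (auto simp: m_def)
  have n: "n mod 5 : {0,1,2,3,4}" by (cases n rule: mod5_cases) auto
  have red: "xs u v (m * k + n) = xs u v ((m * k + n mod 5) mod 5)" for k by (rule xs_cong) (simp add: mod_simps)
  note X = xs_relations(7)[OF p'] xs_relations(7)[OF p] xs' red sfun_expand
  have "- tfun u' v' = - tfun u v" unfolding xs_relations(7)[OF p', symmetric] xs_relations(7)[OF p, symmetric] xs' red
    using m n by (auto simp: mult_ac simp del: xs_simps)
  then show "tfun (ys u v i n) (ys u v i (2 ^ nat i + n)) = tfun u v" by (simp add: u'_def v'_def)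
  show "sfun (ys u v i n) (ys u v i (2 ^ nat i + n)) = sfun u v" unfolding u'_def[symmetric] v'_def[symmetric] sfun_expand xs' red
    using m n by (auto simp: mult_ac add_ac simp del: xs_simps)
qed

text \<open>As $s$ is the sum of the fourfold products, it equals the product of all five values
  times the sum of their inverses; and the inverse of $a/(a-1)$ is $1 - 1/a$.\<close>

lemma sfun_tfun_rho:
  assumes p: "pentagon u v"
  shows "tfun (ys u v 1 0) (ys u v 1 2) = - 1 / tfun u v"
    and "sfun (ys u v 1 0) (ys u v 1 2) = (sfun u v + 5 * tfun u v) / (tfun u v)\<^sup>2"
proof -
  define u' v' where "u' = ys u v 1 0" and "v' = ys u v 1 2"
  have p': "pentagon u' v'" and xs': "!!k. xs u' v' k = ys u v 1 (2 * k)" unfolding u'_def v'_def using xs_rho[OF p] by auto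
  define a b c d e where abc: "a = xs u v 0" "b = xs u v 1" "c = xs u v 2" "d = xs u v 3" "e = xs u v 4"
  note rel = xs_relations[OF p, folded abc]
  note sf = sfun_expand[of u v, folded abc]
  note e4 = brumer_symmetric_functions(3)[OF rel sf]
  have nz: "a ~= 0" "b ~= 0" "c ~= 0" "d ~= 0" "e ~= 0" unfolding abc by (rule xs_neq_0[OF p])+
  have nz1: "a - 1 ~= 0" "b - 1 ~= 0" "c - 1 ~= 0" "d - 1 ~= 0" "e - 1 ~= 0" unfolding abc using xs_neq_1[OF p] by (simp_all del: xs_simps)
  have m1: "b - 1 = - (a * c)" "c - 1 = - (b * d)" "d - 1 = - (c * e)" "e - 1 = - (d * a)" "a - 1 = - (e * b)" using rel by simp_all
  have "ys u v 1 6 = ys u v 1 1" "ys u v 1 8 = ys u v 1 3" by (rule ys_cong; simp)+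
  then have x': "xs u' v' 0 = a / (a - 1)" "xs u' v' 1 = c / (c - 1)" "xs u' v' 2 = e / (e - 1)"
    "xs u' v' 3 = b / (b - 1)" "xs u' v' 4 = d / (d - 1)" by (simp_all add: xs' ys_1 abc del: xs_simps)
  define t where "t = tfun u v"
  have t: "t = - (a * b * c * d * e)" using rel(7) by (simp add: t_def)
  have t0: "t ~= 0" using nz by (simp add: t)
  show T: "tfun (ys u v 1 0) (ys u v 1 2) = - 1 / tfun u v" proof -
    have "- tfun u' v' = 1 / t" unfolding xs_relations(7)[OF p', symmetric] x' unfolding m1 t using nz by (simp add: field_simps)
    then show ?thesis by (simp add: u'_def v'_def t_def) (metis minus_equation_iff)
  qed
  have e4': "sfun u' v' = xs u' v' 0 * xs u' v' 1 * xs u' v' 2 * xs u' v' 3 + xs u' v' 1 * xs u' v' 2 * xs u' v' 3 * xs u' v' 4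
      + xs u' v' 2 * xs u' v' 3 * xs u' v' 4 * xs u' v' 0 + xs u' v' 3 * xs u' v' 4 * xs u' v' 0 * xs u' v' 1
      + xs u' v' 4 * xs u' v' 0 * xs u' v' 1 * xs u' v' 2" by (rule brumer_symmetric_functions(3)[OF xs_relations[OF p'] sfun_expand, symmetric])
  have inv4: "A * B * C * D = (A * B * C * D * E) * inverse E" if "E ~= 0" for A B C D E :: 'a using that by simp
  have i: "inverse (a / (a - 1)) = 1 - inverse a" "inverse (b / (b - 1)) = 1 - inverse b" "inverse (c / (c - 1)) = 1 - inverse c"
    "inverse (d / (d - 1)) = 1 - inverse d" "inverse (e / (e - 1)) = 1 - inverse e" using nz by (simp_all add: divide_simps)
  have P: "xs u' v' 0 * xs u' v' 1 * xs u' v' 2 * xs u' v' 3 * xs u' v' 4 = 1 / t" using xs_relations(7)[OF p'] T by (simp add: u'_def v'_def t_def)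
  have nz': "xs u' v' k ~= 0" for k by (rule xs_neq_0[OF p'])
  have "sfun u' v' = 1 / t * (inverse (xs u' v' 0) + inverse (xs u' v' 1) + inverse (xs u' v' 2) + inverse (xs u' v' 3) + inverse (xs u' v' 4))"
    unfolding e4' P[symmetric] using nz' by (simp add: field_simps del: xs_simps)
  also have "... = 1 / t * (5 - (inverse a + inverse b + inverse c + inverse d + inverse e))" unfolding x' i by simp
  also have "inverse a + inverse b + inverse c + inverse d + inverse e = - sfun u v / t" unfolding e4[symmetric] t using nz by (simp add: field_simps)
  finally show "sfun (ys u v 1 0) (ys u v 1 2) = (sfun u v + 5 * tfun u v) / (tfun u v)\<^sup>2"
    using t0 by (simp add: u'_def v'_def t_def[symmetric] field_simps power2_eq_square)
qed

text \<open>Hence admissibility says that $t$ differs from its conjugate $-1/t$. It also allows $s$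
  to be recovered from $q$ and $t$, because $qt = s(t + 1/t) + 5$.\<close>

lemma pfun_sq: "pentagon u v ==> (pfun u v)\<^sup>2 + 4 = (tfun u v + 1 / tfun u v)\<^sup>2"
  using tfun_neq_0[of u v] by (simp add: pfun_def power2_eq_square field_simps)

lemma qfun_alt: "pentagon u v ==> qfun u v = (sfun u v * (tfun u v + 1 / tfun u v) + 5) / tfun u v"
  using tfun_neq_0[of u v] by (simp add: qfun_def power2_eq_square field_simps)

lemma pfun_qfun_rho:
  assumes p: "pentagon u v"
  shows "pfun (ys u v 1 0) (ys u v 1 2) = pfun u v" "qfun (ys u v 1 0) (ys u v 1 2) = qfun u v"
  using tfun_neq_0[OF p] unfolding pfun_def qfun_def sfun_tfun_rho[OF p] by (simp_all add: field_simps power2_eq_square)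

lemma pfun_qfun_affine:
  assumes p: "pentagon u v" and i: "i : {0..<4}"
  shows "pfun (ys u v i n) (ys u v i (2 ^ nat i + n)) = pfun u v"
    and "qfun (ys u v i n) (ys u v i (2 ^ nat i + n)) = qfun u v"
proof -
  have even: "pfun (ys u v j n) (ys u v j (2 ^ nat j + n)) = pfun u v \<and> qfun (ys u v j n) (ys u v j (2 ^ nat j + n)) = qfun u v"
    if "j = 0 \<or> j = 2" for j unfolding pfun_def qfun_def sfun_tfun_neighbour[OF p that] by simp
  have "pfun (ys u v i n) (ys u v i (2 ^ nat i + n)) = pfun u v \<and> qfun (ys u v i n) (ys u v i (2 ^ nat i + n)) = qfun u v"
  proof (cases "i = 0 \<or> i = 2")
    case False
    define j where "j = i - 1"
    have j: "j = 0 \<or> j = 2" "j \<ge> 0" using False i by (auto simp: j_def)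
    have ij: "1 + j = i" "nat i = Suc (nat j)" using j by (auto simp: j_def)
    define u' v' where "u' = ys u v j n" and "v' = ys u v j (2 ^ nat j + n)"
    have p': "pentagon u' v'" unfolding u'_def v'_def by (rule pentagon_affine(1)[OF p j(2)])
    have "ys u' v' 1 0 = ys u v i n" "ys u' v' 1 2 = ys u v i (2 ^ nat i + n)"
      unfolding u'_def v'_def pentagon_affine(2)[OF p j(2)] ij by (simp_all add: mult.commute)
    then show ?thesis using pfun_qfun_rho[OF p'] even[OF j(1)] by (simp add: u'_def v'_def)
  qed (use even in blast)
  then show "pfun (ys u v i n) (ys u v i (2 ^ nat i + n)) = pfun u v"
    and "qfun (ys u v i n) (ys u v i (2 ^ nat i + n)) = qfun u v" by auto
qed

text \<open>The value of $p$ leaves $t$ and $-1/t$; given $t$, the value of $q$ determines $s$; then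
  \<open>u'\<close> is one of five roots, and \<open>v'\<close> one of its two neighbours. These $2
  \<cdot> 5 \<cdot> 2$ possibilities are the images under $F_{20}$.\<close>

lemma same_invariants_imp_affine:
  assumes p: "pentagon u v" and p': "pentagon u' v'" and adm: "(pfun u v)\<^sup>2 + 4 ~= 0"
    and eq: "pfun u' v' = pfun u v" "qfun u' v' = qfun u v"
  obtains n i where "n : {0..<5}" "i : {0..<4}" "u' = ys u v i n" "v' = ys u v i (2 ^ nat i + n)"
proof -
  have m: "tfun u v + 1 / tfun u v ~= 0" using adm unfolding pfun_sq[OF p] by simp
  note t0 = tfun_neq_0[OF p] tfun_neq_0[OF p']
  have key: "\<exists>n i. n : {0..<5} \<and> (i = 0 \<or> i = 2) \<and> u' = ys a b i n \<and> v' = ys a b i (2 ^ nat i + n)"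
    if ab: "pentagon a b" and t: "tfun u' v' = tfun a b" and q: "qfun a b = qfun u' v'" "tfun a b + 1 / tfun a b ~= 0" for a b proof -
    have "sfun u' v' = sfun a b" using q tfun_neq_0[OF ab] unfolding qfun_alt[OF ab] qfun_alt[OF p'] t by simp
    then have "poly (brumer (sfun a b) (tfun a b)) u' = 0" using brumer_root_iff[OF p', of u'] t by (metis xs_simps(1))
    then obtain k where "u' = xs a b k" using brumer_root_iff[OF ab] by blast
    moreover define n where "n = k mod 5"
    ultimately have u': "u' = xs a b n" using xs_cong[of k "k mod 5"] by simp
    have n: "n : {0..<5}" by (simp add: n_def)
    have pn: "pentagon u' (xs a b (n + 1))" unfolding u' by (rule pentagon_xs[OF ab])
    have "tfun u' (xs a b (n + 1)) = tfun a b" using sfun_tfun_neighbour(1)[OF ab, of 0 n] by (simp add: u' ys_0 add.commute)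
    then have "v' = xs a b (n + 1) \<or> v' = (1 - u') / xs a b (n + 1)" using tfun_eq_iff[OF pn, of v'] p' t by simp
    moreover have "(1 - u') / xs a b (n + 1) = xs a b (n + 4)" proof -
      have "xs a b (n + 5) = xs a b n" "xs a b (n + 6) = xs a b (n + 1)" by (rule xs_cong; presburger)+
      then have "xs a b (n + 4) * xs a b (n + 1) = 1 - u'" using xs_rec[OF ab, of "n + 4"] u' by (simp add: add.assoc)
      then show ?thesis using xs_neq_0[OF ab, of "n + 1"] by (simp add: field_simps)
    qed
    ultimately have "v' = xs a b (1 + n) \<or> v' = xs a b (4 + n)" by (simp add: add.commute)
    then show ?thesis proof
      assume "v' = xs a b (1 + n)"
      then show ?thesis using u' n by (intro exI[of _ n] exI[of _ 0]) (simp add: ys_0)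
    next
      assume "v' = xs a b (4 + n)"
      then show ?thesis using u' n by (intro exI[of _ n] exI[of _ 2]) (simp add: ys_def)
    qed
  qed
  have "(tfun u' v' - tfun u v) * (tfun u v * tfun u' v' + 1) = 0" using eq(1) t0 by (simp add: pfun_def field_simps)
  then consider "tfun u' v' = tfun u v" | "tfun u v * tfun u' v' = - 1" by (auto simp: eq_neg_iff_add_eq_0)
  then show thesis proof cases
    case 1
    obtain n i where "n : {0..<5}" "i = 0 \<or> i = 2" "u' = ys u v i n" "v' = ys u v i (2 ^ nat i + n)" using key[OF p 1 eq(2)[symmetric] m] by blast
    then show thesis using that[of n i] by auto
  next
    case 2
    define a b where "a = ys u v 1 0" and "b = ys u v 1 2"
    have ab: "pentagon a b" unfolding a_def b_def by (rule xs_rho(1)[OF p])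
    have tab: "tfun a b = - 1 / tfun u v" unfolding a_def b_def by (rule sfun_tfun_rho(1)[OF p])
    have "tfun u v * tfun u' v' = tfun u v * tfun a b" using 2 t0(1) tab by simp
    then have t: "tfun u' v' = tfun a b" using t0(1) by simp
    have m': "tfun a b + 1 / tfun a b ~= 0" proof -
      have "tfun a b + 1 / tfun a b = - (tfun u v + 1 / tfun u v)" by (simp add: tab)
      then show ?thesis using m by (metis neg_equal_0_iff_equal)
    qed
    have q: "qfun a b = qfun u' v'" unfolding a_def b_def using pfun_qfun_rho[OF p] eq by simp
    obtain n i where ni: "n : {0..<5}" "i = 0 \<or> i = 2" "u' = ys a b i n" "v' = ys a b i (2 ^ nat i + n)" using key[OF ab t q m'] by blast
    have yab: "ys a b e k = ys u v (e + 1) (2 * k)" for e k using pentagon_affine(2)[OF p, of 1 0 e k] by (simp add: a_def b_def)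
    define n' where "n' = (2 * n) mod 5"
    have "u' = ys u v (i + 1) n'" "v' = ys u v (i + 1) (2 ^ nat (i + 1) + n')" unfolding ni(3,4) yab using ni(2)
      by (auto intro!: ys_cong simp: n'_def mod_simps nat_add_distrib algebra_simps)
    moreover have "n' : {0..<5}" "i + 1 : {0..<4}" using ni(2) by (auto simp: n'_def)
    ultimately show thesis using that by blast
  qed
qed

lemma exists_pentagon_with_invariants:
  fixes p q :: "'a::alg_closed_field"
  assumes adm: "p\<^sup>2 + 4 ~= 0"
  obtains u v where "pentagon u v" "pfun u v = p" "qfun u v = q"
proof -
  have "degree [:- 1, - p, 1:] > 0" by simp
  then obtain t where t: "poly [:- 1, - p, 1:] t = 0" using alg_closed_imp_poly_has_root by blast
  then have t0: "t ~= 0" by auto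
  have pt: "t - 1 / t = p" using t t0 by (simp add: field_simps)
  define m where "m = t + 1 / t"
  have "m\<^sup>2 = p\<^sup>2 + 4" using t0 by (simp add: m_def pt[symmetric] power2_eq_square field_simps)
  then have m: "m ~= 0" using adm by auto
  obtain u v where uv: "pentagon u v" "tfun u v = t" "sfun u v = (q * t - 5) / m" using exists_pentagon[OF t0] by blast
  have "pfun u v = p" by (simp add: pfun_def uv(2) pt)
  moreover have "qfun u v = q" using m t0 by (simp add: qfun_alt[OF uv(1)] uv(2,3) m_def[symmetric])
  ultimately show thesis using that uv(1) by blast
qed

section \<open>The roots of the $F_{20}$-quintic\<close>

definition zs :: "'a::field => 'a => int => 'a" where
  "zs u v k = (xs u v k - 1) / (xs u v k)\<^sup>2"

text \<open>The second factor is the \<rho>-conjugate of the first. Their product is a combination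
  of the terms $(x-1)^i x^{10-2i}$, that is, $x^{10}$ times a quintic in $(x-1)/x^2$; this is where
  the $F_{20}$-polynomial comes from.\<close>

lemma brumer_product:
  fixes t t' s :: "'a::field"
  assumes "t * t' = - 1"
  shows "poly (brumer s t) x * poly (brumer (s * t'\<^sup>2 - 5 * t') t') x =
    x^10 + (t + t' - 6) * (x - 1) * x^8 + (s + (s * t'\<^sup>2 - 5 * t') - 3 * (t + t') + 8) * (x - 1)^2 * x^6
    + ((t + t')\<^sup>2 - (t + t') - 3 * (s + (s * t'\<^sup>2 - 5 * t')) + 5) * (x - 1)^3 * x^4
    + (s * (s * t'\<^sup>2 - 5 * t') - 2 * (t + t') + 2) * (x - 1)^4 * x^2 + (x - 1)^5"
proof -
  have red: "t * (t' * c) = - c" for c using assms by (metis mult.assoc mult_minus1)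
  show ?thesis by (simp add: brumer_def eval_nat_numeral algebra_simps red assms)
qed

lemma f_F20_brumer:
  assumes p: "pentagon u v" and adm: "(pfun u v)\<^sup>2 + 4 ~= 0" and x: "x ~= 0"
  shows "x^10 * poly (f_F20 (pfun u v, qfun u v)) ((x - 1) / x\<^sup>2) =
    poly (brumer (sfun u v) (tfun u v)) x *
    poly (brumer (sfun (ys u v 1 0) (ys u v 1 2)) (tfun (ys u v 1 0) (ys u v 1 2))) x"
proof -
  define s t t' where "s = sfun u v" and "t = tfun u v" and "t' = - 1 / tfun u v"
  have t0: "t ~= 0" unfolding t_def by (rule tfun_neq_0[OF p])
  have tt: "t * t' = - 1" using t0 by (simp add: t_def t'_def)
  have t'eq: "t' = - 1 / t" by (simp add: t_def t'_def)
  define s' where "s' = s * t'\<^sup>2 - 5 * t'"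
  have s': "(s + 5 * t) / t\<^sup>2 = s'" using t0 by (simp add: s'_def t'eq field_simps power2_eq_square)
  have P: "pfun u v = t + t'" by (simp add: pfun_def t_def t'_def)
  have Q: "qfun u v = s + s'" by (simp add: qfun_def s'[symmetric] s_def t_def)
  have rho: "sfun (ys u v 1 0) (ys u v 1 2) = s'" "tfun (ys u v 1 0) (ys u v 1 2) = t'"
    unfolding sfun_tfun_rho[OF p] s'[symmetric] by (simp_all add: s_def t_def t'_def)
  \<comment> \<open>The fraction in the coefficient of $X^4$ is the product of $s$ and its
    \<rho>-conjugate.\<close>
  have D: "((qfun u v)\<^sup>2 + 5 * pfun u v * qfun u v - 25) / ((pfun u v)\<^sup>2 + 4) = s * s'" proof -
    have "(qfun u v)\<^sup>2 + 5 * pfun u v * qfun u v - 25 = s * s' * ((pfun u v)\<^sup>2 + 4)" proof -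
      have red: "t * (t' * c) = - c" for c using tt by (metis mult.assoc mult_minus1)
      have tt': "t' * t = - 1" using tt by (simp add: mult.commute)
      have red': "t' * (t * c) = - c" for c using tt' by (metis mult.assoc mult_minus1)
      show ?thesis unfolding P Q s'_def by (simp add: power2_eq_square algebra_simps red red' tt tt')
    qed
    then show ?thesis using adm by simp
  qed
  define z where "z = (x - 1) / x\<^sup>2"
  have zx: "z * x\<^sup>2 = x - 1" using x by (simp add: z_def)
  have z1: "x^10 * z = (x - 1) * x^8" unfolding zx[symmetric] by (simp add: eval_nat_numeral mult_ac)
  have z2: "x^10 * z^2 = (x - 1)^2 * x^6" unfolding zx[symmetric] by (simp add: eval_nat_numeral mult_ac)
  have z3: "x^10 * z^3 = (x - 1)^3 * x^4" unfolding zx[symmetric] by (simp add: eval_nat_numeral mult_ac)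
  have z4: "x^10 * z^4 = (x - 1)^4 * x^2" unfolding zx[symmetric] by (simp add: eval_nat_numeral mult_ac)
  have z5: "x^10 * z^5 = (x - 1)^5" unfolding zx[symmetric] by (simp add: eval_nat_numeral mult_ac)
  have "poly (f_F20 (pfun u v, qfun u v)) z = 1 + (t + t' - 6) * z + (s + s' - 3 * (t + t') + 8) * z^2
     + ((t + t')\<^sup>2 - (t + t') - 3 * (s + s') + 5) * z^3 + (s * s' - 2 * (t + t') + 2) * z^4 + z^5"
    unfolding f_F20_def prod.case D unfolding P Q by (simp add: eval_nat_numeral algebra_simps)
  then have "x^10 * poly (f_F20 (pfun u v, qfun u v)) z = x^10 + (t + t' - 6) * (x^10 * z) + (s + s' - 3 * (t + t') + 8) * (x^10 * z^2)
     + ((t + t')\<^sup>2 - (t + t') - 3 * (s + s') + 5) * (x^10 * z^3) + (s * s' - 2 * (t + t') + 2) * (x^10 * z^4) + x^10 * z^5"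
    by (simp only: distrib_left mult.left_commute[of "x^10"] mult_1_right)
  also have "... = poly (brumer s t) x * poly (brumer s' t') x" unfolding z1 z2 z3 z4 z5 s'_def brumer_product[OF tt] by (simp only: mult.assoc)
  finally show ?thesis unfolding rho by (simp add: s_def t_def z_def)
qed

text \<open>The function $(x-1)/x^2$ is invariant under $x \<mapsto> x/(x-1)$, which is why ten
  values of \<open>ys\<close> yield only five zeros.\<close>

lemma zs_ys: "pentagon u v ==> (ys u v e k - 1) / (ys u v e k)\<^sup>2 = zs u v k"
proof -
  assume p: "pentagon u v"
  define a where "a = xs u v k"
  have a: "a ~= 0" "a - 1 ~= 0" using xs_neq_0[OF p] xs_neq_1[OF p] by (auto simp: a_def)
  have "a / (a - 1) - 1 = 1 / (a - 1)" using a by (simp add: field_simps)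
  then have "(a / (a - 1) - 1) / (a / (a - 1))\<^sup>2 = (a - 1) / a\<^sup>2" using a by (simp add: power_divide power2_eq_square)
  then show ?thesis by (simp add: ys_def zs_def a_def)
qed

lemma zs_cong: "k mod 5 = l mod 5 ==> zs u v k = zs u v l" by (simp add: zs_def xs_cong[of k l])

lemma f_F20_root_iff:
  fixes u v :: "'a::alg_closed_field"
  assumes p: "pentagon u v" and adm: "(pfun u v)\<^sup>2 + 4 ~= 0"
  shows "poly (f_F20 (pfun u v, qfun u v)) x = 0 \<longleftrightarrow> (\<exists>k\<in>{0..<5}. x = zs u v k)"
proof
  assume x: "poly (f_F20 (pfun u v, qfun u v)) x = 0"
  then have x0: "x ~= 0" by (auto simp: f_F20_def)
  have "degree [:1, - 1, x:] > 0" using x0 by simp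
  then obtain a where a: "poly [:1, - 1, x:] a = 0" using alg_closed_imp_poly_has_root by blast
  then have a0: "a ~= 0" by auto
  have "x = (a - 1) / a\<^sup>2" using a a0 by (simp add: field_simps power2_eq_square)
  then have "poly (brumer (sfun u v) (tfun u v)) a *
    poly (brumer (sfun (ys u v 1 0) (ys u v 1 2)) (tfun (ys u v 1 0) (ys u v 1 2))) a = 0" using f_F20_brumer[OF p adm a0] x by simp
  then have "(\<exists>k. a = xs u v k) \<or> (\<exists>k. a = xs (ys u v 1 0) (ys u v 1 2) k)"
    using brumer_root_iff[OF p] brumer_root_iff[OF xs_rho(1)[OF p]] by simp
  then have "\<exists>e k. a = ys u v e k" using xs_rho(2)[OF p] by (metis ys_0)
  then obtain e k where "a = ys u v e k" by blast
  then have "x = zs u v (k mod 5)" using \<open>x = (a - 1) / a\<^sup>2\<close> zs_ys[OF p, of e k] zs_cong[of k "k mod 5"] by simp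
  then show "\<exists>k\<in>{0..<5}. x = zs u v k" by (intro bexI[of _ "k mod 5"]) simp_all
next
  assume "\<exists>k\<in>{0..<5}. x = zs u v k"
  then obtain k where k: "x = zs u v k" by blast
  have "poly (brumer (sfun u v) (tfun u v)) (xs u v k) = 0" using brumer_root_iff[OF p] by blast
  then show "poly (f_F20 (pfun u v, qfun u v)) x = 0" using f_F20_brumer[OF p adm xs_neq_0[OF p, of k]] xs_neq_0[OF p, of k] by (simp add: k zs_def)
qed

section \<open>The affine group over the field with five elements and its realization by Galois
  automorphisms\<close>

section \<open>The affine group $F_{20}$\<close>

abbreviation "\<A> \<equiv> carrier F20"
abbreviation "\<e> \<equiv> \<one>\<^bsub>F20\<^esub>"
abbreviation F20_mult (infixl "\<cdot>" 70) where "x \<cdot> y \<equiv> x \<otimes>\<^bsub>F20\<^esub> y"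

definition aff :: "int \<times> int => int => int" where
  "aff g k = (2 ^ nat (snd g) * k + fst g) mod 5"

lemma carrier_F20: "\<A> = {0..<5} \<times> {0..<4}" by (simp add: F20_def semidirect_def carrier_integer_mod_group)

lemma mult_F20: "g \<cdot> h = ((fst g + 2 ^ nat (snd g) * fst h) mod 5, (snd g + snd h) mod 4)"
  by (cases g; cases h) (simp add: F20_def semidirect_def mod_simps)

lemma one_F20: "\<e> = (0, 0)" by (simp add: F20_def semidirect_def)

lemma power2_mod5: "(2::int) ^ n mod 5 = 2 ^ (n mod 4) mod 5"
proof -
  have "(2::int) ^ n = (2 ^ 4) ^ (n div 4) * 2 ^ (n mod 4)" by (simp only: power_mult[symmetric] power_add[symmetric] mult_div_mod_eq)
  moreover have "((2::int) ^ 4) ^ q mod 5 = 1" for q using power_mod[of "16 :: int" 5 q] by simp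
  ultimately show ?thesis by (metis mod_mult_left_eq mult_1)
qed

lemma power2_add_mod5:
  assumes "i \<ge> 0" "j \<ge> 0"
  shows "(2::int) ^ nat ((i + j) mod 4) mod 5 = (2 ^ nat i * 2 ^ nat j) mod 5"
proof -
  have "nat ((i + j) mod 4) = (nat i + nat j) mod 4" using assms by (simp add: nat_mod_distrib nat_add_distrib)
  then show ?thesis using power2_mod5[of "nat i + nat j"] by (simp add: power_add)
qed

lemma range4_cases: "(i :: int) : {0..<4} ==> i = 0 \<or> i = 1 \<or> i = 2 \<or> i = 3" by auto

lemma aff_mult:
  assumes "snd g \<ge> 0" "snd h \<ge> 0"
  shows "aff (g \<cdot> h) k = aff g (aff h k)"
proof -
  have red: "(a mod 5 * k + c) mod 5 = (a * k + c) mod 5" for a c :: int by (metis mod_add_left_eq mod_mult_left_eq)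
  have "aff (g \<cdot> h) k = (2 ^ nat ((snd g + snd h) mod 4) * k + (fst g + 2 ^ nat (snd g) * fst h)) mod 5"
    by (simp add: aff_def mult_F20 mod_add_right_eq)
  also have "... = (2 ^ nat (snd g) * 2 ^ nat (snd h) * k + (fst g + 2 ^ nat (snd g) * fst h)) mod 5"
    by (subst (1 2) red[symmetric]) (simp only: power2_add_mod5[OF assms])
  also have "... = (2 ^ nat (snd g) * (2 ^ nat (snd h) * k + fst h) + fst g) mod 5" by (simp add: algebra_simps)
  also have "... = aff g (aff h k)" by (simp add: aff_def) (metis mod_add_left_eq mod_mult_right_eq)
  finally show ?thesis .
qed

lemma aff_eqD:
  assumes "g : \<A>" "h : \<A>" "aff g 0 = aff h 0" "aff g 1 = aff h 1"
  shows "g = h"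
proof -
  have r: "fst g : {0..<5}" "fst h : {0..<5}" "snd g : {0..<4}" "snd h : {0..<4}" using assms(1,2) by (auto simp: carrier_F20)
  then have f: "fst g = fst h" using assms(3) by (simp add: aff_def)
  have "(2 ^ nat (snd g) + fst g) mod 5 = (2 ^ nat (snd h) + fst g) mod 5" using assms(4) f by (simp add: aff_def)
  then have "(2::int) ^ nat (snd g) mod 5 = 2 ^ nat (snd h) mod 5" by (metis add_diff_cancel_right' mod_diff_left_eq)
  then have "snd g = snd h" using range4_cases[OF r(3)] range4_cases[OF r(4)] by (elim disjE) simp_all
  then show ?thesis using f by (simp add: prod_eq_iff)
qed

lemma aff_one: "aff \<e> k = k mod 5" by (simp add: aff_def one_F20)

lemma mult_F20_closed: "g \<cdot> h : \<A>" by (simp add: mult_F20 carrier_F20)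

lemma group_F20: "group F20"
proof (rule groupI)
  show "\<e> : \<A>" by (simp add: one_F20 carrier_F20)
  show "g \<cdot> h : \<A>" for g h by (rule mult_F20_closed)
  have nn: "snd g \<ge> 0" if "g : \<A>" for g using that by (auto simp: carrier_F20)
  show "\<e> \<cdot> g = g" if "g : \<A>" for g using that by (auto simp: one_F20 mult_F20 carrier_F20)
  show "g \<cdot> h \<cdot> k = g \<cdot> (h \<cdot> k)"
    if "g : \<A>" "h : \<A>" "k : \<A>" for g h k by (rule aff_eqD[OF mult_F20_closed mult_F20_closed]; simp only: aff_mult nn mult_F20_closed that)
  show "\<exists>h\<in>\<A>. h \<cdot> g = \<e>" if g: "g : \<A>" for g proof -
    obtain n i where ni: "g = (n, i)" "i : {0..<4}" using g by (auto simp: carrier_F20)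
    define h where "h = ((- (2 ^ nat ((- i) mod 4) * n)) mod 5, (- i) mod 4)"
    have "h : \<A>" by (simp add: h_def carrier_F20)
    moreover have "h \<cdot> g = \<e>" by (simp add: mult_F20 one_F20 h_def ni(1) mod_simps)
    ultimately show ?thesis by blast
  qed
qed

section \<open>The Galois action on the orbit of a point\<close>

context
  fixes h :: "'a::field => 'b::field"
  assumes h: "rhom h"
begin

lemmas rhom_field_simps = rhom_simps[OF h] rhom_divide[OF h] rhom_sum[OF h]

lemma rhom_xs: "h (xs u v k) = xs (h u) (h v) k" by (simp add: xs_def rhom_field_simps)

lemma rhom_ys: "h (ys u v e k) = ys (h u) (h v) e k" by (simp add: ys_def rhom_xs rhom_field_simps)

lemma rhom_tfun: "h (tfun u v) = tfun (h u) (h v)" by (simp add: tfun_def rhom_field_simps)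

lemma rhom_sfun: "h (sfun u v) = sfun (h u) (h v)" by (simp add: sfun_def rhom_xs rhom_field_simps)

lemma rhom_pfun: "h (pfun u v) = pfun (h u) (h v)" by (simp add: pfun_def rhom_tfun rhom_field_simps)

lemma rhom_qfun: "h (qfun u v) = qfun (h u) (h v)" by (simp add: qfun_def rhom_tfun rhom_sfun rhom_field_simps)

lemma rhom_pentagon: "pentagon (h u) (h v) \<longleftrightarrow> pentagon u v"
  using rhom_eq_iff[OF h, of u 1] rhom_eq_iff[OF h, of v 1] rhom_eq_iff[OF h, of "u + v" 1] rhom_eq_0_iff[OF h]
  by (simp add: pentagon_def rhom_simps[OF h])

lemma map_poly_f_F20: "map_poly h (f_F20 (p, q)) = f_F20 (h p, h q)" by (simp add: f_F20_def map_poly_pCons_rhom[OF h] rhom_field_simps)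

end

text \<open>The exponent of \<open>g\<close> enters twice: as the multiplier $2^i$ of the index, and
  through its parity, which decides whether $x$ and $x/(x-1)$ are exchanged.\<close>

definition acts_by :: "('a::field => 'a) => 'a => 'a => int \<times> int => bool" where
  "acts_by \<phi> u v g \<longleftrightarrow> (\<forall>e k. \<phi> (ys u v e k) = ys u v (e + snd g) (aff g k))"

lemma ys_aff: "ys u v e (aff g k) = ys u v e (2 ^ nat (snd g) * k + fst g)" by (rule ys_cong) (simp_all add: aff_def)

lemma ys_mod: "ys u v e (k mod 5) = ys u v e k" by (rule ys_cong) simp_all

lemma acts_by_comp:
  assumes "acts_by \<phi> u v g" "acts_by \<psi> u v h" "snd g \<ge> 0" "snd h \<ge> 0"
  shows "acts_by (\<phi> \<circ> \<psi>) u v (g \<cdot> h)" unfolding acts_by_def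
proof (intro allI)
  fix e k
  have "(\<phi> \<circ> \<psi>) (ys u v e k) = ys u v (e + snd h + snd g) (aff g (aff h k))" using assms(1,2) by (simp add: acts_by_def)
  also have "... = ys u v (e + snd (g \<cdot> h)) (aff (g \<cdot> h) k)" proof (rule ys_cong)
    have "even ((snd g + snd h) mod 4) = even (snd g + snd h)" by presburger
    then show "even (e + snd h + snd g) = even (e + snd (g \<cdot> h))" by (auto simp: mult_F20)
  qed (simp add: aff_mult[OF assms(3,4)])
  finally show "(\<phi> \<circ> \<psi>) (ys u v e k) = ys u v (e + snd (g \<cdot> h)) (aff (g \<cdot> h) k)" .
qed

definition point_over :: "'m::field \<times> 'm => 'm alg_closure => 'm alg_closure => bool" where
  "point_over b u v \<longleftrightarrow> pentagon u v \<and> pfun u v = to_ac (fst b) \<and> qfun u v = to_ac (snd b)"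

lemma exists_point_over:
  assumes "admissible b" obtains u v where "point_over b u v"
proof -
  have "(to_ac (fst b))\<^sup>2 + 4 ~= 0" using assms to_ac_eq_0_iff[of "(fst b)\<^sup>2 + 4"] by (simp add: admissible_def)
  then show thesis using exists_pentagon_with_invariants that unfolding point_over_def by metis
qed

text \<open>The image of $(u,v)$ has the same invariants, because these lie in the base, and points
  with equal invariants form one orbit of $F_{20}$.\<close>

lemma ac_aut_acts_by:
  assumes b: "admissible b" "point_over b u v" and \<phi>: "\<phi> : ac_auts"
  shows "\<exists>g\<in>\<A>. acts_by \<phi> u v g"
proof -
  note hom = ac_auts_rhom[OF \<phi>]
  have p: "pentagon u v" and pq: "pfun u v = to_ac (fst b)" "qfun u v = to_ac (snd b)" using b(2) by (auto simp: point_over_def)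
  have adm: "(pfun u v)\<^sup>2 + 4 ~= 0" using b(1) to_ac_eq_0_iff[of "(fst b)\<^sup>2 + 4"] by (simp add: admissible_def pq)
  have "pentagon (\<phi> u) (\<phi> v)" "pfun (\<phi> u) (\<phi> v) = pfun u v" "qfun (\<phi> u) (\<phi> v) = qfun u v"
    using p by (simp_all add: rhom_pentagon[OF hom] pq ac_auts_base[OF \<phi>] flip: rhom_pfun[OF hom] rhom_qfun[OF hom])
  from same_invariants_imp_affine[OF p this(1) adm this(2,3)]
  obtain n i where ni: "n : {0..<5}" "i : {0..<4}" "\<phi> u = ys u v i n" "\<phi> v = ys u v i (2 ^ nat i + n)" .
  have "\<phi> (ys u v e k) = ys u v (e + snd (n, i)) (aff (n, i) k)" for e k
    unfolding rhom_ys[OF hom] ni(3,4) ys_aff using pentagon_affine(2)[OF p, of i n e k] ni(2) by simp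
  then show ?thesis using ni(1,2) by (intro bexI[of _ "(n, i)"]) (auto simp: acts_by_def carrier_F20)
qed


text \<open>Two-transitivity of the full affine group; the required multiplier exists because 2 is a
  primitive root modulo 5.\<close>

lemma exists_affine_map:
  fixes k l c d :: int
  assumes "k mod 5 ~= l mod 5" "c mod 5 ~= d mod 5"
  obtains g where "g : \<A>" "aff g k = c mod 5" "aff g l = d mod 5"
proof -
  define r s where "r = (l - k) mod 5" and "s = (d - c) mod 5"
  have "r ~= 0" "s ~= 0" using assms by (auto simp: r_def s_def mod_eq_dvd_iff dvd_eq_mod_eq_0[symmetric] dvd_diff_commute)
  moreover have "r : {0..<5}" "s : {0..<5}" by (simp_all add: r_def s_def)
  ultimately have "r : {1,2,3,4}" "s : {1,2,3,4}" by auto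
  then have "\<exists>i\<in>{0,1,2,3}. (2 ^ nat i * r) mod 5 = s" by (elim insertE emptyE) simp_all
  then obtain i where i': "i : {0,1,2,3}" and "(2 ^ nat i * r) mod 5 = s" by (rule bexE)
  moreover have "i : {0..<4}" using i' by auto
  ultimately have i: "i : {0..<4}" "(2 ^ nat i * r) mod 5 = s" by simp_all
  define g where "g = ((c - 2 ^ nat i * k) mod 5, i)"
  have "g : \<A>" using i(1) by (simp add: g_def carrier_F20)
  moreover have "aff g k = c mod 5" by (simp add: aff_def g_def mod_simps)
  moreover have "aff g l = d mod 5" proof -
    have "aff g l = (2 ^ nat i * (l - k) + c) mod 5" by (simp add: aff_def g_def mod_simps algebra_simps)
    also have "... = ((2 ^ nat i * r) mod 5 + c) mod 5" unfolding r_def by (metis mod_add_left_eq mod_mult_right_eq)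
    also have "... = (d - c + c) mod 5" unfolding i(2) s_def by (rule mod_add_left_eq)
    finally show ?thesis by simp
  qed
  ultimately show thesis by (rule that)
qed

locale quintic_point =
  fixes b :: "'m::field \<times> 'm" and u v :: "'m alg_closure"
  assumes inf: "infinite (UNIV :: 'm set)" and adm: "admissible b" and gal: "Gal (f_F20 b) \<cong> F20"
    and pt: "point_over b u v"
begin

text \<open>A choice for the moment: uniqueness, \<open>code_eqI\<close>, has to wait until the five
  zeros are known to be distinct.\<close>

definition code :: "('m alg_closure => 'm alg_closure) => int \<times> int" where
  "code \<phi> = (SOME g. g : \<A> \<and> acts_by \<phi> u v g)"

lemma code:
  assumes "\<phi> : ac_auts" shows "code \<phi> : \<A>" "acts_by \<phi> u v (code \<phi>)"
proof -
  have "\<exists>g. g : \<A> \<and> acts_by \<phi> u v g" using ac_aut_acts_by[OF adm pt assms] by blast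
  then have "code \<phi> : \<A> \<and> acts_by \<phi> u v (code \<phi>)" unfolding code_def by (rule someI_ex)
  then show "code \<phi> : \<A>" "acts_by \<phi> u v (code \<phi>)" by auto
qed

lemma code_nonneg: "\<phi> : ac_auts ==> snd (code \<phi>) \<ge> 0" using code(1)[of \<phi>] by (auto simp: carrier_F20)

lemma pent: "pentagon u v" using pt by (simp add: point_over_def)

lemma adm_pfun: "(pfun u v)\<^sup>2 + 4 ~= 0" using adm pt to_ac_eq_0_iff[of "(fst b)\<^sup>2 + 4"] by (simp add: admissible_def point_over_def)

lemma map_poly_f: "map_poly to_ac (f_F20 b) = f_F20 (pfun u v, qfun u v)"
  using pt map_poly_f_F20[OF rhom_to_ac, of "fst b" "snd b"] by (simp add: point_over_def)

lemma roots_f: "{x. poly (map_poly to_ac (f_F20 b)) x = 0} = zs u v ` {0..<5}" unfolding map_poly_f using f_F20_root_iff[OF pent adm_pfun] by auto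

lemma splitting_field_f: "splitting_field (f_F20 b) = generated (zs u v ` {0..<5})" unfolding splitting_field_eq roots_f ..

lemma code_zs: "\<phi> : ac_auts ==> \<phi> (zs u v k) = zs u v (aff (code \<phi>) k)"
proof -
  assume \<phi>: "\<phi> : ac_auts"
  note hom = ac_auts_rhom[OF \<phi>]
  have "\<phi> (zs u v k) = (\<phi> (ys u v 0 k) - 1) / (\<phi> (ys u v 0 k))\<^sup>2"
    unfolding zs_ys[OF pent, of 0 k, symmetric] by (simp add: rhom_simps[OF hom] rhom_divide[OF hom])
  also have "\<phi> (ys u v 0 k) = ys u v (0 + snd (code \<phi>)) (aff (code \<phi>) k)" using code(2)[OF \<phi>] by (simp add: acts_by_def)
  finally show ?thesis by (simp add: zs_ys[OF pent])
qed

lemma agree_if_code_eq: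
  assumes "\<phi> : ac_auts" "\<psi> : ac_auts" "code \<phi> = code \<psi>" "z : splitting_field (f_F20 b)"
  shows "\<phi> z = \<psi> z" by (rule ac_auts_eq_on_generated[OF assms(1,2) _ assms(4)[unfolded splitting_field_f]])
    (use code_zs[OF assms(1)] code_zs[OF assms(2)] assms(3) in auto)

lemma card_Gal: "card (carrier (Gal (f_F20 b))) = 20"
proof -
  obtain f where "f : iso (Gal (f_F20 b)) F20" using gal by (auto simp: is_iso_def)
  then have "bij_betw f (carrier (Gal (f_F20 b))) (\<A>)" by (simp add: iso_def)
  then show ?thesis using bij_betw_same_card by (fastforce simp: carrier_F20)
qed

text \<open>The code determines the restriction to the splitting field, so the 20 elements of the
  Galois group force at least 20 codes.\<close>

lemma code_surj: "code ` ac_auts = \<A>"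
proof (rule card_subset_eq)
  show "finite (\<A>)" by (simp add: carrier_F20)
  show sub: "code ` ac_auts \<subseteq> \<A>" using code(1) by blast
  let ?r = "\<lambda>\<phi>. restrict \<phi> (splitting_field (f_F20 b))"
  define F where "F g = ?r (SOME \<phi>. \<phi> : ac_auts \<and> code \<phi> = g)" for g
  have "?r \<phi> = F (code \<phi>)" if \<phi>: "\<phi> : ac_auts" for \<phi> proof -
    define \<psi> where "\<psi> = (SOME \<psi>. \<psi> : ac_auts \<and> code \<psi> = code \<phi>)"
    have "\<psi> : ac_auts \<and> code \<psi> = code \<phi>" unfolding \<psi>_def by (rule someI[of _ \<phi>]) (use \<phi> in simp)
    then have "?r \<phi> = ?r \<psi>" using agree_if_code_eq[OF \<phi>] by (intro restrict_ext) auto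
    then show ?thesis by (simp add: F_def \<psi>_def)
  qed
  then have "carrier (Gal (f_F20 b)) = F ` code ` ac_auts" by (auto simp: carrier_Gal image_image)
  moreover have fin: "finite (code ` ac_auts)" using sub by (rule finite_subset) (simp add: carrier_F20)
  ultimately have "20 \<le> card (code ` ac_auts)" using card_image_le[OF fin, of F] card_Gal by simp
  moreover have "card (code ` ac_auts) \<le> card (\<A>)" using sub by (intro card_mono) (simp_all add: carrier_F20)
  ultimately show "card (code ` ac_auts) = card (\<A>)" by (simp add: carrier_F20)
qed

text \<open>If two zeros coincided, two-transitivity would make all five equal, and the Galois group
  would be trivial instead of having 20 elements.\<close>

lemma zs_inj: "zs u v k = zs u v l \<longleftrightarrow> k mod 5 = l mod 5"
proof (rule iffI[rotated], erule zs_cong, rule ccontr)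
  assume eq: "zs u v k = zs u v l" and ne: "k mod 5 ~= l mod 5"
  have all: "zs u v c = zs u v d" for c d proof (cases "c mod 5 = d mod 5")
    case False
    obtain g where g: "g : \<A>" "aff g k = c mod 5" "aff g l = d mod 5" by (rule exists_affine_map[OF ne False])
    obtain \<phi> where \<phi>: "\<phi> : ac_auts" "code \<phi> = g" using code_surj g(1) by (metis imageE)
    have "zs u v (c mod 5) = zs u v (d mod 5)" using code_zs[OF \<phi>(1), of k] code_zs[OF \<phi>(1), of l] eq by (simp add: \<phi>(2) g)
    moreover have "zs u v c = zs u v (c mod 5)" "zs u v d = zs u v (d mod 5)" by (rule zs_cong, simp)+
    ultimately show ?thesis by simp
  qed (rule zs_cong)
  let ?r = "\<lambda>\<phi>. restrict \<phi> (splitting_field (f_F20 b))"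
  have "?r \<phi> = ?r id" if \<phi>: "\<phi> : ac_auts" for \<phi> proof (rule restrict_ext)
    fix z assume "z : splitting_field (f_F20 b)"
    then show "\<phi> z = id z" unfolding splitting_field_f proof (rule ac_auts_eq_on_generated[OF \<phi> ac_auts_id, rotated])
      fix x assume "x : zs u v ` {0..<5}"
      then obtain k where x: "x = zs u v k" by blast
      show "\<phi> x = id x" unfolding x code_zs[OF \<phi>] id_apply by (rule all)
    qed
  qed
  then have "carrier (Gal (f_F20 b)) \<subseteq> {?r id}" by (auto simp: carrier_Gal)
  then have "card (carrier (Gal (f_F20 b))) \<le> 1" using card_mono[of "{?r id}"] by simp
  then show False using card_Gal by simp
qed

lemma code_eqI:
  assumes \<phi>: "\<phi> : ac_auts" and g: "g : \<A>" "acts_by \<phi> u v g \<or> (\<forall>k. \<phi> (zs u v k) = zs u v (aff g k))"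
  shows "code \<phi> = g"
proof -
  have "\<phi> (zs u v k) = zs u v (aff g k)" for k using g(2) proof
    note hom = ac_auts_rhom[OF \<phi>]
    assume a: "acts_by \<phi> u v g"
    have "\<phi> (zs u v k) = (\<phi> (ys u v 0 k) - 1) / (\<phi> (ys u v 0 k))\<^sup>2"
      unfolding zs_ys[OF pent, of 0 k, symmetric] by (simp add: rhom_simps[OF hom] rhom_divide[OF hom])
    also have "\<phi> (ys u v 0 k) = ys u v (0 + snd g) (aff g k)" using a by (simp add: acts_by_def)
    finally show ?thesis by (simp add: zs_ys[OF pent])
  qed blast
  then have "aff (code \<phi>) k mod 5 = aff g k mod 5" for k using code_zs[OF \<phi>, of k] zs_inj by metis
  then have "aff (code \<phi>) k = aff g k" for k by (simp add: aff_def)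
  then show ?thesis using aff_eqD[OF code(1)[OF \<phi>] g(1)] by blast
qed

lemma code_comp: "\<phi> : ac_auts ==> \<psi> : ac_auts ==> code (\<phi> \<circ> \<psi>) = code \<phi> \<cdot> code \<psi>"
  by (intro code_eqI ac_auts_comp mult_F20_closed disjI1 acts_by_comp code code_nonneg)

lemma code_eq_iff:
  assumes "\<phi> : ac_auts" "\<psi> : ac_auts"
  shows "code \<phi> = code \<psi> \<longleftrightarrow> (\<forall>z\<in>splitting_field (f_F20 b). \<phi> z = \<psi> z)"
proof
  assume *: "\<forall>z\<in>splitting_field (f_F20 b). \<phi> z = \<psi> z"
  have "zs u v k : splitting_field (f_F20 b)" for k
    unfolding splitting_field_f by (intro subsetD[OF subset_generated]) (metis zs_cong imageI atLeastLessThan_iff mod_mod_trivial pos_mod_bound pos_mod_sign zero_less_numeral)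
  then have "\<phi> (zs u v k) = zs u v (aff (code \<psi>) k)" for k using * code_zs[OF assms(2)] by simp
  then show "code \<phi> = code \<psi>" by (intro code_eqI assms code) blast
qed (use agree_if_code_eq[OF assms] in blast)

lemma degree_f: "degree (map_poly to_ac (f_F20 b)) = 5" "lead_coeff (map_poly to_ac (f_F20 b)) = 1" unfolding map_poly_f by (simp_all add: f_F20_def)

lemma f_factorization: "map_poly to_ac (f_F20 b) = (\<Prod>k\<in>{0..<5}. [:- zs u v k, 1:])"
proof -
  let ?f = "map_poly to_ac (f_F20 b)" and ?g = "\<Prod>k\<in>{0..<5}. [:- zs u v k, 1:]"
  have inj: "inj_on (zs u v) {0..<5}" using zs_inj by (auto simp: inj_on_def)
  have deg: "degree ?g = 5" by (subst degree_prod_eq_sum_degree) auto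
  have lc: "lead_coeff ?g = 1" by (simp add: lead_coeff_prod)
  show ?thesis proof (rule ccontr)
    assume "?f ~= ?g"
    then have nz: "?f - ?g ~= 0" by simp
    have "zs u v ` {0..<5} \<subseteq> {x. poly (?f - ?g) x = 0}" proof (intro image_subsetI CollectI)
      fix k :: int assume k: "k : {0..<5}"
      have "poly ?f (zs u v k) = 0" using roots_f k by blast
      moreover have "poly ?g (zs u v k) = 0" unfolding poly_prod using k by (intro prod_zero) auto
      ultimately show "poly (?f - ?g) (zs u v k) = 0" by simp
    qed
    then have "card (zs u v ` {0..<5}) \<le> card {x. poly (?f - ?g) x = 0}" by (rule card_mono[OF poly_roots_finite[OF nz]])
    also have "... \<le> degree (?f - ?g)" by (rule card_poly_roots_bound[OF nz])
    also have "... < 5" proof -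
      have "coeff (?f - ?g) 5 = 0" using degree_f deg lc by simp
      moreover have "degree (?f - ?g) \<le> 5" by (rule degree_diff_le) (simp_all add: degree_f deg)
      ultimately show ?thesis using nz by (metis leading_coeff_0_iff order_le_less)
    qed
    finally show False by (simp add: card_image[OF inj])
  qed
qed

lemma zs_separable: "separable_over (range to_ac) (zs u v k)"
proof -
  define l where "l = k mod 5"
  have l: "l : {0..<5}" by (simp add: l_def)
  have kl: "zs u v k = zs u v l" unfolding l_def by (rule zs_cong) simp
  define g where "g = (\<Prod>k\<in>{0..<5} - {l}. [:- zs u v k, 1:])"
  have "map_poly to_ac (f_F20 b) = [:- zs u v l, 1:] * g" unfolding f_factorization g_def by (rule prod.remove) (use l in auto)
  then have "poly (map_poly to_ac (f_F20 b)) (zs u v l) = 0"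
    "poly (pderiv (map_poly to_ac (f_F20 b))) (zs u v l) = poly g (zs u v l)"
    by (simp_all only: pderiv_mult poly_mult poly_add) (simp_all add: pderiv_pCons)
  moreover have "poly g (zs u v l) ~= 0" using zs_inj[of l] l by (auto simp: g_def poly_prod)
  ultimately show ?thesis unfolding separable_over_def kl by (intro bexI[of _ "map_poly to_ac (f_F20 b)"]) (auto simp: polys_over_range_to_ac)
qed

lemma galois_splitting_field: "galois_field (splitting_field (f_F20 b))" unfolding splitting_field_f
proof (rule galois_field_generated)
  show "fixed_is_base (generated (zs u v ` {0..<5}))" by (rule fixed_is_base_generated) (auto intro: zs_separable)
  show "\<phi> x : generated (zs u v ` {0..<5})" if \<phi>: "\<phi> : ac_auts" and x: "x : zs u v ` {0..<5}" for \<phi> x proof -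
    obtain k where "x = zs u v k" using x by blast
    then have "\<phi> x = zs u v (aff (code \<phi>) k)" using code_zs[OF \<phi>] by simp
    moreover have "aff (code \<phi>) k : {0..<5}" by (simp add: aff_def)
    ultimately show ?thesis by (intro subsetD[OF subset_generated]) simp
  qed
qed

lemma finite_restrict: "finite ((\<lambda>\<phi>. restrict \<phi> (splitting_field (f_F20 b))) ` ac_auts)"
  using card_Gal unfolding carrier_Gal by (metis card.infinite zero_neq_numeral)

lemma primitive:
  "\<exists>\<theta>\<in>splitting_field (f_F20 b). \<forall>\<phi>\<in>ac_auts. \<phi> \<theta> = \<theta> \<longleftrightarrow> code \<phi> = \<e>"
proof -
  have "intermediate (splitting_field (f_F20 b))" unfolding splitting_field_f by (rule intermediate_generated)
  from primitive_element[OF inf this finite_restrict] obtain \<theta> where \<theta>: "\<theta> : splitting_field (f_F20 b)"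
    "\<forall>\<phi>\<in>ac_auts. \<phi> \<theta> = \<theta> --> (\<forall>z\<in>splitting_field (f_F20 b). \<phi> z = z)" by blast
  have id: "code id = \<e>" by (rule code_eqI[OF ac_auts_id]) (simp_all add: one_F20 carrier_F20 acts_by_def aff_def ys_mod)
  have "\<phi> \<theta> = \<theta> \<longleftrightarrow> code \<phi> = \<e>" if "\<phi> : ac_auts" for \<phi>
    using code_eq_iff[OF that ac_auts_id] \<theta> that unfolding id by auto
  then show ?thesis using \<theta>(1) by blast
qed

lemma code_one_ys: "\<phi> : ac_auts ==> code \<phi> = \<e> ==> \<phi> (ys u v e k) = ys u v e k"
  using code(2)[of \<phi>] by (simp add: acts_by_def one_F20 aff_def ys_mod)

text \<open>The equation $z X^2 - X + 1 = 0$ alone could make \<open>ys\<close> generate a quadratic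
  extension. But an automorphism trivial on the splitting field has trivial code and therefore fixes
  \<open>ys\<close>. For this to imply membership, the argument takes place in a Galois field
  \<open>E\<close> containing all \<open>ys\<close>, so their separability must be checked
  first.\<close>

lemma ys_in_splitting_field: "ys u v e k : splitting_field (f_F20 b)"
proof -
  let ?Z = "zs u v ` {0..<5}" and ?Y = "(\<lambda>(e, k). ys u v e k) ` ({0, 1} \<times> {0..<5})"
  have L: "intermediate (splitting_field (f_F20 b))" unfolding splitting_field_f by (rule intermediate_generated)
  have fib: "fixed_is_base (generated ?Z)" using galois_splitting_field unfolding splitting_field_f by (simp add: galois_field_def fixed_is_base_def)
  have sep: "separable_over (generated ?Z) (ys u v e k)" for e k proof -
    define a where "a = ys u v e k"
    define z where "z = zs u v k"
    have za: "z = (a - 1) / a\<^sup>2" unfolding z_def a_def by (rule zs_ys[OF pent, symmetric])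
    have a0: "a ~= 0" using xs_neq_0[OF pent, of k] xs_neq_1[OF pent, of k] by (auto simp: a_def ys_def)
    have "zs u v k = zs u v (k mod 5)" by (rule zs_cong) simp
    then have zmem: "z : generated ?Z" by (intro subsetD[OF subset_generated]) (auto simp: z_def)
    note g = intermediate_generated[of ?Z]
    \<comment> \<open>At the root \<open>a\<close> the derivative of $z X^2 - X + 1$ is $(a-2)/a$;
      in the exceptional case $a = 2$ a linear polynomial is a witness. In characteristic 2 this
      case cannot occur, because \<open>a\<close> is nonzero.\<close>
    show ?thesis proof (cases "a = 2")
      case True
      have "[:- 2, 1:] : polys_over (generated ?Z)" by (rule polys_over_linear[OF g intermediate_numeral[OF g]])
      then show ?thesis unfolding separable_over_def a_def[symmetric] by (intro bexI[of _ "[:- 2, 1:]"]) (simp_all add: True pderiv_pCons)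
    next
      case False
      have "[:1, - 1, z:] : polys_over (generated ?Z)"
        by (intro polys_over_pCons[OF g] polys_over_0[OF g] zmem intermediate_minus[OF g] intermediate_1[OF g])
      moreover have "poly [:1, - 1, z:] a = 0" using a0 by (simp add: za field_simps power2_eq_square)
      moreover have "poly (pderiv [:1, - 1, z:]) a ~= 0" proof -
        have "poly (pderiv [:1, - 1, z:]) a = (a - 2) / a" using a0 by (simp add: za pderiv_pCons field_simps power2_eq_square)
        then show ?thesis using False a0 by simp
      qed
      ultimately show ?thesis unfolding separable_over_def a_def[symmetric] by blast
    qed
  qed
  define E where "E = generated (?Y \<union> ?Z)"
  have yE: "ys u v e k : E" for e k proof -
    have "ys u v e k = ys u v (e mod 2) (k mod 5)" by (rule ys_cong) auto
    moreover have "e mod 2 : {0, 1}" "k mod 5 : {0..<5}" by auto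
    ultimately show ?thesis unfolding E_def by (intro subsetD[OF subset_generated] UnI1) (auto simp: image_iff)
  qed
  have LE: "splitting_field (f_F20 b) \<subseteq> E"
    unfolding E_def splitting_field_f using subset_generated[of "?Y \<union> ?Z"] by (intro generated_mono) simp
  have "galois_field E" unfolding E_def proof (rule galois_field_generated)
    show "fixed_is_base (generated (?Y \<union> ?Z))" by (rule fixed_is_base_generated_union[OF _ fib]) (auto intro: sep)
    fix \<phi> :: "'m alg_closure => 'm alg_closure" and x
    assume \<phi>: "\<phi> : ac_auts" and x: "x : ?Y \<union> ?Z"
    from x show "\<phi> x : generated (?Y \<union> ?Z)" proof
      assume "x : ?Y"
      then obtain e k where "x = ys u v e k" by (auto simp: image_iff)
      then have "\<phi> x = ys u v (e + snd (code \<phi>)) (aff (code \<phi>) k)" using code(2)[OF \<phi>] by (simp add: acts_by_def)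
      then show ?thesis using yE unfolding E_def by simp
    next
      assume "x : ?Z"
      then have "x : splitting_field (f_F20 b)" unfolding splitting_field_f by (rule subsetD[OF subset_generated])
      then show ?thesis using ac_auts_splitting_field[OF \<phi>] LE unfolding E_def by blast
    qed
  qed
  obtain \<theta> where \<theta>: "\<theta> : splitting_field (f_F20 b)" "\<forall>\<phi>\<in>ac_auts. \<phi> \<theta> = \<theta> \<longleftrightarrow> code \<phi> = \<e>"
    using primitive by (rule bexE)
  obtain h where h: "ys u v e k = poly (map_poly to_ac h) \<theta>"
  proof (rule stabilizer_imp_polynomial[OF \<open>galois_field E\<close>, of \<theta> "ys u v e k"])
    show "\<theta> : E" using \<theta>(1) LE by blast
    show "\<phi> (ys u v e k) = ys u v e k" if "\<phi> : ac_auts" "\<phi> \<theta> = \<theta>" for \<phi> using that \<theta>(2) code_one_ys by blast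
  qed (use yE that in auto)
  show ?thesis unfolding h by (rule polys_over_poly[OF L polys_over_base[OF L] \<theta>(1)])
qed

end

section \<open>Subdirect products in $F_{20} \<times> F_{20}$, their orbits and their isomorphism
  types\<close>

section \<open>Subdirect products of two copies of $F_{20}$\<close>

interpretation F: group F20 by (rule group_F20)

lemma snd_mult_F20: "snd (g \<cdot> h) = (snd g + snd h) mod 4" by (simp add: mult_F20)

lemma fst_snd_F20: "g : \<A> ==> fst g : {0..<5} \<and> snd g : {0..<4}" by (auto simp: carrier_F20)

lemma snd_inv_F20: "g : \<A> ==> snd (inv\<^bsub>F20\<^esub> g) = (- snd g) mod 4"
proof -
  assume g: "g : \<A>"
  have "(snd (inv\<^bsub>F20\<^esub> g) + snd g) mod 4 = 0" using F.l_inv[OF g] by (simp add: mult_F20 one_F20)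
  moreover have "snd (inv\<^bsub>F20\<^esub> g) : {0..<4}" using fst_snd_F20[OF F.inv_closed[OF g]] by blast
  ultimately show ?thesis by (simp, presburger)
qed

locale subdirect_F20 =
  fixes \<G> :: "((int \<times> int) \<times> (int \<times> int)) set"
  assumes sub: "(g, h) : \<G> ==> g : \<A> \<and> h : \<A>"
    and mult: "(g, h) : \<G> ==> (g', h') : \<G> ==> (g \<cdot> g', h \<cdot> h') : \<G>"
    and inverse: "(g, h) : \<G> ==> (inv\<^bsub>F20\<^esub> g, inv\<^bsub>F20\<^esub> h) : \<G>"
    and surj1: "g : \<A> ==> \<exists>h. (g, h) : \<G>"
    and surj2: "h : \<A> ==> \<exists>g. (g, h) : \<G>"
begin

lemma swap: "subdirect_F20 {(h, g). (g, h) : \<G>}" by unfold_locales (use sub mult inverse surj1 surj2 in auto)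

lemma one: "((0, 0), (0, 0)) : \<G>"
proof -
  obtain h where h: "(\<e>, h) : \<G>" using surj1[OF F.one_closed] by blast
  from mult[OF h inverse[OF h]] sub[OF h] show ?thesis by (simp add: one_F20)
qed

lemma translations1:
  assumes "((x, 0), (0, 0)) : \<G>" "x mod 5 ~= 0"
  shows "((n mod 5, 0), (0, 0)) : \<G>"
proof -
  have x: "x : {0..<5}" using sub[OF assms(1)] by (simp add: carrier_F20)
  have pw: "((int k * x) mod 5, 0) = ((int k * x) mod 5, 0) \<and> (((int k * x) mod 5, 0), (0, 0)) : \<G>" for k proof (induction k)
    case (Suc k)
    from mult[OF assms(1) conjunct2[OF Suc]] show ?case by (simp add: mult_F20 mod_simps algebra_simps)
  qed (simp add: one)
  have "x : {1,2,3,4}" using x assms(2) by auto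
  then have "\<exists>y\<in>{1,2,3,4}. (y * x) mod 5 = 1" by (elim insertE emptyE) simp_all
  then obtain y where y': "y : {1,2,3,4}" and y: "(y * x) mod 5 = 1" by (rule bexE)
  define k where "k = nat (n mod 5 * y)"
  have nn: "0 \<le> n mod 5 * y" using y' by auto
  have "(int k * x) mod 5 = (n mod 5 * (y * x)) mod 5" using nn by (simp add: k_def mult.assoc)
  also have "... = (n mod 5 * ((y * x) mod 5)) mod 5" by (rule mod_mult_right_eq[symmetric])
  also have "... = n mod 5" by (simp add: y)
  finally show ?thesis using pw[of k] by simp
qed

text \<open>If \<open>g\<close> is not itself a translation, its commutator with a lift of the
  translation \<open>(1, 0)\<close> is a nontrivial one; the second component cancels because that
  of \<open>g\<close> is trivial.\<close>

lemma translations_if_kernel: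
  assumes g: "(g, (0, 0)) : \<G>" "g ~= (0, 0)"
  shows "((n mod 5, 0), (0, 0)) : \<G>"
proof (cases "snd g = 0")
  case True
  then show ?thesis using g sub[OF g(1)] by (intro translations1[of "fst g"]) (auto simp: carrier_F20 prod_eq_iff)
next
  case False
  have gc: "g : \<A>" using sub[OF g(1)] by blast
  have i: "snd g : {1, 2, 3}" using fst_snd_F20[OF gc] False by auto
  obtain h where h: "((1, 0), h) : \<G>" using surj1[of "(1, 0)"] by (auto simp: carrier_F20)
  define c where "c = g \<cdot> (1, 0)"
  define d where "d = (1, 0) \<cdot> g"
  have hc: "h : \<A>" using sub[OF h] by blast
  have "(c, h) : \<G>" "(d, h) : \<G>" using mult[OF g(1) h] mult[OF h g(1)] F.l_one[OF hc] F.r_one[OF hc] by (simp_all add: one_F20 c_def d_def)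
  from mult[OF this(1) inverse[OF this(2)]] hc
  have e: "(c \<cdot> inv\<^bsub>F20\<^esub> d, (0, 0)) : \<G>" by (simp add: one_F20)
  have cc: "c : \<A>" "d : \<A>" unfolding c_def d_def by (rule mult_F20_closed)+
  have s: "snd c = snd d" unfolding c_def d_def by (simp add: mult_F20)
  have s0: "snd (c \<cdot> inv\<^bsub>F20\<^esub> d) = 0" unfolding mult_F20 snd_conv snd_inv_F20[OF cc(2)] s by (simp add: mod_simps)
  have "c ~= d" proof
    assume "c = d"
    then have "(fst g + 2 ^ nat (snd g)) mod 5 = (1 + fst g) mod 5" by (simp add: c_def d_def mult_F20)
    then show False using i by (elim insertE emptyE) (simp_all, presburger+)
  qed
  then have "c \<cdot> inv\<^bsub>F20\<^esub> d ~= \<e>" using cc by (metis F.inv_closed F.inv_equality F.inv_inv)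
  then have ne: "fst (c \<cdot> inv\<^bsub>F20\<^esub> d) ~= 0" using s0 by (simp add: one_F20 prod_eq_iff)
  have "fst (c \<cdot> inv\<^bsub>F20\<^esub> d) : {0..<5}" using fst_snd_F20[OF mult_F20_closed] by blast
  then have "fst (c \<cdot> inv\<^bsub>F20\<^esub> d) mod 5 ~= 0" using ne by auto
  moreover have "((fst (c \<cdot> inv\<^bsub>F20\<^esub> d), 0), (0, 0)) : \<G>" using e s0 by (metis prod.collapse)
  ultimately show ?thesis by (intro translations1)
qed

text \<open>Take the 16th power of a lift of \<open>(1, 0)\<close>: since 16 is 1 modulo 5 the
  second component is unchanged, and since 16 is 0 modulo 4 the first becomes a translation, which
  the assumption removes.\<close>

lemma translations2_if_translations1:
  assumes t: "!!n. ((n mod 5, 0), (0, 0)) : \<G>"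
  shows "((0, 0), (1, 0)) : \<G>"
proof -
  obtain g where g: "(g, (1, 0)) : \<G>" using surj2[of "(1, 0)"] by (auto simp: carrier_F20)
  have e: "(1, 0) \<cdot> (1, 0) = (2, 0)" "(2, 0) \<cdot> (2, 0) = (4, 0)"
    "(4, 0) \<cdot> (4, 0) = (3, 0)" "(3, 0) \<cdot> (3, 0) = (1, 0)" by (simp_all add: mult_F20)
  note g2 = mult[OF g g, unfolded e]
  note g4 = mult[OF g2 g2, unfolded e]
  note g8 = mult[OF g4 g4, unfolded e]
  note g16 = mult[OF g8 g8, unfolded e]
  define k where "k = (g \<cdot> g) \<cdot> (g \<cdot> g)"
  define l where "l = (k \<cdot> k) \<cdot> (k \<cdot> k)"
  have l: "(l, (1, 0)) : \<G>" using g16 unfolding l_def k_def .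
  have "snd k = 0" unfolding k_def snd_mult_F20 by presburger
  then have s: "snd l = 0" unfolding l_def snd_mult_F20 by simp
  have "fst l : {0..<5}" using sub[OF l] fst_snd_F20 by blast
  then show ?thesis using mult[OF t[of "- fst l"] l] s by (simp add: mult_F20 mod_simps)
qed

definition exponents :: "(int \<times> int) set" where
  "exponents = (\<lambda>(g, h). (snd g, snd h)) ` \<G>"

lemma full_translations:
  assumes t1: "!!n. ((n mod 5, 0), (0, 0)) : \<G>" and t2: "!!n. ((0, 0), (n mod 5, 0)) : \<G>"
  shows "(g, h) : \<G> \<longleftrightarrow> g : \<A> \<and> h : \<A> \<and> (snd g, snd h) : exponents"
proof
  assume r: "g : \<A> \<and> h : \<A> \<and> (snd g, snd h) : exponents"
  then obtain g' h' where gh: "(g', h') : \<G>" "snd g' = snd g" "snd h' = snd h" by (auto simp: exponents_def)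
  have "(((fst g - fst g') mod 5, 0) \<cdot> g', (0, 0) \<cdot> h') : \<G>" by (rule mult[OF t1 gh(1)])
  from mult[OF t2[of "fst h - fst h'"] this] show "(g, h) : \<G>"
    using r gh sub[OF gh(1)] fst_snd_F20[of g] fst_snd_F20[of h] fst_snd_F20[of g'] fst_snd_F20[of h']
    by (simp add: mult_F20 mod_simps prod_eq_iff del: F.l_one)
next
  assume gh: "(g, h) : \<G>"
  have "(snd g, snd h) : exponents" unfolding exponents_def by (rule image_eqI[OF _ gh]) simp
  then show "g : \<A> \<and> h : \<A> \<and> (snd g, snd h) : exponents" using sub[OF gh] by blast
qed

text \<open>Goursat's lemma for $C_4 \<times> C_4$: the common quotient is trivial, $C_2$ or $C_4$,
  and in the last case the identification is by 1 or by -1.\<close>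

lemma exponents_cases:
  "exponents = {0..<4} \<times> {0..<4} \<or> exponents = {(i, j) \<in> {0..<4} \<times> {0..<4}. even i \<longleftrightarrow> even j}
   \<or> exponents = {(i, j) \<in> {0..<4} \<times> {0..<4}. i = j} \<or> exponents = {(i, j) \<in> {0..<4} \<times> {0..<4}. (i + j) mod 4 = 0}"
proof -
  let ?R = "{0..<4} :: int set"
  have add: "((i + i') mod 4, (j + j') mod 4) : exponents" if ij: "(i, j) : exponents" "(i', j') : exponents" for i j i' j' proof -
    obtain g h g' h' where "(g, h) : \<G>" "(g', h') : \<G>" "i = snd g" "j = snd h" "i' = snd g'" "j' = snd h'"
      using ij unfolding exponents_def by (elim imageE) (auto simp: case_prod_beta)
    then show ?thesis using mult[of g h g' h'] snd_mult_F20 unfolding exponents_def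
      by (intro image_eqI[of _ _ "(g \<cdot> g', h \<cdot> h')"]) simp_all
  qed
  have R: "i : ?R \<and> j : ?R" if "(i, j) : exponents" for i j using that sub fst_snd_F20 by (force simp: exponents_def)
  obtain y where y: "(1, y) : exponents" using surj1[of "(0, 1)"] by (force simp: exponents_def carrier_F20)
  obtain x where x: "(x, 1) : exponents" using surj2[of "(0, 1)"] by (force simp: exponents_def carrier_F20)
  have z: "(0, 0) : exponents" using one by (force simp: exponents_def)
  have m1: "(i, (i * y) mod 4) : exponents" if "i : ?R" for i proof -
    note y2 = add[OF y y] note y3 = add[OF y2 y]
    show ?thesis using range4_cases[OF that] y z y2 y3 R[OF y] by (elim disjE) (simp_all add: mod_simps)
  qed
  have red: "(i, j) : exponents \<longleftrightarrow> (0, (j - i * y) mod 4) : exponents" if "i : ?R" "j : ?R" for i j proof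
    assume ij: "(i, j) : exponents"
    have "((i + (- i) mod 4) mod 4, (j + ((- i) mod 4 * y) mod 4) mod 4) : exponents" by (rule add[OF ij m1]) simp
    moreover have "(j + ((- i) mod 4 * y) mod 4) mod 4 = (j - i * y) mod 4"
      by (metis add_uminus_conv_diff mod_add_right_eq mod_mult_left_eq mult_minus_left)
    ultimately show "(0, (j - i * y) mod 4) : exponents" by (simp add: mod_simps)
  next
    assume "(0, (j - i * y) mod 4) : exponents"
    from add[OF this m1[OF that(1)]] that show "(i, j) : exponents" by (simp add: mod_simps)
  qed
  \<comment> \<open>The kernel of the first projection. With the fixed lift \<open>(1, y)\<close> of
    a generator, membership of \<open>(i, j)\<close> depends only on whether $j - iy$ lies in this
    kernel.\<close>
  define D where "D d \<longleftrightarrow> (0, d) : exponents" for d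
  have fin: "(i, j) : exponents \<longleftrightarrow> i : ?R \<and> j : ?R \<and> D ((j - i * y) mod 4)" for i j
    using red[of i j] R[of i j] unfolding D_def by blast
  have D: "exponents = {(i, j) \<in> ?R \<times> ?R. D ((j - i * y) mod 4)}"
    by (rule Set.set_eqI, rename_tac p, case_tac p) (simp only: fin mem_Collect_eq prod.case mem_Times_iff fst_conv snd_conv conj_assoc)
  have D0: "D 0" using z by (simp add: D_def)
  have Dadd: "D d ==> D e ==> D ((d + e) mod 4)" for d e using add[of 0 d 0 e] by (simp add: D_def)
  have D13: "D 1 \<longleftrightarrow> D 3" using Dadd[of 1 1] Dadd[of 2 1] Dadd[of 3 3] Dadd[of 2 3] by auto
  have all: "D 1 ==> D d" if "d : ?R" for d using range4_cases[OF that] D0 Dadd[of 1 1] D13 by auto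
  show ?thesis proof (cases "D 1")
    case True
    then have "exponents = ?R \<times> ?R" unfolding D using all by auto
    then show ?thesis by (rule disjI1)
  next
    case False
    have yR: "y : ?R" using R[OF y] by blast
    have Dx: "D ((1 - x * y) mod 4)" using x R[OF x] red[of x 1] by (simp add: D_def)
    have y13: "y = 1 \<or> y = 3" proof (rule ccontr)
      assume "\<not> (y = 1 \<or> y = 3)"
      then have "even y" using range4_cases[OF yR] by auto
      then have "(1 - x * y) mod 4 = 1 \<or> (1 - x * y) mod 4 = 3" using range4_cases[OF yR] R[OF x] range4_cases[of x] by auto
      then show False using Dx False D13 by auto
    qed
    have mm: "k mod 4 = 0 \<or> k mod 4 = 1 \<or> k mod 4 = 2 \<or> k mod 4 = 3" for k :: int by (rule range4_cases) simp
    show ?thesis proof (cases "D 2")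
      case True
      have ev: "D (k mod 4) \<longleftrightarrow> even k" for k using mm[of k] True D0 False D13 by (elim disjE) (simp_all, presburger+)
      have par: "even (j - i * y) \<longleftrightarrow> (even i \<longleftrightarrow> even j)" for i j using y13 by auto
      have "exponents = {(i, j) \<in> ?R \<times> ?R. even i \<longleftrightarrow> even j}" unfolding D ev par ..
      then show ?thesis by (rule disjI2[OF disjI1])
    next
      case False2: False
      have z4: "D (k mod 4) \<longleftrightarrow> k mod 4 = 0" for k using mm[of k] False2 D0 False D13 by (elim disjE) simp_all
      have e: "exponents = {(i, j) \<in> ?R \<times> ?R. (j - i * y) mod 4 = 0}" unfolding D z4 ..
      from y13 show ?thesis proof
        assume "y = 1"
        have ij: "(j - i * y) mod 4 = 0 \<longleftrightarrow> i = j" if "i : ?R" "j : ?R" for i j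
          using that \<open>y = 1\<close> by (simp, presburger)
        have "exponents = {(i, j) \<in> ?R \<times> ?R. i = j}"
          unfolding e by (rule Collect_cong, rename_tac p, case_tac p) (simp only: prod.case mem_Times_iff fst_conv snd_conv ij cong: conj_cong)
        then show ?thesis by (rule disjI2[OF disjI2[OF disjI1]])
      next
        assume "y = 3"
        have ij: "(j - i * y) mod 4 = 0 \<longleftrightarrow> (i + j) mod 4 = 0" for i j using \<open>y = 3\<close> by (simp, presburger)
        have "exponents = {(i, j) \<in> ?R \<times> ?R. (i + j) mod 4 = 0}" unfolding e ij ..
        then show ?thesis by (rule disjI2[OF disjI2[OF disjI2]])
      qed
    qed
  qed
qed

text \<open>With both kernels trivial the group is the graph of an automorphism of $F_{20}$, and
  these are all inner. The image \<open>h\<close> of \<open>(1, 0)\<close> has trivial fifth power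
  and is therefore a translation; the relation $kh = h^2 k$ forces the image \<open>k\<close> of
  \<open>(0, 1)\<close> to have exponent 1.\<close>

lemma graph_of_inner:
  assumes k1: "!!g. (g, (0, 0)) : \<G> ==> g = (0, 0)" and k2: "!!h. ((0, 0), h) : \<G> ==> h = (0, 0)"
  shows "\<exists>c\<in>\<A>. \<G> = {(g, h). g : \<A> \<and> h : \<A> \<and> h \<cdot> c = c \<cdot> g}"
proof -
  have unique: "h = h'" if "(g, h) : \<G>" "(g, h') : \<G>" for g h h' proof -
    have c: "g : \<A>" "h : \<A>" "h' : \<A>" using sub that by blast+
    from mult[OF that(1) inverse[OF that(2)]] have "h \<cdot> inv\<^bsub>F20\<^esub> h' = \<e>" using k2 c by (simp add: one_F20)
    then show ?thesis using c by (metis F.inv_closed F.inv_equality F.inv_inv)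
  qed
  obtain h where h: "((1, 0), h) : \<G>" using surj1[of "(1, 0)"] by (auto simp: carrier_F20)
  obtain k where k: "((0, 1), k) : \<G>" using surj1[of "(0, 1)"] by (auto simp: carrier_F20)
  have hc: "fst h : {0..<5}" "snd h : {0..<4}" and kc: "fst k : {0..<5}" "snd k : {0..<4}" using sub[OF h] sub[OF k] fst_snd_F20 by blast+
  have e: "(1, 0) \<cdot> (1, 0) = (2, 0)" "(2, 0) \<cdot> (2, 0) = (4, 0)"
    "(1, 0) \<cdot> (4, 0) = (0, 0)" by (simp_all add: mult_F20)
  note h2 = mult[OF h h, unfolded e]
  note h4 = mult[OF h2 h2, unfolded e]
  note h5 = mult[OF h h4, unfolded e]
  define h5' where "h5' = h \<cdot> (h \<cdot> h \<cdot> (h \<cdot> h))"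
  have "((0, 0), h5') : \<G>" using h5 unfolding h5'_def .
  from k2[OF this] have "snd h5' = 0" by simp
  then have sh: "snd h = 0" using range4_cases[OF hc(2)] unfolding h5'_def snd_mult_F20 by (elim disjE) simp_all
  have ah: "fst h ~= 0" proof
    assume "fst h = 0"
    then have "((1, 0), (0, 0)) : \<G>" using h sh by (metis prod.collapse)
    then show False using k1 by fastforce
  qed
  have "((0, 1) \<cdot> (1, 0), k \<cdot> h) : \<G>" "((1, 0) \<cdot> (1, 0) \<cdot> (0, 1), h \<cdot> h \<cdot> k) : \<G>" by (intro mult h k)+
  then have "k \<cdot> h = h \<cdot> h \<cdot> k" by (intro unique[of "(2, 1)"]) (simp_all add: mult_F20)
  then have "(fst k + 2 ^ nat (snd k) * fst h) mod 5 = (fst h + fst h + fst k) mod 5" using sh by (simp add: mult_F20 mod_simps)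
  then have "5 dvd (fst k + 2 ^ nat (snd k) * fst h) - (fst h + fst h + fst k)" by (simp only: mod_eq_dvd_iff)
  then have "5 dvd (2 ^ nat (snd k) * fst h - 2 * fst h)" by (simp add: algebra_simps)
  then have dvd: "(2 ^ nat (snd k) * fst h - 2 * fst h) mod 5 = 0" by simp
  have ah': "fst h : {1,2,3,4}" using hc(1) ah by auto
  have sk: "snd k = 1" using range4_cases[OF kc(2)] ah' dvd by (elim disjE insertE emptyE) simp_all
  from ah'
  have "\<exists>l\<in>{0,1,2,3::int}. 2 ^ nat l mod 5 = fst h" by (elim insertE emptyE) simp_all
  then obtain l where l': "l : {0,1,2,3}" and l: "2 ^ nat l mod 5 = fst h" by (rule bexE)
  \<comment> \<open>Conjugation by \<open>(m, l)\<close> maps \<open>(1, 0)\<close> to the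
    translation by $2^l$, which must be \<open>fst h\<close>; matching the image of
    \<open>(0, 1)\<close> gives $m = -$\<open>fst k\<close>.\<close>
  define c where "c = ((- fst k) mod 5, l)"
  have c: "c : \<A>" using l' by (auto simp: c_def carrier_F20)
  have hh: "h \<cdot> c = c \<cdot> (1, 0)" using sh l[symmetric] l' by (auto simp: mult_F20 c_def mod_simps algebra_simps)
  have kk: "k \<cdot> c = c \<cdot> (0, 1)"

  proof -
    have "(fst k + 2 * ((- fst k) mod 5)) mod 5 = (- fst k) mod 5" by presburger
    then show ?thesis using sk by (simp add: mult_F20 c_def add.commute)
  qed
  define K where "K = {g \<in> \<A>. \<exists>h. (g, h) : \<G> \<and> h \<cdot> c = c \<cdot> g}"
  have Kmult: "g \<cdot> g' : K" if "g : K" "g' : K" for g g' proof -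
    from \<open>g : K\<close> obtain x where x: "g : \<A>" "(g, x) : \<G>" "x \<cdot> c = c \<cdot> g" unfolding K_def by (elim CollectE conjE exE)
    from \<open>g' : K\<close> obtain x' where x': "g' : \<A>" "(g', x') : \<G>" "x' \<cdot> c = c \<cdot> g'"
      unfolding K_def by (elim CollectE conjE exE)
    have xc: "x : \<A>" "x' : \<A>" using sub[OF x(2)] sub[OF x'(2)] by simp_all
    have "x \<cdot> x' \<cdot> c = x \<cdot> (x' \<cdot> c)" by (rule F.m_assoc[OF xc c])
    also have "... = (x \<cdot> c) \<cdot> g'" unfolding x'(3) by (rule F.m_assoc[OF xc(1) c x'(1), symmetric])
    also have "... = c \<cdot> (g \<cdot> g')" unfolding x(3) by (rule F.m_assoc[OF c x(1) x'(1)])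
    finally show ?thesis unfolding K_def using mult[OF x(2) x'(2)] mult_F20_closed[of g g'] by (intro CollectI conjI exI[of _ "x \<cdot> x'"])
  qed
  have K1: "(1, 0) : K" "(0, 1) : K" unfolding K_def using h k hh kk sub[OF h] sub[OF k] by (intro CollectI conjI exI[of _ h] exI[of _ k]; simp)+
  have K0: "(0, 0) : K" 
    unfolding K_def using one sub[OF one] F.l_one[OF c] F.r_one[OF c] by (intro CollectI conjI exI[of _ "(0, 0)"]) (simp_all add: one_F20)
  have Kn: "(int n mod 5, 0) : K" for n proof (induction n)
    case (Suc n)
    from Kmult[OF K1(1) Suc] show ?case by (simp add: mult_F20 mod_simps add.commute)
  qed (simp add: K0)
  have Ki: "(0, int n mod 4) : K" for n proof (induction n)
    case (Suc n)
    from Kmult[OF K1(2) Suc] show ?case by (simp add: mult_F20 mod_simps add.commute)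
  qed (simp add: K0)
  have Kall: "g : K" if "g : \<A>" for g proof -
    have r: "fst g : {0..<5}" "snd g : {0..<4}" using fst_snd_F20[OF that] by auto
    from Kmult[OF Kn[of "nat (fst g)"] Ki[of "nat (snd g)"]] r show ?thesis by (simp add: mult_F20)
  qed
  have "\<G> = {(g, h). g : \<A> \<and> h : \<A> \<and> h \<cdot> c = c \<cdot> g}" proof (intro equalityI subrelI)
    fix g x assume gx: "(g, x) : \<G>"
    then have gc: "g : \<A>" "x : \<A>" using sub[OF gx] by simp_all
    obtain x' where "(g, x') : \<G>" "x' \<cdot> c = c \<cdot> g" using Kall[OF gc(1)] unfolding K_def by (elim CollectE conjE exE)
    then show "(g, x) : {(g, h). g : \<A> \<and> h : \<A> \<and> h \<cdot> c = c \<cdot> g}" using unique[OF gx] gc by simp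
  next
    fix g x assume "(g, x) : {(g, h). g : \<A> \<and> h : \<A> \<and> h \<cdot> c = c \<cdot> g}"
    then have gx: "g : \<A>" "x : \<A>" "x \<cdot> c = c \<cdot> g" by simp_all
    obtain x' where x': "(g, x') : \<G>" "x' \<cdot> c = c \<cdot> g" using Kall[OF gx(1)] unfolding K_def by (elim CollectE conjE exE)
    then have "x = x'" using gx c sub[OF x'(1)] F.r_cancel[of x c x'] by simp
    then show "(g, x) : \<G>" using x' by simp
  qed
  then show ?thesis using c by blast
qed

text \<open>As soon as one kernel is nontrivial, the group contains all translations on both sides
  and is determined by its exponents; otherwise it is the graph of an inner automorphism.\<close>

theorem classification:
  "(\<forall>g h. (g, h) : \<G> \<longleftrightarrow> g : \<A> \<and> h : \<A>) \<or>
   (\<forall>g h. (g, h) : \<G> \<longleftrightarrow> g : \<A> \<and> h : \<A> \<and> (even (snd g) \<longleftrightarrow> even (snd h))) \<or>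
   (\<forall>g h. (g, h) : \<G> \<longleftrightarrow> g : \<A> \<and> h : \<A> \<and> snd g = snd h) \<or>
   (\<forall>g h. (g, h) : \<G> \<longleftrightarrow> g : \<A> \<and> h : \<A> \<and> (snd g + snd h) mod 4 = 0) \<or>
   (\<exists>c\<in>\<A>. \<forall>g h. (g, h) : \<G> \<longleftrightarrow> g : \<A> \<and> h : \<A> \<and> h \<cdot> c = c \<cdot> g)"
proof (cases "\<exists>g h. (g, h) : \<G> \<and> (g ~= (0, 0) \<and> h = (0, 0) \<or> g = (0, 0) \<and> h ~= (0, 0))")
  case True
  interpret sw: subdirect_F20 "{(h, g). (g, h) : \<G>}" by (rule swap)
  have "(\<forall>n. ((n mod 5, 0), (0, 0)) : \<G>) \<and> (\<forall>n. ((0, 0), (n mod 5, 0)) : \<G>)" proof -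
    from True consider g where "(g, (0, 0)) : \<G>" "g ~= (0, 0)" | h where "((0, 0), h) : \<G>" "h ~= (0, 0)" by blast
    then show ?thesis proof cases
      case (1 g)
      have t: "((n mod 5, 0), (0, 0)) : \<G>" for n by (rule translations_if_kernel[OF 1])
      have "((0, 0), (1, 0)) : \<G>" by (rule translations2_if_translations1[OF t])
      then have "((0, 0), (n mod 5, 0)) : \<G>" for n using sw.translations1[of 1 n] by simp
      with t show ?thesis by blast
    next
      case (2 h)
      have t: "((0, 0), (n mod 5, 0)) : \<G>" for n using sw.translations_if_kernel[of h n] 2 by simp
      have "((1, 0), (0, 0)) : \<G>" using sw.translations2_if_translations1 t by simp
      then have "((n mod 5, 0), (0, 0)) : \<G>" for n using translations1[of 1 n] by simp
      with t show ?thesis by blast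
    qed
  qed
  then have full: "(g, h) : \<G> \<longleftrightarrow> g : \<A> \<and> h : \<A> \<and> (snd g, snd h) : exponents" for g h
    by (intro full_translations) blast+
  have r: "snd g : {0..<4}" if "g : \<A>" for g using fst_snd_F20[OF that] by blast
  show ?thesis using exponents_cases proof (elim disjE)
    assume *: "exponents = {0..<4} \<times> {0..<4}"
    have "\<forall>g h. (g, h) : \<G> \<longleftrightarrow> g : \<A> \<and> h : \<A>"
      unfolding full * mem_Times_iff fst_conv snd_conv using r by blast
    then show ?thesis by blast
  next
    assume *: "exponents = {(i, j) \<in> {0..<4} \<times> {0..<4}. even i \<longleftrightarrow> even j}"
    have "\<forall>g h. (g, h) : \<G> \<longleftrightarrow> g : \<A> \<and> h : \<A> \<and> (even (snd g) \<longleftrightarrow> even (snd h))"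
      unfolding full * mem_Collect_eq prod.case mem_Times_iff fst_conv snd_conv using r by blast
    then show ?thesis by blast
  next
    assume *: "exponents = {(i, j) \<in> {0..<4} \<times> {0..<4}. i = j}"
    have "\<forall>g h. (g, h) : \<G> \<longleftrightarrow> g : \<A> \<and> h : \<A> \<and> snd g = snd h"
      unfolding full * mem_Collect_eq prod.case mem_Times_iff fst_conv snd_conv using r by blast
    then show ?thesis by blast
  next
    assume *: "exponents = {(i, j) \<in> {0..<4} \<times> {0..<4}. (i + j) mod 4 = 0}"
    have "\<forall>g h. (g, h) : \<G> \<longleftrightarrow> g : \<A> \<and> h : \<A> \<and> (snd g + snd h) mod 4 = 0"
      unfolding full * mem_Collect_eq prod.case mem_Times_iff fst_conv snd_conv using r by blast
    then show ?thesis by blast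
  qed
next
  case False
  then have "\<exists>c\<in>\<A>. \<G> = {(g, h). g : \<A> \<and> h : \<A> \<and> h \<cdot> c = c \<cdot> g}" by (intro graph_of_inner) blast+
  then show ?thesis by (intro disjI2) auto
qed

end

section \<open>Orbits on the forty indices\<close>

definition indices :: "(int \<times> (int \<times> int)) set" where
  "indices = {0, 1} \<times> \<A>"

text \<open>Forced by the shape of the resolvent roots: when $(g,h)$ is applied to the sum attached
  to $(e, A)$ and the sum is reindexed by $g$, the matching \<open>A\<close> of the two index sets
  becomes $h A g^{-1}$.\<close>

definition index_act :: "(int \<times> int) \<times> (int \<times> int) => int \<times> (int \<times> int) => int \<times> (int \<times> int)" where
  "index_act = (\<lambda>(g, h) (e, A). ((e + snd g) mod 2, h \<cdot> A \<cdot> inv\<^bsub>F20\<^esub> g))"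

text \<open>Orbit lengths are recorded through a system of representatives, in the form from which
  \<open>factor_degrees_pair\<close> builds the irreducible factors.\<close>

definition orbit_type :: "((int \<times> int) \<times> (int \<times> int)) set => nat multiset => bool" where
  "orbit_type \<G> D \<longleftrightarrow> (\<exists>(I :: nat set) x. finite I \<and> (\<forall>i\<in>I. x i : indices) \<and>
     indices = (\<Union>i\<in>I. (\<lambda>\<gamma>. index_act \<gamma> (x i)) ` \<G>) \<and>
     (\<forall>i\<in>I. \<forall>j\<in>I. i ~= j --> (\<lambda>\<gamma>. index_act \<gamma> (x i)) ` \<G> \<inter> (\<lambda>\<gamma>. index_act \<gamma> (x j)) ` \<G> = {}) \<and>
     image_mset (\<lambda>i. card ((\<lambda>\<gamma>. index_act \<gamma> (x i)) ` \<G>)) (mset_set I) = D)"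

lemma finite_indices: "finite indices" by (simp add: indices_def carrier_F20)

lemma index_act_closed:
  "g : \<A> ==> h : \<A> ==> x : indices ==> index_act (g, h) x : indices" by (cases x) (auto simp: indices_def index_act_def mult_F20_closed)

text \<open>Here \<kappa> is a complete invariant of the orbits, so orbit lengths become fibre sizes
  that can be counted without computing orbits.\<close>

lemma orbit_type_fibres:
  fixes \<kappa> :: "int \<times> (int \<times> int) => nat"
  assumes sub: "!!g h. (g, h) : \<G> ==> g : \<A> \<and> h : \<A>"
    and inv: "!!g h x. (g, h) : \<G> ==> x : indices ==> \<kappa> (index_act (g, h) x) = \<kappa> x"
    and I: "finite I" "!!i. i : I ==> r i : indices \<and> \<kappa> (r i) = i" "!!x. x : indices ==> \<kappa> x : I"
    and trans: "!!y i. y : indices ==> i = \<kappa> y ==> \<exists>\<gamma>\<in>\<G>. index_act \<gamma> (r i) = y"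
  shows "orbit_type \<G> (image_mset (\<lambda>i. card {x \<in> indices. \<kappa> x = i}) (mset_set I))"
proof -
  have orb: "(\<lambda>\<gamma>. index_act \<gamma> (r i)) ` \<G> = {x \<in> indices. \<kappa> x = i}" if "i : I" for i
  proof (intro equalityI subsetI)
    fix y assume "y : (\<lambda>\<gamma>. index_act \<gamma> (r i)) ` \<G>"
    then obtain g h where "(g, h) : \<G>" "y = index_act (g, h) (r i)" by auto
    then show "y : {x \<in> indices. \<kappa> x = i}" using sub[of g h] inv[of g h "r i"] I(2)[OF that] index_act_closed[of g h "r i"] by simp
  next
    fix y assume "y : {x \<in> indices. \<kappa> x = i}"
    then show "y : (\<lambda>\<gamma>. index_act \<gamma> (r i)) ` \<G>" using trans[of y i] by force
  qed
  show ?thesis unfolding orbit_type_def proof (intro exI[of _ I] exI[of _ r] conjI)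
    show "indices = (\<Union>i\<in>I. (\<lambda>\<gamma>. index_act \<gamma> (r i)) ` \<G>)" using I(3) by (auto simp: orb)
    show "image_mset (\<lambda>i. card ((\<lambda>\<gamma>. index_act \<gamma> (r i)) ` \<G>)) (mset_set I)
      = image_mset (\<lambda>i. card {x \<in> indices. \<kappa> x = i}) (mset_set I)" using I(1) by (intro image_mset_cong) (simp add: orb)
  qed (use I in \<open>auto simp: orb\<close>)
qed

lemma snd_index_act:
  assumes "g : \<A>"
  shows "snd (snd (index_act (g, h) (e, A))) = (snd h + snd A - snd g) mod 4"
  using snd_inv_F20[OF assms] by (simp add: index_act_def snd_mult_F20 mod_simps)

text \<open>A group containing all translations sees only $e$ and the exponent of \<open>A\<close>,
  and five indices share each such pair. To move $(e, A)$ to $(e', A')$ it suffices to try $g = (0,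
  (e'-e) mod 2)$ and $h = A' g A^{-1}$; this is the exponent pair tested in
  \<open>trans\<close>.\<close>

lemma orbit_type_exponents:
  fixes \<kappa> :: "int => int => nat"
  assumes G: "!!g h. (g, h) : \<G> \<longleftrightarrow> g : \<A> \<and> h : \<A> \<and> Q (snd g) (snd h)"
    and inv: "!!e a i j. e : {0, 1} ==> a : {0..<4} ==> i : {0..<4} ==> j : {0..<4} ==> Q i j ==>
      \<kappa> ((e + i) mod 2) ((j + a - i) mod 4) = \<kappa> e a"
    and trans: "!!e a e' a'. e : {0, 1} ==> e' : {0, 1} ==> a : {0..<4} ==> a' : {0..<4} ==> \<kappa> e a = \<kappa> e' a' ==>
      Q ((e' - e) mod 2) ((a' + (e' - e) mod 2 - a) mod 4)"
    and I: "I = (\<lambda>(e, a). \<kappa> e a) ` ({0, 1} \<times> {0..<4})"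
  shows "orbit_type \<G> (image_mset (\<lambda>i. 5 * (\<Sum>e\<in>{0, 1}. \<Sum>a\<in>{0, 1, 2, 3}. if \<kappa> e a = i then 1 else 0)) (mset_set I))"
proof -
  define k where "k = (\<lambda>x :: int \<times> (int \<times> int). \<kappa> (fst x) (snd (snd x)))"
  have "\<exists>r. r : indices \<and> k r = i" if i: "i : I" for i proof -
    obtain p where p: "p : {0, 1} \<times> {0..<4}" "i = (\<lambda>(e, a). \<kappa> e a) p" using i unfolding I by blast
    then show ?thesis by (intro exI[of _ "(fst p, (0, snd p))"]) (simp add: k_def indices_def carrier_F20 mem_Times_iff case_prod_beta)
  qed
  then obtain r where r: "!!i. i : I ==> r i : indices \<and> k (r i) = i" by metis
  have range: "fst x : {0, 1} \<and> snd x : \<A> \<and> snd (snd x) : {0..<4}" if "x : indices" for x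
    using that fst_snd_F20[of "snd x"] by (auto simp: indices_def)
  have kI: "k x : I" if "x : indices" for x unfolding I k_def using range[OF that] by (intro image_eqI[of _ _ "(fst x, snd (snd x))"]) simp_all
  have "orbit_type \<G> (image_mset (\<lambda>i. card {x \<in> indices. k x = i}) (mset_set I))" proof (rule orbit_type_fibres)
    show "finite I" unfolding I by simp
    show "k (index_act (g, h) x) = k x" if gh: "(g, h) : \<G>" and x: "x : indices" for g h x proof -
      have g: "g : \<A>" "h : \<A>" "Q (snd g) (snd h)" using gh G by blast+
      have "k (index_act (g, h) x) = \<kappa> ((fst x + snd g) mod 2) ((snd h + snd (snd x) - snd g) mod 4)"
        using snd_index_act[OF g(1), of h "fst x" "snd x"] by (simp add: k_def) (simp add: index_act_def case_prod_beta)
      also have "... = k x" unfolding k_def using range[OF x] fst_snd_F20[OF g(1)] fst_snd_F20[OF g(2)] g(3) by (intro inv) blast+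
      finally show ?thesis .
    qed
    show "\<exists>\<gamma>\<in>\<G>. index_act \<gamma> (r i) = y" if y: "y : indices" "i = k y" for y i proof -
      have ri: "r i : indices" "k (r i) = i" using r[OF kI[OF y(1)]] y(2) by simp_all
      obtain e A where eA: "r i = (e, A)" by (cases "r i")
      obtain e' A' where eA': "y = (e', A')" by (cases y)
      have rg: "e : {0, 1}" "A : \<A>" "snd A : {0..<4}" "e' : {0, 1}" "A' : \<A>" "snd A' : {0..<4}"
        using range[OF ri(1)] range[OF y(1)] by (simp_all add: eA eA')
      define g :: "int \<times> int" where "g = (0, (e' - e) mod 2)"
      have gc: "g : \<A>" using pos_mod_bound[of 2 "e' - e"] pos_mod_sign[of 2 "e' - e"] by (simp add: g_def carrier_F20 del: pos_mod_bound)
      define h where "h = A' \<cdot> g \<cdot> inv\<^bsub>F20\<^esub> A"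
      have hc: "h : \<A>" unfolding h_def by (rule mult_F20_closed)
      have "Q (snd g) (snd h)" proof -
        have "snd h = (snd A' + snd g - snd A) mod 4" using snd_inv_F20[OF rg(2)] by (simp add: h_def snd_mult_F20 mod_simps)
        moreover have "k (r i) = k y" using ri(2) y(2) by simp
        then have "\<kappa> e (snd A) = \<kappa> e' (snd A')" unfolding eA eA' by (simp add: k_def)
        ultimately show ?thesis using trans[OF rg(1,4,3,6)] by (simp only: g_def snd_conv)
      qed
      then have "(g, h) : \<G>" using G gc hc by blast
      moreover have "index_act (g, h) (e, A) = (e', A')" proof -
        have "(e + (e' - e) mod 2) mod 2 = e'" using rg(4) by (auto simp: mod_simps)
        moreover have "h \<cdot> A \<cdot> inv\<^bsub>F20\<^esub> g = A'" unfolding h_def using rg gc by (simp add: F.m_assoc F.r_inv F.l_inv)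
        ultimately show ?thesis by (simp add: index_act_def g_def)
      qed
      ultimately show ?thesis using eA eA' by metis
    qed
  qed (use G r kI in blast)+
  moreover have "card {x \<in> indices. k x = i} = 5 * (\<Sum>e\<in>{0, 1}. \<Sum>a\<in>{0, 1, 2, 3}. if \<kappa> e a = i then 1 else 0)" for i
  proof -
    let ?f = "\<lambda>(n :: int, e :: int, a :: int). (e, (n, a))"
    let ?P = "{p \<in> {0, 1} \<times> {0, 1, 2, 3}. \<kappa> (fst p) (snd p) = i}"
    have r4: "{0..<4} = {0, 1, 2, 3 :: int}" by auto
    have "{x \<in> indices. k x = i} = ?f ` ({0..<5} \<times> ?P)" proof (intro equalityI subsetI)
      fix x assume "x : {x \<in> indices. k x = i}"
      then show "x : ?f ` ({0..<5} \<times> ?P)" by (intro image_eqI[of _ _ "(fst (snd x), fst x, snd (snd x))"])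
          (auto simp: indices_def carrier_F20 r4 k_def mem_Times_iff)
    next
      fix x assume "x : ?f ` ({0..<5} \<times> ?P)"
      then obtain n e a where "x = (e, (n, a))" "n : {0..<5}" "(e, a) : ?P" by (elim imageE) (auto simp: case_prod_beta)
      then show "x : {x \<in> indices. k x = i}" by (auto simp: indices_def carrier_F20 r4 k_def)
    qed
    moreover have "inj_on ?f A" for A by (auto simp: inj_on_def)
    moreover have "card ?P = (\<Sum>p\<in>{0, 1} \<times> {0, 1, 2, 3}. if \<kappa> (fst p) (snd p) = i then 1 else 0)"
      unfolding card_eq_sum by (rule sum.inter_filter) simp
    ultimately show ?thesis by (simp only: card_image card_cartesian_product sum.cartesian_product) (simp add: case_prod_beta)
  qed
  ultimately show ?thesis by simp
qed

lemma product_01_4: "{0, 1} \<times> {0..<4} = {(0,0),(0,1),(0,2),(0,3),(1,0),(1,1),(1,2),(1::int,3::int)}" by auto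

lemma orbit_type_full:
  assumes "!!g h. (g, h) : \<G> \<longleftrightarrow> g : \<A> \<and> h : \<A>"
  shows "orbit_type \<G> {#40#}"
proof -
  have "orbit_type \<G> (image_mset (\<lambda>i. 5 * (\<Sum>e\<in>{0, 1}. \<Sum>a\<in>{0, 1, 2, 3}. if (\<lambda>_ _. 0 :: nat) (e :: int) (a :: int) = i then 1 else 0)) (mset_set {0}))"
    by (rule orbit_type_exponents[where Q = "\<lambda>_ _. True"]) (use assms in \<open>simp_all add: product_01_4\<close>)
  then show ?thesis by simp
qed

lemma orbit_type_even:
  assumes "!!g h. (g, h) : \<G> \<longleftrightarrow> g : \<A> \<and> h : \<A> \<and> (even (snd g) \<longleftrightarrow> even (snd h))"
  shows "orbit_type \<G> (replicate_mset 2 20)"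
proof -
  have "orbit_type \<G> (image_mset (\<lambda>i. 5 * (\<Sum>e\<in>{0, 1}. \<Sum>a\<in>{0, 1, 2, 3}. if (\<lambda>_ a. nat (a mod 2)) (e :: int) (a :: int) = i then 1 else 0)) (mset_set {0, 1}))"
  proof (rule orbit_type_exponents[where Q = "\<lambda>i j. even i \<longleftrightarrow> even j"])
    show "nat ((j + a - i) mod 4 mod 2) = nat (a mod 2)" if "even i \<longleftrightarrow> even j" for i j a :: int
      by (rule arg_cong[of _ _ nat]) (use that in presburger)
    show "even ((e' - e) mod 2) \<longleftrightarrow> even ((a' + (e' - e) mod 2 - a) mod 4)" if "nat (a mod 2) = nat (a' mod 2)" for e e' a a' :: int
    proof -
      have "a mod 2 = a' mod 2" using that by simp
      then show ?thesis by presburger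
    qed
    show "{0, 1} = (\<lambda>(e :: int, a). nat (a mod 2)) ` ({0, 1} \<times> {0..<4})" unfolding product_01_4 by auto
  qed (use assms in auto)
  then show ?thesis by (simp add: numeral_2_eq_2)
qed

text \<open>Equal exponents leave the exponent of \<open>A\<close> unchanged while $e$ can be moved
  freely: four orbits of 10.\<close>

lemma orbit_type_diagonal:
  assumes "!!g h. (g, h) : \<G> \<longleftrightarrow> g : \<A> \<and> h : \<A> \<and> snd g = snd h"
  shows "orbit_type \<G> (replicate_mset 4 10)"
proof -
  have "orbit_type \<G> (image_mset (\<lambda>i. 5 * (\<Sum>e\<in>{0, 1}. \<Sum>a\<in>{0, 1, 2, 3}. if (\<lambda>_ a. nat a) (e :: int) (a :: int) = i then 1 else 0)) (mset_set {0, 1, 2, 3}))"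
  proof (rule orbit_type_exponents[where Q = "\<lambda>i j. i = j"])
    show "(e' - e) mod 2 = (a' + (e' - e) mod 2 - a) mod 4" if "nat a = nat a'" "a : {0..<4}" "a' : {0..<4}" for e e' a a' :: int proof -
      have "a = a'" using that by auto
      then show ?thesis by presburger
    qed
    show "{0, 1, 2, 3} = (\<lambda>(e :: int, a). nat a) ` ({0, 1} \<times> {0..<4})" unfolding product_01_4 by auto
  qed (use assms in auto)
  then show ?thesis by (simp add: eval_nat_numeral)
qed

text \<open>If $i + j = 0$ modulo 4, the exponent $a$ of \<open>A\<close> changes by $-2i$ and $e$
  by $i$ modulo 2, so $a + 2e$ modulo 4 is the invariant.\<close>

lemma orbit_type_antidiagonal:
  assumes "!!g h. (g, h) : \<G> \<longleftrightarrow> g : \<A> \<and> h : \<A> \<and> (snd g + snd h) mod 4 = 0"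
  shows "orbit_type \<G> (replicate_mset 4 10)"
proof -
  have "orbit_type \<G> (image_mset (\<lambda>i. 5 * (\<Sum>e\<in>{0, 1}. \<Sum>a\<in>{0, 1, 2, 3}. if (\<lambda>e a. nat ((a + 2 * e) mod 4)) (e :: int) (a :: int) = i then 1 else 0)) (mset_set {0, 1, 2, 3}))"
  proof (rule orbit_type_exponents[where Q = "\<lambda>i j. (i + j) mod 4 = 0"])
    have two: "2 * (d mod 2) = (2 * d) mod 4" for d :: int by (simp add: mult_mod_right)
    show "nat (((j + a - i) mod 4 + 2 * ((e + i) mod 2)) mod 4) = nat ((a + 2 * e) mod 4)" if ij: "(i + j) mod 4 = 0" for i j a e :: int proof -
      have "((j + a - i) mod 4 + 2 * ((e + i) mod 2)) mod 4 = ((i + j) + (a + 2 * e)) mod 4" unfolding two mod_add_eq by (simp add: algebra_simps)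
      also have "... = ((i + j) mod 4 + (a + 2 * e)) mod 4" by (rule mod_add_left_eq[symmetric])
      finally show ?thesis by (simp add: ij)
    qed
    show "((e' - e) mod 2 + (a' + (e' - e) mod 2 - a) mod 4) mod 4 = 0"
      if eq: "nat ((a + 2 * e) mod 4) = nat ((a' + 2 * e') mod 4)" for e e' a a' :: int proof -
      have "(a' + 2 * e') mod 4 = (a + 2 * e) mod 4" using eq by simp
      then have dvd: "4 dvd (a' + 2 * e') - (a + 2 * e)" by (simp only: mod_eq_dvd_iff)
      have "((e' - e) mod 2 + (a' + (e' - e) mod 2 - a) mod 4) mod 4 = (2 * ((e' - e) mod 2) + (a' - a)) mod 4"
        unfolding mod_add_right_eq by (simp add: algebra_simps)
      also have "... = ((a' + 2 * e') - (a + 2 * e)) mod 4" unfolding two mod_add_left_eq by (simp add: algebra_simps)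
      finally show ?thesis using dvd by simp
    qed
    show "{0, 1, 2, 3} = (\<lambda>(e :: int, a). nat ((a + 2 * e) mod 4)) ` ({0, 1} \<times> {0..<4})" unfolding product_01_4 by auto
  qed (use assms in auto)
  then show ?thesis by (simp add: eval_nat_numeral)
qed


text \<open>Up to the factor \<open>c\<close>, the action is conjugation; \<open>conj_class\<close> is 0, 4 or 5 on the
  translations and the rotation exponent otherwise.\<close>

definition conj_class :: "int \<times> (int \<times> int) => nat" where
  "conj_class = (\<lambda>(e, (m, l)). if l ~= 0 then nat l else if m = 0 then 0
     else if (m = 1 \<or> m = 4) = (e = 0) then 4 else 5)"

lemma conjugate_F20:
  assumes "g : \<A>" "B : \<A>"
  shows "g \<cdot> B \<cdot> inv\<^bsub>F20\<^esub> g = ((fst g + 2 ^ nat (snd g) * fst B - 2 ^ nat (snd B) * fst g) mod 5, snd B)"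
proof -
  let ?C = "((fst g + 2 ^ nat (snd g) * fst B - 2 ^ nat (snd B) * fst g) mod 5, snd B)"
  have C: "?C : \<A>" using fst_snd_F20[OF assms(2)] by (simp add: carrier_F20)
  have "g \<cdot> B = ?C \<cdot> g" by (simp add: mult_F20 mod_simps add.commute)
  then show ?thesis using C assms by (simp add: F.m_assoc F.r_inv)
qed

text \<open>After replacing \<open>A\<close> by $c^{-1} A$ the action is conjugation by
  \<open>g\<close>, with \<open>e\<close> shifted by the parity of \<open>g\<close>. The identity
  gives an orbit of length 2 and each nontrivial exponent one of length 10. The eight indices with a
  nontrivial translation split into two orbits of 4: odd elements exchange squares and nonsquares
  modulo 5 and change \<open>e\<close> at the same time.\<close>

lemma orbit_type_graph:
  assumes c: "c : \<A>"
    and G: "!!g h. (g, h) : \<G> \<longleftrightarrow> g : \<A> \<and> h : \<A> \<and> h \<cdot> c = c \<cdot> g"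
  shows "orbit_type \<G> (replicate_mset 3 10 + replicate_mset 2 4 + {#2#})"
proof -
  define tw where "tw x = (fst x, inv\<^bsub>F20\<^esub> c \<cdot> snd x)" for x :: "int \<times> (int \<times> int)"
  define \<kappa> where "\<kappa> x = conj_class (tw x)" for x
  define r :: "nat => int \<times> (int \<times> int)" where
    "r i = (0, c \<cdot> (if i = 0 then (0, 0) else if i = 4 then (1, 0) else if i = 5 then (2, 0) else (0, int i)))" for i
  have tw_act: "tw (index_act (g, h) (e, A)) = ((e + snd g) mod 2, g \<cdot> snd (tw (e, A)) \<cdot> inv\<^bsub>F20\<^esub> g)"
    if gh: "(g, h) : \<G>" and A: "A : \<A>" for g h e A proof -
    have g: "g : \<A>" "h : \<A>" "h \<cdot> c = c \<cdot> g" using gh G by blast+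
    have "inv\<^bsub>F20\<^esub> c \<cdot> h = g \<cdot> inv\<^bsub>F20\<^esub> c"
      using g c by (metis F.inv_closed F.inv_solve_left F.inv_solve_right F.m_assoc F.m_closed)
    then have "inv\<^bsub>F20\<^esub> c \<cdot> (h \<cdot> A \<cdot> inv\<^bsub>F20\<^esub> g) = g \<cdot> (inv\<^bsub>F20\<^esub> c \<cdot> A) \<cdot> inv\<^bsub>F20\<^esub> g"
      using g(1,2) A c by (metis F.inv_closed F.m_assoc F.m_closed)
    then show ?thesis by (simp add: tw_def index_act_def)
  qed
  have graph: "(g, c \<cdot> g \<cdot> inv\<^bsub>F20\<^esub> c) : \<G>" if "g : \<A>" for g unfolding G using that c by (simp add: F.m_assoc)
  have tw_c: "tw (e, c \<cdot> B) = (e, B)" if "B : \<A>" for e B using that c by (simp add: tw_def flip: F.m_assoc)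
  have tw_inj: "x = y" if "x : indices" "y : indices" "tw x = tw y" for x y using that c by (auto simp: tw_def indices_def prod_eq_iff[of x y])
  have cls: "conj_class ((e + snd g) mod 2, g \<cdot> B \<cdot> inv\<^bsub>F20\<^esub> g) = conj_class (e, B)"
    if g: "g : \<A>" and B: "B : \<A>" and e: "e : {0, 1}" for g B e proof (cases "snd B = 0")
    case True
    have "(fst g + 2 ^ nat (snd g) * fst B - 2 ^ nat (snd B) * fst g) mod 5 = (2 ^ nat (snd g) * fst B) mod 5" by (simp add: True)
    moreover have "fst B : {0, 1, 2, 3, 4}" using fst_snd_F20[OF B] by auto
    moreover have "snd g = 0 \<or> snd g = 1 \<or> snd g = 2 \<or> snd g = 3" using fst_snd_F20[OF g] range4_cases by blast
    moreover have "B = (fst B, 0)" using True by (simp add: prod_eq_iff)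
    ultimately show ?thesis using e unfolding conjugate_F20[OF g B] True by (elim insertE emptyE disjE) (simp_all add: conj_class_def)
  next
    case False
    then show ?thesis unfolding conjugate_F20[OF g B] by (cases B) (simp add: conj_class_def)
  qed
  have "orbit_type \<G> (image_mset (\<lambda>i. card {x \<in> indices. \<kappa> x = i}) (mset_set {0, 1, 2, 3, 4, 5}))"
  proof (rule orbit_type_fibres)
    show "g : \<A> \<and> h : \<A>" if "(g, h) : \<G>" for g h using that G by blast
    show "\<kappa> (index_act (g, h) x) = \<kappa> x" if gh: "(g, h) : \<G>" and x: "x : indices" for g h x proof -
      obtain e A where eA: "x = (e, A)" by (cases x)
      have "e : {0, 1}" "A : \<A>" using x by (auto simp: eA indices_def)
      moreover have "g : \<A>" using gh G by blast
      moreover have "snd (tw (e, A)) : \<A>" "tw (e, A) = (e, snd (tw (e, A)))" by (simp_all add: tw_def mult_F20_closed)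
      ultimately show ?thesis unfolding \<kappa>_def eA using tw_act[OF gh] cls by metis
    qed
    have B: "(if i = 0 then (0, 0) else if i = 4 then (1, 0) else if i = 5 then (2, 0) else (0, int i)) : \<A>"
      if "i : {0, 1, 2, 3, 4, 5}" for i :: nat using that by (auto simp: carrier_F20)
    show "r i : indices \<and> \<kappa> (r i) = i" if i: "i : {0, 1, 2, 3, 4, 5}" for i proof
      show "r i : indices" by (simp add: r_def indices_def mult_F20_closed)
      show "\<kappa> (r i) = i" unfolding \<kappa>_def r_def tw_c[OF B[OF i]] using i by (elim insertE emptyE) (simp_all add: conj_class_def)
    qed
    show "\<exists>\<gamma>\<in>\<G>. index_act \<gamma> (r i) = y" if y: "y : indices" and i: "i = \<kappa> y" for y i proof -
      obtain e m l where ty: "tw y = (e, (m, l))" by (metis prod.exhaust)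
      have e: "e : {0, 1}" using y ty by (auto simp: tw_def indices_def)
      have "snd (tw y) : \<A>" by (simp add: tw_def mult_F20_closed)
      then have ml: "m : {0..<5}" "l : {0..<4}" by (simp_all add: ty carrier_F20)
      have m: "m : {0, 1, 2, 3, 4}" using ml by auto
      note l = range4_cases[OF ml(2)]
      have i': "i = conj_class (e, (m, l))" using i by (simp add: \<kappa>_def ty)
      have iI: "i : {0, 1, 2, 3, 4, 5}" using l unfolding i' conj_class_def by (elim disjE) simp_all
      let ?B = "if i = 0 then (0 :: int, 0 :: int) else if i = 4 then (1, 0) else if i = 5 then (2, 0) else (0, int i)"
      \<comment> \<open>For translations a power of \<open>(0, 1)\<close> does it; for exponent
        \<open>l\<close> different from 0 one solves $(1 - 2^l) n = m$ modulo 5, which is possible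
        because $2^l$ is not 1, and takes \<open>(n, e)\<close>.\<close>
      have "\<exists>g\<in>\<A>. (snd g mod 2, ((fst g + 2 ^ nat (snd g) * fst ?B - 2 ^ nat (snd ?B) * fst g) mod 5, snd ?B)) = (e, (m, l))"
      proof (cases "l = 0")
        case True
        have *: "(0, j) : \<A>" if "j : {0, 1, 2, 3}" for j using that by (auto simp: carrier_F20)
        have "\<exists>j\<in>{0, 1, 2, 3}. (j mod 2, ((2 ^ nat j * fst ?B) mod 5, snd ?B)) = (e, (m, l))"
          using m e unfolding i' conj_class_def True by (elim insertE emptyE) simp_all
        then obtain j where j: "j : {0, 1, 2, 3}" "(j mod 2, ((2 ^ nat j * fst ?B) mod 5, snd ?B)) = (e, (m, l))" by (rule bexE)
        then show ?thesis by (intro bexI[OF _ *[OF j(1)]]) simp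
      next
        case False
        have *: "(n, e) : \<A>" if "n : {0, 1, 2, 3, 4}" for n using that e by (auto simp: carrier_F20)
        have B': "?B = (0, l)" using l False unfolding i' conj_class_def by (elim disjE) simp_all
        have "\<exists>n\<in>{0, 1, 2, 3, 4}. (n - 2 ^ nat l * n) mod 5 = m" using m l False by (elim insertE emptyE disjE) simp_all
        then obtain n where n: "n : {0, 1, 2, 3, 4}" "(n - 2 ^ nat l * n) mod 5 = m" by (rule bexE)
        have "e mod 2 = e" using e by auto
        then show ?thesis unfolding B' using n(2) by (intro bexI[OF _ *[OF n(1)]]) simp
      qed
      then obtain g where g: "g : \<A>"
        "(snd g mod 2, ((fst g + 2 ^ nat (snd g) * fst ?B - 2 ^ nat (snd ?B) * fst g) mod 5, snd ?B)) = (e, (m, l))" by (rule bexE)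
      let ?\<gamma> = "(g, c \<cdot> g \<cdot> inv\<^bsub>F20\<^esub> c)"
      have \<gamma>: "?\<gamma> : \<G>" by (rule graph[OF g(1)])
      have "tw (index_act ?\<gamma> (r i)) = tw y"
        unfolding r_def tw_act[OF \<gamma> mult_F20_closed] tw_c[OF B[OF iI]] snd_conv conjugate_F20[OF g(1) B[OF iI]] ty add_0_left by (rule g(2))
      moreover have "index_act ?\<gamma> (r i) : indices"
        using g(1) by (intro index_act_closed mult_F20_closed) (simp_all add: r_def indices_def mult_F20_closed)
      ultimately have "index_act ?\<gamma> (r i) = y" using tw_inj y by blast
      then show ?thesis using \<gamma> by blast
    qed
    show "\<kappa> x : {0, 1, 2, 3, 4, 5}" if "x : indices" for x proof -
      obtain e m l where tx: "tw x = (e, (m, l))" by (metis prod.exhaust)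
      have "snd (tw x) : \<A>" by (simp add: tw_def mult_F20_closed)
      then have "l : {0..<4}" by (simp_all add: tx carrier_F20)
      from range4_cases[OF this] show ?thesis unfolding \<kappa>_def tx conj_class_def by (elim disjE) simp_all
    qed
  qed simp
  moreover have "card {x \<in> indices. \<kappa> x = i} = card {x \<in> indices. conj_class x = i}" for i proof (rule bij_betw_same_card)
    show "bij_betw tw {x \<in> indices. \<kappa> x = i} {x \<in> indices. conj_class x = i}" unfolding bij_betw_def proof
      show "inj_on tw {x \<in> indices. \<kappa> x = i}" using tw_inj by (auto simp: inj_on_def)
      show "tw ` {x \<in> indices. \<kappa> x = i} = {x \<in> indices. conj_class x = i}" proof (intro equalityI subsetI)
        fix y assume "y : tw ` {x \<in> indices. \<kappa> x = i}"
        then obtain x where "x : indices" "\<kappa> x = i" "y = tw x" by blast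
        then show "y : {x \<in> indices. conj_class x = i}" by (simp add: \<kappa>_def) (simp add: tw_def indices_def mult_F20_closed mem_Times_iff)
      next
        fix y assume y: "y : {x \<in> indices. conj_class x = i}"
        then have "snd y : \<A>" "fst y : {0, 1}" by (auto simp: indices_def)
        moreover from this have "tw (fst y, c \<cdot> snd y) = y" using tw_c by simp
        ultimately show "y : tw ` {x \<in> indices. \<kappa> x = i}"
          using y by (intro image_eqI[of _ _ "(fst y, c \<cdot> snd y)"]) (simp_all add: \<kappa>_def indices_def mult_F20_closed)
      qed
    qed
  qed
  moreover have "card {x \<in> indices. conj_class x = l} = 10" if "l : {1, 2, 3}" for l proof -
    have "{x \<in> indices. conj_class x = l} = {0, 1} \<times> ({0..<5} \<times> {int l})"
      using that by (auto simp: indices_def carrier_F20 conj_class_def split: if_splits)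
    then show ?thesis by (simp add: card_cartesian_product)
  qed
  moreover have "card {x \<in> indices. conj_class x = 0} = 2" proof -
    have "{x \<in> indices. conj_class x = 0} = {0, 1} \<times> ({0} \<times> {0})"
      by (auto simp: indices_def carrier_F20 conj_class_def split: if_splits)
    then show ?thesis by (simp add: card_cartesian_product)
  qed
  moreover have "card {x \<in> indices. conj_class x = 4} = 4" proof -
    have "{x \<in> indices. conj_class x = 4} = {(0, (1, 0)), (0, (4, 0)), (1, (2, 0)), (1, (3, 0))}"
      by (auto simp: indices_def carrier_F20 conj_class_def split: if_splits)
    then show ?thesis by simp
  qed
  moreover have "card {x \<in> indices. conj_class x = 5} = 4" proof -
    have "{x \<in> indices. conj_class x = 5} = {(1, (1, 0)), (1, (4, 0)), (0, (2, 0)), (0, (3, 0))}"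
      by (auto simp: indices_def carrier_F20 conj_class_def split: if_splits)
    then show ?thesis by simp
  qed
  moreover have "replicate_mset 3 10 + replicate_mset 2 4 + {#2#} = {#2, 10, 10, 10, 4, 4 :: nat#}"
    by (rule multiset_eqI) (simp add: numeral_3_eq_3 numeral_2_eq_2)
  ultimately show ?thesis by simp
qed

section \<open>Identification of the groups\<close>

abbreviation pair_group :: "((int \<times> int) \<times> (int \<times> int)) set => ((int \<times> int) \<times> (int \<times> int)) monoid" where
  "pair_group \<G> \<equiv> (F20 \<times>\<times> F20)\<lparr>carrier := \<G>\<rparr>"

lemma pair_group_full:
  assumes "!!g h. (g, h) : \<G> \<longleftrightarrow> g : \<A> \<and> h : \<A>"
  shows "pair_group \<G> \<cong> SmallGroup_400_205"
proof -
  have "\<G> = \<A> \<times> \<A>" using assms by auto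
  then have "pair_group \<G> = SmallGroup_400_205" by (simp add: SmallGroup_400_205_def DirProd_def)
  then show ?thesis by (simp add: iso_refl)
qed

lemma pair_group_even:
  assumes "!!g h. (g, h) : \<G> \<longleftrightarrow> g : \<A> \<and> h : \<A> \<and> (even (snd g) \<longleftrightarrow> even (snd h))"
  shows "pair_group \<G> \<cong> SmallGroup_200_42"
proof -
  have "\<G> = {(g, h). g : \<A> \<and> h : \<A> \<and> (even (snd g) \<longleftrightarrow> even (snd h))}"
    by (rule Set.set_eqI, rename_tac x, case_tac x) (simp only: assms mem_Collect_eq prod.case)
  then have "pair_group \<G> = SmallGroup_200_42" by (simp add: SmallGroup_200_42_def)
  then show ?thesis by (simp add: iso_refl)
qed

lemma pair_group_diagonal:
  assumes G: "!!g h. (g, h) : \<G> \<longleftrightarrow> g : \<A> \<and> h : \<A> \<and> snd g = snd h"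
  shows "pair_group \<G> \<cong> SmallGroup_100_11"
proof -
  define f where "f = (\<lambda>(g :: int \<times> int, h :: int \<times> int). ((fst g, fst h), snd g))"
  have "f : iso (pair_group \<G>) SmallGroup_100_11" proof (rule isoI)
    show "f : hom (pair_group \<G>) SmallGroup_100_11" proof (rule homI)
      fix x y assume "x : carrier (pair_group \<G>)" "y : carrier (pair_group \<G>)"
      then show "f (x \<otimes>\<^bsub>pair_group \<G>\<^esub> y) = f x \<otimes>\<^bsub>SmallGroup_100_11\<^esub> f y"
        using G[of "fst x" "snd x"] by (cases x; cases y)
          (simp add: f_def SmallGroup_100_11_def semidirect_def mult_F20 DirProd_def mod_simps)
    qed (use G fst_snd_F20 in \<open>force simp: f_def SmallGroup_100_11_def semidirect_def DirProd_def carrier_integer_mod_group\<close>)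
    show "bij_betw f (carrier (pair_group \<G>)) (carrier SmallGroup_100_11)" unfolding bij_betw_def proof
      show "inj_on f (carrier (pair_group \<G>))" using G by (auto simp: inj_on_def f_def prod_eq_iff)
      show "f ` carrier (pair_group \<G>) = carrier SmallGroup_100_11" proof (intro equalityI subsetI)
        fix x assume "x : carrier SmallGroup_100_11"
        then show "x : f ` carrier (pair_group \<G>)" by (intro image_eqI[of _ _ "((fst (fst x), snd x), (snd (fst x), snd x))"])
            (auto simp: f_def SmallGroup_100_11_def semidirect_def DirProd_def carrier_integer_mod_group G carrier_F20)
      qed (use G fst_snd_F20 in \<open>force simp: f_def SmallGroup_100_11_def semidirect_def DirProd_def carrier_integer_mod_group\<close>)
    qed
  qed
  then show ?thesis unfolding is_iso_def by blast
qed

text \<open>The exponent of \<open>h\<close> is the negative of that of \<open>g\<close>, and 3 is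
  the inverse of 2 modulo 5, so \<open>h\<close> multiplies by a power of 3.\<close>

lemma pair_group_antidiagonal:
  assumes G: "!!g h. (g, h) : \<G> \<longleftrightarrow> g : \<A> \<and> h : \<A> \<and> (snd g + snd h) mod 4 = 0"
  shows "pair_group \<G> \<cong> SmallGroup_100_12"
proof -
  define f where "f = (\<lambda>(g :: int \<times> int, h :: int \<times> int). ((fst g, fst h), snd g))"
  have opp: "snd h = (- snd g) mod 4" if gh: "(g, h) : \<G>" for g h proof -
    have "(snd g + snd h) mod 4 = 0" "snd h : {0..<4}" using gh G fst_snd_F20 by blast+
    then show ?thesis by (simp, presburger)
  qed
  have pow: "(2 ^ nat (snd h) * k) mod 5 = (3 ^ nat (snd g) * k) mod (5 :: int)" if gh: "(g, h) : \<G>" for g h k proof -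
    have "snd g : {0..<4}" using gh G fst_snd_F20 by blast
    from range4_cases[OF this] have "(2 :: int) ^ nat (snd h) mod 5 = 3 ^ nat (snd g) mod 5" unfolding opp[OF gh] by (elim disjE) simp_all
    then show ?thesis by (metis mod_mult_left_eq)
  qed
  have "f : iso (pair_group \<G>) SmallGroup_100_12" proof (rule isoI)
    show "f : hom (pair_group \<G>) SmallGroup_100_12" proof (rule homI)
      fix x y assume xy: "x : carrier (pair_group \<G>)" "y : carrier (pair_group \<G>)"
      obtain g h g' h' where e: "x = (g, h)" "y = (g', h')" by (cases x; cases y) blast
      have gh: "(g, h) : \<G>" using xy e by simp
      have "(fst h + 2 ^ nat (snd h) * fst h') mod 5 = (fst h + (3 ^ nat (snd g) * fst h') mod 5) mod 5"
        using pow[OF gh, of "fst h'"] by (metis mod_add_right_eq)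
      then show "f (x \<otimes>\<^bsub>pair_group \<G>\<^esub> y) = f x \<otimes>\<^bsub>SmallGroup_100_12\<^esub> f y"
        by (simp add: e f_def SmallGroup_100_12_def semidirect_def mult_F20 DirProd_def mod_simps)
    qed (use G fst_snd_F20 in \<open>force simp: f_def SmallGroup_100_12_def semidirect_def DirProd_def carrier_integer_mod_group\<close>)
    show "bij_betw f (carrier (pair_group \<G>)) (carrier SmallGroup_100_12)" unfolding bij_betw_def proof
      show "inj_on f (carrier (pair_group \<G>))" proof (rule inj_onI)
        fix x y assume xy: "x : carrier (pair_group \<G>)" "y : carrier (pair_group \<G>)" "f x = f y"
        have "snd (snd x) = (- snd (fst x)) mod 4" "snd (snd y) = (- snd (fst y)) mod 4"
          using xy(1,2) opp[of "fst x" "snd x"] opp[of "fst y" "snd y"] by simp_all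
        then show "x = y" using xy(3) by (simp add: f_def case_prod_beta prod_eq_iff)
      qed
      show "f ` carrier (pair_group \<G>) = carrier SmallGroup_100_12" proof (intro equalityI subsetI)
        fix x assume "x : carrier SmallGroup_100_12"
        then show "x : f ` carrier (pair_group \<G>)" by (intro image_eqI[of _ _ "((fst (fst x), snd x), (snd (fst x), (- snd x) mod 4))"])
            (auto simp: f_def SmallGroup_100_12_def semidirect_def DirProd_def carrier_integer_mod_group G carrier_F20 mod_simps)
      qed (use G fst_snd_F20 in \<open>force simp: f_def SmallGroup_100_12_def semidirect_def DirProd_def carrier_integer_mod_group\<close>)
    qed
  qed
  then show ?thesis unfolding is_iso_def by blast
qed

lemma pair_group_graph:
  assumes c: "c : \<A>"
    and G: "!!g h. (g, h) : \<G> \<longleftrightarrow> g : \<A> \<and> h : \<A> \<and> h \<cdot> c = c \<cdot> g"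
  shows "pair_group \<G> \<cong> SmallGroup_20_3"
proof -
  have u: "h = h'" if "(g, h) : \<G>" "(g, h') : \<G>" for g h h' using that c F.r_cancel[of h c h'] unfolding G by simp
  have "fst : iso (pair_group \<G>) SmallGroup_20_3" proof (rule isoI)
    show "fst : hom (pair_group \<G>) SmallGroup_20_3" by (rule homI) (auto simp: SmallGroup_20_3_def DirProd_def G)
    show "bij_betw fst (carrier (pair_group \<G>)) (carrier SmallGroup_20_3)" unfolding bij_betw_def proof
      show "inj_on fst (carrier (pair_group \<G>))" proof (rule inj_onI)
        fix x y assume "x : carrier (pair_group \<G>)" "y : carrier (pair_group \<G>)" and eq: "fst x = fst y"
        then have "(fst x, snd x) : \<G>" "(fst x, snd y) : \<G>" unfolding eq by simp_all (simp flip: eq)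
        then have "snd x = snd y" by (rule u)
        then show "x = y" using eq by (simp only: prod_eq_iff)
      qed
      show "fst ` carrier (pair_group \<G>) = carrier SmallGroup_20_3" proof (intro equalityI subsetI)
        fix g assume "g : carrier SmallGroup_20_3"
        then have "(g, c \<cdot> g \<cdot> inv\<^bsub>F20\<^esub> c) : \<G>" unfolding G using c by (simp add: F.m_assoc SmallGroup_20_3_def)
        then show "g : fst ` carrier (pair_group \<G>)" by force
      next
        fix g assume "g : fst ` carrier (pair_group \<G>)"
        then obtain h where "(g, h) : \<G>" by auto
        then show "g : carrier SmallGroup_20_3" by (simp add: G SmallGroup_20_3_def)
      qed
    qed
  qed
  then show ?thesis unfolding is_iso_def by blast
qed


lemma iso_card: "G \<cong> H ==> card (carrier G) = card (carrier H)" unfolding is_iso_def iso_def using bij_betw_same_card by blast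

lemma card_SmallGroups:
  "card (carrier SmallGroup_400_205) = 400" "card (carrier SmallGroup_200_42) = 200"
  "card (carrier SmallGroup_100_11) = 100" "card (carrier SmallGroup_100_12) = 100"
  "card (carrier SmallGroup_20_3) = 20"
proof -
  show "card (carrier SmallGroup_200_42) = 200" proof -
    let ?P = "{p \<in> {0..<4 :: int} \<times> {0..<4 :: int}. even (fst p) \<longleftrightarrow> even (snd p)}"
    let ?f = "\<lambda>x :: (int \<times> int) \<times> (int \<times> int). ((fst (fst x), fst (snd x)), (snd (fst x), snd (snd x)))"
    have "bij_betw ?f (carrier SmallGroup_200_42) (({0..<5} \<times> {0..<5}) \<times> ?P)" by (rule bij_betwI[where g = ?f])
        (simp_all add: SmallGroup_200_42_def carrier_F20 mem_Times_iff case_prod_beta)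
    from bij_betw_same_card[OF this] have "card (carrier SmallGroup_200_42) = 25 * card ?P" by (simp add: card_cartesian_product)
    moreover have "card ?P = (\<Sum>p\<in>{0..<4 :: int} \<times> {0..<4 :: int}. if even (fst p) \<longleftrightarrow> even (snd p) then 1 else 0)"
      unfolding card_eq_sum by (rule sum.inter_filter) simp
    moreover have "... = (\<Sum>i\<in>{0..<4 :: int}. \<Sum>j\<in>{0..<4 :: int}. if even i \<longleftrightarrow> even j then 1 else (0 :: nat))"
      unfolding sum.cartesian_product by (simp add: case_prod_beta)
    moreover have "{0..<4} = {0, 1, 2, 3 :: int}" by auto
    ultimately show ?thesis by simp
  qed
qed (simp_all add: SmallGroup_400_205_def SmallGroup_100_11_def SmallGroup_100_12_def SmallGroup_20_3_def
    semidirect_def carrier_F20 carrier_integer_mod_group card_cartesian_product)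

text \<open>In the first group every subgroup of order 5 is normal; in the second one $(1,1)$ and its
  conjugate $(2,3)$ generate different subgroups.  The condition $n^6 = n$ avoids the unit.\<close>

lemma SmallGroup_100_not_iso: "\<not> SmallGroup_100_11 \<cong> SmallGroup_100_12"
proof
  let ?G = SmallGroup_100_11 and ?H = SmallGroup_100_12
  assume "?G \<cong> ?H"
  then obtain f where f: "f : hom ?G ?H" "bij_betw f (carrier ?G) (carrier ?H)" by (auto simp: is_iso_def iso_def)
  have mG: "x \<otimes>\<^bsub>?G\<^esub> y = (((fst (fst x) + 2 ^ nat (snd x) * fst (fst y)) mod 5, (snd (fst x) + 2 ^ nat (snd x) * snd (fst y)) mod 5), (snd x + snd y) mod 4)" for x y
    by (cases x; cases y) (simp add: SmallGroup_100_11_def semidirect_def DirProd_def case_prod_beta mod_simps)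
  have mH: "x \<otimes>\<^bsub>?H\<^esub> y = (((fst (fst x) + 2 ^ nat (snd x) * fst (fst y)) mod 5, (snd (fst x) + 3 ^ nat (snd x) * snd (fst y)) mod 5), (snd x + snd y) mod 4)" for x y
    by (cases x; cases y) (simp add: SmallGroup_100_12_def semidirect_def DirProd_def case_prod_beta mod_simps)
  have cG: "carrier ?G = ({0..<5} \<times> {0..<5}) \<times> {0..<4}" and cH: "carrier ?H = ({0..<5} \<times> {0..<5}) \<times> {0..<4}"
    by (simp_all add: SmallGroup_100_11_def SmallGroup_100_12_def semidirect_def carrier_integer_mod_group)
  have closed: "x \<otimes>\<^bsub>?G\<^esub> y : carrier ?G" for x y unfolding mG cG by simp
  obtain n where n: "n : carrier ?G" "f n = ((1, 1), 0)"
    using f(2) unfolding bij_betw_def cH by (metis (no_types, lifting) imageE atLeastLessThan_iff mem_Sigma_iff zero_le_one one_less_numeral_iff order_refl semiring_norm(76) semiring_norm(77) zero_less_numeral)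
  obtain g where g: "g : carrier ?G" "f g = ((0, 0), 1)"
    using f(2) unfolding bij_betw_def cH by (metis (no_types, lifting) imageE atLeastLessThan_iff mem_Sigma_iff zero_le_one one_less_numeral_iff order_refl semiring_norm(76) semiring_norm(77) zero_less_numeral)
  define n2 where "n2 = n \<otimes>\<^bsub>?G\<^esub> n"
  define n3 where "n3 = n2 \<otimes>\<^bsub>?G\<^esub> n"
  define n4 where "n4 = n3 \<otimes>\<^bsub>?G\<^esub> n"
  define n6 where "n6 = n4 \<otimes>\<^bsub>?G\<^esub> n2"
  have c: "n2 : carrier ?G" "n3 : carrier ?G" "n4 : carrier ?G" "n6 : carrier ?G" unfolding n2_def n3_def n4_def n6_def by (rule closed)+
  note hm = hom_mult[OF f(1)]
  have f2: "f n2 = ((2, 2), 0)" unfolding n2_def hm[OF n(1) n(1)] n(2) mH by simp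
  have f3: "f n3 = ((3, 3), 0)" unfolding n3_def hm[OF c(1) n(1)] n(2) f2 mH by simp
  have f4: "f n4 = ((4, 4), 0)" unfolding n4_def hm[OF c(2) n(1)] n(2) f3 mH by simp
  have f6: "f n6 = ((1, 1), 0)" unfolding n6_def hm[OF c(3) c(1)] f4 f2 mH by simp
  have "n6 = n" using f6 n f(2) c(4) by (metis bij_betw_def inj_onD)
  have sn: "snd n : {0..<4}" using n(1) by (auto simp: cG)
  have "(2 * snd n) mod 4 = snd n"
    using arg_cong[OF \<open>n6 = n\<close>, of snd] unfolding n6_def n4_def n3_def n2_def mG snd_conv by (simp add: mod_simps)
  then have s0: "snd n = 0" using range4_cases[OF sn] by (elim disjE) simp_all
  have r: "fst (fst n) : {0..<5}" "snd (fst n) : {0..<5}" using n(1) by (auto simp: cG)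
  have sg: "snd g : {0..<4}" using g(1) by (auto simp: cG)
  have "g \<otimes>\<^bsub>?G\<^esub> n = n \<otimes>\<^bsub>?G\<^esub> g \<or> g \<otimes>\<^bsub>?G\<^esub> n = n2 \<otimes>\<^bsub>?G\<^esub> g \<or> g \<otimes>\<^bsub>?G\<^esub> n = n3 \<otimes>\<^bsub>?G\<^esub> g \<or> g \<otimes>\<^bsub>?G\<^esub> n = n4 \<otimes>\<^bsub>?G\<^esub> g"
    using range4_cases[OF sg] proof (elim disjE)
    assume "snd g = 0"
    then show ?thesis by (intro disjI1) (simp add: mG s0 add.commute)
  next
    assume "snd g = 1"
    then have "g \<otimes>\<^bsub>?G\<^esub> n = n2 \<otimes>\<^bsub>?G\<^esub> g" by (simp add: n2_def mG s0 mod_simps algebra_simps)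
    then show ?thesis by blast
  next
    assume "snd g = 2"
    then have "g \<otimes>\<^bsub>?G\<^esub> n = n4 \<otimes>\<^bsub>?G\<^esub> g" by (simp add: n4_def n3_def n2_def mG s0 mod_simps algebra_simps)
    then show ?thesis by blast
  next
    assume g3: "snd g = 3"
    have L: "g \<otimes>\<^bsub>?G\<^esub> n = (((fst (fst g) + 8 * fst (fst n)) mod 5, (snd (fst g) + 8 * snd (fst n)) mod 5), 3)"
      by (simp add: mG s0 g3)
    have R: "n3 \<otimes>\<^bsub>?G\<^esub> g = (((fst (fst n) + fst (fst n) + fst (fst n) + fst (fst g)) mod 5,
        (snd (fst n) + snd (fst n) + snd (fst n) + snd (fst g)) mod 5), 3)" by (simp add: n3_def n2_def mG s0 g3 mod_simps)
    have "(a + 8 * x) mod 5 = (x + x + x + a) mod 5" for a x :: int by (simp add: mod_eq_dvd_iff)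
    then have "g \<otimes>\<^bsub>?G\<^esub> n = n3 \<otimes>\<^bsub>?G\<^esub> g" unfolding L R by simp
    then show ?thesis by blast
  qed
  then have "f g \<otimes>\<^bsub>?H\<^esub> f n = f n \<otimes>\<^bsub>?H\<^esub> f g \<or> f g \<otimes>\<^bsub>?H\<^esub> f n = f n2 \<otimes>\<^bsub>?H\<^esub> f g \<or> f g \<otimes>\<^bsub>?H\<^esub> f n = f n3 \<otimes>\<^bsub>?H\<^esub> f g \<or> f g \<otimes>\<^bsub>?H\<^esub> f n = f n4 \<otimes>\<^bsub>?H\<^esub> f g"
    using hm n(1) g(1) c by metis
  then show False unfolding n(2) g(2) f2 f3 f4 mH by simp
qed

section \<open>The forty roots and the compositum of two splitting fields\<close>

section \<open>The roots of the resolvent\<close>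

text \<open>The index \<open>(0, (0, 0))\<close> gives the invariant $P$ of the resolvent, and the
  forty indices describe its conjugates under $F_{20} \<times> F_{20}$; the stabilizer is a diagonal
  copy of $D_5$.\<close>

definition resolvent_root :: "'a::field => 'a => 'a => 'a => int \<times> (int \<times> int) => 'a" where
  "resolvent_root u v u' v' = (\<lambda>(e, A). \<Sum>k\<in>{0..<5}. ys u v e k * ys u' v' (e + snd A) (aff A k))"

lemma aff_range: "aff g k : {0..<5}" by (simp add: aff_def)

lemma bij_aff:
  assumes g: "g : \<A>" shows "bij_betw (aff g) {0..<5} {0..<5}"
proof (rule bij_betwI[where g = "aff (inv\<^bsub>F20\<^esub> g)"])
  have n: "snd g \<ge> 0" "snd (inv\<^bsub>F20\<^esub> g) \<ge> 0" using fst_snd_F20[OF g] fst_snd_F20[OF F.inv_closed[OF g]] by auto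
  show "aff (inv\<^bsub>F20\<^esub> g) (aff g k) = k" if "k : {0..<5}" for k using aff_mult[OF n(2,1), of k] g that by (simp add: aff_one)
  show "aff g (aff (inv\<^bsub>F20\<^esub> g) k) = k" if "k : {0..<5}" for k using aff_mult[OF n, of k] g that by (simp add: aff_one)
qed (simp_all add: aff_def)

lemma resolvent_root_act:
  assumes hom: "rhom \<phi>" and g: "g : \<A>" "acts_by \<phi> u v g" and h: "h : \<A>" "acts_by \<phi> u' v' h"
    and x: "x : indices"
  shows "\<phi> (resolvent_root u v u' v' x) = resolvent_root u v u' v' (index_act (g, h) x)"
proof -
  obtain e A where x': "x = (e, A)" by (cases x)
  have A: "A : \<A>" using x by (simp add: x' indices_def)
  define C where "C = h \<cdot> A \<cdot> inv\<^bsub>F20\<^esub> g"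
  have Cc: "C : \<A>" unfolding C_def by (rule mult_F20_closed)
  have Cg: "C \<cdot> g = h \<cdot> A" unfolding C_def using g h A by (simp add: F.m_assoc)
  have nn: "snd g \<ge> 0" "snd h \<ge> 0" "snd A \<ge> 0" "snd C \<ge> 0"
    using fst_snd_F20[OF g(1)] fst_snd_F20[OF h(1)] fst_snd_F20[OF A] fst_snd_F20[OF Cc] by auto
  have "(snd C + snd g) mod 4 = (snd h + snd A) mod 4" using arg_cong[OF Cg, of snd] by (simp add: snd_mult_F20)
  then have par: "even (snd C + snd g) \<longleftrightarrow> even (snd h + snd A)" by presburger
  have eg: "even ((e + snd g) mod 2) = even (e + snd g)" by presburger
  have "\<phi> (resolvent_root u v u' v' x) = (\<Sum>k\<in>{0..<5}. ys u v (e + snd g) (aff g k) * ys u' v' (e + snd A + snd h) (aff h (aff A k)))"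
    using g(2) h(2) by (simp add: resolvent_root_def x' rhom_sum[OF hom] rhom_mult[OF hom] acts_by_def)
  also have "... = (\<Sum>k\<in>{0..<5}. ys u v ((e + snd g) mod 2) (aff g k) * ys u' v' ((e + snd g) mod 2 + snd C) (aff C (aff g k)))"
  proof (rule sum.cong[OF refl])
    fix k
    have "aff h (aff A k) = aff C (aff g k)" using aff_mult[OF nn(2,3)] aff_mult[OF nn(4,1)] Cg by metis
    moreover have "ys u v (e + snd g) (aff g k) = ys u v ((e + snd g) mod 2) (aff g k)" by (rule ys_cong) (use eg in simp_all)
    moreover have "ys u' v' (e + snd A + snd h) l = ys u' v' ((e + snd g) mod 2 + snd C) l" for l by (rule ys_cong) (use par eg in auto)
    ultimately show "ys u v (e + snd g) (aff g k) * ys u' v' (e + snd A + snd h) (aff h (aff A k))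
      = ys u v ((e + snd g) mod 2) (aff g k) * ys u' v' ((e + snd g) mod 2 + snd C) (aff C (aff g k))" by simp
  qed
  also have "... = (\<Sum>k\<in>{0..<5}. ys u v ((e + snd g) mod 2) k * ys u' v' ((e + snd g) mod 2 + snd C) (aff C k))"
    by (rule sum.reindex_bij_betw[OF bij_aff[OF g(1)]])
  finally show ?thesis by (simp add: resolvent_root_def x' index_act_def C_def)
qed

section \<open>Pairs of quintics\<close>

locale quintic_pair = A: quintic_point b u v + B: quintic_point b' u' v'
  for b b' :: "'m::field \<times> 'm" and u v u' v'
begin

definition \<G> :: "((int \<times> int) \<times> (int \<times> int)) set" where
  "\<G> = (\<lambda>\<phi>. (A.code \<phi>, B.code \<phi>)) ` ac_auts"

abbreviation "L \<equiv> splitting_field (f_F20 b)"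
abbreviation "L' \<equiv> splitting_field (f_F20 b')"
abbreviation "N \<equiv> splitting_field (f_F20 b * f_F20 b')"

lemma mem_\<G>: "(g, h) : \<G> \<longleftrightarrow> (\<exists>\<phi>\<in>ac_auts. A.code \<phi> = g \<and> B.code \<phi> = h)"
  by (auto simp: \<G>_def)

lemma (in quintic_point) code_id: "code id = \<e>" by (rule code_eqI[OF ac_auts_id]) (simp_all add: one_F20 carrier_F20 acts_by_def aff_def ys_mod)

lemma (in quintic_point) code_inv:
  assumes \<phi>: "\<phi> : ac_auts" shows "code (inv_into UNIV \<phi>) = inv\<^bsub>F20\<^esub> code \<phi>"
proof -
  have "inv_into UNIV \<phi> \<circ> \<phi> = id" using ac_auts_bij[OF \<phi>] by (simp add: bij_is_inj)
  then have "code (inv_into UNIV \<phi>) \<cdot> code \<phi> = \<e>" using code_comp[OF ac_auts_inv[OF \<phi>] \<phi>] code_id by simp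
  then show ?thesis using code(1)[OF \<phi>] code(1)[OF ac_auts_inv[OF \<phi>]] by (simp add: F.inv_equality)
qed

sublocale sd: subdirect_F20 \<G>
proof
  show "g : \<A> \<and> h : \<A>" if "(g, h) : \<G>" for g h using that A.code(1) B.code(1) by (auto simp: mem_\<G>)
  show "(g \<cdot> g', h \<cdot> h') : \<G>" if "(g, h) : \<G>" "(g', h') : \<G>" for g h g' h'
    using that A.code_comp B.code_comp ac_auts_comp unfolding mem_\<G> by metis
  show "(inv\<^bsub>F20\<^esub> g, inv\<^bsub>F20\<^esub> h) : \<G>" if "(g, h) : \<G>" for g h
    using that A.code_inv B.code_inv ac_auts_inv unfolding mem_\<G> by metis
  show "\<exists>h. (g, h) : \<G>" if "g : \<A>" for g using that A.code_surj unfolding mem_\<G> by (metis imageE)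
  show "\<exists>g. (g, h) : \<G>" if "h : \<A>" for h using that B.code_surj unfolding mem_\<G> by (metis imageE)
qed

lemma N_eq: "N = generated (zs u v ` {0..<5} \<union> zs u' v' ` {0..<5})"
proof -
  have "{x. poly (map_poly to_ac (f_F20 b * f_F20 b')) x = 0} = zs u v ` {0..<5} \<union> zs u' v' ` {0..<5}"
    using A.roots_f B.roots_f by (auto simp: rhom_mult[OF rhom_map_poly[OF rhom_to_ac]])
  then show ?thesis by (simp add: splitting_field_eq)
qed

lemma L_subset_N: "L \<subseteq> N" "L' \<subseteq> N" unfolding N_eq A.splitting_field_f B.splitting_field_f
  using subset_generated[of "zs u v ` {0..<5} \<union> zs u' v' ` {0..<5}"] by (intro generated_mono; simp)+

lemma galois_N: "galois_field N" unfolding galois_field_def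
proof (intro conjI ballI impI)
  show "intermediate N" unfolding N_eq by (rule intermediate_generated)
  show "\<phi> z : N" if "\<phi> : ac_auts" "z : N" for \<phi> z using that by (rule ac_auts_splitting_field)
  have "fixed_is_base N" unfolding N_eq by (rule fixed_is_base_generated) (auto intro: A.zs_separable B.zs_separable)
  then show "z : range to_ac" if "z : N" "\<forall>\<phi>\<in>ac_auts. \<phi> z = z" for z using that by (simp add: fixed_is_base_def)
qed

lemma intermediate_N: "intermediate N" and intermediate_L: "intermediate L" "intermediate L'"
  using galois_N A.galois_splitting_field B.galois_splitting_field by (auto simp: galois_field_def)

lemma agree_on_N:
  assumes \<phi>: "\<phi> : ac_auts" and \<psi>: "\<psi> : ac_auts"
  shows "(A.code \<phi>, B.code \<phi>) = (A.code \<psi>, B.code \<psi>) \<longleftrightarrow> (\<forall>z\<in>N. \<phi> z = \<psi> z)"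
proof
  assume eq: "(A.code \<phi>, B.code \<phi>) = (A.code \<psi>, B.code \<psi>)"
  show "\<forall>z\<in>N. \<phi> z = \<psi> z" unfolding N_eq proof (rule ballI, erule ac_auts_eq_on_generated[OF \<phi> \<psi>, rotated])
    fix x assume "x : zs u v ` {0..<5} \<union> zs u' v' ` {0..<5}"
    then show "\<phi> x = \<psi> x" using A.code_zs[OF \<phi>] A.code_zs[OF \<psi>] B.code_zs[OF \<phi>] B.code_zs[OF \<psi>] eq by auto
  qed
next
  assume "\<forall>z\<in>N. \<phi> z = \<psi> z"
  then show "(A.code \<phi>, B.code \<phi>) = (A.code \<psi>, B.code \<psi>)"
    using A.code_eq_iff[OF \<phi> \<psi>] B.code_eq_iff[OF \<phi> \<psi>] L_subset_N by auto
qed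

lemma Gal_product: "Gal (f_F20 b * f_F20 b') \<cong> pair_group \<G>"
  unfolding \<G>_def using A.code_comp B.code_comp agree_on_N by (intro Gal_iso) (simp_all add: DirProd_def)

text \<open>The Galois correspondence for \<open>L\<close> inside \<open>N\<close>: an element fixed
  by the stabilizer of a primitive element of \<open>L\<close> is a polynomial in that primitive
  element.\<close>

lemma mem_L_iff:
  assumes z: "z : N"
  shows "z : L \<longleftrightarrow> (\<forall>\<phi>\<in>ac_auts. A.code \<phi> = \<e> --> \<phi> z = z)"
proof
  assume "z : L"
  then show "\<forall>\<phi>\<in>ac_auts. A.code \<phi> = \<e> --> \<phi> z = z" using A.code_eq_iff[OF _ ac_auts_id] A.code_id by simp
next
  assume fixed: "\<forall>\<phi>\<in>ac_auts. A.code \<phi> = \<e> --> \<phi> z = z"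
  obtain \<theta> where \<theta>: "\<theta> : L" "\<forall>\<phi>\<in>ac_auts. \<phi> \<theta> = \<theta> \<longleftrightarrow> A.code \<phi> = \<e>" using A.primitive by (rule bexE)
  have "\<theta> : N" using \<theta>(1) L_subset_N by blast
  from stabilizer_imp_polynomial[OF galois_N this z] obtain h where "z = poly (map_poly to_ac h) \<theta>" using fixed \<theta>(2) by metis
  then show "z : L" using polys_over_poly[OF intermediate_L(1) polys_over_base[OF intermediate_L(1)] \<theta>(1)] by simp
qed

lemma swap: "quintic_pair b' b u' v' u v" by unfold_locales

lemma N_swap: "splitting_field (f_F20 b' * f_F20 b) = N" by (simp add: mult.commute)

lemma mem_L'_iff:
  assumes z: "z : N"
  shows "z : L' \<longleftrightarrow> (\<forall>\<phi>\<in>ac_auts. B.code \<phi> = \<e> --> \<phi> z = z)"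
proof -
  interpret sw: quintic_pair b' b u' v' u v by (rule swap)
  show ?thesis using sw.mem_L_iff[of z] z by (simp add: N_swap)
qed

text \<open>Given \<phi>, fullness provides an automorphism that agrees with \<phi> on
  \<open>L\<close> and is trivial on \<open>L'\<close>; so \<phi> fixes the intersection.\<close>

lemma intersection_base:
  assumes full: "!!g h. (g, h) : \<G> \<longleftrightarrow> g : \<A> \<and> h : \<A>"
  shows "L \<inter> L' = range to_ac"
proof
  show "range to_ac \<subseteq> L \<inter> L'" using intermediate_base[OF intermediate_L(1)] intermediate_base[OF intermediate_L(2)] by auto
  show "L \<inter> L' \<subseteq> range to_ac" proof
    fix z assume z: "z : L \<inter> L'"
    then have zN: "z : N" using L_subset_N by blast
    have "\<phi> z = z" if \<phi>: "\<phi> : ac_auts" for \<phi> proof -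
      obtain \<psi> where \<psi>: "\<psi> : ac_auts" "A.code \<psi> = A.code \<phi>" "B.code \<psi> = \<e>"
        using full[of "A.code \<phi>" "\<e>"] A.code(1)[OF \<phi>] F.one_closed unfolding mem_\<G> by blast
      have "\<phi> z = \<psi> z" using A.code_eq_iff[OF \<phi> \<psi>(1)] \<psi>(2) z by auto
      also have "... = z" using mem_L'_iff[OF zN] \<psi> z by blast
      finally show ?thesis .
    qed
    then show "z : range to_ac" using galois_N zN by (simp add: galois_field_def)
  qed
qed

lemma intersection_all:
  assumes "!!g h. (g, h) : \<G> ==> g = \<e> \<longleftrightarrow> h = \<e>"
  shows "L = L'"
proof -
  have "A.code \<phi> = \<e> \<longleftrightarrow> B.code \<phi> = \<e>" if "\<phi> : ac_auts" for \<phi> using assms that unfolding mem_\<G> by blast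
  then have "z : L \<longleftrightarrow> z : L'" if "z : N" for z using mem_L_iff[OF that] mem_L'_iff[OF that] by blast
  then show ?thesis using L_subset_N by blast
qed

text \<open>The hypothesis on \<kappa> says that it labels the cosets of a subgroup of $C_4$. By
  \<open>G1\<close> the automorphisms with label \<open>\<kappa> 0\<close> are those agreeing on
  \<open>L\<close> with one that is trivial on \<open>L'\<close>; they form the group
  \<open>H\<close> of the intersection, whose index is the number of labels. An element \<eta> with
  stabilizer \<open>H\<close> generates the intersection.\<close>

lemma intersection_degree:
  fixes \<kappa> :: "int => int"
  assumes \<kappa>: "!!i j. i : {0..<4} ==> j : {0..<4} ==> \<kappa> ((i + j) mod 4) = \<kappa> j \<longleftrightarrow> \<kappa> i = \<kappa> 0"
    and G1: "!!g. (g, \<e>) : \<G> \<longleftrightarrow> g : \<A> \<and> \<kappa> (snd g) = \<kappa> 0"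
  shows "extension_degree (card (\<kappa> ` {0..<4})) (L \<inter> L')"
proof -
  let ?s = "\<lambda>\<phi>. snd (A.code \<phi>)"
  have s: "?s \<phi> : {0..<4}" if "\<phi> : ac_auts" for \<phi> using fst_snd_F20[OF A.code(1)[OF that]] by blast
  define H where "H = {\<phi> \<in> ac_auts. \<kappa> (?s \<phi>) = \<kappa> 0}"
  have fin: "finite ((\<lambda>\<phi>. restrict \<phi> N) ` ac_auts)" proof -
    define R where "R g = restrict (SOME \<phi>. \<phi> : ac_auts \<and> (A.code \<phi>, B.code \<phi>) = g) N" for g
    have "restrict \<phi> N = R (A.code \<phi>, B.code \<phi>)" if \<phi>: "\<phi> : ac_auts" for \<phi> proof -
      define \<psi> where "\<psi> = (SOME \<psi>. \<psi> : ac_auts \<and> (A.code \<psi>, B.code \<psi>) = (A.code \<phi>, B.code \<phi>))"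
      have "\<psi> : ac_auts \<and> (A.code \<psi>, B.code \<psi>) = (A.code \<phi>, B.code \<phi>)"
        unfolding \<psi>_def by (rule someI[of _ \<phi>]) (use \<phi> in simp)
      then have "restrict \<phi> N = restrict \<psi> N" using agree_on_N[OF \<phi>, of \<psi>] by (intro restrict_ext) auto
      then show ?thesis by (simp add: R_def \<psi>_def)
    qed
    then have "(\<lambda>\<phi>. restrict \<phi> N) ` ac_auts \<subseteq> R ` \<G>" by (auto simp: \<G>_def)
    moreover have "finite \<G>" using sd.sub by (intro finite_subset[of \<G> "\<A> \<times> \<A>"]) (auto simp: carrier_F20)
    ultimately show ?thesis by (meson finite_imageI finite_subset)
  qed
  obtain \<theta> where \<theta>: "\<theta> : N" "\<forall>\<phi>\<in>ac_auts. \<phi> \<theta> = \<theta> --> (\<forall>z\<in>N. \<phi> z = z)"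
    using primitive_element[OF A.inf intermediate_N fin] by (rule bexE)
  have "\<exists>\<eta>\<in>N. \<forall>\<phi>\<in>ac_auts. \<phi> \<eta> = \<eta> \<longleftrightarrow> \<phi> : H"
  proof (rule exists_element_with_stabilizer[OF A.inf intermediate_N _ \<theta>(1)])
    show "\<phi> z : N" if "\<phi> : ac_auts" "z : N" for \<phi> z using that by (rule ac_auts_splitting_field)
    show "H \<subseteq> ac_auts" by (auto simp: H_def)
    show "\<phi> \<circ> \<psi> : H" if "\<phi> : H" "\<psi> : H" for \<phi> \<psi>
      using that \<kappa>[OF s s, of \<phi> \<psi>] by (simp add: H_def ac_auts_comp A.code_comp snd_mult_F20)
    show "\<phi> : H" if \<phi>: "\<phi> : ac_auts" "\<phi> \<theta> = \<theta>" for \<phi> proof -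
      have "A.code \<phi> = A.code id" using agree_on_N[OF \<phi>(1) ac_auts_id] \<theta>(2) \<phi> by auto
      then show ?thesis using \<phi>(1) by (simp add: H_def A.code_id one_F20)
    qed
  qed
  then obtain \<eta> where \<eta>: "\<eta> : N" and stab: "\<forall>\<phi>\<in>ac_auts. \<phi> \<eta> = \<eta> \<longleftrightarrow> \<phi> : H" by (rule bexE)
  have fix_both: "\<phi> z = z" if z: "z : L \<inter> L'" and \<phi>: "\<phi> : H" for z \<phi> proof -
    have \<phi>a: "\<phi> : ac_auts" "\<kappa> (?s \<phi>) = \<kappa> 0" using \<phi> by (auto simp: H_def)
    have "(A.code \<phi>, \<e>) : \<G>" using G1 A.code(1)[OF \<phi>a(1)] \<phi>a(2) by blast
    then obtain \<psi> where \<psi>: "\<psi> : ac_auts" "A.code \<psi> = A.code \<phi>" "B.code \<psi> = \<e>" unfolding mem_\<G> by blast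
    have "\<phi> z = \<psi> z" using A.code_eq_iff[OF \<phi>a(1) \<psi>(1)] \<psi>(2) z by auto
    also have "... = z" using mem_L'_iff[of z] \<psi> z L_subset_N by blast
    finally show ?thesis .
  qed
  have \<eta>LL: "\<eta> : L \<inter> L'" proof
    have "\<phi> : H" if "\<phi> : ac_auts" "A.code \<phi> = \<e>" for \<phi> using that by (simp add: H_def one_F20)
    then show "\<eta> : L" using mem_L_iff[OF \<eta>] stab by blast
    have "\<phi> : H" if "\<phi> : ac_auts" "B.code \<phi> = \<e>" for \<phi>
      using that G1[of "A.code \<phi>"] unfolding mem_\<G> by (auto simp: H_def)
    then show "\<eta> : L'" using mem_L'_iff[OF \<eta>] stab by blast
  qed
  have same: "\<phi> \<eta> = \<psi> \<eta> \<longleftrightarrow> \<kappa> (?s \<phi>) = \<kappa> (?s \<psi>)" if \<phi>: "\<phi> : ac_auts" and \<psi>: "\<psi> : ac_auts" for \<phi> \<psi>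
  proof -
    note bij = ac_auts_bij[OF \<psi>]
    let ?\<chi> = "inv_into UNIV \<psi> \<circ> \<phi>"
    have \<chi>: "?\<chi> : ac_auts" by (intro ac_auts_comp ac_auts_inv \<phi> \<psi>)
    have "\<psi> \<circ> ?\<chi> = \<phi>" using surj_f_inv_f[OF bij_is_surj[OF bij]] by (simp add: fun_eq_iff)
    then have "?s \<phi> = (?s \<psi> + ?s ?\<chi>) mod 4" using A.code_comp[OF \<psi> \<chi>] by (metis snd_mult_F20)
    then have "?s \<phi> = (?s ?\<chi> + ?s \<psi>) mod 4" by (simp add: add.commute)
    then have "\<kappa> (?s \<phi>) = \<kappa> (?s \<psi>) \<longleftrightarrow> ?\<chi> : H" using \<kappa>[OF s[OF \<chi>] s[OF \<psi>]] \<chi> by (simp add: H_def)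
    also have "... \<longleftrightarrow> ?\<chi> \<eta> = \<eta>" using stab \<chi> by blast
    also have "... \<longleftrightarrow> \<phi> \<eta> = \<psi> \<eta>"
      using inv_f_f[OF bij_is_inj[OF bij]] surj_f_inv_f[OF bij_is_surj[OF bij]] by (metis comp_apply)
    finally show ?thesis by blast
  qed
  have card: "card (\<kappa> ` {0..<4}) = card (ac_orbit \<eta>)" proof -
    have sS: "?s ` ac_auts = {0..<4}" proof (intro equalityI subsetI)
      fix i :: int assume "i : {0..<4}"
      then have "(0, i) : A.code ` ac_auts" unfolding A.code_surj by (simp add: carrier_F20)
      then obtain \<phi> where "\<phi> : ac_auts" "A.code \<phi> = (0, i)" by (metis imageE)
      then show "i : ?s ` ac_auts" by (intro image_eqI[of _ _ \<phi>]) simp_all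
    qed (use s in auto)
    define F where "F a = \<kappa> (?s (SOME \<phi>. \<phi> : ac_auts \<and> \<phi> \<eta> = a))" for a
    have F: "F (\<phi> \<eta>) = \<kappa> (?s \<phi>)" if \<phi>: "\<phi> : ac_auts" for \<phi> proof -
      define \<psi> where "\<psi> = (SOME \<psi>. \<psi> : ac_auts \<and> \<psi> \<eta> = \<phi> \<eta>)"
      have "\<psi> : ac_auts \<and> \<psi> \<eta> = \<phi> \<eta>" unfolding \<psi>_def by (rule someI[of _ \<phi>]) (use \<phi> in simp)
      then show ?thesis using same[OF \<phi>, of \<psi>] by (simp add: F_def \<psi>_def[symmetric])
    qed
    have "bij_betw F (ac_orbit \<eta>) (\<kappa> ` {0..<4})" unfolding bij_betw_def proof
      show "inj_on F (ac_orbit \<eta>)" by (rule inj_onI) (auto simp: ac_orbit_def F same)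
      show "F ` ac_orbit \<eta> = \<kappa> ` {0..<4}" unfolding sS[symmetric] ac_orbit_def by (auto simp: F image_iff) (metis F)
    qed
    then show ?thesis by (simp add: bij_betw_same_card)
  qed
  show ?thesis proof (rule extension_degree_orbit[OF card])
    show "poly (map_poly to_ac h) \<eta> : L \<inter> L'" for h
      using \<eta>LL polys_over_poly[OF intermediate_L(1) polys_over_base[OF intermediate_L(1)]]
        polys_over_poly[OF intermediate_L(2) polys_over_base[OF intermediate_L(2)]] by blast
    show "\<exists>h. z = poly (map_poly to_ac h) \<eta> \<and> degree h < card (\<kappa> ` {0..<4})" if z: "z : L \<inter> L'" for z proof -
      have zN: "z : N" using z L_subset_N by blast
      have st: "\<phi> z = z" if "\<phi> : ac_auts" "\<phi> \<eta> = \<eta>" for \<phi> using fix_both[OF z] stab that by blast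
      show ?thesis proof (rule stabilizer_imp_polynomial[OF galois_N \<eta> zN])
        show "\<phi> z = z" if "\<phi> : ac_auts" "\<phi> \<eta> = \<eta>" for \<phi> using st[OF that] .
      next
        fix h assume h: "z = poly (map_poly to_ac h) \<eta>" "degree h < card {\<phi> \<eta> |\<phi>. \<phi> : ac_auts}"
        have "card {\<phi> \<eta> |\<phi>. \<phi> : ac_auts} = card (\<kappa> ` {0..<4})" using card by (simp add: ac_orbit_def Setcompr_eq_image)
        then show ?thesis using h by metis
      qed
    qed
  qed
qed

abbreviation "rr \<equiv> resolvent_root u v u' v'"

lemma rr_in_N: "rr x : N"
proof -
  obtain e A where "x = (e, A)" by (cases x)
  then show ?thesis using A.ys_in_splitting_field B.ys_in_splitting_field L_subset_N unfolding resolvent_root_def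
    by (simp only: prod.case) (intro intermediate_sum[OF intermediate_N] intermediate_mult[OF intermediate_N]; blast)
qed

lemma rr_act: "\<phi> : ac_auts ==> x : indices ==> \<phi> (rr x) = rr (index_act (A.code \<phi>, B.code \<phi>) x)"
  by (intro resolvent_root_act ac_auts_rhom A.code B.code)

lemma orbit_rr: "x : indices ==> ac_orbit (rr x) = rr ` (\<lambda>\<gamma>. index_act \<gamma> x) ` \<G>"
  unfolding ac_orbit_def \<G>_def using rr_act by (auto simp: image_image image_iff)

lemma orbit_polynomial_dvd:
  assumes g: "map_poly to_ac g = (\<Prod>a\<in>ac_orbit x. [:- a, 1:])" "degree g = card (ac_orbit x)"
    and p: "poly (map_poly to_ac p) x = 0"
  shows "g dvd p"
proof -
  note hom = rhom_map_poly[OF rhom_to_ac]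
  have "x : ac_orbit x" unfolding ac_orbit_def by (intro CollectI exI[of _ id]) (simp add: ac_auts_id)
  then have gx: "poly (map_poly to_ac g) x = 0" unfolding g(1) poly_prod using finite_ac_orbit by (intro prod_zero) auto
  define r where "r = p mod g"
  have "p = p div g * g + r" by (simp add: r_def)
  then have "map_poly to_ac p = map_poly to_ac (p div g) * map_poly to_ac g + map_poly to_ac r" by (metis rhom_add[OF hom] rhom_mult[OF hom])
  then have rx: "poly (map_poly to_ac r) x = 0" using p gx by simp
  have "r = 0" proof (rule ccontr)
    assume r0: "r ~= 0"
    then have m: "map_poly to_ac r ~= 0" using map_poly_to_ac_eq_iff[of r 0] by simp
    have "(\<Prod>a\<in>ac_orbit x. [:- a, 1:]) ~= 0" using finite_ac_orbit[of x] by (simp add: prod_zero_iff)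
    then have g0: "g ~= 0" using g(1) by auto
    have "ac_orbit x \<subseteq> {y. poly (map_poly to_ac r) y = 0}" using ac_auts_root rx by (auto simp: ac_orbit_def)
    then have "degree g \<le> card {y. poly (map_poly to_ac r) y = 0}" unfolding g(2) by (rule card_mono[OF poly_roots_finite[OF m]])
    also have "... \<le> degree (map_poly to_ac r)" by (rule card_poly_roots_bound[OF m])
    also have "... = degree r" by (rule degree_map_poly) simp
    also have "... < degree g" unfolding r_def using r0 g0 degree_mod_less[of g p] by (simp add: r_def)
    finally show False by simp
  qed
  then show ?thesis by (simp add: r_def mod_eq_0_iff_dvd)
qed

text \<open>Squarefree over \<open>M\<close> could still allow multiple roots in the closure through
  inseparability. Here the roots lie in the Galois field \<open>N\<close>, so each has an
  irreducible orbit polynomial with simple roots, and a double root of \<open>H\<close> makes its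
  square divide \<open>H\<close>.\<close>

lemma squarefree_imp_inj:
  assumes H: "map_poly to_ac H = (\<Prod>x\<in>indices. [:- rr x, 1:])" and sf: "squarefree H"
  shows "inj_on rr indices"
proof (rule inj_onI, rule ccontr)
  fix x y assume xy: "x : indices" "y : indices" "rr x = rr y" "x ~= y"
  note hom = rhom_map_poly[OF rhom_to_ac]
  define a where "a = rr x"
  obtain g where g: "map_poly to_ac g = (\<Prod>a\<in>ac_orbit a. [:- a, 1:])" "irreducible g" "degree g = card (ac_orbit a)"
    using irreducible_orbit_polynomial[OF galois_N rr_in_N] unfolding a_def by metis
  have "(\<Prod>x\<in>indices. [:- rr x, 1:]) = [:- rr x, 1:] * ([:- rr y, 1:] * (\<Prod>x\<in>indices - {x} - {y}. [:- rr x, 1:]))"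
    using xy finite_indices by (simp add: prod.remove[of indices x] prod.remove[of "indices - {x}" y])
  then have H2: "map_poly to_ac H = [:- a, 1:] * ([:- a, 1:] * (\<Prod>x\<in>indices - {x} - {y}. [:- rr x, 1:]))"
    unfolding H a_def xy(3)[symmetric] .
  have Ha: "poly (map_poly to_ac H) a = 0" "poly (pderiv (map_poly to_ac H)) a = 0"
    unfolding H2 by (simp_all only: pderiv_mult poly_mult poly_add) (simp_all add: pderiv_pCons)
  obtain k where k: "H = g * k" using orbit_polynomial_dvd[OF g(1,3) Ha(1)] by (rule dvdE)
  have aO: "a : ac_orbit a" unfolding ac_orbit_def by (intro CollectI exI[of _ id]) (simp add: ac_auts_id)
  define q where "q = (\<Prod>c\<in>ac_orbit a - {a}. [:- c, 1:])"
  have gq: "map_poly to_ac g = [:- a, 1:] * q" unfolding g(1) q_def by (rule prod.remove[OF finite_ac_orbit aO])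
  have "poly q a ~= 0" using finite_ac_orbit[of a] by (simp add: q_def poly_prod prod_zero_iff)
  moreover have "poly (pderiv (map_poly to_ac H)) a = poly q a * poly (map_poly to_ac k) a"
    unfolding k rhom_mult[OF hom] gq by (simp only: pderiv_mult poly_mult poly_add) (simp add: pderiv_pCons)
  ultimately have "poly (map_poly to_ac k) a = 0" using Ha(2) by simp
  then have "g dvd k" by (rule orbit_polynomial_dvd[OF g(1,3)])
  then have "g\<^sup>2 dvd H" unfolding k power2_eq_square by (rule mult_dvd_mono[OF dvd_refl])
  then have "g dvd 1" using sf by (simp add: squarefree_def)
  then show False using g(2) by (simp add: irreducible_def)
qed

lemma inj_imp_squarefree:
  assumes H: "map_poly to_ac H = (\<Prod>x\<in>indices. [:- rr x, 1:])" and inj: "inj_on rr indices"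
  shows "squarefree H" unfolding squarefree_def
proof (intro allI impI)
  fix p assume "p\<^sup>2 dvd H"
  then obtain k where k: "H = p\<^sup>2 * k" by (rule dvdE)
  note hom = rhom_map_poly[OF rhom_to_ac]
  have H0: "map_poly to_ac H ~= 0" unfolding H using finite_indices by simp
  then have p0: "p ~= 0" using k by auto
  have "degree p = 0" proof (rule ccontr)
    assume "degree p ~= 0"
    then have "degree (map_poly to_ac p) > 0" by (subst degree_map_poly) simp_all
    then obtain a where a: "poly (map_poly to_ac p) a = 0" using alg_closed_imp_poly_has_root by blast
    have Hp: "map_poly to_ac H = map_poly to_ac p * (map_poly to_ac p * map_poly to_ac k)"
      unfolding k by (simp add: rhom_mult[OF hom] rhom_power[OF hom] power2_eq_square mult.assoc)
    have Ha: "poly (map_poly to_ac H) a = 0" "poly (pderiv (map_poly to_ac H)) a = 0" unfolding Hp by (simp_all add: pderiv_mult a)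
    obtain x where x: "x : indices" "a = rr x" using Ha(1) unfolding H poly_prod using finite_indices by auto
    define q where "q = (\<Prod>y\<in>indices - {x}. [:- rr y, 1:])"
    have "map_poly to_ac H = [:- a, 1:] * q" unfolding H q_def x(2) by (rule prod.remove[OF finite_indices x(1)])
    then have "poly (pderiv (map_poly to_ac H)) a = poly q a" by (simp only: pderiv_mult poly_mult poly_add) (simp add: pderiv_pCons)
    moreover have "poly q a ~= 0" using inj x finite_indices by (auto simp: q_def poly_prod inj_on_def)
    ultimately show False using Ha(2) by simp
  qed
  then show "p dvd 1" using p0 by (simp add: is_unit_iff_degree)
qed

lemma factor_degrees_pair:
  assumes H: "map_poly to_ac H = (\<Prod>x\<in>indices. [:- rr x, 1:])" and sf: "squarefree H" and D: "orbit_type \<G> D"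
  shows "factor_degrees H D"
proof -
  have inj: "inj_on rr indices" by (rule squarefree_imp_inj[OF H sf])
  from D[unfolded orbit_type_def] obtain I :: "nat set" and x where *: "finite I \<and> (\<forall>i\<in>I. x i : indices) \<and>
     indices = (\<Union>i\<in>I. (\<lambda>\<gamma>. index_act \<gamma> (x i)) ` \<G>) \<and>
     (\<forall>i\<in>I. \<forall>j\<in>I. i ~= j --> (\<lambda>\<gamma>. index_act \<gamma> (x i)) ` \<G> \<inter> (\<lambda>\<gamma>. index_act \<gamma> (x j)) ` \<G> = {}) \<and>
     image_mset (\<lambda>i. card ((\<lambda>\<gamma>. index_act \<gamma> (x i)) ` \<G>)) (mset_set I) = D" by (elim exE)
  then have I: "finite I" "!!i. i : I ==> x i : indices"
    and un: "indices = (\<Union>i\<in>I. (\<lambda>\<gamma>. index_act \<gamma> (x i)) ` \<G>)"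
    and dj: "\<forall>i\<in>I. \<forall>j\<in>I. i ~= j --> (\<lambda>\<gamma>. index_act \<gamma> (x i)) ` \<G> \<inter> (\<lambda>\<gamma>. index_act \<gamma> (x j)) ` \<G> = {}"
    and Deq: "image_mset (\<lambda>i. card ((\<lambda>\<gamma>. index_act \<gamma> (x i)) ` \<G>)) (mset_set I) = D"
    by (elim conjE; assumption | blast)+
  define Ob where "Ob i = (\<lambda>\<gamma>. index_act \<gamma> (x i)) ` \<G>" for i
  have sub: "Ob i \<subseteq> indices" if "i : I" for i using un that unfolding Ob_def by blast
  have injO: "inj_on rr (Ob i)" if "i : I" for i using inj sub[OF that] by (rule inj_on_subset)
  have orb: "ac_orbit (rr (x i)) = rr ` Ob i" if "i : I" for i unfolding Ob_def by (rule orbit_rr[OF I(2)[OF that]])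
  have "(\<Prod>x\<in>indices. [:- rr x, 1:]) = (\<Prod>i\<in>I. \<Prod>x\<in>Ob i. [:- rr x, 1:])" proof -
    have "(\<Prod>x\<in>(\<Union>i\<in>I. Ob i). [:- rr x, 1:]) = (\<Prod>i\<in>I. \<Prod>x\<in>Ob i. [:- rr x, 1:])"
      using I(1) sub finite_indices dj unfolding Ob_def[symmetric] by (intro prod.UNION_disjoint) (auto intro: finite_subset)
    then show ?thesis unfolding Ob_def un[symmetric] .
  qed
  also have "... = (\<Prod>i\<in>I. \<Prod>a\<in>ac_orbit (rr (x i)). [:- a, 1:])" by (rule prod.cong[OF refl]) (simp add: orb prod.reindex[OF injO])
  finally have "factor_degrees H (image_mset (\<lambda>i. card (ac_orbit (rr (x i)))) (mset_set I))"
    using H by (intro factor_degrees_orbits[OF galois_N I(1) rr_in_N]) simp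
  also have "image_mset (\<lambda>i. card (ac_orbit (rr (x i)))) (mset_set I) = D" unfolding Deq[symmetric] Ob_def[symmetric] using I(1)
    by (intro image_mset_cong) (simp add: orb card_image[OF injO])
  finally show ?thesis .
qed

end

section \<open>The generic resolvent, descent of its coefficients and their specialization\<close>

section \<open>Specialization of rational functions\<close>

text \<open>The graph of a partially defined ring homomorphism on a local ring of a field.\<close>

locale place =
  fixes V :: "'a::field => 'b::field => bool"
  assumes one: "V 1 1" and diff: "V r c ==> V s d ==> V (r - s) (c - d)"
    and mult: "V r c ==> V s d ==> V (r * s) (c * d)"
    and inv: "V r c ==> c ~= 0 ==> V (inverse r) (inverse c)"
    and unique: "V r c ==> V r c' ==> c = c'"
begin

lemma zero: "V 0 0" using diff[OF one one] by simp

lemma uminus: "V r c ==> V (- r) (- c)" using diff[OF zero] by simp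

lemma add: "V r c ==> V s d ==> V (r + s) (c + d)" using diff[OF _ uminus, of r c s d] by simp

lemma div: "V r c ==> V s d ==> d ~= 0 ==> V (r / s) (c / d)" using mult[OF _ inv] by (simp add: divide_inverse)

lemma pow: "V r c ==> V (r ^ n) (c ^ n)" by (induction n) (simp_all add: one mult)

lemma nat: "V (of_nat n) (of_nat n)" by (induction n) (simp_all add: zero one add)

lemma num: "V (numeral n) (numeral n)" using nat[of "numeral n"] by simp

lemma sum: "(!!a. a : A ==> V (f a) (g a)) ==> V (sum f A) (sum g A)" by (induction A rule: infinite_finite_induct) (simp_all add: zero add)

lemma nonzero: "V r c ==> c ~= 0 ==> r ~= 0" using unique zero by blast

lemmas field_ops = one zero num uminus diff add mult div pow

lemma xs: "V r u ==> V s v ==> pentagon u v ==> V (xs r s k) (xs u v k)" unfolding xs_def by (auto simp: pentagon_def intro!: field_ops)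

lemma ys: "V r u ==> V s v ==> pentagon u v ==> V (ys r s e k) (ys u v e k)"
  unfolding ys_def using xs[of r u s v k] xs_neq_1[of u v k] by (auto intro!: field_ops)

lemma tfun: "V r u ==> V s v ==> pentagon u v ==> V (tfun r s) (tfun u v)" unfolding tfun_def by (auto simp: pentagon_def intro!: field_ops)

lemma sfun: "V r u ==> V s v ==> pentagon u v ==> V (sfun r s) (sfun u v)" unfolding sfun_def by (intro sum mult diff xs one)

lemma pfun: "V r u ==> V s v ==> pentagon u v ==> V (pfun r s) (pfun u v)" unfolding pfun_def by (intro diff tfun div one tfun_neq_0)

lemma qfun: "V r u ==> V s v ==> pentagon u v ==> V (qfun r s) (qfun u v)"
  unfolding qfun_def by (intro add tfun sfun div mult num pow power_not_zero tfun_neq_0)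

lemma resolvent_root:
  assumes "V r u" "V s v" "V r' u'" "V s' v'" "pentagon u v" "pentagon u' v'"
  shows "V (resolvent_root r s r' s' x) (resolvent_root u v u' v' x)"
  unfolding resolvent_root_def using assms by (auto intro!: sum mult ys split: prod.split)

lemma poly:
  assumes "rhom f" "rhom g" "!!a. V (f a) (g a)" "V r c"
  shows "V (poly (map_poly f S) r) (poly (map_poly g S) c)" by (induction S)
    (simp_all add: map_poly_pCons_rhom[OF assms(1)] map_poly_pCons_rhom[OF assms(2)] zero add mult assms)

lemma coeff_mult: "(!!i. V (coeff P i) (coeff P' i)) ==> (!!i. V (coeff Q i) (coeff Q' i)) ==>
    V (coeff (P * Q) i) (coeff (P' * Q') i)" unfolding Polynomial.coeff_mult by (intro sum mult)

lemma coeff_prod_linear: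
  assumes "!!a. a : A ==> V (f a) (g a)"
  shows "V (coeff (\<Prod>a\<in>A. [:- f a, 1:]) i) (coeff (\<Prod>a\<in>A. [:- g a, 1:]) i)" using assms
proof (induction A arbitrary: i rule: infinite_finite_induct)
  case (insert a A)
  have *: "V (coeff [:- f a, 1:] i) (coeff [:- g a, 1:] i)" for i
    using insert.prems[of a] by (auto simp: coeff_pCons zero one uminus split: nat.split)
  show ?case unfolding prod.insert[OF insert.hyps] by (rule coeff_mult[OF *]) (use insert in auto)
qed (auto simp: zero one coeff_1)

end

lemma rhom_eval_poly4:
  assumes h: "rhom h" shows "rhom (eval_poly4 h a b c d)" unfolding eval_poly4_def[abs_def]
  by (rule rhom_poly_map_poly[OF rhom_poly_map_poly[OF rhom_poly_map_poly[OF rhom_poly_map_poly[OF h]]]])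

lemma rhom_to_fract: "rhom (to_fract :: 'a::idom => 'a fract)" by (rule rhomI) simp_all

lemma rhom_const4: "rhom (const4 :: 'k::field => 'k ratfun4)" unfolding const4_def[abs_def]
  by (rule rhomI) (simp_all add: to_fract_add[symmetric] to_fract_mult[symmetric] one_pCons[symmetric])

lemma eval_poly4_generators:
  assumes h: "rhom h"
  shows "eval_poly4 h a b c d [:[:[:[:z:]:]:]:] = h z" "eval_poly4 h a b c d [:[:[:[:0, 1:]:]:]:] = a"
    "eval_poly4 h a b c d [:[:[:0, 1:]:]:] = b" "eval_poly4 h a b c d [:[:0, 1:]:] = c"
    "eval_poly4 h a b c d [:0, 1:] = d"
proof -
  note 2 = rhom_poly_map_poly[OF h, of a]
  note 3 = rhom_poly_map_poly[OF 2, of b]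
  note 4 = rhom_poly_map_poly[OF 3, of c]
  note s = eval_poly4_def map_poly_pCons_rhom[OF h] map_poly_pCons_rhom[OF 2] map_poly_pCons_rhom[OF 3]
    map_poly_pCons_rhom[OF 4] rhom_0[OF h] rhom_1[OF h] rhom_1[OF rhom_map_poly[OF h]] rhom_1[OF rhom_map_poly[OF 2]]
    rhom_1[OF rhom_map_poly[OF 3]]
  show "eval_poly4 h a b c d [:[:[:[:z:]:]:]:] = h z" "eval_poly4 h a b c d [:[:[:[:0, 1:]:]:]:] = a"
    "eval_poly4 h a b c d [:[:[:0, 1:]:]:] = b" "eval_poly4 h a b c d [:[:0, 1:]:] = c"
    "eval_poly4 h a b c d [:0, 1:] = d" by (simp_all add: s)
qed

text \<open>A relational form of \<open>eval_ratfun4\<close>: the function is defined at the point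
  and has the value \<open>c\<close> there. Being defined is part of the relation, so
  \<open>place\<close> can propagate it through field operations.\<close>

definition val :: "('k::field => 'b::field) => 'b => 'b => 'b => 'b => 'k ratfun4 => 'b => bool" where
  "val h u v u' v' r c \<longleftrightarrow> (\<exists>n d. r = Fract n d \<and> eval_poly4 h u v u' v' d ~= 0 \<and>
     c = eval_poly4 h u v u' v' n / eval_poly4 h u v u' v' d)"

lemma place_val:
  assumes h: "rhom h" shows "place (val h u v u' v')"
proof
  let ?E = "eval_poly4 h u v u' v'"
  note E = rhom_simps[OF rhom_eval_poly4[OF h, of u v u' v']]
  have nz: "d ~= 0" if "?E d ~= 0" for d using that E(1) by metis
  show "val h u v u' v' 1 1" unfolding val_def by (intro exI[of _ 1]) (simp add: E One_fract_def)
  fix r c assume "val h u v u' v' r c"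
  then obtain n d where r: "r = Fract n d" "?E d ~= 0" "c = ?E n / ?E d" unfolding val_def by blast
  show "val h u v u' v' (inverse r) (inverse c)" if "c ~= 0" unfolding val_def by (intro exI[of _ d] exI[of _ n]) (use r that in auto)
  fix s c' assume "val h u v u' v' s c'"
  then obtain m e where s: "s = Fract m e" "?E e ~= 0" "c' = ?E m / ?E e" unfolding val_def by blast
  show "val h u v u' v' (r - s) (c - c')" unfolding val_def by (intro exI[of _ "n * e - m * d"] exI[of _ "d * e"])
      (use r s nz[OF r(2)] nz[OF s(2)] in \<open>simp add: E diff_frac_eq\<close>)
  show "val h u v u' v' (r * s) (c * c')" unfolding val_def by (intro exI[of _ "n * m"] exI[of _ "d * e"]) (use r s nz in \<open>auto simp: E\<close>)
next
  let ?E = "eval_poly4 h u v u' v'"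
  note E = rhom_simps[OF rhom_eval_poly4[OF h, of u v u' v']]
  have nz: "d ~= 0" if "?E d ~= 0" for d using that E(1) by metis
  fix r c c' assume "val h u v u' v' r c" "val h u v u' v' r c'"
  then obtain n d m e where r: "r = Fract n d" "?E d ~= 0" "c = ?E n / ?E d"
    and s: "r = Fract m e" "?E e ~= 0" "c' = ?E m / ?E e" unfolding val_def by blast
  have "n * e = m * d" using r(1) s(1) nz[OF r(2)] nz[OF s(2)] by (simp add: eq_fract)
  then have "?E n * ?E e = ?E m * ?E d" using E(4) by metis
  then show "c = c'" using r s by (simp add: frac_eq_eq)
qed

lemma val_to_fract:
  assumes h: "rhom h" shows "val h u v u' v' (to_fract n) (eval_poly4 h u v u' v' n)" unfolding val_def to_fract_def
  by (intro exI[of _ n] exI[of _ 1]) (simp add: rhom_1[OF rhom_eval_poly4[OF h]])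

lemma val_generators:
  assumes h: "rhom h"
  shows "val h u v u' v' (const4 z) (h z)" "val h u v u' v' x1 u" "val h u v u' v' y1 v"
    "val h u v u' v' x2 u'" "val h u v u' v' y2 v'" using val_to_fract[OF h, of u v u' v'] eval_poly4_generators[OF h, of u v u' v']
  unfolding const4_def x1_def y1_def x2_def y2_def by metis+

lemma eval_ratfun4_val:
  assumes h: "rhom h" and v: "val h u v u' v' r c" shows "eval_ratfun4 h u v u' v' r = c" unfolding eval_ratfun4_def val_def[symmetric]
  by (rule the_equality) (use v place.unique[OF place_val[OF h]] in blast)+

lemma (in place) eval_poly4:
  assumes f: "rhom f" and h: "rhom h" and c: "!!z. V (f z) (h z)" and r: "V r1 a" "V r2 b" "V r3 c" "V r4 d"
  shows "V (eval_poly4 f r1 r2 r3 r4 D) (eval_poly4 h a b c d D)"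
proof -
  note f2 = rhom_poly_map_poly[OF f, of r1] and h2 = rhom_poly_map_poly[OF h, of a]
  note f3 = rhom_poly_map_poly[OF f2, of r2] and h3 = rhom_poly_map_poly[OF h2, of b]
  note f4 = rhom_poly_map_poly[OF f3, of r3] and h4 = rhom_poly_map_poly[OF h3, of c]
  show ?thesis unfolding eval_poly4_def by (intro poly f f2 f3 f4 h h2 h3 h4 c r)
qed

lemma exists_nonroot:
  fixes f :: "'a::comm_ring_1 => 'b::field"
  assumes f: "rhom f" and P: "f (lead_coeff P) ~= 0" and E: "finite E" and inf: "infinite (UNIV :: 'b set)"
  shows "\<exists>x. x \<notin> E \<and> poly (map_poly f P) x ~= 0"
proof -
  have "map_poly f P ~= 0" using P coeff_map_poly_rhom[OF f, of P "degree P"] by auto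
  then have "finite (E \<union> {x. poly (map_poly f P) x = 0})" using E poly_roots_finite by blast
  then obtain x where "x \<notin> E \<union> {x. poly (map_poly f P) x = 0}" using ex_new_if_finite[OF inf] by blast
  then show ?thesis by blast
qed

text \<open>The variables are chosen from the innermost outwards, each time keeping an iterated
  leading coefficient of \<open>D\<close> nonzero. The excluded sets for \<open>b\<close> and
  \<open>d\<close> may depend on the preceding choice.\<close>

lemma exists_nonzero_value:
  fixes h :: "'k::field => 'b::field"
  assumes h: "rhom h" and inf: "infinite (UNIV :: 'b set)" and D: "D ~= 0"
    and E: "finite E" "!!a. finite (E' a)"
  shows "\<exists>a b c d. a \<notin> E \<and> b \<notin> E' a \<and> c \<notin> E \<and> d \<notin> E' c \<and> eval_poly4 h a b c d D ~= 0"
proof -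
  have lc: "lead_coeff (lead_coeff (lead_coeff (lead_coeff D))) ~= 0" using D by simp
  have "h (lead_coeff (lead_coeff (lead_coeff (lead_coeff D)))) ~= 0" using lc rhom_eq_0_iff[OF h] by blast
  from exists_nonroot[OF h this E(1) inf]
  obtain a where a: "a \<notin> E" "poly (map_poly h (lead_coeff (lead_coeff (lead_coeff D)))) a ~= 0" by blast
  note h2 = rhom_poly_map_poly[OF h, of a]
  from exists_nonroot[OF h2 a(2) E(2)[of a] inf] obtain b where b: "b \<notin> E' a"
    "poly (map_poly (\<lambda>S. poly (map_poly h S) a) (lead_coeff (lead_coeff D))) b ~= 0" by blast
  note h3 = rhom_poly_map_poly[OF h2, of b]
  from exists_nonroot[OF h3 b(2) E(1) inf] obtain c where c: "c \<notin> E"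
    "poly (map_poly (\<lambda>R. poly (map_poly (\<lambda>S. poly (map_poly h S) a) R) b) (lead_coeff D)) c ~= 0" by blast
  note h4 = rhom_poly_map_poly[OF h3, of c]
  from exists_nonroot[OF h4 c(2) E(2)[of c] inf] obtain d where d: "d \<notin> E' c"
    "eval_poly4 h a b c d D ~= 0" unfolding eval_poly4_def by blast
  show ?thesis using a(1) b(1) c(1) d by blast
qed

text \<open>The quadruple serves in two roles, as coordinates of two pentagons and as values of
  $p,q,p',q'$; hence both kinds of nondegeneracy. The four inequalities of neighbours are what
  \<open>xs_inj\<close> needs.\<close>

lemma exists_pentagon_nonzero_value:
  fixes h :: "'k::field => 'b::field"
  assumes h: "rhom h" and inf: "infinite (UNIV :: 'b set)" and D: "D ~= 0"
  obtains a b c d where "pentagon a b" "pentagon c d" "a\<^sup>2 + 4 ~= 0" "c\<^sup>2 + 4 ~= 0"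
    "a ~= b" "a\<^sup>2 ~= 1 - b" "c ~= d" "c\<^sup>2 ~= 1 - d" "eval_poly4 h a b c d D ~= 0"
proof -
  have "{a :: 'b. a\<^sup>2 + 4 = 0} = {a. poly [:4, 0, 1:] a = 0}" by (simp add: power2_eq_square algebra_simps)
  moreover have "finite {a::'b. poly [:4, 0, 1:] a = 0}" by (rule poly_roots_finite) simp
  ultimately have fin: "finite ({0, 1} \<union> {a::'b. a\<^sup>2 + 4 = 0})" by simp
  have "finite {0, 1, 1 - a, a, 1 - a\<^sup>2}" for a :: 'b by simp
  from exists_nonzero_value[where E' = "\<lambda>a. {0, 1, 1 - a, a, 1 - a\<^sup>2}", OF h inf D fin this] obtain a b c d where
    *: "a \<notin> {0, 1} \<union> {a. a\<^sup>2 + 4 = 0} \<and> b \<notin> {0, 1, 1 - a, a, 1 - a\<^sup>2} \<and> c \<notin> {0, 1} \<union> {a. a\<^sup>2 + 4 = 0}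
      \<and> d \<notin> {0, 1, 1 - c, c, 1 - c\<^sup>2} \<and> eval_poly4 h a b c d D ~= 0" by (elim exE)
  have **: "x + y ~= 1" if "y ~= 1 - x" for x y :: 'b using that by (metis add_diff_cancel_left')
  have ***: "x\<^sup>2 ~= 1 - y" if "y ~= 1 - x\<^sup>2" for x y :: 'b using that by (metis add_diff_cancel diff_add_cancel add.commute)
  show ?thesis proof (rule that[of a b c d])
    show "pentagon a b" "pentagon c d" unfolding pentagon_def using * ** by simp_all
    show "a\<^sup>2 ~= 1 - b" "c\<^sup>2 ~= 1 - d" using * *** by simp_all
  qed (use * in auto)
qed

lemma rhom_poly_expand:
  fixes f :: "'a::comm_ring_1 poly => 'b::comm_ring_1"
  assumes f: "rhom f" shows "f P = poly (map_poly (\<lambda>a. f [:a:]) P) (f [:0, 1:])"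
proof -
  have f': "rhom (\<lambda>a. f [:a:])"
    by (rule rhomI) (simp_all add: rhom_add[OF f, symmetric] rhom_mult[OF f, symmetric] rhom_1[OF f] one_pCons[symmetric] mult.commute)
  show ?thesis proof (induction P)
    case (pCons a P)
    have "pCons a P = [:a:] + [:0, 1:] * P" by simp
    then have "f (pCons a P) = f [:a:] + f [:0, 1:] * f P" by (metis rhom_add[OF f] rhom_mult[OF f])
    then show ?case using pCons.IH by (simp add: map_poly_pCons_rhom[OF f'])
  qed (simp add: rhom_0[OF f])
qed

lemma rhom_ratfun4_eqI:
  fixes \<Phi> \<Psi> :: "'k::field ratfun4 => 'b::field"
  assumes \<Phi>: "rhom \<Phi>" and \<Psi>: "rhom \<Psi>" and eq: "!!c. \<Phi> (const4 c) = \<Psi> (const4 c)"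
    "\<Phi> x1 = \<Psi> x1" "\<Phi> y1 = \<Psi> y1" "\<Phi> x2 = \<Psi> x2" "\<Phi> y2 = \<Psi> y2"
  shows "\<Phi> = \<Psi>"
proof -
  have *: "\<Phi> (to_fract n) = poly (map_poly (\<lambda>Q. poly (map_poly (\<lambda>R. poly (map_poly (\<lambda>S.
       poly (map_poly (\<lambda>c. \<Phi> (const4 c)) S) (\<Phi> x1)) R) (\<Phi> y1)) Q) (\<Phi> x2)) n) (\<Phi> y2)"
    if \<Phi>: "rhom \<Phi>" for \<Phi> :: "'k ratfun4 => 'b" and n proof -
    have c: "rhom (\<lambda>a. [:a:] :: 'c::comm_ring_1 poly)" by (rule rhomI) simp_all
    note 1 = rhom_comp[OF \<Phi> rhom_to_fract]
    note 2 = rhom_comp[OF 1 c]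
    note 3 = rhom_comp[OF 2 c]
    note 4 = rhom_comp[OF 3 c]
    show ?thesis unfolding const4_def x1_def y1_def x2_def y2_def by (simp only: rhom_poly_expand[OF 1, of n] rhom_poly_expand[OF 2, symmetric]
          rhom_poly_expand[OF 3, symmetric] rhom_poly_expand[OF 4, symmetric])
  qed
  have fr: "\<Phi> (to_fract n) = \<Psi> (to_fract n)" for n unfolding *[OF \<Phi>] *[OF \<Psi>] eq ..
  show ?thesis proof
    fix r :: "'k ratfun4"
    obtain n d where r: "r = Fract n d" by (cases r)
    then have "r = to_fract n / to_fract d" by (simp add: Fract_conv_to_fract)
    then show "\<Phi> r = \<Psi> r" by (simp add: rhom_divide[OF \<Phi>] rhom_divide[OF \<Psi>] fr)
  qed
qed

text \<open>Algebraic independence over the constants, which makes the substitution defined on the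
  whole function field.\<close>

definition dominant :: "'k::field ratfun4 => 'k ratfun4 => 'k ratfun4 => 'k ratfun4 => bool" where
  "dominant r1 r2 r3 r4 \<longleftrightarrow> (\<forall>D. D ~= 0 --> eval_poly4 const4 r1 r2 r3 r4 D ~= 0)"

lemma dominant_val:
  assumes "dominant r1 r2 r3 r4"
  shows "val const4 r1 r2 r3 r4 r (eval_ratfun4 const4 r1 r2 r3 r4 r)"
proof -
  obtain n d where r: "r = Fract n d" "d ~= 0" by (cases r)
  then have "val const4 r1 r2 r3 r4 r (eval_poly4 const4 r1 r2 r3 r4 n / eval_poly4 const4 r1 r2 r3 r4 d)"
    unfolding val_def using assms unfolding dominant_def by blast
  then show ?thesis using eval_ratfun4_val[OF rhom_const4] by metis
qed

lemma dominant_rhom: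
  assumes d: "dominant r1 r2 r3 r4" shows "rhom (eval_ratfun4 const4 r1 r2 r3 r4)"
proof -
  interpret place "val const4 r1 r2 r3 r4" by (rule place_val[OF rhom_const4])
  note e = eval_ratfun4_val[OF rhom_const4] and v = dominant_val[OF d]
  show ?thesis by (rule rhomI) (intro e one add mult v)+
qed

lemma eval_ratfun4_generators:
  "eval_ratfun4 const4 r1 r2 r3 r4 (const4 z) = const4 z" "eval_ratfun4 const4 r1 r2 r3 r4 x1 = r1"
  "eval_ratfun4 const4 r1 r2 r3 r4 y1 = r2" "eval_ratfun4 const4 r1 r2 r3 r4 x2 = r3"
  "eval_ratfun4 const4 r1 r2 r3 r4 y2 = r4" by (intro eval_ratfun4_val[OF rhom_const4] val_generators[OF rhom_const4])+

text \<open>Algebraic independence is tested at points: if all suitable quadruples occur as values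
  of $r_1,\<dots>,r_4$, a polynomial relation is refuted by a quadruple at which the polynomial does
  not vanish.\<close>

lemma dominantI:
  fixes h :: "'k::field => 'b::field"
  assumes h: "rhom h" and inf: "infinite (UNIV :: 'b set)"
    and pts: "!!a b c d. pentagon a b ==> pentagon c d ==> a\<^sup>2 + 4 ~= 0 ==> c\<^sup>2 + 4 ~= 0 ==>
      \<exists>u v u' v'. val h u v u' v' r1 a \<and> val h u v u' v' r2 b \<and> val h u v u' v' r3 c \<and> val h u v u' v' r4 d"
  shows "dominant r1 r2 r3 r4" unfolding dominant_def
proof (intro allI impI)
  fix D :: "'k poly4" assume "D ~= 0"
  obtain a b c d where *: "pentagon a b" "pentagon c d" "a\<^sup>2 + 4 ~= 0" "c\<^sup>2 + 4 ~= 0" "eval_poly4 h a b c d D ~= 0"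
    by (rule exists_pentagon_nonzero_value[OF h inf \<open>D ~= 0\<close>]) (rule that; assumption)
  from pts[OF *(1-4)] obtain u v u' v' where
    v: "val h u v u' v' r1 a" "val h u v u' v' r2 b" "val h u v u' v' r3 c" "val h u v u' v' r4 d" by blast
  interpret place "val h u v u' v'" by (rule place_val[OF h])
  show "eval_poly4 const4 r1 r2 r3 r4 D ~= 0" using nonzero[OF eval_poly4[OF rhom_const4 h val_generators(1)[OF h] v] *(5)] .
qed

lemma (in place) pentagonI: "V r a ==> V s b ==> pentagon a b ==> pentagon r s" unfolding pentagon_def using unique zero one add by metis

text \<open>An equality $x_k = x_l$ propagates under \<sigma> and makes the sequence invariant under
  the shift by $m = l - k$. Here $m = 1, 4$ contradict $u \<noteq> v$, and $m = 2, 3$ contradict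
  $u^2 \<noteq> 1 - v$.\<close>

lemma xs_inj:
  assumes \<sigma>: "acts_by \<sigma> u v (1, 0)" and ne: "u ~= v" "u\<^sup>2 ~= 1 - v" "u ~= 0"
  shows "xs u v k = xs u v l \<longleftrightarrow> k mod 5 = l mod 5"
proof
  assume eq: "xs u v k = xs u v l"
  have st: "\<sigma> (xs u v m) = xs u v (m + 1)" for m proof -
    have "\<sigma> (ys u v 0 m) = ys u v 0 (aff (1, 0) m)" using \<sigma> by (simp add: acts_by_def)
    then show ?thesis by (simp add: ys_0 aff_def xs_cong[of "(m + 1) mod 5" "m + 1"])
  qed
  have sh: "xs u v (k + int n) = xs u v (l + int n)" for n proof (induction n)
    case (Suc n)
    then show ?case using st[of "k + int n"] st[of "l + int n"] by (simp add: ac_simps)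
  qed (simp add: eq)
  define m where "m = (l - k) mod 5"
  define n where "n = nat ((- k) mod 5)"
  have n: "(k + int n) mod 5 = 0" "(l + int n) mod 5 = m" unfolding n_def m_def by (simp_all add: mod_simps)
  have sh': "xs u v i = xs u v (m + i)" if "i \<ge> 0" for i proof -
    have "xs u v i = xs u v (k + int (n + nat i))" proof (rule xs_cong)
      have "(k + int (n + nat i)) mod 5 = ((k + int n) mod 5 + i) mod 5" using that by (simp add: mod_simps add.assoc)
      then show "i mod 5 = (k + int (n + nat i)) mod 5" by (simp add: n(1))
    qed
    also have "... = xs u v (l + int (n + nat i))" by (rule sh)
    also have "... = xs u v (m + i)" proof (rule xs_cong)
      have "(l + int (n + nat i)) mod 5 = ((l + int n) mod 5 + i) mod 5" using that by (simp add: mod_simps add.assoc)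
      then show "(l + int (n + nat i)) mod 5 = (m + i) mod 5" by (simp add: n(2))
    qed
    finally show ?thesis .
  qed
  have "m : {0..<5}" by (simp add: m_def)
  then have "m = 0 \<or> m = 1 \<or> m = 2 \<or> m = 3 \<or> m = 4" by auto
  moreover have "m ~= 1" using sh'[of 0] ne by auto
  moreover have "m ~= 2" using sh'[of 0] ne by (auto simp: power2_eq_square field_simps)
  moreover have "m ~= 3" using sh'[of 2] ne xs_cong[of 5 0 u v] by (auto simp: power2_eq_square field_simps)
  moreover have "m ~= 4" using sh'[of 1] ne xs_cong[of 5 0 u v] by auto
  ultimately have "m = 0" by blast
  then have "(l - k) mod 5 = 0" by (simp add: m_def)
  then show "k mod 5 = l mod 5" by presburger
qed (rule xs_cong)

lemma aff_mod: "aff g (k mod 5) = aff g k" unfolding aff_def by (metis mod_add_left_eq mod_mult_right_eq)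

lemma exists_affine_preimage:
  assumes p: "pentagon a b" and g: "g : \<A>"
  shows "\<exists>u v. pentagon u v \<and> ys u v (snd g) (fst g) = a \<and> ys u v (snd g) (2 ^ nat (snd g) + fst g) = b"
proof -
  define g' where "g' = inv\<^bsub>F20\<^esub> g"
  have g': "g' : \<A>" unfolding g'_def using g by simp
  have nn: "snd g \<ge> 0" "snd g' \<ge> 0" using fst_snd_F20[OF g] fst_snd_F20[OF g'] by auto
  have inv: "g' \<cdot> g = \<e>" unfolding g'_def using g by simp
  have a: "aff g' (aff g k) = k mod 5" for k using aff_mult[OF nn(2,1), of k] inv by (simp add: aff_one)
  have "(snd g' + snd g) mod 4 = 0" using arg_cong[OF inv, of snd] by (simp add: snd_mult_F20 one_F20)
  then have par: "even (snd g + snd g')" by presburger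
  let ?u = "ys a b (snd g') (fst g')" and ?v = "ys a b (snd g') (2 ^ nat (snd g') + fst g')"
  have *: "ys ?u ?v (snd g) m = xs a b k" if m: "m mod 5 = aff g k" for m k proof -
    have "ys ?u ?v (snd g) m = ys a b (snd g + snd g') (aff g' m)" unfolding pentagon_affine(2)[OF p nn(2)] ys_aff ..
    also have "aff g' m = k mod 5" using a[of k] aff_mod[of g' m] m by simp
    also have "ys a b (snd g + snd g') (k mod 5) = ys a b 0 k" by (rule ys_cong) (use par in auto)
    finally show ?thesis by (simp add: ys_0)
  qed
  show ?thesis
    by (intro exI conjI) (rule pentagon_affine(1)[OF p nn(2)], use *[of "fst g" 0] *[of "2 ^ nat (snd g) + fst g" 1] in \<open>simp_all add: aff_def\<close>)
qed

section \<open>The generic resolvent\<close>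

text \<open>The automorphism of the function field attached to $(g,h)$; the six named automorphisms
  are instances, see \<open>subst4_automorphisms\<close>.\<close>

definition subst4 :: "int \<times> int => int \<times> int => 'k::field ratfun4 => 'k ratfun4" where
  "subst4 g h = eval_ratfun4 const4 (ys x1 y1 (snd g) (fst g)) (ys x1 y1 (snd g) (2 ^ nat (snd g) + fst g))
     (ys x2 y2 (snd h) (fst h)) (ys x2 y2 (snd h) (2 ^ nat (snd h) + fst h))"

lemma subst4_generators:
  "subst4 g h (const4 z) = const4 z" "subst4 g h x1 = ys x1 y1 (snd g) (fst g)"
  "subst4 g h y1 = ys x1 y1 (snd g) (2 ^ nat (snd g) + fst g)" "subst4 g h x2 = ys x2 y2 (snd h) (fst h)"
  "subst4 g h y2 = ys x2 y2 (snd h) (2 ^ nat (snd h) + fst h)" unfolding subst4_def by (rule eval_ratfun4_generators)+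

lemma sum_nat_0_4: "(\<Sum>i = 0..4. f i) = f 0 + f 1 + f 2 + f 3 + f (4::nat)" by (simp add: numeral_eq_Suc)

lemma BijGroup_UNIV:
  "carrier (BijGroup UNIV) = {f. bij f}" "\<one>\<^bsub>BijGroup UNIV\<^esub> = id"
  "bij f ==> bij g ==> f \<otimes>\<^bsub>BijGroup UNIV\<^esub> g = f \<circ> g"
  by (auto simp: BijGroup_def Bij_def extensional_def compose_def fun_eq_iff)

abbreviation even_F20 :: "(int \<times> int) set" where "even_F20 \<equiv> {A \<in> \<A>. even (snd A)}"

lemma even_F20_eq: "even_F20 = {0..<5} \<times> {0, 2}" unfolding carrier_F20 by (auto dest: range4_cases)

abbreviation \<r> :: "int \<times> int" where "\<r> \<equiv> (0, 1)"

lemma F20_elements: "(0, 0) : \<A>" "\<r> : \<A>" "(0, 2) : \<A>" "(1, 0) : \<A>" by (simp_all add: carrier_F20)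

lemma bij_index_act:
  assumes g: "g : \<A>" and h: "h : \<A>"
  shows "bij_betw (index_act (g, h)) indices indices"
proof -
  have inj: "inj_on (index_act (g, h)) indices" proof (rule inj_onI)
    fix x y assume x: "x : indices" and y: "y : indices" and eq: "index_act (g, h) x = index_act (g, h) y"
    obtain e A f B where xy: "x = (e, A)" "y = (f, B)" by (cases x, cases y)
    have A: "A : \<A>" "B : \<A>" "e = 0 \<or> e = 1" "f = 0 \<or> f = 1" using x y by (auto simp: xy indices_def)
    have e1: "(e + snd g) mod 2 = (f + snd g) mod 2" and e2: "h \<cdot> A \<cdot> inv\<^bsub>F20\<^esub> g = h \<cdot> B \<cdot> inv\<^bsub>F20\<^esub> g"
      using eq by (simp_all add: xy index_act_def)
    have "e = f" using e1 A(3,4) by presburger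
    moreover have "A = B" using e2 A g h by simp
    ultimately show "x = y" by (simp add: xy)
  qed
  have "index_act (g, h) ` indices \<subseteq> indices" using index_act_closed[OF g h] by blast
  then show ?thesis unfolding bij_betw_def using inj endo_inj_surj[OF finite_indices] by blast
qed

text \<open>The powers \<open>(0, 0)\<close> and \<open>\<r>\<close> represent the two cosets of
  $D_5$ on either side, so the four blocks of ten factors fill the forty indices without
  repetition.\<close>

lemma bij_resolvent_index:
  "bij_betw (\<lambda>(\<gamma>, A). index_act \<gamma> (0, A)) (({(0, 0), \<r>} \<times> {(0, 0), \<r>}) \<times> even_F20) indices"
proof -
  let ?f = "\<lambda>(\<gamma>, A). index_act \<gamma> (0, A)" and ?D = "({(0, 0), \<r>} \<times> {(0, 0), \<r>}) \<times> even_F20"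
  have inj: "inj_on ?f ?D" proof (rule inj_onI)
    fix x y assume x: "x : ?D" and y: "y : ?D" and eq: "?f x = ?f y"
    obtain g h A g' h' A' where xy: "x = ((g, h), A)" "y = ((g', h'), A')" by (metis prod.exhaust)
    have m: "g = (0, 0) \<or> g = \<r>" "g' = (0, 0) \<or> g' = \<r>" "h = (0, 0) \<or> h = \<r>" "h' = (0, 0) \<or> h' = \<r>"
      and A: "A : \<A>" "A' : \<A>" "even (snd A)" "even (snd A')" using x y unfolding xy by blast+
    have c: "g : \<A>" "g' : \<A>" "h : \<A>" "h' : \<A>" using m F20_elements by metis+
    have e1: "snd g mod 2 = snd g' mod 2" and e2: "h \<cdot> A \<cdot> inv\<^bsub>F20\<^esub> g = h' \<cdot> A' \<cdot> inv\<^bsub>F20\<^esub> g'"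
      using eq by (simp_all add: xy index_act_def)
    have g: "g = g'" using e1 m(1,2) by auto
    have hA: "h \<cdot> A = h' \<cdot> A'" using e2 A c unfolding g by simp
    have "(snd h + snd A) mod 4 = (snd h' + snd A') mod 4" using arg_cong[OF hA, of snd] by (simp add: snd_mult_F20)
    then have "even (snd h) = even (snd h')" using A(3,4) by presburger
    then have h: "h = h'" using m(3,4) by auto
    then have "A = A'" using hA A c by simp
    then show "x = y" using g h by (simp add: xy)
  qed
  have sub: "?f ` ?D \<subseteq> indices" proof (rule image_subsetI)
    fix z assume z: "z : ?D"
    obtain g h A where z': "z = ((g, h), A)" by (metis prod.exhaust)
    have m: "g = (0, 0) \<or> g = \<r>" "h = (0, 0) \<or> h = \<r>" and A: "A : \<A>" using z unfolding z' by blast+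
    have "g : \<A>" "h : \<A>" using m F20_elements by metis+
    then have "index_act (g, h) (0, A) : indices" by (rule index_act_closed) (simp add: indices_def A)
    then show "?f z : indices" by (simp add: z')
  qed
  have "card (?f ` ?D) = card ?D" by (rule card_image[OF inj])
  also have "... = 40" unfolding even_F20_eq by (simp add: card_cartesian_product)
  also have "... = card indices" by (simp add: indices_def carrier_F20 card_cartesian_product)
  finally have "?f ` ?D = indices" by (rule card_subset_eq[OF finite_indices sub])
  then show ?thesis using inj by (simp add: bij_betw_def)
qed

abbreviation generic_root :: "int \<times> (int \<times> int) => 'k::field ratfun4" where
  "generic_root \<equiv> resolvent_root x1 y1 x2 y2"

text \<open>
  Everything generic is checked at points of an infinite field \<open>'b\<close> receiving a homomorphism from
  the field of constants.
\<close>

context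
  fixes j :: "'k::field => 'b::alg_closed_field"
  assumes j: "rhom j" and inf: "infinite (UNIV :: 'b set)"
begin

lemma pentagon_generic:
  "pentagon (x1 :: 'k ratfun4) y1" "pentagon (x2 :: 'k ratfun4) y2"
  "(x1 :: 'k ratfun4) ~= y1" "(x1 :: 'k ratfun4)\<^sup>2 ~= 1 - y1" "(x2 :: 'k ratfun4) ~= y2" "(x2 :: 'k ratfun4)\<^sup>2 ~= 1 - y2"
proof -
  obtain a b c d :: 'b where *: "pentagon a b" "pentagon c d" "a ~= b" "a\<^sup>2 ~= 1 - b" "c ~= d" "c\<^sup>2 ~= 1 - d"
    by (rule exists_pentagon_nonzero_value[OF j inf one_neq_zero]) (rule that; assumption)
  interpret place "val j a b c d" by (rule place_val[OF j])
  note g = val_generators(2-5)[OF j, of a b c d]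
  show "pentagon (x1 :: 'k ratfun4) y1" "pentagon (x2 :: 'k ratfun4) y2" using pentagonI[OF g(1,2) *(1)] pentagonI[OF g(3,4) *(2)] .
  show "(x1 :: 'k ratfun4) ~= y1" "(x2 :: 'k ratfun4) ~= y2" using unique g *(3,5) by metis+
  show "(x1 :: 'k ratfun4)\<^sup>2 ~= 1 - y1" "(x2 :: 'k ratfun4)\<^sup>2 ~= 1 - y2"
    using unique pow[OF g(1), of 2] pow[OF g(3), of 2] diff[OF one g(2)] diff[OF one g(4)] *(4,6) by metis+
qed

context
  fixes g h :: "int \<times> int"
  assumes g: "g : \<A>" and h: "h : \<A>"
begin

lemma rhom_subst4: "rhom (subst4 g h :: 'k ratfun4 => 'k ratfun4)" unfolding subst4_def
proof (rule dominant_rhom, rule dominantI[OF j inf])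
  fix a b c d :: 'b assume ab: "pentagon a b" and cd: "pentagon c d"
  obtain u v where u: "pentagon u v" "ys u v (snd g) (fst g) = a" "ys u v (snd g) (2 ^ nat (snd g) + fst g) = b"
    using exists_affine_preimage[OF ab g] by blast
  obtain u' v' where u': "pentagon u' v'" "ys u' v' (snd h) (fst h) = c" "ys u' v' (snd h) (2 ^ nat (snd h) + fst h) = d"
    using exists_affine_preimage[OF cd h] by blast
  interpret place "val j u v u' v'" by (rule place_val[OF j])
  note G = val_generators(2-5)[OF j, of u v u' v']
  have "val j u v u' v' (ys x1 y1 (snd g) (fst g)) a \<and> val j u v u' v' (ys x1 y1 (snd g) (2 ^ nat (snd g) + fst g)) b \<and>
    val j u v u' v' (ys x2 y2 (snd h) (fst h)) c \<and> val j u v u' v' (ys x2 y2 (snd h) (2 ^ nat (snd h) + fst h)) d"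
    unfolding u(2,3)[symmetric] u'(2,3)[symmetric] by (intro conjI ys G u(1) u'(1))
  then show "\<exists>u v u' v'. val j u v u' v' (ys x1 y1 (snd g) (fst g)) a \<and> val j u v u' v' (ys x1 y1 (snd g) (2 ^ nat (snd g) + fst g)) b \<and>
    val j u v u' v' (ys x2 y2 (snd h) (fst h)) c \<and> val j u v u' v' (ys x2 y2 (snd h) (2 ^ nat (snd h) + fst h)) d" by blast
qed

lemma subst4_acts:
  "acts_by (subst4 g h :: 'k ratfun4 => 'k ratfun4) x1 y1 g" "acts_by (subst4 g h :: 'k ratfun4 => 'k ratfun4) x2 y2 h"
proof -
  have nn: "snd g \<ge> 0" "snd h \<ge> 0" using fst_snd_F20[OF g] fst_snd_F20[OF h] by auto
  show "acts_by (subst4 g h :: 'k ratfun4 => 'k ratfun4) x1 y1 g" "acts_by (subst4 g h :: 'k ratfun4 => 'k ratfun4) x2 y2 h"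
    unfolding acts_by_def rhom_ys[OF rhom_subst4] subst4_generators ys_aff
      pentagon_affine(2)[OF pentagon_generic(1) nn(1)] pentagon_affine(2)[OF pentagon_generic(2) nn(2)] by simp_all
qed

lemma subst4_eqI:
  fixes \<Phi> :: "'k ratfun4 => 'k ratfun4"
  assumes \<Phi>: "rhom \<Phi>" "!!c. \<Phi> (const4 c) = const4 c" "acts_by \<Phi> x1 y1 g" "acts_by \<Phi> x2 y2 h"
  shows "\<Phi> = subst4 g h"
proof (rule rhom_ratfun4_eqI[OF \<Phi>(1) rhom_subst4])
  have eq: "x1 = (ys x1 y1 0 0 :: 'k ratfun4)" "y1 = (ys x1 y1 0 1 :: 'k ratfun4)"
    "x2 = (ys x2 y2 0 0 :: 'k ratfun4)" "y2 = (ys x2 y2 0 1 :: 'k ratfun4)" by (simp_all add: ys_0)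
  have a: "\<Phi> (ys x1 y1 e k) = subst4 g h (ys x1 y1 e k)" "\<Phi> (ys x2 y2 e k) = subst4 g h (ys x2 y2 e k)" for e k
    using \<Phi>(3,4) subst4_acts unfolding acts_by_def by simp_all
  show "\<Phi> x1 = subst4 g h x1" "\<Phi> y1 = subst4 g h y1" "\<Phi> x2 = subst4 g h x2" "\<Phi> y2 = subst4 g h y2" using a eq by metis+
qed (simp add: \<Phi>(2) subst4_generators)

lemma subst4_root:
  "x : indices ==> subst4 g h (generic_root x :: 'k ratfun4) = generic_root (index_act (g, h) x)"
  by (rule resolvent_root_act[OF rhom_subst4 g subst4_acts(1) h subst4_acts(2)])

end

lemma subst4_comp:
  assumes g: "g : \<A>" "g' : \<A>" and h: "h : \<A>" "h' : \<A>"
  shows "(subst4 g h :: 'k ratfun4 => 'k ratfun4) \<circ> subst4 g' h' = subst4 (g \<cdot> g') (h \<cdot> h')"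
proof (rule subst4_eqI[OF mult_F20_closed mult_F20_closed])
  have nn: "snd g \<ge> 0" "snd g' \<ge> 0" "snd h \<ge> 0" "snd h' \<ge> 0"
    using fst_snd_F20[OF g(1)] fst_snd_F20[OF g(2)] fst_snd_F20[OF h(1)] fst_snd_F20[OF h(2)] by auto
  show "rhom ((subst4 g h :: 'k ratfun4 => 'k ratfun4) \<circ> subst4 g' h')"
    unfolding comp_def by (rule rhom_comp[OF rhom_subst4[OF g(1) h(1)] rhom_subst4[OF g(2) h(2)]])
  show "acts_by ((subst4 g h :: 'k ratfun4 => 'k ratfun4) \<circ> subst4 g' h') x1 y1 (g \<cdot> g')"
    by (rule acts_by_comp[OF subst4_acts(1)[OF g(1) h(1)] subst4_acts(1)[OF g(2) h(2)] nn(1,2)])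
  show "acts_by ((subst4 g h :: 'k ratfun4 => 'k ratfun4) \<circ> subst4 g' h') x2 y2 (h \<cdot> h')"
    by (rule acts_by_comp[OF subst4_acts(2)[OF g(1) h(1)] subst4_acts(2)[OF g(2) h(2)] nn(3,4)])
qed (simp add: subst4_generators)

lemma subst4_id: "(subst4 (0, 0) (0, 0) :: 'k ratfun4 => 'k ratfun4) = id" by (rule sym, rule subst4_eqI[OF F20_elements(1) F20_elements(1)])
    (simp_all add: rhom_id id_def acts_by_def aff_def ys_mod)

lemma bij_subst4:
  assumes g: "g : \<A>" and h: "h : \<A>"
  shows "bij (subst4 g h :: 'k ratfun4 => 'k ratfun4)"
proof (rule o_bij)
  show "(subst4 (inv\<^bsub>F20\<^esub> g) (inv\<^bsub>F20\<^esub> h) :: 'k ratfun4 => 'k ratfun4) \<circ> subst4 g h = id"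
    using subst4_comp[of "inv\<^bsub>F20\<^esub> g" g "inv\<^bsub>F20\<^esub> h" h] g h subst4_id by (simp add: one_F20)
  show "(subst4 g h :: 'k ratfun4 => 'k ratfun4) \<circ> subst4 (inv\<^bsub>F20\<^esub> g) (inv\<^bsub>F20\<^esub> h) = id"
    using subst4_comp[of g "inv\<^bsub>F20\<^esub> g" h "inv\<^bsub>F20\<^esub> h"] g h subst4_id by (simp add: one_F20)
qed

lemma subst4_automorphisms:
  "(\<sigma>1 :: 'k ratfun4 => 'k ratfun4) = subst4 (1, 0) (0, 0)" "(\<tau>1 :: 'k ratfun4 => 'k ratfun4) = subst4 (0, 2) (0, 0)"
  "(\<rho>1 :: 'k ratfun4 => 'k ratfun4) = subst4 \<r> (0, 0)" "(\<sigma>2 :: 'k ratfun4 => 'k ratfun4) = subst4 (0, 0) (1, 0)"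
  "(\<tau>2 :: 'k ratfun4 => 'k ratfun4) = subst4 (0, 0) (0, 2)" "(\<rho>2 :: 'k ratfun4 => 'k ratfun4) = subst4 (0, 0) \<r>"
proof -
  have r: "ys u v 1 2 = (v - 1) / (u + v - 1)" if p: "pentagon u v" for u v :: "'k ratfun4" proof -
    have u: "u ~= 0" and n: "u + v - 1 ~= 0" using p pentagon_uv_neq(1)[OF p] by (auto simp: pentagon_def)
    have n': "1 - (u + v) ~= 0" using n by auto
    have "(1 - v) / u - 1 = (1 - (u + v)) / u" using u by (simp add: diff_divide_distrib add_divide_distrib)
    then have "ys u v 1 2 = (1 - v) / (1 - (u + v))" using u by (simp add: ys_1)
    also have "... = (v - 1) / (u + v - 1)" by (subst frac_eq_eq[OF n' n]) (simp add: algebra_simps)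
    finally show ?thesis .
  qed
  show "(\<sigma>1 :: 'k ratfun4 => 'k ratfun4) = subst4 (1, 0) (0, 0)" "(\<tau>1 :: 'k ratfun4 => 'k ratfun4) = subst4 (0, 2) (0, 0)"
    "(\<sigma>2 :: 'k ratfun4 => 'k ratfun4) = subst4 (0, 0) (1, 0)" "(\<tau>2 :: 'k ratfun4 => 'k ratfun4) = subst4 (0, 0) (0, 2)"
    by (simp_all add: \<sigma>1_def \<tau>1_def \<sigma>2_def \<tau>2_def subst4_def ys_def)
  show "(\<rho>1 :: 'k ratfun4 => 'k ratfun4) = subst4 \<r> (0, 0)" "(\<rho>2 :: 'k ratfun4 => 'k ratfun4) = subst4 (0, 0) \<r>"
    unfolding \<rho>1_def \<rho>2_def subst4_def using r[OF pentagon_generic(1)] r[OF pentagon_generic(2)] by (simp_all add: ys_1 ys_0)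
qed

lemma funpow_shift:
  fixes \<sigma> :: "'k ratfun4 => 'k ratfun4"
  assumes "rhom \<sigma>" "acts_by \<sigma> u v (1, 0)"
  shows "rhom (\<sigma> ^^ n)" "(\<sigma> ^^ n) (xs u v k) = xs u v (k + int n)"
proof -
  show "rhom (\<sigma> ^^ n)" by (induction n) (use assms(1) in \<open>simp_all add: id_def rhom_id comp_def rhom_comp\<close>)
  have st: "\<sigma> (xs u v m) = xs u v (m + 1)" for m proof -
    have "\<sigma> (ys u v 0 m) = ys u v 0 (aff (1, 0) m)" using assms(2) by (simp add: acts_by_def)
    then show ?thesis by (simp add: ys_0 aff_def xs_cong[of "(m + 1) mod 5" "m + 1"])
  qed
  show "(\<sigma> ^^ n) (xs u v k) = xs u v (k + int n)" by (induction n) (simp_all add: st ac_simps)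
qed

lemma generic_invariants:
  "(t1 :: 'k ratfun4) = tfun x1 y1" "(s1 :: 'k ratfun4) = sfun x1 y1" "(p1 :: 'k ratfun4) = pfun x1 y1" "(q1 :: 'k ratfun4) = qfun x1 y1"
  "(t2 :: 'k ratfun4) = tfun x2 y2" "(s2 :: 'k ratfun4) = sfun x2 y2" "(p2 :: 'k ratfun4) = pfun x2 y2" "(q2 :: 'k ratfun4) = qfun x2 y2"
  "(P_inv :: 'k ratfun4) = generic_root (0, (0, 0))"
proof -
  note c = F20_elements
  note s1 = rhom_subst4[OF c(4,1), folded subst4_automorphisms(1)] subst4_acts(1)[OF c(4,1), folded subst4_automorphisms(1)]
  note s2 = rhom_subst4[OF c(1,4), folded subst4_automorphisms(4)] subst4_acts(2)[OF c(1,4), folded subst4_automorphisms(4)]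
  note f1 = funpow_shift[OF s1] and f2 = funpow_shift[OF s2]
  have per: "xs u v 5 = xs u v 0" for u v :: "'k ratfun4" by (rule xs_cong) simp
  have e1: "(\<sigma>1 ^^ i) ((x1 - 1) * (y1 - 1)) = (xs x1 y1 (int i) - 1) * (xs x1 y1 (1 + int i) - 1 :: 'k ratfun4)" for i
    using f1(2)[of i 0] f1(2)[of i 1] by (simp add: rhom_simps[OF f1(1)])
  have e2: "(\<sigma>2 ^^ i) ((x2 - 1) * (y2 - 1)) = (xs x2 y2 (int i) - 1) * (xs x2 y2 (1 + int i) - 1 :: 'k ratfun4)" for i
    using f2(2)[of i 0] f2(2)[of i 1] by (simp add: rhom_simps[OF f2(1)])
  show t: "(t1 :: 'k ratfun4) = tfun x1 y1" "(t2 :: 'k ratfun4) = tfun x2 y2" by (simp_all add: t1_def t2_def tfun_def)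
  show s: "(s1 :: 'k ratfun4) = sfun x1 y1" "(s2 :: 'k ratfun4) = sfun x2 y2"
    unfolding s1_def s2_def e1 e2 sum_nat_0_4 sfun_expand using per by simp_all
  show "(p1 :: 'k ratfun4) = pfun x1 y1" "(q1 :: 'k ratfun4) = qfun x1 y1" "(p2 :: 'k ratfun4) = pfun x2 y2" "(q2 :: 'k ratfun4) = qfun x2 y2"
    by (simp_all add: p1_def q1_def p2_def q2_def pfun_def qfun_def s t)
  have x: "(\<sigma>1 ^^ i) x1 = (xs x1 y1 (int i) :: 'k ratfun4)" "(\<sigma>2 ^^ i) x2 = (xs x2 y2 (int i) :: 'k ratfun4)" for i
    using f1(2)[of i 0] f2(2)[of i 0] by simp_all
  have five: "{0..<5} = {0, 1, 2, 3, 4 :: int}" by auto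
  show "(P_inv :: 'k ratfun4) = generic_root (0, (0, 0))"
    unfolding P_inv_def x sum_nat_0_4 resolvent_root_def five by (simp add: ys_0 aff_def add.assoc mult.commute)
qed

lemma generate_automorphisms:
  "generate (BijGroup UNIV) {\<sigma>2, \<tau>2 :: 'k ratfun4 => 'k ratfun4} = subst4 (0, 0) ` even_F20"
proof
  let ?G = "BijGroup (UNIV :: 'k ratfun4 set)" and ?S = "subst4 (0, 0) :: int \<times> int => 'k ratfun4 => 'k ratfun4"
  interpret G: group ?G by (rule group_BijGroup)
  have o: "(0, 0) \<cdot> (0, 0) = (0, 0)" by (simp add: mult_F20)
  have m: "?S A \<otimes>\<^bsub>?G\<^esub> ?S B = ?S (A \<cdot> B)" if "A : \<A>" "B : \<A>" for A B
    using subst4_comp[OF F20_elements(1,1) that] BijGroup_UNIV(3)[OF bij_subst4[OF F20_elements(1) that(1)] bij_subst4[OF F20_elements(1) that(2)]]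
    by (simp add: o)
  have "subgroup (?S ` even_F20) ?G" proof (rule G.subgroupI)
    show "?S ` even_F20 \<subseteq> carrier ?G" using bij_subst4[OF F20_elements(1)] by (auto simp: BijGroup_UNIV(1))
    show "?S ` even_F20 ~= {}" using F20_elements(1) by auto
    fix f assume "f : ?S ` even_F20"
    then obtain A where A: "A : \<A>" "even (snd A)" "f = ?S A" by blast
    have e: "even (snd (inv\<^bsub>F20\<^esub> A))" proof -
      have "(snd A + snd (inv\<^bsub>F20\<^esub> A)) mod 4 = 0" using arg_cong[OF F.r_inv[OF A(1)], of snd] by (simp add: snd_mult_F20 one_F20)
      then show ?thesis using A(2) by presburger
    qed
    have "inv\<^bsub>?G\<^esub> f = ?S (inv\<^bsub>F20\<^esub> A)" proof (rule G.inv_equality)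
      show "?S (inv\<^bsub>F20\<^esub> A) \<otimes>\<^bsub>?G\<^esub> f = \<one>\<^bsub>?G\<^esub>"
        unfolding A(3) m[OF F.inv_closed[OF A(1)] A(1)] F.l_inv[OF A(1)] BijGroup_UNIV(2) one_F20 by (rule subst4_id)
    qed (use A(1,3) bij_subst4[OF F20_elements(1)] F.inv_closed[OF A(1)] in \<open>simp_all add: BijGroup_UNIV(1)\<close>)
    then show "inv\<^bsub>?G\<^esub> f : ?S ` even_F20" using e F.inv_closed[OF A(1)] by simp
    fix f' assume "f' : ?S ` even_F20"
    then obtain B where B: "B : \<A>" "even (snd B)" "f' = ?S B" by blast
    have "even (snd (A \<cdot> B))" unfolding snd_mult_F20 using A(2) B(2) by presburger
    then show "f \<otimes>\<^bsub>?G\<^esub> f' : ?S ` even_F20" unfolding A(3) B(3) m[OF A(1) B(1)] using mult_F20_closed by blast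
  qed
  moreover have "{\<sigma>2, \<tau>2} \<subseteq> ?S ` even_F20" unfolding subst4_automorphisms using F20_elements(3,4) by auto
  ultimately show "generate ?G {\<sigma>2, \<tau>2} \<subseteq> ?S ` even_F20" by (rule G.generate_subgroup_incl[rotated])
  have 1: "?S (int n mod 5, 0) : generate ?G {\<sigma>2, \<tau>2}" for n proof (induction n)
    case 0
    have eq: "(int 0 mod 5, 0 :: int) = (0, 0)" by simp
    show ?case unfolding eq subst4_id BijGroup_UNIV(2)[symmetric] by (rule generate.one)
  next
    case (Suc n)
    have "\<sigma>2 \<otimes>\<^bsub>?G\<^esub> ?S (int n mod 5, 0) = ?S ((1, 0) \<cdot> (int n mod 5, 0))"
      unfolding subst4_automorphisms by (rule m) (simp_all add: carrier_F20)
    also have "(1, 0) \<cdot> (int n mod 5, 0) = (int (Suc n) mod 5, 0)" by (simp add: mult_F20 mod_simps)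
    finally show ?case using generate.eng[OF generate.incl[of \<sigma>2 "{\<sigma>2, \<tau>2}"] Suc] by simp
  qed
  show "?S ` even_F20 \<subseteq> generate ?G {\<sigma>2, \<tau>2}" proof
    fix f assume "f : ?S ` even_F20"
    then obtain n i where f: "f = ?S (n, i)" "n : {0..<5}" "i = 0 \<or> i = 2" unfolding even_F20_eq by blast
    have n: "?S (n, 0) : generate ?G {\<sigma>2, \<tau>2}" using 1[of "nat n"] f(2) by simp
    have "?S (n, 0) \<otimes>\<^bsub>?G\<^esub> \<tau>2 = ?S ((n, 0) \<cdot> (0, 2))"
      unfolding subst4_automorphisms by (rule m) (use f(2) in \<open>simp_all add: carrier_F20\<close>)
    also have "(n, 0) \<cdot> (0, 2) = (n, 2)" using f(2) by (simp add: mult_F20)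
    finally have "?S (n, 2) : generate ?G {\<sigma>2, \<tau>2}" using generate.eng[OF n generate.incl[of \<tau>2 "{\<sigma>2, \<tau>2}"]] by simp
    then show "f : generate ?G {\<sigma>2, \<tau>2}" using f(1,3) n by auto
  qed
qed

lemma generic_xs_inj:
  "xs x1 y1 k = (xs x1 y1 l :: 'k ratfun4) \<longleftrightarrow> k mod 5 = l mod 5" "xs x2 y2 k = (xs x2 y2 l :: 'k ratfun4) \<longleftrightarrow> k mod 5 = l mod 5"
proof -
  have "(x1 :: 'k ratfun4) ~= 0" "(x2 :: 'k ratfun4) ~= 0" using pentagon_generic(1,2) by (auto simp: pentagon_def)
  then show "xs x1 y1 k = (xs x1 y1 l :: 'k ratfun4) \<longleftrightarrow> k mod 5 = l mod 5" "xs x2 y2 k = (xs x2 y2 l :: 'k ratfun4) \<longleftrightarrow> k mod 5 = l mod 5"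
    using xs_inj[OF subst4_acts(1)[OF F20_elements(4,1)] pentagon_generic(3,4)]
      xs_inj[OF subst4_acts(2)[OF F20_elements(1,4)] pentagon_generic(5,6)] by blast+
qed

text \<open>The product in \<open>F1\<close> runs over a set of maps. It becomes a product over ten
  group elements only because these give different maps, which follows from the generic distinctness
  of the $x_k$.\<close>

lemma F1_eq: "(F1 :: 'k ratfun4 poly) = (\<Prod>A\<in>even_F20. [:- generic_root (0, A), 1:])"
proof -
  let ?S = "subst4 (0, 0) :: int \<times> int => 'k ratfun4 => 'k ratfun4"
  have inj: "inj_on ?S even_F20" proof (rule inj_onI)
    fix A B assume A: "A : even_F20" and B: "B : even_F20" and eq: "?S A = ?S B"
    have Ac: "A : \<A>" "even (snd A)" and Bc: "B : \<A>" "even (snd B)" using A B by blast+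
    have "xs x2 y2 (aff A k) = (xs x2 y2 (aff B k) :: 'k ratfun4)" for k proof -
      have "ys x2 y2 (0 + snd A) (aff A k) = (ys x2 y2 (0 + snd B) (aff B k) :: 'k ratfun4)"
        using subst4_acts(2)[OF F20_elements(1) Ac(1)] subst4_acts(2)[OF F20_elements(1) Bc(1)] eq unfolding acts_by_def by metis
      then show ?thesis using Ac(2) Bc(2) by (simp add: ys_def)
    qed
    then have "aff A k = aff B k" for k using generic_xs_inj(2) by (simp add: aff_def)
    then show "A = B" using aff_eqD[OF Ac(1) Bc(1)] by blast
  qed
  have P: "?S A P_inv = generic_root (0, A)" if A: "A : even_F20" for A proof -
    have A': "A : \<A>" using A by blast
    have "index_act ((0, 0), A) (0, (0, 0)) = (0, A)" using A' F.r_one[OF A'] F.inv_one by (simp add: index_act_def one_F20)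
    then show ?thesis unfolding generic_invariants(9) by (subst subst4_root[OF F20_elements(1) A']) (simp_all add: indices_def F20_elements(1))
  qed
  show ?thesis unfolding F1_def generate_automorphisms prod.reindex[OF inj] comp_def by (rule prod.cong[OF refl]) (simp only: P)
qed

lemma map_poly_subst4_prod:
  assumes "g : \<A>" "h : \<A>" "!!x. x : A ==> f x : indices"
  shows "map_poly (subst4 g h) (\<Prod>x\<in>A. [:- generic_root (f x), 1:] :: 'k ratfun4 poly) =
    (\<Prod>x\<in>A. [:- generic_root (index_act (g, h) (f x)), 1:])"
proof -
  note r = rhom_subst4[OF assms(1,2)]
  show ?thesis unfolding rhom_prod[OF rhom_map_poly[OF r]] by (rule prod.cong[OF refl])
      (simp add: map_poly_pCons_rhom[OF r] rhom_minus[OF r] subst4_root[OF assms(1,2)] assms(3) rhom_1[OF r])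
qed

lemma H_res_eq: "(H_res :: 'k ratfun4 poly) = (\<Prod>x\<in>indices. [:- generic_root x, 1:])"
proof -
  let ?f = "\<lambda>\<gamma>. \<Prod>A\<in>even_F20. [:- generic_root (index_act \<gamma> (0, A)), 1:] :: 'k ratfun4 poly"
  have i: "(0, A) : indices" if "A : even_F20" for A using that by (auto simp: indices_def)
  have \<rho>\<rho>: "(\<rho>1 \<circ> \<rho>2 :: 'k ratfun4 => 'k ratfun4) = subst4 \<r> \<r>"
    unfolding subst4_automorphisms subst4_comp[OF F20_elements(2,1,1,2)] by (simp add: mult_F20)
  have id: "map_poly (subst4 (0, 0) (0, 0)) F1 = (F1 :: 'k ratfun4 poly)" by (rule poly_eqI) (simp add: coeff_map_poly subst4_id)
  have F: "map_poly (subst4 g h) F1 = ?f (g, h)" if "g : \<A>" "h : \<A>" for g h unfolding F1_eq by (rule map_poly_subst4_prod[OF that i])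
  have "H_res = ?f ((0, 0), (0, 0)) * ?f (\<r>, (0, 0)) * ?f ((0, 0), \<r>) * ?f (\<r>, \<r>)"
    unfolding H_res_def F2_def F3_def F4_def \<rho>\<rho> unfolding subst4_automorphisms
    by (simp only: F[OF F20_elements(1,1), unfolded id, symmetric] F[OF F20_elements(2,1), symmetric]
        F[OF F20_elements(1,2), symmetric] F[OF F20_elements(2,2), symmetric])
  also have "... = (\<Prod>\<gamma>\<in>{(0, 0), \<r>} \<times> {(0, 0), \<r>}. ?f \<gamma>)" by (simp add: ac_simps)
  also have "... = (\<Prod>(\<gamma>, A)\<in>({(0, 0), \<r>} \<times> {(0, 0), \<r>}) \<times> even_F20. [:- generic_root (index_act \<gamma> (0, A)), 1:])"
    by (rule prod.cartesian_product)
  also have "... = (\<Prod>x\<in>indices. [:- generic_root x, 1:])"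
    using prod.reindex_bij_betw[OF bij_resolvent_index, of "\<lambda>x. [:- generic_root x, 1:] :: 'k ratfun4 poly"] by (simp add: case_prod_beta')
  finally show ?thesis .
qed

lemma H_res_invariant:
  assumes "g : \<A>" "h : \<A>"
  shows "map_poly (subst4 g h) H_res = (H_res :: 'k ratfun4 poly)"
  unfolding H_res_eq map_poly_subst4_prod[OF assms, of indices "\<lambda>x. x", simplified]
  by (rule prod.reindex_bij_betw[OF bij_index_act[OF assms], of "\<lambda>x. [:- generic_root x, 1:] :: 'k ratfun4 poly"])

end

section \<open>Descent of invariants\<close>

locale subring_set =
  fixes A :: "'a::comm_ring_1 set"
  assumes one: "1 : A" and diff: "a : A ==> b : A ==> a - b : A" and mult: "a : A ==> b : A ==> a * b : A"
begin

lemma zero: "0 : A" using diff[OF one one] by simp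

lemma uminus: "a : A ==> - a : A" using diff[OF zero] by simp

lemma add: "a : A ==> b : A ==> a + b : A" using diff[OF _ uminus, of a b] by simp

lemma pow: "a : A ==> a ^ n : A" by (induction n) (simp_all add: one mult)

lemma num: "numeral n : A"
proof -
  have "of_nat m : A" for m by (induction m) (simp_all add: zero one add)
  from this[of "numeral n"] show ?thesis by simp
qed

lemma sum: "(!!i. i : I ==> f i : A) ==> sum f I : A" by (induction I rule: infinite_finite_induct) (simp_all add: zero add)

lemmas ring_ops = one zero num uminus diff add mult pow

lemma poly_eval: "(!!i. coeff P i : A) ==> b : A ==> poly P b : A" unfolding poly_altdef by (intro sum mult pow)

lemma subring_polys: "subring_set {P. \<forall>i. coeff P i : A}" by unfold_locales (auto simp: coeff_1 coeff_mult one zero diff mult intro!: sum)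

lemma coeff_prod_linear:
  assumes "!!a. a : B ==> f a : A" shows "coeff (\<Prod>a\<in>B. [:- f a, 1:]) i : A"
proof -
  interpret P: subring_set "{P. \<forall>i. coeff P i : A}" by (rule subring_polys)
  have "(\<Prod>a\<in>B. [:- f a, 1:]) : {P. \<forall>i. coeff P i : A}" using assms proof (induction B rule: infinite_finite_induct)
    case (insert a B)
    have "[:- f a, 1:] : {P. \<forall>i. coeff P i : A}" using insert.prems[of a] by (auto simp: coeff_pCons zero one uminus split: nat.split)
    then show ?case unfolding prod.insert[OF insert.hyps] using insert by (intro P.mult) auto
  qed (use P.one in auto)
  then show ?thesis by blast
qed

end

text \<open>Rings rather than fields are generated, to keep control of the denominators that must
  not vanish on specialization.\<close>

inductive_set subring_gen :: "'a::comm_ring_1 set => 'a set" for S where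
  base: "s : S ==> s : subring_gen S"
| one: "1 : subring_gen S"
| diff: "a : subring_gen S ==> b : subring_gen S ==> a - b : subring_gen S"
| mult: "a : subring_gen S ==> b : subring_gen S ==> a * b : subring_gen S"

lemma subring_set_gen: "subring_set (subring_gen S)" by unfold_locales (rule subring_gen.intros; assumption)+

lemma subring_gen_least:
  assumes "subring_set A" "S \<subseteq> A" shows "subring_gen S \<subseteq> A"
proof
  interpret subring_set A by fact
  fix x assume "x : subring_gen S"
  then show "x : A" by induction (use assms(2) in \<open>auto intro: one diff mult\<close>)
qed

lemma subring_gen_fixed:
  assumes \<phi>: "rhom \<phi>" and S: "!!s. s : S ==> \<phi> s = s" and x: "x : subring_gen S"
  shows "\<phi> x = x" using x by induction (simp_all add: S rhom_simps[OF \<phi>])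

text \<open>One stage of the descent, in one pair of variables over a set \<open>S\<close> of
  scalars. It is used first with the second orbit as scalars, then with $p$, $q$ and $1/(p^2+4)$ of
  the first pair.\<close>

locale descent =
  fixes u v :: "'a::field" and \<sigma> \<tau> \<rho> :: "'a => 'a" and S :: "'a set"
  assumes pent: "pentagon u v" and adm: "(pfun u v)\<^sup>2 + 4 ~= 0"
    and inj: "xs u v k = xs u v l \<longleftrightarrow> k mod 5 = l mod 5"
    and hom: "rhom \<sigma>" "rhom \<tau>" "rhom \<rho>"
    and acts: "acts_by \<sigma> u v (1, 0)" "acts_by \<tau> u v (0, 2)" "acts_by \<rho> u v (0, 1)"
    and fixed: "s : S ==> \<sigma> s = s" "s : S ==> \<tau> s = s" "s : S ==> \<rho> s = s"
begin

abbreviation "s \<equiv> sfun u v"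
abbreviation "t \<equiv> tfun u v"
abbreviation "p \<equiv> pfun u v"
abbreviation "q \<equiv> qfun u v"

definition "K = subring_gen (S \<union> {p, q, 1 / (p\<^sup>2 + 4)})"

sublocale K: subring_set K unfolding K_def by (rule subring_set_gen)

lemma K_base: "S \<subseteq> K" "p : K" "q : K" "1 / (p\<^sup>2 + 4) : K" unfolding K_def by (auto intro: subring_gen.base)

lemma t0: "t ~= 0" by (rule tfun_neq_0[OF pent])

lemma t_sq: "t * t = p * t + 1" using t0 by (simp add: pfun_def field_simps)

text \<open>The ring $K[t]$, generated as a module by 1 and $t$ because $t^2 = pt + 1$; it is the
  first floor of the tower that \<rho>, \<sigma> and \<tau> dismantle.\<close>

definition "A = {a + b * t | a b. a : K \<and> b : K}"

lemma K_A: "K \<subseteq> A"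
proof
  fix a assume "a : K"
  moreover have "a = a + 0 * t" by simp
  ultimately show "a : A" unfolding A_def using K.zero by blast
qed

lemma t_A: "t : A"
proof -
  have "t = 0 + 1 * t" by simp
  then show ?thesis unfolding A_def using K.zero K.one by blast
qed

sublocale A: subring_set A
proof
  show "1 : A" using K_A K.one by blast
  fix x y assume "x : A" "y : A"
  then obtain a b c d where *: "x = a + b * t" "y = c + d * t" "a : K" "b : K" "c : K" "d : K" unfolding A_def by blast
  have "x - y = (a - c) + (b - d) * t" unfolding * by (simp add: algebra_simps)
  then show "x - y : A" unfolding A_def using * K.diff by blast
  have "x * y = a * c + (a * d + b * c) * t + b * d * (t * t)" unfolding * by (simp add: algebra_simps)
  also have "... = (a * c + b * d) + (a * d + b * c + b * d * p) * t" unfolding t_sq by (simp add: algebra_simps)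
  finally have "x * y = (a * c + b * d) + (a * d + b * c + b * d * p) * t" .
  moreover have "a * c + b * d : K" "a * d + b * c + b * d * p : K" using * K_base(2) by (auto intro!: K.add K.mult)
  ultimately show "x * y : A" unfolding A_def by blast
qed

lemma t_inv_A: "1 / t : A"
proof -
  have "1 / t = t - p" by (simp add: pfun_def)
  then show ?thesis using A.diff[OF t_A] K_A K_base(2) by auto
qed

lemma s_A: "s : A"
proof -
  have c: "t + 1 / t ~= 0" using pfun_sq[OF pent] adm by auto
  have "q * t = s * (t + 1 / t) + 5" using qfun_alt[OF pent] t0 by simp
  then have "s = (q * t - 5) / (t + 1 / t)" using c by (simp add: field_simps)
  also have "... = (q * t - 5) * (t + 1 / t) * (1 / (p\<^sup>2 + 4))" unfolding pfun_sq[OF pent] using c by (simp add: power2_eq_square)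
  also have "... : A" using K_A K_base t_A t_inv_A by (intro A.mult A.diff A.add A.num) blast+
  finally show ?thesis .
qed

definition "polys = {P. \<forall>i. coeff P i : A}"

sublocale P: subring_set polys unfolding polys_def by (rule A.subring_polys)

lemma polys_pCons: "a : A ==> P : polys ==> pCons a P : polys" unfolding polys_def by (auto simp: coeff_pCons split: nat.split)

lemma polys_smult: "a : A ==> P : polys ==> smult a P : polys" unfolding polys_def by (auto intro: A.mult)

text \<open>The constant term $t$ of the quintic is a unit of \<open>A\<close>, so the inverse of a
  root is a polynomial in it.\<close>

lemma polys_root_inverse:
  obtains I where "I : polys" "\<forall>k. poly I (xs u v k) = 1 / xs u v k"
proof -
  let ?I = "smult (- (1 / t)) [:s, t\<^sup>2 - t - 2 * s - 1, s - t + 3, t - 3, 1:]"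
  show ?thesis proof (rule that[of ?I])
    show "?I : polys" by (intro polys_smult polys_pCons P.zero A.ring_ops t_inv_A t_A s_A)
    show "\<forall>k. poly ?I (xs u v k) = 1 / xs u v k" proof
    fix k
    have "poly (brumer s t) (xs u v k) = 0" using brumer_root_iff[OF pent] by blast
    then have "xs u v k * poly [:s, t\<^sup>2 - t - 2 * s - 1, s - t + 3, t - 3, 1:] (xs u v k) = - t"
      unfolding brumer_def by (simp add: eq_neg_iff_add_eq_0 algebra_simps)
    then show "poly ?I (xs u v k) = 1 / xs u v k" using t0 xs_neq_0[OF pent, of k] unfolding poly_smult by (simp add: field_simps del: poly_pCons)
    qed
  qed
qed

text \<open>The quintic has the value $t^2$ at 1, a unit; \<open>?Q\<close> is the quotient of the
  quintic minus $t^2$ by $X - 1$.\<close>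

lemma polys_root_minus_1_inverse:
  obtains J where "J : polys" "\<forall>k. poly J (xs u v k) = 1 / (xs u v k - 1)"
proof -
  let ?Q = "[:t\<^sup>2 - t, t\<^sup>2 - t - s, s + 1, t - 2, 1:]"
  let ?J = "smult (- (1 / t * (1 / t))) ?Q"
  show ?thesis proof (rule that[of ?J])
    show "?J : polys" by (intro polys_smult polys_pCons P.zero A.ring_ops t_inv_A t_A s_A)
    show "\<forall>k. poly ?J (xs u v k) = 1 / (xs u v k - 1)" proof
    fix k
    have "poly (brumer s t) (xs u v k) = 0" using brumer_root_iff[OF pent] by blast
    moreover have "(xs u v k - 1) * poly ?Q (xs u v k) = poly (brumer s t) (xs u v k) - t * t"
      unfolding brumer_def by (simp add: algebra_simps power2_eq_square)
    ultimately have "(xs u v k - 1) * poly ?Q (xs u v k) = - (t * t)" by simp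
    then show "poly ?J (xs u v k) = 1 / (xs u v k - 1)"
      using t0 xs_neq_1[OF pent, of k] unfolding poly_smult by (simp add: eq_divide_eq mult.commute del: poly_pCons)
    qed
  qed
qed

text \<open>The top of the tower, $A[u] + v A[u]$; it is a ring because $v$ is quadratic over
  $A[u]$.\<close>

definition "B = {poly P u + v * poly Q u | P Q. P : polys \<and> Q : polys}"

lemma polys_B: "P : polys ==> poly P u : B"
proof -
  assume "P : polys"
  moreover have "poly P u = poly P u + v * poly 0 u" by simp
  ultimately show ?thesis unfolding B_def using P.zero by blast
qed

text \<open>The neighbours $v$ and $x_4$ of $u$ are the two solutions of $t(u,v) = t$. Their product
  is $1 - u$ and their sum $-(u - 2 + tu/(u-1))$, a polynomial in $u$ over \<open>A\<close> because
  $1/(u-1)$ is one.\<close>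

lemma neighbour_sum:
  obtains \<alpha> where "\<alpha> : polys" "v * v = v * poly \<alpha> u + (u - 1)" "xs u v 4 = poly \<alpha> u - v"
proof -
  obtain J where J0: "J : polys" "\<forall>k. poly J (xs u v k) = 1 / (xs u v k - 1)" by (rule polys_root_minus_1_inverse)
  note J = J0(1) J0(2)[rule_format]
  let ?\<alpha> = "- ([:-2, 1:] + [:0, t:] * J)"
  have nz: "u ~= 0" "v ~= 0" "u - 1 ~= 0" using pent by (auto simp: pentagon_def)
  have *: "v * v = v * poly ?\<alpha> u + (u - 1)" proof -
    have "t * u / (u - 1) = - ((v - 1) * (u + v - 1) / v)" unfolding tfun_def using nz by (simp add: divide_simps)
    moreover have "poly ?\<alpha> u = - ((u - 2) + t * u / (u - 1))" using J(2)[of 0] by (simp add: algebra_simps)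
    ultimately have eq: "poly ?\<alpha> u = - ((u - 2) + - ((v - 1) * (u + v - 1) / v))" by (simp only:)
    show ?thesis unfolding eq using nz by (simp add: field_simps)
  qed
  have "v * xs u v 4 = 1 - u" using nz by simp
  also have "... = v * (poly ?\<alpha> u - v)" using * by (simp add: algebra_simps)
  finally have "xs u v 4 = poly ?\<alpha> u - v" using nz by simp
  then show ?thesis using that[of ?\<alpha>] * J(1) by (metis P.uminus P.add P.mult polys_pCons P.zero A.one A.zero A.uminus A.num t_A)
qed

sublocale B: subring_set B
proof
  have "poly 1 u : B" by (rule polys_B[OF P.one])
  then show "1 : B" by simp
  fix x y assume "x : B" "y : B"
  then obtain P Q P' Q' where *: "x = poly P u + v * poly Q u" "y = poly P' u + v * poly Q' u"
    "P : polys" "Q : polys" "P' : polys" "Q' : polys" unfolding B_def by blast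
  have "x - y = poly (P - P') u + v * poly (Q - Q') u" unfolding * by (simp add: algebra_simps)
  then show "x - y : B" unfolding B_def using * P.diff by blast
  obtain \<alpha> where \<alpha>: "\<alpha> : polys" "v * v = v * poly \<alpha> u + (u - 1)" by (rule neighbour_sum)
  have "x * y = poly P u * poly P' u + v * (poly P u * poly Q' u + poly Q u * poly P' u) + (v * v) * (poly Q u * poly Q' u)"
    unfolding * by (simp add: algebra_simps)
  also have "... = poly (P * P' + [:-1, 1:] * (Q * Q')) u + v * poly (P * Q' + Q * P' + \<alpha> * (Q * Q')) u"
    unfolding \<alpha>(2) by (simp add: algebra_simps)
  finally have "x * y = poly (P * P' + [:-1, 1:] * (Q * Q')) u + v * poly (P * Q' + Q * P' + \<alpha> * (Q * Q')) u" .
  moreover have "P * P' + [:-1, 1:] * (Q * Q') : polys" "P * Q' + Q * P' + \<alpha> * (Q * Q') : polys"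
    using * \<alpha>(1) by (intro P.add P.mult polys_pCons P.zero A.one A.uminus; simp)+
  ultimately show "x * y : B" unfolding B_def by blast
qed

lemma A_B: "A \<subseteq> B" using polys_B[OF polys_pCons[OF _ P.zero]] by auto

lemma u_B: "u : B" using polys_B[OF polys_pCons[OF A.zero polys_pCons[OF A.one P.zero]]] by simp

lemma v_B: "v : B"
proof -
  have "v = poly 0 u + v * poly 1 u" by simp
  then show ?thesis unfolding B_def using P.zero P.one by blast
qed

lemma polys_poly_B: "P : polys ==> b : B ==> poly P b : B" by (rule B.poly_eval) (use A_B in \<open>auto simp: polys_def\<close>)

lemma xs_B: "xs u v k : B"
proof -
  obtain I where I0: "I : polys" "\<forall>k. poly I (xs u v k) = 1 / xs u v k" by (rule polys_root_inverse)
  note I = I0(1) I0(2)[rule_format]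
  have ui: "1 / u : B" using polys_B[OF I(1)] I(2)[of 0] by simp
  obtain \<alpha> where \<alpha>: "\<alpha> : polys" "xs u v 4 = poly \<alpha> u - v" by (rule neighbour_sum)
  have nz: "u ~= 0" "v ~= 0" using pent by (auto simp: pentagon_def)
  have 4: "xs u v 4 : B" unfolding \<alpha>(2) by (intro B.diff polys_B \<alpha>(1) v_B)
  have 2: "xs u v 2 : B" using B.mult[OF B.diff[OF B.one v_B] ui] by simp
  have "xs u v 3 = (1 - xs u v 4) * (1 / u)" using nz by (simp add: field_simps)
  then have 3: "xs u v 3 : B" using B.mult[OF B.diff[OF B.one 4] ui] by simp
  show ?thesis by (rule mod5_cases[of k])
      (use 2 3 4 u_B v_B xs_cong[of k 0 u v] xs_cong[of k 1 u v] xs_cong[of k 2 u v] xs_cong[of k 3 u v] xs_cong[of k 4 u v] in \<open>simp_all del: xs_simps(3-5)\<close>)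
qed

lemma ys_B: "ys u v e k : B"
proof -
  obtain J where J0: "J : polys" "\<forall>k. poly J (xs u v k) = 1 / (xs u v k - 1)" by (rule polys_root_minus_1_inverse)
  note J = J0(1) J0(2)[rule_format]
  have "xs u v k * poly J (xs u v k) : B" by (intro B.mult xs_B polys_poly_B J(1))
  then show ?thesis using xs_B by (simp add: ys_def J(2))
qed

lemma images:
  "\<sigma> t = t" "\<tau> t = t" "\<rho> t = - 1 / t" "\<sigma> (xs u v k) = xs u v (k + 1)" "\<tau> u = u" "\<tau> v = xs u v 4"
  "\<sigma> p = p" "\<tau> p = p" "\<rho> p = p" "\<sigma> q = q" "\<tau> q = q" "\<rho> q = q"
proof -
  have gen: "\<phi> u = ys u v (snd g) (aff g 0)" "\<phi> v = ys u v (snd g) (aff g 1)" if "acts_by \<phi> u v g" for \<phi> g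
    using that[unfolded acts_by_def, rule_format, of 0 0] that[unfolded acts_by_def, rule_format, of 0 1] by (simp_all add: ys_0)
  have \<sigma>: "\<sigma> u = ys u v 0 1" "\<sigma> v = ys u v 0 2" using gen[OF acts(1)] by (simp_all add: aff_def)
  have \<tau>: "\<tau> u = ys u v 2 0" "\<tau> v = ys u v 2 4" using gen[OF acts(2)] by (simp_all add: aff_def)
  have \<rho>: "\<rho> u = ys u v 1 0" "\<rho> v = ys u v 1 2" using gen[OF acts(3)] by (simp_all add: aff_def)
  show "\<tau> u = u" "\<tau> v = xs u v 4" using \<tau> by (simp_all add: ys_def)
  show "\<sigma> t = t" using sfun_tfun_neighbour(1)[OF pent, of 0 1] by (simp add: rhom_tfun[OF hom(1)] \<sigma>)
  show "\<tau> t = t" using sfun_tfun_neighbour(1)[OF pent, of 2 0] by (simp add: rhom_tfun[OF hom(2)] \<tau>)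
  show "\<rho> t = - 1 / t" using sfun_tfun_rho(1)[OF pent] by (simp add: rhom_tfun[OF hom(3)] \<rho>)
  have "\<sigma> (ys u v 0 k) = ys u v 0 (aff (1, 0) k)" using acts(1) by (simp add: acts_by_def)
  then show "\<sigma> (xs u v k) = xs u v (k + 1)" by (simp add: ys_0 aff_def xs_cong[of "(k + 1) mod 5" "k + 1"])
  show "\<sigma> p = p" "\<sigma> q = q" using pfun_qfun_affine[OF pent, of 0 1] by (simp_all add: rhom_pfun[OF hom(1)] rhom_qfun[OF hom(1)] \<sigma>)
  show "\<tau> p = p" "\<tau> q = q" using pfun_qfun_affine[OF pent, of 2 0] by (simp_all add: rhom_pfun[OF hom(2)] rhom_qfun[OF hom(2)] \<tau>)
  show "\<rho> p = p" "\<rho> q = q" using pfun_qfun_affine[OF pent, of 1 0] by (simp_all add: rhom_pfun[OF hom(3)] rhom_qfun[OF hom(3)] \<rho>)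
qed

lemma K_fixed: assumes a: "a : K" shows "\<sigma> a = a" "\<tau> a = a" "\<rho> a = a"
proof -
  note a' = a[unfolded K_def]
  show "\<sigma> a = a" by (rule subring_gen_fixed[OF hom(1) _ a']) (auto simp: fixed images rhom_simps[OF hom(1)] rhom_divide[OF hom(1)])
  show "\<tau> a = a" by (rule subring_gen_fixed[OF hom(2) _ a']) (auto simp: fixed images rhom_simps[OF hom(2)] rhom_divide[OF hom(2)])
  show "\<rho> a = a" by (rule subring_gen_fixed[OF hom(3) _ a']) (auto simp: fixed images rhom_simps[OF hom(3)] rhom_divide[OF hom(3)])
qed

lemma A_fixed: assumes "a : A" shows "\<sigma> a = a" "\<tau> a = a"
  using assms K_fixed by (auto simp: A_def images rhom_simps[OF hom(1)] rhom_simps[OF hom(2)])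

lemma polys_fixed: assumes "P : polys" shows "map_poly \<sigma> P = P" "map_poly \<tau> P = P"
  using assms A_fixed by (auto simp: polys_def poly_eq_iff coeff_map_poly_rhom[OF hom(1)] coeff_map_poly_rhom[OF hom(2)])

lemma polys_reduce:
  assumes "P : polys"
  shows "\<exists>P'\<in>polys. degree P' \<le> 4 \<and> (\<forall>k. poly P (xs u v k) = poly P' (xs u v k))" using assms
proof (induction P)
  case 0
  then show ?case by (intro bexI[of _ 0]) auto
next
  case (pCons a P)
  have a: "a : A" "P : polys" using pCons.prems unfolding polys_def by (auto dest: spec[of _ 0] spec[of _ "Suc _"])
  then obtain P' where P': "P' : polys" "degree P' \<le> 4" "!!k. poly P (xs u v k) = poly P' (xs u v k)" using pCons.IH by blast
  define R where "R = pCons a P'"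
  have R: "R : polys" "degree R \<le> 5" using a P' polys_pCons degree_pCons_le[of a P'] by (auto simp: R_def)
  define T where "T = R - smult (coeff R 5) (brumer s t)"
  have b: "brumer s t : polys" unfolding brumer_def by (intro polys_pCons P.zero A.ring_ops t_A s_A)
  have T: "T : polys" unfolding T_def by (intro P.diff polys_smult R b) (use R in \<open>simp add: polys_def\<close>)
  have "degree (brumer s t) = 5" "coeff (brumer s t) 5 = 1" by (simp_all add: brumer_def numeral_eq_Suc)
  then have "coeff T i = 0" if "i > 4" for i using that R(2) by (cases "i = 5") (simp_all add: T_def coeff_eq_0)
  then have d: "degree T \<le> 4" by (intro degree_le) auto
  have "poly (pCons a P) (xs u v k) = poly T (xs u v k)" for k using brumer_root_iff[OF pent, of "xs u v k"] P'(3)[of k] by (auto simp: T_def R_def)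
  then show ?case using T d by blast
qed

text \<open>Each generator removes one floor. Since \<tau> fixes $u$ but moves $v$, the $v$-part
  vanishes; invariance under \<sigma> makes a polynomial of degree at most 4 take one value at five
  distinct roots, so it is constant; and \<rho> sends $t$ to $-1/t$, different from $t$, so the
  $t$-part vanishes.\<close>

theorem descent:
  assumes c: "c : subring_gen (S \<union> {ys u v e k | e k. True})" and inv: "\<sigma> c = c" "\<tau> c = c" "\<rho> c = c"
  shows "c : subring_gen (S \<union> {p, q, 1 / (p\<^sup>2 + 4)})"
proof -
  have "subring_gen (S \<union> {ys u v e k | e k. True}) \<subseteq> B"
    by (rule subring_gen_least[OF B.subring_set_axioms]) (use ys_B K_base(1) K_A A_B in blast)
  then obtain P Q where cPQ: "c = poly P u + v * poly Q u" and PQ: "P : polys" "Q : polys" using c unfolding B_def by blast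
  have \<tau>P: "\<tau> (poly P u) = poly P u" "\<tau> (poly Q u) = poly Q u"
    using poly_map_poly_rhom[OF hom(2), of P u] poly_map_poly_rhom[OF hom(2), of Q u] by (simp_all add: polys_fixed PQ images)
  have "poly P u + xs u v 4 * poly Q u = poly P u + v * poly Q u"
    using inv(2) unfolding cPQ by (simp add: rhom_simps[OF hom(2)] \<tau>P images(6) del: xs_simps)
  then have "(xs u v 4 - v) * poly Q u = 0" by (simp add: algebra_simps del: xs_simps)
  moreover have "xs u v 4 ~= v" using inj[of 4 1] by simp
  ultimately have "poly Q u = 0" by (simp del: xs_simps)
  then have cP: "c = poly P u" using cPQ by simp
  obtain P' where P': "P' : polys" "degree P' \<le> 4" "!!k. poly P (xs u v k) = poly P' (xs u v k)" using polys_reduce[OF PQ(1)] by blast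
  have ck: "poly P' (xs u v (int k)) = c" for k proof (induction k)
    case 0
    then show ?case using P'(3)[of 0] cP by simp
  next
    case (Suc k)
    then show ?case using poly_map_poly_rhom[OF hom(1), of P' "xs u v (int k)"] inv(1) by (simp add: polys_fixed P'(1) images(4) ac_simps)
  qed
  have "P' - [:c:] = 0" proof (rule ccontr)
    assume nz: "P' - [:c:] ~= 0"
    have "inj_on (\<lambda>k. xs u v (int k)) {0..<5}" by (rule inj_onI) (auto simp: inj zmod_int[symmetric])
    then have "5 = card ((\<lambda>k. xs u v (int k)) ` {0..<5})" by (simp add: card_image)
    also have "... \<le> card {x. poly (P' - [:c:]) x = 0}" by (rule card_mono[OF poly_roots_finite[OF nz]]) (auto simp: ck)
    also have "... \<le> degree (P' - [:c:])" by (rule card_poly_roots_bound[OF nz])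
    also have "... \<le> 4" using P'(2) by (intro degree_diff_le) auto
    finally show False by simp
  qed
  then have "coeff P' 0 = c" by (metis coeff_pCons_0 eq_iff_diff_eq_0)
  then have "c : A" using P'(1) unfolding polys_def by blast
  then obtain a b where ab: "c = a + b * t" "a : K" "b : K" unfolding A_def by blast
  have "a + b * (- 1 / t) = a + b * t" using inv(3) unfolding ab(1) by (simp add: rhom_simps[OF hom(3)] K_fixed ab(2,3) images)
  then have "b * (t + 1 / t) = 0" by (simp add: algebra_simps)
  moreover have "t + 1 / t ~= 0" using pfun_sq[OF pent] adm by auto
  ultimately have "b = 0" by simp
  then show ?thesis using ab unfolding K_def by simp
qed

end

section \<open>Specialization of the resolvent\<close>

lemma infinite_alg_closure:
  assumes "infinite (UNIV :: 'm::field set)" shows "infinite (UNIV :: 'm alg_closure set)"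
proof
  assume "finite (UNIV :: 'm alg_closure set)"
  then have "finite (range (to_ac :: 'm => _))" by (rule finite_subset[rotated]) simp
  then have "finite (UNIV :: 'm set)" by (rule finite_imageD) (simp add: inj_on_def rhom_eq_iff[OF rhom_to_ac])
  then show False using assms by simp
qed

context
  fixes j :: "'k::field => 'b::alg_closed_field"
  assumes j: "rhom j" and inf: "infinite (UNIV :: 'b set)"
begin

lemma dominant_invariants: "dominant (p1 :: 'k ratfun4) q1 p2 q2"
proof (rule dominantI[OF j inf])
  fix a b c d :: 'b assume "a\<^sup>2 + 4 ~= 0" "c\<^sup>2 + 4 ~= 0"
  obtain u v where u: "pentagon u v" "pfun u v = a" "qfun u v = b" by (rule exists_pentagon_with_invariants[OF \<open>a\<^sup>2 + 4 ~= 0\<close>])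
  obtain u' v' where u': "pentagon u' v'" "pfun u' v' = c" "qfun u' v' = d"
    by (rule exists_pentagon_with_invariants[OF \<open>c\<^sup>2 + 4 ~= 0\<close>])
  interpret place "val j u v u' v'" by (rule place_val[OF j])
  note G = val_generators(2-5)[OF j, of u v u' v']
  have "val j u v u' v' p1 a \<and> val j u v u' v' q1 b \<and> val j u v u' v' p2 c \<and> val j u v u' v' q2 d"
    unfolding generic_invariants[OF j inf] u(2,3)[symmetric] u'(2,3)[symmetric] by (intro conjI pfun qfun G u(1) u'(1))
  then show "\<exists>u v u' v'. val j u v u' v' p1 a \<and> val j u v u' v' q1 b \<and> val j u v u' v' p2 c \<and> val j u v u' v' q2 d" by blast
qed

lemma generic_admissible:
  "(pfun x1 y1 :: 'k ratfun4)\<^sup>2 + 4 ~= 0" "(pfun x2 y2 :: 'k ratfun4)\<^sup>2 + 4 ~= 0"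
proof -
  obtain a b c d :: 'b where *: "a\<^sup>2 + 4 ~= 0" by (rule exists_pentagon_nonzero_value[OF j inf one_neq_zero]) (rule that; assumption)
  obtain u v where u: "pentagon u v" "pfun u v = a" by (rule exists_pentagon_with_invariants[OF *])
  interpret place "val j u v u v" by (rule place_val[OF j])
  note G = val_generators(2-5)[OF j, of u v u v]
  have "val j u v u v ((pfun x1 y1)\<^sup>2 + 4) (a\<^sup>2 + 4)" "val j u v u v ((pfun x2 y2)\<^sup>2 + 4) (a\<^sup>2 + 4)"
    unfolding u(2)[symmetric] by (intro add pow num pfun G u(1))+
  then show "(pfun x1 y1 :: 'k ratfun4)\<^sup>2 + 4 ~= 0" "(pfun x2 y2 :: 'k ratfun4)\<^sup>2 + 4 ~= 0" using nonzero * by blast+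
qed

text \<open>The coefficients lie in the ring generated by the two orbits and are fixed by $F_{20}
  \<times> F_{20}$, so the two pairs of variables can be descended one after the other.\<close>

lemma coeff_H_res:
  "coeff (H_res :: 'k ratfun4 poly) i : subring_gen ({p1, q1, 1 / (p1\<^sup>2 + 4)} \<union> {p2, q2, 1 / (p2\<^sup>2 + 4)})"
proof -
  note c = F20_elements
  define Y1 Y2 where "Y1 = {ys x1 y1 e k :: 'k ratfun4 | e k. True}" and "Y2 = {ys x2 y2 e k :: 'k ratfun4 | e k. True}"
  let ?c = "coeff (H_res :: 'k ratfun4 poly) i"
  have inv: "subst4 g h ?c = ?c" if "g : \<A>" "h : \<A>" for g h
    using H_res_invariant[OF j inf that] coeff_map_poly_rhom[OF rhom_subst4[OF j inf that], of H_res i] by simp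
  have "?c : subring_gen (Y2 \<union> Y1)" proof -
    interpret subring_set "subring_gen (Y2 \<union> Y1)" by (rule subring_set_gen)
    have Y: "ys x1 y1 e k : subring_gen (Y2 \<union> Y1)" "ys x2 y2 e k : subring_gen (Y2 \<union> Y1)" for e k
      unfolding Y1_def Y2_def by (rule subring_gen.base, blast)+
    have "generic_root x : subring_gen (Y2 \<union> Y1)" for x unfolding resolvent_root_def by (cases x) (simp, intro sum mult Y)
    then show ?thesis unfolding H_res_eq[OF j inf] by (intro coeff_prod_linear)
  qed
  have fix1: "subst4 g (0, 0) (ys x2 y2 e k) = (ys x2 y2 e k :: 'k ratfun4)" if "g : \<A>" for g e k
    using subst4_acts(2)[OF j inf that c(1)] by (simp add: acts_by_def aff_def ys_mod)
  have fixY: "subst4 g (0, 0) s = s" if "g : \<A>" "s : Y2" for g s using that(2) fix1[OF that(1)] unfolding Y2_def by (elim CollectE exE conjE) simp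
  interpret D1: descent "x1 :: 'k ratfun4" y1 "subst4 (1, 0) (0, 0)" "subst4 (0, 2) (0, 0)" "subst4 \<r> (0, 0)" Y2
    by (rule descent.intro[OF pentagon_generic(1)[OF j inf] generic_admissible(1) generic_xs_inj(1)[OF j inf]
          rhom_subst4[OF j inf c(4,1)] rhom_subst4[OF j inf c(3,1)] rhom_subst4[OF j inf c(2,1)]
          subst4_acts(1)[OF j inf c(4,1)] subst4_acts(1)[OF j inf c(3,1)] subst4_acts(1)[OF j inf c(2,1)]
          fixY[OF c(4)] fixY[OF c(3)] fixY[OF c(2)]])
  have "?c : subring_gen (Y2 \<union> {pfun x1 y1, qfun x1 y1, 1 / ((pfun x1 y1)\<^sup>2 + 4)})"
    by (rule D1.descent) (use \<open>?c : subring_gen (Y2 \<union> Y1)\<close> inv c in \<open>simp_all add: Y1_def\<close>)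
  then have c2: "?c : subring_gen ({p1, q1, 1 / (p1\<^sup>2 + 4)} \<union> Y2)" unfolding generic_invariants[OF j inf] by (simp only: Un_commute)
  have fix2: "subst4 (0, 0) h x1 = (x1 :: 'k ratfun4)" "subst4 (0, 0) h y1 = (y1 :: 'k ratfun4)" for h by (simp_all add: subst4_generators ys_def)
  have fix3: "subst4 (0, 0) h s = s" if s: "s : {p1, q1, 1 / (p1\<^sup>2 + 4) :: 'k ratfun4}" and h: "h : \<A>" for s h proof -
    note r = rhom_subst4[OF j inf c(1) h]
    have "subst4 (0, 0) h (pfun x1 y1) = (pfun x1 y1 :: 'k ratfun4)" "subst4 (0, 0) h (qfun x1 y1) = (qfun x1 y1 :: 'k ratfun4)"
      by (simp_all add: rhom_pfun[OF r] rhom_qfun[OF r] fix2)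
    then show ?thesis using s unfolding generic_invariants[OF j inf] by (auto simp: rhom_simps[OF r] rhom_divide[OF r])
  qed
  interpret D2: descent "x2 :: 'k ratfun4" y2 "subst4 (0, 0) (1, 0)" "subst4 (0, 0) (0, 2)" "subst4 (0, 0) \<r>" "{p1, q1, 1 / (p1\<^sup>2 + 4)}"
    by (rule descent.intro[OF pentagon_generic(2)[OF j inf] generic_admissible(2) generic_xs_inj(2)[OF j inf]
          rhom_subst4[OF j inf c(1,4)] rhom_subst4[OF j inf c(1,3)] rhom_subst4[OF j inf c(1,2)]
          subst4_acts(2)[OF j inf c(1,4)] subst4_acts(2)[OF j inf c(1,3)] subst4_acts(2)[OF j inf c(1,2)]
          fix3[OF _ c(4)] fix3[OF _ c(3)] fix3[OF _ c(2)]])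
  have "?c : subring_gen ({p1, q1, 1 / (p1\<^sup>2 + 4)} \<union> {pfun x2 y2, qfun x2 y2, 1 / ((pfun x2 y2)\<^sup>2 + 4)})"
    by (rule D2.descent) (use c2 inv c in \<open>simp_all add: Y2_def\<close>)
  then show ?thesis unfolding generic_invariants(7,8)[OF j inf] .
qed

end

theorem H_spec_factorization:
  fixes \<iota> :: "'k::field => 'm::field"
  assumes \<iota>: "rhom \<iota>" and inf: "infinite (UNIV :: 'm set)" and adm: "admissible b" "admissible b'"
    and pt: "point_over b u v" "point_over b' u' v'"
  shows "map_poly to_ac (H_spec \<iota> b b') = (\<Prod>x\<in>indices. [:- resolvent_root u v u' v' x, 1:])"
proof -
  define j where "j = (\<lambda>c. to_ac (\<iota> c))"
  have j: "rhom j" unfolding j_def by (rule rhom_comp[OF rhom_to_ac \<iota>])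
  note inf' = infinite_alg_closure[OF inf]
  interpret R: place "val const4 (p1 :: 'k ratfun4) q1 p2 q2" by (rule place_val[OF rhom_const4])
  interpret Z: place "val \<iota> (fst b) (snd b) (fst b') (snd b')" by (rule place_val[OF \<iota>])
  interpret W: place "val j u v u' v'" by (rule place_val[OF j])
  note T = rhom_simps[OF rhom_to_ac] rhom_divide[OF rhom_to_ac]
  \<comment> \<open>Three compatible facts about a coefficient: \<open>R\<close> expresses it in
    $p,q,p',q'$, \<open>R\<close> has the value \<open>z\<close> at the parameters, and the
    coefficient itself has the same value at the point. Elements with such a \<open>z\<close> form a
    ring containing all generators.\<close>
  define good where "good c z \<longleftrightarrow> (\<exists>R. val const4 p1 q1 p2 q2 R c \<and>
    val \<iota> (fst b) (snd b) (fst b') (snd b') R z \<and> val j u v u' v' c (to_ac z))" for c :: "'k ratfun4" and z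
  have pent: "pentagon u v" "pentagon u' v'" and inv: "pfun u v = to_ac (fst b)" "qfun u v = to_ac (snd b)"
    "pfun u' v' = to_ac (fst b')" "qfun u' v' = to_ac (snd b')" using pt by (auto simp: point_over_def)
  note GW = val_generators(2-5)[OF j, of u v u' v'] and GZ = val_generators(2-5)[OF \<iota>, of "fst b" "snd b" "fst b'" "snd b'"]
    and GR = val_generators(2-5)[OF rhom_const4, of p1 q1 p2 q2]
  note gi = generic_invariants[OF j inf', symmetric]
  have W: "val j u v u' v' p1 (to_ac (fst b))" "val j u v u' v' q1 (to_ac (snd b))"
    "val j u v u' v' p2 (to_ac (fst b'))" "val j u v u' v' q2 (to_ac (snd b'))"
    using W.pfun[OF GW(1,2) pent(1)] W.qfun[OF GW(1,2) pent(1)] W.pfun[OF GW(3,4) pent(2)] W.qfun[OF GW(3,4) pent(2)] unfolding gi inv .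
  have diff: "good (c - c') (z - z')" and mult: "good (c * c') (z * z')" if "good c z" "good c' z'" for c c' z z'
    using that R.diff R.mult Z.diff Z.mult W.diff W.mult unfolding good_def by (simp_all add: T) metis+
  have one: "good 1 1" unfolding good_def using R.one Z.one W.one by (metis T(2))
  have recip: "good (1 / (c\<^sup>2 + 4)) (1 / (z\<^sup>2 + 4))" if c: "good c z" and z: "z\<^sup>2 + 4 ~= 0" for c z proof -
    obtain R where R: "val const4 p1 q1 p2 q2 R c" "val \<iota> (fst b) (snd b) (fst b') (snd b') R z" "val j u v u' v' c (to_ac z)"
      using c unfolding good_def by blast
    have z': "(to_ac z)\<^sup>2 + 4 ~= 0" using z rhom_eq_0_iff[OF rhom_to_ac, of "z\<^sup>2 + 4"] by (simp add: T)
    have w: "val j u v u' v' (c\<^sup>2 + 4) ((to_ac z)\<^sup>2 + 4)" by (intro W.add W.pow W.num R)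
    have "val const4 p1 q1 p2 q2 (1 / (R\<^sup>2 + 4)) (1 / (c\<^sup>2 + 4))" by (intro R.div R.one R.add R.pow R.num R W.nonzero[OF w z'])
    moreover have "val \<iota> (fst b) (snd b) (fst b') (snd b') (1 / (R\<^sup>2 + 4)) (1 / (z\<^sup>2 + 4))"
      by (intro Z.div Z.one Z.add Z.pow Z.num R z)
    moreover have "val j u v u' v' (1 / (c\<^sup>2 + 4)) (to_ac (1 / (z\<^sup>2 + 4)))" unfolding T by (intro W.div W.one w z')
    ultimately show ?thesis unfolding good_def by blast
  qed
  have gens: "good p1 (fst b)" "good q1 (snd b)" "good p2 (fst b')" "good q2 (snd b')" unfolding good_def using GR GZ W by blast+
  interpret S: subring_set "{c. \<exists>z. good c z}" proof
    show "1 : {c. \<exists>z. good c z}" using one by blast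
    fix a b assume "a : {c. \<exists>z. good c z}" "b : {c. \<exists>z. good c z}"
    then obtain z z' where g: "good a z" "good b z'" by blast
    show "a - b : {c. \<exists>z. good c z}" "a * b : {c. \<exists>z. good c z}" using diff[OF g] mult[OF g] by blast+
  qed
  have "subring_gen ({p1, q1, 1 / (p1\<^sup>2 + 4)} \<union> {p2, q2, 1 / (p2\<^sup>2 + 4)}) \<subseteq> {c. \<exists>z. good c z}"
    using gens recip[OF gens(1)] recip[OF gens(3)] adm unfolding admissible_def by (intro subring_gen_least[OF S.subring_set_axioms]) auto
  then have coeffs: "\<exists>z. good (coeff H_res i) z" for i using coeff_H_res[OF j inf'] by blast
  note dom = dominant_invariants[OF j inf']
  have spec: "specialize \<iota> b b' c = z" if cz: "good c z" for c z proof -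
    obtain R where R: "val const4 p1 q1 p2 q2 R c" "val \<iota> (fst b) (snd b) (fst b') (snd b') R z" using cz unfolding good_def by blast
    have e: "eval_ratfun4 const4 p1 q1 p2 q2 R = c" by (rule eval_ratfun4_val[OF rhom_const4 R(1)])
    \<comment> \<open>Algebraic independence of the invariants makes the substitution injective, so
      the \<open>R\<close> at hand is the one meant in \<open>specialize\<close>.\<close>
    have "(THE R. eval_ratfun4 const4 p1 q1 p2 q2 R = c) = R" using e rhom_eq_iff[OF dominant_rhom[OF dom]] by (intro the_equality) auto
    then show ?thesis unfolding specialize_def using eval_ratfun4_val[OF \<iota> R(2)] by simp
  qed
  have s0: "specialize \<iota> b b' 0 = 0" using spec[OF diff[OF one one]] by simp
  show ?thesis proof (rule poly_eqI)
    fix i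
    obtain z where z: "good (coeff H_res i) z" using coeffs by blast
    have "val j u v u' v' (coeff H_res i) (coeff (\<Prod>x\<in>indices. [:- resolvent_root u v u' v' x, 1:]) i)"
      unfolding H_res_eq[OF j inf'] by (rule W.coeff_prod_linear) (intro W.resolvent_root GW pent)
    moreover have "val j u v u' v' (coeff H_res i) (to_ac z)" using z unfolding good_def by blast
    ultimately have "coeff (\<Prod>x\<in>indices. [:- resolvent_root u v u' v' x, 1:]) i = to_ac z" by (rule W.unique)
    then show "coeff (map_poly to_ac (H_spec \<iota> b b')) i = coeff (\<Prod>x\<in>indices. [:- resolvent_root u v u' v' x, 1:]) i"
      unfolding H_spec_def by (simp add: coeff_map_poly s0 spec[OF z])
  qed
qed

section \<open>Existence of Tschirnhausen equivalent parameters with squarefree resolvent\<close>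

section \<open>Cross ratios of five points\<close>

text \<open>
  Cross ratios identify the surface of pentagons with the moduli space of five points on the
  projective line, on which \<open>F20\<close> acts by permuting the points.
\<close>

definition cross :: "(int => 'a::field) => int => 'a" where
  "cross w k = (w (k + 1) - w (k + 4)) * (w (k + 3) - w (k + 2)) / ((w (k + 1) - w (k + 3)) * (w (k + 4) - w (k + 2)))"

text \<open>On the left \<open>a1\<close> cancels; what remains is the three-term identity between
  products of differences of \<open>a0\<close>, \<open>a2\<close>, \<open>a3\<close>,
  \<open>a4\<close>.\<close>

lemma cross_identity:
  fixes a0 a1 a2 a3 a4 :: "'a::field"
  assumes "a1 ~= a3" "a4 ~= a2" "a0 ~= a3" "a1 ~= a4"
  shows "(a1 - a4) * (a3 - a2) / ((a1 - a3) * (a4 - a2)) * ((a3 - a1) * (a0 - a4) / ((a3 - a0) * (a1 - a4)))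
    = 1 - (a2 - a0) * (a4 - a3) / ((a2 - a4) * (a0 - a3))"
proof -
  have nz: "(a1 - a3) * (a4 - a2) * ((a3 - a0) * (a1 - a4)) ~= 0" "(a2 - a4) * (a0 - a3) ~= 0" using assms by auto
  have "1 - (a2 - a0) * (a4 - a3) / ((a2 - a4) * (a0 - a3)) = ((a2 - a4) * (a0 - a3) - (a2 - a0) * (a4 - a3)) / ((a2 - a4) * (a0 - a3))"
    by (simp only: diff_divide_distrib divide_self[OF nz(2)])
  also have "... = (a1 - a4) * (a3 - a2) * ((a3 - a1) * (a0 - a4)) / ((a1 - a3) * (a4 - a2) * ((a3 - a0) * (a1 - a4)))"
    by (subst frac_eq_eq[OF nz(2,1)]) (simp add: algebra_simps)
  finally show ?thesis by (simp only: times_divide_times_eq)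
qed

lemma cross_odd_identity:
  fixes b1 b2 b3 b4 :: "'a::field"
  assumes "b1 ~= b3" "b4 ~= b2" "b2 ~= b1" "b3 ~= b4" and y: "y = (b1 - b4) * (b3 - b2) / ((b1 - b3) * (b4 - b2))"
  shows "y / (y - 1) = (b2 - b3) * (b1 - b4) / ((b2 - b1) * (b3 - b4))"
proof -
  have nz: "(b1 - b3) * (b4 - b2) ~= 0" "(b2 - b1) * (b3 - b4) ~= 0" using assms by auto
  have "y - 1 = ((b1 - b4) * (b3 - b2) - (b1 - b3) * (b4 - b2)) / ((b1 - b3) * (b4 - b2))"
    unfolding y by (simp only: diff_divide_distrib divide_self[OF nz(1)])
  also have "(b1 - b4) * (b3 - b2) - (b1 - b3) * (b4 - b2) = - ((b2 - b1) * (b3 - b4))" by (simp add: algebra_simps)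
  finally have "y / (y - 1) = (b1 - b4) * (b3 - b2) / (- ((b2 - b1) * (b3 - b4)))" unfolding y using nz(1) by simp
  also have "... = (b2 - b3) * (b1 - b4) / ((b2 - b1) * (b3 - b4))" by (subst frac_eq_eq) (use nz(2) in \<open>auto simp: algebra_simps\<close>)
  finally show ?thesis .
qed

text \<open>Numerator and denominator are kept apart, so that later conditions can be cleared to
  polynomials in the points. For odd \<open>e\<close> the quotient is $x/(x-1)$, which is again a
  cross ratio of the same four points.\<close>

definition cross_num :: "(int => 'a::field) => int => int => 'a" where
  "cross_num w e k = (if even e then (w (k + 1) - w (k + 4)) * (w (k + 3) - w (k + 2)) else (w (k + 2) - w (k + 3)) * (w (k + 1) - w (k + 4)))"

definition cross_den :: "(int => 'a::field) => int => int => 'a" where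
  "cross_den w e k = (if even e then (w (k + 1) - w (k + 3)) * (w (k + 4) - w (k + 2)) else (w (k + 2) - w (k + 1)) * (w (k + 3) - w (k + 4)))"

locale five_points =
  fixes w :: "int => 'a::field"
  assumes w_eq_iff: "w k = w l \<longleftrightarrow> k mod 5 = l mod 5"
begin

lemma per: "k mod 5 = l mod 5 ==> w k = w l" by (simp add: w_eq_iff)

lemma add_mod5: "(k + i) mod 5 = (k + j) mod 5 \<longleftrightarrow> i mod 5 = (j :: int) mod 5" by (metis add_diff_cancel_left mod_eq_dvd_iff)

lemma ne: "i mod 5 ~= j mod 5 ==> w (k + i) ~= w (k + j)" by (simp add: w_eq_iff add_mod5)

abbreviation "u \<equiv> cross w 0"
abbreviation "v \<equiv> cross w 1"

lemma cross_rec: "cross w k * cross w (k + 2) = 1 - cross w (k + 1)"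
proof -
  have p: "w (k + 5) = w (k + 0)" "w (k + 6) = w (k + 1)" by (rule per; simp add: add_mod5)+
  have i: "k + 1 + 1 = k + 2" "k + 1 + 2 = k + 3" "k + 1 + 3 = k + 4" "k + 1 + 4 = k + 5"
    "k + 2 + 1 = k + 3" "k + 2 + 2 = k + 4" "k + 2 + 3 = k + 5" "k + 2 + 4 = k + 6" by simp_all
  show ?thesis unfolding cross_def i p by (rule cross_identity; rule ne; simp)
qed

lemma cross_neq_0: "cross w k ~= 0" unfolding cross_def using ne[of 1 4 k] ne[of 3 2 k] ne[of 1 3 k] ne[of 4 2 k] by simp

lemma cross_per: "k mod 5 = l mod 5 ==> cross w k = cross w l"
proof -
  assume kl: "k mod 5 = l mod 5"
  have "w (k + i) = w (l + i)" for i by (rule per) (metis kl mod_add_left_eq)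
  then show ?thesis by (simp add: cross_def)
qed

lemma pentagon_cross: "pentagon u v"
proof -
  have r: "u * cross w 2 = 1 - v" "v * cross w 3 = 1 - cross w 2" "cross w 4 * v = 1 - u"
    using cross_rec[of 0] cross_rec[of 1] cross_rec[of 4] cross_per[of 6 1] cross_per[of 5 0] by simp_all
  have "u ~= 1" "v ~= 1" using r(1,3) cross_neq_0 by auto
  moreover have "u * (1 - cross w 2) = u + v - 1" using r(1) by (simp add: algebra_simps)
  then have "u * (v * cross w 3) = u + v - 1" using r(2) by simp
  then have "u + v - 1 ~= 0" using cross_neq_0 by (metis mult_eq_0_iff)
  ultimately show ?thesis using cross_neq_0 by (auto simp: pentagon_def)
qed

lemma xs_cross: "xs u v k = cross w k" by (rule xs_eqI[OF pentagon_cross refl refl cross_rec cross_per, symmetric])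

abbreviation "num \<equiv> cross_num w"
abbreviation "den \<equiv> cross_den w"

lemma den_neq_0: "den e k ~= 0" unfolding cross_den_def using ne[of 1 3 k] ne[of 4 2 k] ne[of 2 1 k] ne[of 3 4 k] by simp

lemma ys_cross: "ys u v e k = num e k / den e k"
proof (cases "even e")
  case True
  then have "ys u v e k = cross w k" by (simp add: ys_def xs_cross)
  then show ?thesis using True by (simp only: cross_num_def cross_den_def cross_def[of w k] if_True)
next
  case False
  have "cross w k / (cross w k - 1) = (w (k + 2) - w (k + 3)) * (w (k + 1) - w (k + 4)) / ((w (k + 2) - w (k + 1)) * (w (k + 3) - w (k + 4)))"
    by (rule cross_odd_identity[OF ne[of 1 3 k] ne[of 4 2 k] ne[of 2 1 k] ne[of 3 4 k] cross_def]) simp_all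
  then show ?thesis using False by (simp only: ys_def xs_cross cross_num_def cross_den_def if_False)
qed

text \<open>Multiplication by $2^i$ permutes the four offsets occurring in a cross ratio. The
  multipliers 1 and 4 reproduce it; 2 and 3 turn it into the odd form.\<close>

lemma cross_affine:
  assumes i: "i : {0..<4}"
  shows "cross (\<lambda>k. w (2 ^ nat i * k + n)) k = ys u v i (2 ^ nat i * k + n)"
proof -
  define l where "l = 2 ^ nat i * k + n"
  have s: "w (2 ^ nat i * (k + j) + n) = w (l + m)" if "(2 ^ nat i * j) mod 5 = m mod 5" for j m proof (rule per)
    have "2 ^ nat i * (k + j) + n = l + 2 ^ nat i * j" by (simp add: l_def algebra_simps)
    then show "(2 ^ nat i * (k + j) + n) mod 5 = (l + m) mod 5" using that by (simp add: add_mod5)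
  qed
  have swap: "(a - c) * (d - e) = (c - a) * (e - d)" for a c d e :: 'a by (simp add: algebra_simps)
  consider "i = 0" | "i = 1" | "i = 2" | "i = 3" using range4_cases[OF i] by blast
  then show ?thesis proof cases
    case 1
    note s' = s[of 1 1] s[of 2 2] s[of 3 3] s[of 4 4]
    have "cross (\<lambda>k. w (2 ^ nat i * k + n)) k = (w (l + 1) - w (l + 4)) * (w (l + 3) - w (l + 2)) / ((w (l + 1) - w (l + 3)) * (w (l + 4) - w (l + 2)))"
      unfolding cross_def using s' 1 by simp
    then show ?thesis unfolding l_def[symmetric] ys_cross cross_num_def cross_den_def using 1 by simp
  next
    case 2
    note s' = s[of 1 2] s[of 2 4] s[of 3 1] s[of 4 3]
    have "cross (\<lambda>k. w (2 ^ nat i * k + n)) k = (w (l + 2) - w (l + 3)) * (w (l + 1) - w (l + 4)) / ((w (l + 2) - w (l + 1)) * (w (l + 3) - w (l + 4)))"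
      unfolding cross_def using s' 2 by simp
    then show ?thesis unfolding l_def[symmetric] ys_cross cross_num_def cross_den_def using 2 by simp
  next
    case 3
    note s' = s[of 1 4] s[of 2 3] s[of 3 2] s[of 4 1]
    have "cross (\<lambda>k. w (2 ^ nat i * k + n)) k = (w (l + 4) - w (l + 1)) * (w (l + 2) - w (l + 3)) / ((w (l + 4) - w (l + 2)) * (w (l + 1) - w (l + 3)))"
      unfolding cross_def using s' 3 by simp
    also have "... = (w (l + 1) - w (l + 4)) * (w (l + 3) - w (l + 2)) / ((w (l + 1) - w (l + 3)) * (w (l + 4) - w (l + 2)))"
      by (simp only: swap[of "w (l + 4)" "w (l + 1)" "w (l + 2)" "w (l + 3)"] mult.commute[of "w (l + 4) - w (l + 2)"])
    finally show ?thesis unfolding l_def[symmetric] ys_cross cross_num_def cross_den_def using 3 by simp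
  next
    case 4
    note s' = s[of 1 3] s[of 2 1] s[of 3 4] s[of 4 2]
    have "cross (\<lambda>k. w (2 ^ nat i * k + n)) k = (w (l + 3) - w (l + 2)) * (w (l + 4) - w (l + 1)) / ((w (l + 3) - w (l + 4)) * (w (l + 2) - w (l + 1)))"
      unfolding cross_def using s' 4 by simp
    also have "... = (w (l + 2) - w (l + 3)) * (w (l + 1) - w (l + 4)) / ((w (l + 2) - w (l + 1)) * (w (l + 3) - w (l + 4)))"
      by (simp only: swap[of "w (l + 3)" "w (l + 2)" "w (l + 4)" "w (l + 1)"] mult.commute[of "w (l + 3) - w (l + 4)"])
    finally show ?thesis unfolding l_def[symmetric] ys_cross cross_num_def cross_den_def using 4 by simp
  qed
qed

lemma acts_by_cross:
  assumes \<phi>: "rhom \<phi>" and g: "g : \<A>" and w: "!!k. \<phi> (w k) = w (aff g k)"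
  shows "acts_by \<phi> u v g"
proof -
  have g': "snd g : {0..<4}" "snd g \<ge> 0" using fst_snd_F20[OF g] by auto
  have "\<phi> (w k) = w (2 ^ nat (snd g) * k + fst g)" for k unfolding w by (rule per) (simp add: aff_def)
  then have "\<phi> (cross w k) = cross (\<lambda>k. w (2 ^ nat (snd g) * k + fst g)) k" for k
    by (simp add: cross_def rhom_simps[OF \<phi>] rhom_divide[OF \<phi>])
  then have c: "\<phi> (cross w k) = ys u v (snd g) (2 ^ nat (snd g) * k + fst g)" for k by (simp add: cross_affine[OF g'(1)])
  have uv: "\<phi> u = ys u v (snd g) (fst g)" "\<phi> v = ys u v (snd g) (2 ^ nat (snd g) + fst g)" using c[of 0] c[of 1] by simp_all
  show ?thesis unfolding acts_by_def rhom_ys[OF \<phi>] uv pentagon_affine(2)[OF pentagon_cross g'(2)] ys_aff by simp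
qed

end

lemma exists_five_points:
  fixes u v :: "'a::field"
  assumes inf: "infinite (UNIV :: 'a set)" and p: "pentagon u v"
  shows "\<exists>w. five_points w \<and> cross w 0 = u \<and> cross w 1 = v"
proof -
  obtain m where m: "m \<notin> {0, 1, v, 1 - u}" using ex_new_if_finite[OF inf, of "{0, 1, v, 1 - u}"] by auto
  \<comment> \<open>The points $v, 1-u, 0, \<infinity>, 1$, numbered from 0 to 4, have the required
    cross ratios. The projective map $x \<mapsto> 1/(x-m)$ moves them to finite places, sending
    \<infinity> to 0; the choice of \<open>m\<close> avoids poles.\<close>
  define r0 r1 r2 r4 where "r0 = v - m" and "r1 = 1 - u - m" and "r2 = - m" and "r4 = 1 - m"
  have nz: "r0 ~= 0" "r1 ~= 0" "r2 ~= 0" "r4 ~= 0" using m by (auto simp: r0_def r1_def r2_def r4_def)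
  have r42: "r4 - r2 = 1" by (simp add: r4_def r2_def)
  have p': "u ~= 0" "v ~= 0" "u ~= 1" "v ~= 1" "u + v ~= 1" using p by (auto simp: pentagon_def)
  have d: "r0 ~= r1" "r0 ~= r2" "r0 ~= r4" "r1 ~= r2" "r1 ~= r4" "r2 ~= r4" proof -
    have "r0 - r1 = u + v - 1" "r0 - r2 = v" "r0 - r4 = v - 1" "r1 - r2 = 1 - u" "r1 - r4 = - u" "r2 - r4 = - 1"
      by (simp_all add: r0_def r1_def r2_def r4_def)
    then show "r0 ~= r1" "r0 ~= r2" "r0 ~= r4" "r1 ~= r2" "r1 ~= r4" "r2 ~= r4" using p' by auto
  qed
  define w where "w k = (if k mod 5 = 0 then inverse r0 else if k mod 5 = 1 then inverse r1 else if k mod 5 = 2 then inverse r2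
    else if k mod 5 = 3 then 0 else inverse r4)" for k :: int
  have fp: "five_points w" proof
    show "w k = w l \<longleftrightarrow> k mod 5 = l mod 5" for k l
      by (rule mod5_cases[of k]; rule mod5_cases[of l]) (simp_all add: w_def nz d d[THEN not_sym])
  qed
  have inv_diff: "inverse a - inverse b = (b - a) * inverse a * inverse b" if "a ~= 0" "b ~= 0" for a b :: 'a using that by (simp add: field_simps)
  have i42: "inverse r4 - inverse r2 = - (inverse r4 * inverse r2)" "inverse r2 - inverse r4 = inverse r4 * inverse r2" proof -
    have "r2 - r4 = - 1" using r42 by (simp add: r4_def r2_def)
    then show "inverse r4 - inverse r2 = - (inverse r4 * inverse r2)" unfolding inv_diff[OF nz(4,3)] by simp
    show "inverse r2 - inverse r4 = inverse r4 * inverse r2" unfolding inv_diff[OF nz(3,4)] r42 by simp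
  qed
  have c: "(inverse a - inverse r4) * (0 - inverse r2) / ((inverse a - 0) * (inverse r4 - inverse r2)) = r4 - a"
    if "a ~= 0" for a proof -
    have "t * x * y * (0 - z) / ((x - 0) * (- (y * z))) = t" if "x ~= 0" "y ~= 0" "z ~= 0" for t x y z :: 'a using that by simp
    then show ?thesis unfolding inv_diff[OF that nz(4)] i42(1) using that nz by simp
  qed
  have c': "(inverse r2 - inverse a) * (inverse r4 - 0) / ((inverse r2 - inverse r4) * (inverse a - 0)) = a - r2"
    if "a ~= 0" for a proof -
    have "t * z * x * (y - 0) / (y * z * (x - 0)) = t" if "x ~= 0" "y ~= 0" "z ~= 0" for t x y z :: 'a using that by simp
    then show ?thesis unfolding inv_diff[OF nz(3) that] i42(2) using that nz by simp
  qed
  have "cross w 0 = u" using c[OF nz(2)] unfolding cross_def w_def by (simp add: r4_def r1_def)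
  moreover have "cross w 1 = v" using c'[OF nz(1)] unfolding cross_def w_def by (simp add: r0_def r2_def)
  ultimately show ?thesis using fp by blast
qed

section \<open>Linear independence\<close>

abbreviation ys_indices :: "(int \<times> int) set" where "ys_indices \<equiv> {0, 1} \<times> {0..<5}"

lemma sum_ys_indices:
  "(\<Sum>x\<in>ys_indices. d x * ys u v (fst x) (snd x)) =
    d (0, 0) * u + d (0, 1) * v + d (0, 2) * ((1 - v) / u) + d (0, 3) * ((u + v - 1) / (u * v)) + d (0, 4) * ((1 - u) / v)
    + d (1, 0) * (u / (u - 1)) + d (1, 1) * (v / (v - 1)) + d (1, 2) * ((1 - v) / u / ((1 - v) / u - 1))
    + d (1, 3) * ((u + v - 1) / (u * v) / ((u + v - 1) / (u * v) - 1)) + d (1, 4) * ((1 - u) / v / ((1 - u) / v - 1))"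
proof -
  have five: "{0..<5} = {0, 1, 2, 3, 4 :: int}" by auto
  have "(\<Sum>x\<in>ys_indices. d x * ys u v (fst x) (snd x)) = (\<Sum>e\<in>{0, 1}. \<Sum>k\<in>{0..<5}. d (e, k) * ys u v e k)"
    by (simp add: sum.cartesian_product case_prod_beta')
  then show ?thesis unfolding five by (simp add: ys_def add.assoc)
qed

text \<open>Compare the residues along \<open>u = 1\<close>.\<close>

lemma ys_relation_coefficient:
  fixes d :: "int \<times> int => 'a::field"
  assumes inf: "infinite (UNIV :: 'a set)"
    and rel: "!!u v. pentagon u v ==> (\<Sum>x\<in>ys_indices. d x * ys u v (fst x) (snd x)) = 0"
  shows "d (1, 0) = 0"
proof -
  have key: "d (1, 0) * (v - 1) = d (1, 3) * v" if v: "v ~= 0" "v ~= 1" for v proof -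
    let ?X = "[:0, 1:] :: 'a poly"
    let ?A = "[:-1, 1:] :: 'a poly" and ?B = "[:v - 1, 1:] :: 'a poly"
    \<comment> \<open>For fixed \<open>v\<close> this is the relation multiplied by $u(u-1)(u+v-1)$,
      as a polynomial in $u$. At $u = 1$ only the terms \<open>(1, 0)\<close> and
      \<open>(1, 3)\<close>, with a pole there, survive.\<close>
    define P where "P = smult (d (0, 0)) (?X * ?X * ?A * ?B) + smult (d (0, 1) * v) (?X * ?A * ?B) + smult (d (0, 2) * (1 - v)) (?A * ?B)
      + smult (d (0, 3) / v) (?A * ?B * ?B) - smult (d (0, 4) / v) (?X * ?A * ?A * ?B) + smult (d (1, 0)) (?X * ?X * ?B)
      + smult (d (1, 1) * v / (v - 1)) (?X * ?A * ?B) + smult (d (1, 2) * (v - 1)) (?X * ?A)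
      - smult (d (1, 3) / (v - 1)) (?X * ?B * ?B) + smult (d (1, 4)) (?X * ?A * ?A)"
    have root: "poly P u = 0" if u: "u \<notin> {0, 1, 1 - v}" for u proof -
      have nz: "u ~= 0" "u - 1 ~= 0" "u + v - 1 ~= 0" using u by (auto simp: algebra_simps)
      have pent: "pentagon u v" using u v by (auto simp: pentagon_def algebra_simps)
      have v1: "v - 1 ~= 0" using v by simp
      define a b where "a = u - 1" and "b = u + v - 1"
      have ab: "a ~= 0" "b ~= 0" using nz by (simp_all add: a_def b_def)
      have 2: "(1 - v) / u / ((1 - v) / u - 1) = (v - 1) / b" proof -
        have "(1 - v) / u - 1 = - b / u" using nz by (simp add: b_def field_simps)
        then have "(1 - v) / u / ((1 - v) / u - 1) = (1 - v) / (- b)" using nz by simp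
        also have "... = (v - 1) / b" by (subst frac_eq_eq) (use ab in \<open>auto simp: algebra_simps\<close>)
        finally show ?thesis .
      qed
      have 3: "b / (u * v) / (b / (u * v) - 1) = - b / (a * (v - 1))" proof -
        have "b / (u * v) - 1 = - (a * (v - 1)) / (u * v)" using nz v by (simp add: a_def b_def field_simps)
        then show ?thesis using nz v by simp
      qed
      have 4: "(1 - u) / v / ((1 - u) / v - 1) = a / b" proof -
        have "(1 - u) / v - 1 = - b / v" using v by (simp add: b_def field_simps)
        then have "(1 - u) / v / ((1 - u) / v - 1) = (1 - u) / (- b)" using v by simp
        also have "... = a / b" by (subst frac_eq_eq) (use ab in \<open>auto simp: a_def algebra_simps\<close>)
        finally show ?thesis .
      qed
      have "0 = u * a * b * (d (0, 0) * u + d (0, 1) * v + d (0, 2) * ((1 - v) / u) + d (0, 3) * (b / (u * v)) + d (0, 4) * ((1 - u) / v)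
        + d (1, 0) * (u / a) + d (1, 1) * (v / (v - 1)) + d (1, 2) * ((v - 1) / b)
        + d (1, 3) * (- b / (a * (v - 1))) + d (1, 4) * (a / b))"
        using rel[OF pent] unfolding sum_ys_indices 2 4 unfolding a_def[symmetric] b_def[symmetric] 3 by simp
      also have "... = d (0, 0) * (u * u * a * b) + d (0, 1) * v * (u * a * b) + d (0, 2) * (1 - v) * (a * b) + d (0, 3) / v * (a * b * b)
        - d (0, 4) / v * (u * a * a * b) + d (1, 0) * (u * u * b) + d (1, 1) * v / (v - 1) * (u * a * b) + d (1, 2) * (v - 1) * (u * a)
        - d (1, 3) / (v - 1) * (u * b * b) + d (1, 4) * (u * a * a)" proof -
        have "1 - u = - a" by (simp add: a_def)
        moreover have
          "u * a * b * (x * u) = x * (u * u * a * b)" "u * a * b * (x * v) = x * v * (u * a * b)"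
          "u * a * b * (x * ((1 - v) / u)) = x * (1 - v) * (a * b)" "u * a * b * (x * (b / (u * v))) = x / v * (a * b * b)"
          "u * a * b * (x * (- a / v)) = - (x / v * (u * a * a * b))" "u * a * b * (x * (u / a)) = x * (u * u * b)"
          "u * a * b * (x * (v / (v - 1))) = x * v / (v - 1) * (u * a * b)" "u * a * b * (x * ((v - 1) / b)) = x * (v - 1) * (u * a)"
          "u * a * b * (x * (- b / (a * (v - 1)))) = - (x / (v - 1) * (u * b * b))" "u * a * b * (x * (a / b)) = x * (u * a * a)" for x
          using nz(1) ab v(1) v1 by simp_all
        ultimately show ?thesis by (simp only: distrib_left diff_conv_add_uminus)
      qed
      also have "... = poly P u" proof -
        have "poly ?A u = a" "poly ?B u = b" "poly ?X u = u" by (simp_all add: a_def b_def)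
        then show ?thesis unfolding P_def by (simp only: poly_add poly_diff poly_smult poly_mult)
      qed
      finally show ?thesis by simp
    qed
    have "P = 0" proof (rule ccontr)
      assume "P ~= 0"
      then have "finite ({u. poly P u = 0} \<union> {0, 1, 1 - v})" using poly_roots_finite by simp
      moreover have "{u. poly P u = 0} \<union> {0, 1, 1 - v} = UNIV" using root by blast
      ultimately show False using inf by metis
    qed
    then have "poly P 1 = 0" by simp
    moreover have "poly ?A 1 = 0" "poly ?B 1 = v" "poly ?X 1 = 1" by simp_all
    ultimately have "d (1, 0) * v - d (1, 3) / (v - 1) * (v * v) = 0"
      unfolding P_def by (simp only: poly_add poly_diff poly_smult poly_mult mult_zero_left mult_zero_right mult_1_left mult_1_right add_0_left add_0_right diff_zero)
    then have "v * (d (1, 0) * (v - 1) - d (1, 3) * v) = 0" using v by (simp add: field_simps)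
    then show ?thesis using v by simp
  qed
  let ?Q = "[:- d (1, 0), d (1, 0) - d (1, 3):]"
  have "?Q = 0" proof (rule ccontr)
    assume "?Q ~= 0"
    then have "finite {v. poly ?Q v = 0}" by (rule poly_roots_finite)
    then have "finite ({v. poly ?Q v = 0} \<union> {0, 1})" by (rule finite_UnI) simp
    moreover have "poly ?Q v = 0" if "v ~= 0" "v ~= 1" for v using key[OF that] by (simp add: algebra_simps)
    then have "{v. poly ?Q v = 0} \<union> {0, 1} = UNIV" by blast
    ultimately show False using inf by metis
  qed
  then show ?thesis by simp
qed

lemma double_shift_mod2: "((a + c) mod 2 + c) mod 2 = a mod (2 :: int)" by presburger

lemma shift_mod2_cancel: "(a + c) mod 2 = (b + c) mod 2 ==> a mod 2 = b mod (2 :: int)" by presburger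

lemma even_mod2: "even (a mod 2) \<longleftrightarrow> even (a :: int)" by presburger

lemma mod2_cases: "c mod 2 = 0 \<or> c mod 2 = (1 :: int)" by presburger

text \<open>The group permutes the ten functions transitively, so any nonzero coefficient of a
  relation can be moved to the place \<open>(1, 0)\<close>, where it must vanish. The element
  \<open>(k0, 1 - e0)\<close> provides this move.\<close>

lemma ys_independent:
  fixes d :: "int \<times> int => 'a::field"
  assumes inf: "infinite (UNIV :: 'a set)" and x0: "x0 : ys_indices" "d x0 ~= 0"
  shows "\<exists>u v. pentagon u v \<and> (\<Sum>x\<in>ys_indices. d x * ys u v (fst x) (snd x)) ~= 0"
proof (rule ccontr)
  assume "\<not> ?thesis"
  then have rel: "(\<Sum>x\<in>ys_indices. d x * ys u v (fst x) (snd x)) = 0" if "pentagon u v" for u v using that by blast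
  obtain e0 k0 where e0: "x0 = (e0, k0)" "e0 = 0 \<or> e0 = 1" "k0 : {0..<5}" using x0(1) by (cases x0) auto
  define g' where "g' = (k0, 1 - e0)"
  have g': "g' : \<A>" using e0 by (auto simp: g'_def carrier_F20)
  define g where "g = inv\<^bsub>F20\<^esub> g'"
  have g: "g : \<A>" unfolding g_def using g' by simp
  have nn: "snd g \<ge> 0" "snd g' \<ge> 0" using fst_snd_F20[OF g] fst_snd_F20[OF g'] by auto
  have g'g: "g' \<cdot> g = \<e>" unfolding g_def using g' by simp
  have "(snd g' + snd g) mod 4 = 0" using arg_cong[OF g'g, of snd] by (simp add: snd_mult_F20 one_F20)
  then have par: "even (snd g) \<longleftrightarrow> even (1 - e0)" unfolding g'_def by simp presburger
  have a: "aff g' (aff g k) = k" if "k : {0..<5}" for k using aff_mult[OF nn(2,1), of k] that g'g by (simp add: aff_one)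
  define f where "f x = ((fst x + snd g) mod 2, aff g (snd x))" for x :: "int \<times> int"
  define d' where "d' x = d ((fst x + snd g) mod 2, aff g' (snd x))" for x
  have df: "d' (f x) = d x" if x: "x : ys_indices" for x proof -
    have e: "fst x mod 2 = fst x" and k: "snd x : {0..<5}" using x by auto
    have "((fst x + snd g) mod 2 + snd g) mod 2 = fst x" unfolding double_shift_mod2 by (rule e)
    then show ?thesis using a[OF k] by (simp add: d'_def f_def)
  qed
  have inj: "inj_on f ys_indices" proof (rule inj_onI)
    fix x y assume x: "x : ys_indices" and y: "y : ys_indices" and eq: "f x = f y"
    have e: "fst x mod 2 = fst x" "fst y mod 2 = fst y" and k: "snd x : {0..<5}" "snd y : {0..<5}" using x y by auto
    have eqs: "(fst x + snd g) mod 2 = (fst y + snd g) mod 2" "aff g (snd x) = aff g (snd y)" using eq by (simp_all add: f_def)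
    have "fst x = fst y" using shift_mod2_cancel[OF eqs(1)] e by simp
    moreover have "snd x = snd y" using a[OF k(1)] a[OF k(2)] eqs(2) by metis
    ultimately show "x = y" by (rule prod_eqI)
  qed
  have "f ` ys_indices \<subseteq> ys_indices" proof (rule image_subsetI)
    fix x show "f x : ys_indices" unfolding f_def by (intro SigmaI aff_range) (use mod2_cases in blast)
  qed
  then have "f ` ys_indices = ys_indices" by (rule endo_inj_surj[OF _ _ inj, rotated]) simp
  then have bij: "bij_betw f ys_indices ys_indices" unfolding bij_betw_def using inj by blast
  have "(\<Sum>x\<in>ys_indices. d' x * ys u v (fst x) (snd x)) = 0" if p: "pentagon u v" for u v proof -
    let ?u = "ys u v (snd g) (fst g)" and ?v = "ys u v (snd g) (2 ^ nat (snd g) + fst g)"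
    have "(\<Sum>x\<in>ys_indices. d' x * ys u v (fst x) (snd x)) = (\<Sum>x\<in>ys_indices. d' (f x) * ys u v (fst (f x)) (snd (f x)))"
      by (rule sum.reindex_bij_betw[OF bij, symmetric])
    also have "... = (\<Sum>x\<in>ys_indices. d x * ys ?u ?v (fst x) (snd x))" proof (rule sum.cong[OF refl])
      fix x assume x: "x : ys_indices"
      have "ys u v (fst (f x)) (snd (f x)) = ys u v (fst x + snd g) (aff g (snd x))" by (rule ys_cong) (simp_all add: f_def even_mod2)
      then show "d' (f x) * ys u v (fst (f x)) (snd (f x)) = d x * ys ?u ?v (fst x) (snd x)"
        unfolding df[OF x] pentagon_affine(2)[OF p nn(1)] ys_aff by simp
    qed
    also have "... = 0" by (rule rel[OF pentagon_affine(1)[OF p nn(1)]])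
    finally show ?thesis .
  qed
  from ys_relation_coefficient[OF inf this] have "d ((1 + snd g) mod 2, aff g' 0) = 0" by (simp add: d'_def)
  moreover have "aff g' 0 = k0" using e0(3) by (simp add: g'_def aff_def)
  moreover have "(1 + snd g) mod 2 = e0" using par e0(2) by presburger
  ultimately show False using x0(2) e0(1) by simp
qed

section \<open>Tschirnhausen transformations in general position\<close>

text \<open>Only polynomiality in each single variable is needed.\<close>

definition polyfun :: "((nat => 'b::field) => 'b) => bool" where
  "polyfun F \<longleftrightarrow> (\<forall>c j. \<exists>P. \<forall>z. F (c(j := z)) = poly P z)"

lemma polyfun_const: "polyfun (\<lambda>_. a)" unfolding polyfun_def by (intro allI exI[of _ "[:a:]"]) simp

lemma polyfun_coord: "polyfun (\<lambda>c. c i)" unfolding polyfun_def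
proof (intro allI)
  fix c :: "nat => 'a" and j
  show "\<exists>P. \<forall>z. (c(j := z)) i = poly P z" by (cases "i = j") (intro exI[of _ "[:0, 1:]"], simp, intro exI[of _ "[:c i:]"], simp)
qed

lemma polyfun_binop:
  assumes "polyfun F" "polyfun G"
  shows "polyfun (\<lambda>c. F c + G c)" "polyfun (\<lambda>c. F c - G c)" "polyfun (\<lambda>c. F c * G c)"
proof -
  have *: "\<exists>P. \<forall>z. H (F (c(j := z))) (G (c(j := z))) = poly P z"
    if H: "!!P Q z. H (poly P z) (poly Q z) = poly (H' P Q) z" for H H' c j proof -
    obtain P Q where "\<forall>z. F (c(j := z)) = poly P z" "\<forall>z. G (c(j := z)) = poly Q z" using assms unfolding polyfun_def by metis
    then show ?thesis by (intro exI[of _ "H' P Q"]) (simp add: H)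
  qed
  show "polyfun (\<lambda>c. F c + G c)" unfolding polyfun_def using *[of "(+)" "(+)"] by simp
  show "polyfun (\<lambda>c. F c - G c)" unfolding polyfun_def using *[of "(-)" "(-)"] by simp
  show "polyfun (\<lambda>c. F c * G c)" unfolding polyfun_def using *[of "(*)" "(*)"] by simp
qed

lemma polyfun_sum: "(!!i. i : A ==> polyfun (F i)) ==> polyfun (\<lambda>c. \<Sum>i\<in>A. F i c)"
  by (induction A rule: infinite_finite_induct) (simp_all add: polyfun_const polyfun_binop)

lemma polyfun_prod: "(!!i. i : A ==> polyfun (F i)) ==> polyfun (\<lambda>c. \<Prod>i\<in>A. F i c)"
  by (induction A rule: infinite_finite_induct) (simp_all add: polyfun_const polyfun_binop)

lemma polyfun_power: "polyfun F ==> polyfun (\<lambda>c. F c ^ n)" by (induction n) (simp_all add: polyfun_const polyfun_binop)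

text \<open>Coordinates are replaced by base elements one at a time. In each coordinate every $F_i$
  is a nonzero polynomial, so only finitely many values are forbidden; each function may start from
  its own nonvanishing point \<open>C i\<close>.\<close>

lemma exists_base_nonzero:
  fixes F :: "'i => (nat => 'm::field alg_closure) => 'm alg_closure"
  assumes inf: "infinite (UNIV :: 'm set)" and I: "finite I"
    and F: "!!i. i : I ==> polyfun (F i)" "!!i. i : I ==> F i (C i) ~= 0"
  shows "\<exists>c. \<forall>i\<in>I. F i (\<lambda>j. if j < n then to_ac (c j) else C i j) ~= 0"
proof (induction n)
  case 0
  then show ?case using F by simp
next
  case (Suc n)
  then obtain c where c: "\<forall>i\<in>I. F i (\<lambda>j. if j < n then to_ac (c j) else C i j) ~= 0" by blast
  define C' where "C' i j = (if j < n then to_ac (c j) else C i j)" for i j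
  have "\<forall>i\<in>I. \<exists>P. \<forall>z. F i ((C' i)(n := z)) = poly P z" using F(1) unfolding polyfun_def by blast
  then obtain P where P: "!!i z. i : I ==> F i ((C' i)(n := z)) = poly (P i) z" by metis
  have P0: "P i ~= 0" if i: "i : I" for i proof
    assume P0: "P i = 0"
    have "F i ((C' i)(n := C' i n)) = 0" unfolding P[OF i] P0 by simp
    then have "F i (C' i) = 0" by (simp only: fun_upd_triv)
    then show False using c i by (simp add: C'_def[abs_def])
  qed
  have "finite (\<Union>i\<in>I. {z. poly (P i) z = 0})" using I poly_roots_finite[OF P0] by blast
  then obtain c0 where c0: "to_ac c0 \<notin> (\<Union>i\<in>I. {z. poly (P i) z = 0})" by (rule infinite_avoid[OF inf])
  have "F i (\<lambda>j. if j < Suc n then to_ac ((c(n := c0)) j) else C i j) ~= 0" if i: "i : I" for i proof -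
    have "(\<lambda>j. if j < Suc n then to_ac ((c(n := c0)) j) else C i j) = (C' i)(n := to_ac c0)" by (auto simp: C'_def fun_eq_iff)
    then show ?thesis using P[OF i, of "to_ac c0"] c0 i by auto
  qed
  then show ?case by blast
qed

lemma sum_clear_denominators:
  fixes N D :: "'i => 'a::field"
  assumes J: "finite J" and D: "!!i. i : J ==> D i ~= 0"
  shows "(\<Sum>i\<in>J. d i * N i * (\<Prod>l\<in>J - {i}. D l)) = (\<Prod>l\<in>J. D l) * (\<Sum>i\<in>J. d i * (N i / D i))"
  unfolding sum_distrib_left
proof (rule sum.cong[OF refl])
  fix i assume i: "i : J"
  show "d i * N i * (\<Prod>l\<in>J - {i}. D l) = (\<Prod>l\<in>J. D l) * (d i * (N i / D i))" unfolding prod.remove[OF J i] using D[OF i] by simp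
qed

lemma exists_interpolation:
  fixes z :: "int => 'a::field"
  assumes inj: "inj_on z {0..<5}"
  shows "\<exists>c. (\<forall>j\<ge>5. c j = 0) \<and> (\<forall>k\<in>{0..<5}. (\<Sum>j<5. c j * z k ^ j) = \<omega> k)"
proof -
  define L where "L i = (\<Prod>l\<in>{0..<5} - {i}. [:- z l, 1:])" for i :: int
  define P where "P = (\<Sum>i\<in>{0..<5}. smult (\<omega> i / poly (L i) (z i)) (L i))"
  have Lii: "poly (L i) (z i) ~= 0" if "i : {0..<5}" for i using inj_onD[OF inj _ that] that by (auto simp: L_def poly_prod)
  have Lik: "poly (L i) (z k) = 0" if "k : {0..<5}" "k ~= i" for i k unfolding L_def poly_prod by (rule prod_zero) (use that in auto)
  have P: "poly P (z k) = \<omega> k" if k: "k : {0..<5}" for k proof -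
    have "poly P (z k) = (\<Sum>i\<in>{0..<5}. if i = k then \<omega> k else 0)"
      unfolding P_def poly_sum by (rule sum.cong[OF refl]) (use Lii Lik k in auto)
    then show ?thesis using k by simp
  qed
  have dL: "degree (L i) \<le> 4" if i: "i : {0..<5}" for i proof -
    have "degree (L i) \<le> sum (degree \<circ> (\<lambda>l. [:- z l, 1:])) ({0..<5} - {i})" unfolding L_def by (rule degree_prod_sum_le) simp
    also have "... = card ({0..<5} - {i})" by (simp add: comp_def)
    also have "... = 4" using i by (subst card_Diff_singleton) auto
    finally show ?thesis .
  qed
  have dP: "degree P \<le> 4" unfolding P_def by (rule degree_sum_le) (use dL in \<open>auto intro: order_trans[OF degree_smult_le]\<close>)
  have "(\<Sum>j<5. coeff P j * x ^ j) = poly P x" for x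
    unfolding poly_altdef by (rule sum.mono_neutral_right) (use dP in \<open>auto simp: coeff_eq_0\<close>)
  moreover have "coeff P j = 0" if "j \<ge> 5" for j using that dP by (simp add: coeff_eq_0)
  ultimately show ?thesis using P by (intro exI[of _ "coeff P"]) auto
qed

lemma acts_by_zs:
  assumes "rhom \<phi>" "acts_by \<phi> u v g" "pentagon u v" shows "\<phi> (zs u v k) = zs u v (aff g k)"
proof -
  have "\<phi> (ys u v 0 k) = ys u v (0 + snd g) (aff g k)" using assms(2) unfolding acts_by_def by blast
  then show ?thesis using zs_ys[OF assms(3), of 0 k] zs_ys[OF assms(3), of "0 + snd g" "aff g k"]
    by (metis rhom_divide[OF assms(1)] rhom_diff[OF assms(1)] rhom_1[OF assms(1)] rhom_power[OF assms(1)])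
qed

text \<open>The map $x \<mapsto> (x-1)/x^2$ has degree two, and its fibre through $x$ consists of
  $x$ and $x/(x-1)$.\<close>

lemma zs_eqD:
  assumes p: "pentagon u v" and eq: "zs u v k = zs u v l"
  shows "ys u v 0 k = ys u v 0 l \<or> ys u v 1 k = ys u v 0 l"
proof -
  define a c where "a = xs u v k" and "c = xs u v l"
  have nz: "a ~= 0" "c ~= 0" "a - 1 ~= 0" using xs_neq_0[OF p] xs_neq_1[OF p] by (auto simp: a_def c_def)
  have "(a - 1) * c\<^sup>2 = (c - 1) * a\<^sup>2" using eq nz unfolding zs_def a_def[symmetric] c_def[symmetric] by (simp add: frac_eq_eq)
  then have "(c - a) * (c * (a - 1) - a) = 0" by (simp add: algebra_simps power2_eq_square)
  then have "c = a \<or> c * (a - 1) = a" by auto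
  then have "c = a \<or> a / (a - 1) = c" using nz by (auto simp: field_simps)
  then show ?thesis by (auto simp: ys_0 ys_1 a_def c_def)
qed

lemma prod_mset_proots_linear:
  fixes z :: "'i => 'a::idom"
  assumes "finite A"
  shows "(\<Prod>\<alpha>\<in>#proots (\<Prod>k\<in>A. [:- z k, 1:]). g \<alpha>) = (\<Prod>k\<in>A. g (z k))" using assms
proof induction
  case (insert k A)
  have "(\<Prod>k\<in>A. [:- z k, 1:]) ~= 0" using insert.hyps by simp
  then have "proots ([:- z k, 1:] * (\<Prod>k\<in>A. [:- z k, 1:])) = {#z k#} + proots (\<Prod>k\<in>A. [:- z k, 1:])" by (subst proots_mult) simp_all
  then show ?case unfolding prod.insert[OF insert.hyps] using insert.IH by simp
qed simp

lemma degree_f_F20: "degree (f_F20 b) = 5" by (cases b) (simp add: f_F20_def)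

lemma tschirnhausenI:
  assumes "quintic_point b u v" "quintic_point b' u' v'" "degree U < 5"
    and U: "!!k. poly (map_poly to_ac U) (zs u v k) = zs u' v' k"
  shows "tschirnhausen (f_F20 b) (f_F20 b')" unfolding tschirnhausen_def degree_f_F20
    quintic_point.f_factorization[OF assms(1)] quintic_point.f_factorization[OF assms(2)]
  by (intro exI[of _ U] conjI assms(3), subst prod_mset_proots_linear) (simp_all add: U)

context quintic_point
begin

lemma exists_code:
  assumes "g : \<A>" obtains \<phi> where "\<phi> : ac_auts" "code \<phi> = g" using assms code_surj by (metis imageE)

text \<open>Zeros with the same stabilizers are polynomials in each other.\<close>

lemma exists_zero_polynomial:
  assumes z: "!!k. z k : splitting_field (f_F20 b)" "!!k. z' k : splitting_field (f_F20 b)"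
    and \<phi>: "!!\<phi> k. \<phi> : ac_auts ==> \<phi> (z k) = z (aff (code \<phi>) k)" "!!\<phi> k. \<phi> : ac_auts ==> \<phi> (z' k) = z' (aff (code \<phi>) k)"
    and inj: "!!k l. z k = z l ==> k mod 5 = l mod 5" and per: "!!k. z (k mod 5) = z k" "!!k. z' (k mod 5) = z' k"
  shows "\<exists>U. degree U < 5 \<and> (\<forall>k. poly (map_poly to_ac U) (z k) = z' k)"
proof (rule stabilizer_imp_polynomial[OF galois_splitting_field z(1)[of 0] z(2)[of 0]])
  fix \<phi> assume f: "\<phi> : ac_auts" "\<phi> (z 0) = z 0"
  then have "z (aff (code \<phi>) 0) = z 0" using \<phi>(1) by simp
  then have "aff (code \<phi>) 0 = 0" using inj[of "aff (code \<phi>) 0" 0] by (simp add: aff_def)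
  then show "\<phi> (z' 0) = z' 0" using \<phi>(2)[OF f(1), of 0] by simp
next
  fix U assume U: "z' 0 = poly (map_poly to_ac U) (z 0)" "degree U < card {\<phi> (z 0) |\<phi>. \<phi> : ac_auts}"
  have "{\<phi> (z 0) |\<phi>. \<phi> : ac_auts} \<subseteq> z ` {0..<5}" proof
    fix x assume "x : {\<phi> (z 0) |\<phi>. \<phi> : ac_auts}"
    then obtain \<phi>' where "\<phi>' : ac_auts" "x = \<phi>' (z 0)" by blast
    then have "x = z (aff (code \<phi>') 0)" using \<phi>(1) by simp
    then show "x : z ` {0..<5}" using aff_range by blast
  qed
  then have "card {\<phi> (z 0) |\<phi>. \<phi> : ac_auts} \<le> card (z ` {0..<5})" by (intro card_mono) simp_all
  also have "... \<le> 5" using card_image_le[of "{0..<5::int}" z] by simp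
  finally have d: "degree U < 5" using U(2) by simp
  have "poly (map_poly to_ac U) (z k) = z' k" for k proof -
    have "(k mod 5, 0) : \<A>" by (simp add: carrier_F20)
    then obtain \<psi> where \<psi>: "\<psi> : ac_auts" "code \<psi> = (k mod 5, 0)" by (rule exists_code)
    have a: "aff (code \<psi>) 0 = k mod 5" by (simp add: \<psi>(2) aff_def)
    have "\<psi> (z' 0) = poly (map_poly to_ac U) (\<psi> (z 0))" unfolding U(1) by (rule ac_auts_poly[OF \<psi>(1)])
    then show ?thesis using \<phi>[OF \<psi>(1), of 0] by (simp add: a per)
  qed
  then show ?thesis using d by blast
qed

text \<open>Equivariance under the same codes makes the invariants of the new point lie in the base,
  so it defines new parameters. Old and new zeros have the same stabilizers, hence are polynomials
  in each other; injectivity keeps the new zeros distinct.\<close>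

lemma transfer_point:
  assumes p: "pentagon u' v'" and adm': "(pfun u' v')\<^sup>2 + 4 ~= 0"
    and L: "u' : splitting_field (f_F20 b)" "v' : splitting_field (f_F20 b)"
    and acts: "!!\<phi>. \<phi> : ac_auts ==> acts_by \<phi> u' v' (code \<phi>)"
    and inj: "inj_on (\<lambda>x. ys u' v' (fst x) (snd x)) ys_indices"
  shows "\<exists>b'. quintic_point b' u' v' \<and> tschirnhausen_equiv (f_F20 b) (f_F20 b')"
proof -
  let ?L = "splitting_field (f_F20 b)"
  note gal_L = galois_splitting_field
  have K: "intermediate ?L" using gal_L by (simp add: galois_field_def)
  note I = intermediate_intros[OF K] intermediate_sum[OF K]
  have xsL: "xs u' v' k : ?L" for k unfolding xs_def using L by (auto intro!: I)
  have tL: "tfun u' v' : ?L" unfolding tfun_def using L by (auto intro!: I)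
  have sL: "sfun u' v' : ?L" unfolding sfun_def using xsL by (auto intro!: I)
  have pqL: "pfun u' v' : ?L" "qfun u' v' : ?L" unfolding pfun_def qfun_def using tL sL by (auto intro!: I)
  have zL: "zs u' v' k : ?L" for k unfolding zs_def using xsL by (auto intro!: I)
  have fixed: "\<phi> (pfun u' v') = pfun u' v'" "\<phi> (qfun u' v') = qfun u' v'" if \<phi>: "\<phi> : ac_auts" for \<phi> proof -
    note h = ac_auts_rhom[OF \<phi>]
    define g where "g = code \<phi>"
    have g: "snd g : {0..<4}" unfolding g_def using fst_snd_F20[OF code(1)[OF \<phi>]] by blast
    have "\<phi> (ys u' v' 0 0) = ys u' v' (snd g) (2 ^ nat (snd g) * 0 + fst g)" "\<phi> (ys u' v' 0 1) = ys u' v' (snd g) (2 ^ nat (snd g) * 1 + fst g)"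
      using acts[OF \<phi>] unfolding acts_by_def g_def[symmetric] ys_aff by simp_all
    then have uv: "\<phi> u' = ys u' v' (snd g) (fst g)" "\<phi> v' = ys u' v' (snd g) (2 ^ nat (snd g) + fst g)" by (simp_all add: ys_0)
    show "\<phi> (pfun u' v') = pfun u' v'" "\<phi> (qfun u' v') = qfun u' v'"
      unfolding rhom_pfun[OF h] rhom_qfun[OF h] uv by (rule pfun_qfun_affine[OF p g])+
  qed
  have "pfun u' v' : range to_ac" "qfun u' v' : range to_ac" using gal_L pqL fixed unfolding galois_field_def by blast+
  then obtain p0 q0 where pq: "pfun u' v' = to_ac p0" "qfun u' v' = to_ac q0" by blast
  define b' where "b' = (p0, q0)"
  have pt': "point_over b' u' v'" using p pq by (simp add: point_over_def b'_def)
  have "to_ac (p0\<^sup>2 + 4) ~= 0" using adm' pq(1) by (simp add: rhom_simps[OF rhom_to_ac])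
  then have "p0\<^sup>2 + 4 ~= 0" using rhom_0[OF rhom_to_ac] by metis
  then have ad: "admissible b'" by (simp add: admissible_def b'_def)
  have map': "map_poly to_ac (f_F20 b') = f_F20 (pfun u' v', qfun u' v')" unfolding b'_def map_poly_f_F20[OF rhom_to_ac] pq ..
  have roots': "{x. poly (map_poly to_ac (f_F20 b')) x = 0} = zs u' v' ` {0..<5}" unfolding map' f_F20_root_iff[OF p adm'] by auto
  have z_act: "\<phi> (zs u' v' k) = zs u' v' (aff (code \<phi>) k)" if "\<phi> : ac_auts" for \<phi> k
    by (rule acts_by_zs[OF ac_auts_rhom[OF that] acts[OF that] p])
  have z_inj: "k mod 5 = l mod 5" if eq: "zs u' v' k = zs u' v' l" for k l proof -
    have m: "ys u' v' e (k mod 5) = ys u' v' e k" for e k by (rule ys_mod)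
    have i: "(e, k mod 5) : ys_indices" if "e = 0 \<or> e = 1" for e k :: int using that by auto
    from zs_eqD[OF p eq] show ?thesis proof
      assume "ys u' v' 0 k = ys u' v' 0 l"
      then have "(0 :: int, k mod 5) = (0, l mod 5)" by (intro inj_onD[OF inj _ i i]) (simp_all add: m)
      then show ?thesis by simp
    next
      assume "ys u' v' 1 k = ys u' v' 0 l"
      then have "(1 :: int, k mod 5) = (0, l mod 5)" by (intro inj_onD[OF inj _ i i]) (simp_all add: m)
      then show ?thesis by simp
    qed
  qed
  have zm: "zs u v (k mod 5) = zs u v k" "zs u' v' (k mod 5) = zs u' v' k" for k by (rule zs_cong; simp)+
  have zLb: "zs u v k : ?L" for k proof -
    have "zs u v (k mod 5) : ?L" unfolding splitting_field_f by (rule subsetD[OF subset_generated]) simp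
    then show ?thesis by (simp add: zm)
  qed
  obtain U where U: "degree U < 5" "!!k. poly (map_poly to_ac U) (zs u v k) = zs u' v' k"
    using exists_zero_polynomial[OF zLb zL code_zs z_act _ zm] zs_inj by metis
  obtain U' where U': "degree U' < 5" "!!k. poly (map_poly to_ac U') (zs u' v' k) = zs u v k"
    using exists_zero_polynomial[OF zL zLb z_act code_zs z_inj zm(2,1)] by metis
  have "splitting_field (f_F20 b') = ?L" proof
    show "splitting_field (f_F20 b') \<subseteq> ?L" unfolding splitting_field_eq[of "f_F20 b'"] roots'
      by (rule generated_minimal[OF K]) (use zL in blast)
    have K': "intermediate (splitting_field (f_F20 b'))" unfolding splitting_field_eq by (rule intermediate_generated)
    have z': "zs u' v' k : splitting_field (f_F20 b')" for k proof -
      have "zs u' v' (k mod 5) : splitting_field (f_F20 b')" unfolding splitting_field_eq roots' by (rule subsetD[OF subset_generated]) simp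
      then show ?thesis by (simp add: zm)
    qed
    have "zs u v k : splitting_field (f_F20 b')" for k using polys_over_poly[OF K' polys_over_base[OF K'] z', of U' k] by (simp add: U'(2))
    then show "?L \<subseteq> splitting_field (f_F20 b')" unfolding splitting_field_f by (intro generated_minimal[OF K']) blast
  qed
  then have "Gal (f_F20 b') \<cong> F20" using gal unfolding Gal_def by simp
  then have Q: "quintic_point b' u' v'" using inf ad pt' by unfold_locales
  have "tschirnhausen_equiv (f_F20 b) (f_F20 b')" unfolding tschirnhausen_equiv_def
    using tschirnhausenI[OF quintic_point_axioms Q U] tschirnhausenI[OF Q quintic_point_axioms U'] by blast
  then show ?thesis using Q by blast
qed

end

text \<open>The linear form in the ten cross ratios multiplied by all denominators, which makes it
  polynomial in the five points.\<close>

definition cleared_sum :: "(int \<times> int => 'a::field) => (int => 'a) => 'a" where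
  "cleared_sum d w = (\<Sum>x\<in>ys_indices. d x * cross_num w (fst x) (snd x) * (\<Prod>y\<in>ys_indices - {x}. cross_den w (fst y) (snd y)))"

text \<open>The products of numerators and denominators satisfy $N = -tD$, so this is $D^2(t^2+1)$
  and its nonvanishing means admissibility.\<close>

definition cleared_norm :: "(int => 'a::field) => 'a" where
  "cleared_norm w = (\<Prod>k\<in>{0..4}. cross_num w 0 k)\<^sup>2 + (\<Prod>k\<in>{0..4}. cross_den w 0 k)\<^sup>2"

context five_points
begin

lemma cleared_sum_iff: "cleared_sum d w ~= 0 \<longleftrightarrow> (\<Sum>x\<in>ys_indices. d x * ys u v (fst x) (snd x)) ~= 0"
proof -
  have fJ: "finite ys_indices" by simp
  have eq: "cleared_sum d w = (\<Prod>y\<in>ys_indices. den (fst y) (snd y)) * (\<Sum>x\<in>ys_indices. d x * (num (fst x) (snd x) / den (fst x) (snd x)))"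
    unfolding cleared_sum_def by (rule sum_clear_denominators[OF fJ den_neq_0])
  have nz: "(\<Prod>y\<in>ys_indices. den (fst y) (snd y)) ~= 0" unfolding prod_zero_iff[OF fJ] using den_neq_0 by blast
  show ?thesis unfolding ys_cross eq mult_eq_0_iff using nz by blast
qed

lemma cleared_norm_iff: "cleared_norm w ~= 0 \<longleftrightarrow> (pfun u v)\<^sup>2 + 4 ~= 0"
proof -
  let ?N = "\<Prod>k\<in>{0..4}. num 0 k" and ?D = "\<Prod>k\<in>{0..4}. den 0 k" and ?t = "tfun u v"
  have D: "?D ~= 0" by (subst prod_zero_iff) (simp_all add: den_neq_0)
  have t: "?t ~= 0" by (rule tfun_neq_0[OF pentagon_cross])
  have "?N / ?D = (\<Prod>k\<in>{0..4}. xs u v k)" unfolding prod_dividef[symmetric] by (rule prod.cong[OF refl]) (simp add: ys_cross[symmetric] ys_0)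
  also have "... = - ?t" unfolding atLeast0AtMost4_int using xs_relations(7)[OF pentagon_cross] by (simp add: mult.assoc del: xs_simps)
  finally have "?N = - ?t * ?D" using D by (simp add: divide_eq_eq)
  then have "cleared_norm w = ?D\<^sup>2 * (?t\<^sup>2 + 1)" unfolding cleared_norm_def by (simp add: power2_eq_square algebra_simps)
  moreover have "?t + 1 / ?t = (?t\<^sup>2 + 1) / ?t" using t by (simp add: power2_eq_square add_divide_distrib)
  ultimately show ?thesis unfolding pfun_sq[OF pentagon_cross] using D t by simp
qed

end

lemma exists_admissible_pentagon:
  "\<exists>u v :: 'a::alg_closed_field. pentagon u v \<and> (pfun u v)\<^sup>2 + 4 ~= 0"
proof -
  obtain p :: 'a where p: "p\<^sup>2 + 4 ~= 0" proof (cases "(4 :: 'a) = 0")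
    case True
    then have "(1 :: 'a)\<^sup>2 + 4 ~= 0" by (simp only: True power_one add_0_right one_neq_zero not_False_eq_True)
    then show ?thesis using that by blast
  next
    case False
    then show ?thesis using that[of 0] by simp
  qed
  show ?thesis by (rule exists_pentagon_with_invariants[OF p, of 0]) (use p in blast)
qed

context quintic_point
begin

text \<open>The images of the zeros under a general Tschirnhausen transformation with coefficients
  \<open>c\<close>. For coefficients in the base, Galois permutes them in the same way as the
  zeros.\<close>

definition tvalues :: "(nat => 'm alg_closure) => int => 'm alg_closure" where
  "tvalues c k = (\<Sum>j<5. c j * zs u v k ^ j)"

lemma polyfun_values: "polyfun (\<lambda>c. tvalues c k)" unfolding tvalues_def by (intro polyfun_sum polyfun_binop polyfun_coord polyfun_const)

lemma polyfun_cross: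
  "polyfun (\<lambda>c. cross_num (tvalues c) e k)" "polyfun (\<lambda>c. cross_den (tvalues c) e k)"
proof -
  have "polyfun (\<lambda>c. (tvalues c i - tvalues c j) * (tvalues c l - tvalues c m))" for i j l m
    by (rule polyfun_binop(3); rule polyfun_binop(2); rule polyfun_values)
  then show "polyfun (\<lambda>c. cross_num (tvalues c) e k)" "polyfun (\<lambda>c. cross_den (tvalues c) e k)"
    unfolding cross_num_def cross_den_def by (cases "even e"; simp)+
qed

lemma polyfun_cleared:
  "polyfun (\<lambda>c. cleared_sum d (tvalues c))" "polyfun (\<lambda>c. cleared_norm (tvalues c))"
proof -
  show "polyfun (\<lambda>c. cleared_sum d (tvalues c))" unfolding cleared_sum_def
    by (rule polyfun_sum, rule polyfun_binop(3), rule polyfun_binop(3), rule polyfun_const, rule polyfun_cross(1),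
        rule polyfun_prod, rule polyfun_cross(2))
  show "polyfun (\<lambda>c. cleared_norm (tvalues c))" unfolding cleared_norm_def
    by (rule polyfun_binop(1); rule polyfun_power; rule polyfun_prod; rule polyfun_cross)
qed

lemma values_per: "k mod 5 = l mod 5 ==> tvalues c k = tvalues c l" unfolding tvalues_def using zs_cong[of k l u v] by simp

lemma exists_values:
  assumes w: "five_points w" shows "\<exists>c. tvalues c = w"
proof -
  interpret five_points w by (rule w)
  have "inj_on (zs u v) {0..<5}" by (rule inj_onI) (simp add: zs_inj)
  from exists_interpolation[OF this, of w] obtain c where c: "\<forall>k\<in>{0..<5}. (\<Sum>j<5. c j * zs u v k ^ j) = w k" by blast
  have "tvalues c k = w k" for k proof -
    have "tvalues c k = tvalues c (k mod 5)" by (rule values_per) simp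
    also have "... = w (k mod 5)" unfolding tvalues_def using c by simp
    also have "... = w k" by (rule per) simp
    finally show ?thesis .
  qed
  then show ?thesis by blast
qed

lemma five_points_over: "pentagon a c ==> \<exists>w :: int => 'm alg_closure. five_points w \<and> cross w 0 = a \<and> cross w 1 = c"
  by (rule exists_five_points[OF infinite_alg_closure[OF inf]])

text \<open>Each condition alone can be met over the closure: suitable five points exist, and
  interpolation realizes them as values. Being polynomial in the coefficients, the finitely many
  conditions then hold together for coefficients in the base.\<close>

lemma exists_general_values:
  assumes \<D>: "finite \<D>" "!!d. d : \<D> ==> \<exists>x\<in>ys_indices. d x ~= 0"
  shows "\<exists>c. let w = tvalues (\<lambda>j. to_ac (c j)) in five_points w \<and> cleared_norm w ~= 0 \<and> (\<forall>d\<in>\<D>. cleared_sum d w ~= 0)"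
proof -
  define \<F> :: "((int => 'm alg_closure) => 'm alg_closure) set" where
    "\<F> = (\<lambda>p w. w (fst p) - w (snd p)) ` {p \<in> {0..<5} \<times> {0..<5}. fst p ~= snd p} \<union> {cleared_norm} \<union> cleared_sum ` \<D>"
  have "finite {p \<in> {0..<5} \<times> {0..<5 :: int}. fst p ~= snd p}" by (rule finite_subset[of _ "{0..<5} \<times> {0..<5}"]) auto
  then have fin: "finite \<F>" unfolding \<F>_def using \<D>(1) by (intro finite_UnI finite_imageI) simp_all
  obtain a0 c0 :: "'m alg_closure" where ac: "pentagon a0 c0" "(pfun a0 c0)\<^sup>2 + 4 ~= 0" using exists_admissible_pentagon by blast
  obtain w0 :: "int => 'm alg_closure" where w0: "five_points w0" "cross w0 0 = a0" "cross w0 1 = c0" using five_points_over[OF ac(1)] by blast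
  have ex: "\<exists>c. G (tvalues c) ~= 0" and pf: "polyfun (\<lambda>c. G (tvalues c))" if G: "G : \<F>" for G proof -
    consider (1) k where "k : {0..<5} \<times> {0..<5}" "fst k ~= snd k" "G = (\<lambda>w. w (fst k) - w (snd k))" | (2) "G = cleared_norm"
      | (3) d where "d : \<D>" "G = cleared_sum d" using G unfolding \<F>_def by blast
    then have "(\<exists>w. five_points w \<and> G w ~= 0) \<and> polyfun (\<lambda>c. G (tvalues c))" proof cases
      case 1
      have "fst k mod 5 = fst k" "snd k mod 5 = snd k" using 1(1) by auto
      then have "w0 (fst k) - w0 (snd k) ~= 0" using five_points.w_eq_iff[OF w0(1), of "fst k" "snd k"] 1(2) by simp
      then show ?thesis using w0(1) polyfun_binop(2)[OF polyfun_values polyfun_values] unfolding 1(3) by blast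
    next
      case 2
      then show ?thesis using w0 ac(2) five_points.cleared_norm_iff[OF w0(1)] polyfun_cleared(2) by auto
    next
      case 3
      obtain x where x: "x : ys_indices" "d x ~= 0" using \<D>(2)[OF 3(1)] by blast
      obtain a1 c1 where a1: "pentagon a1 c1" "(\<Sum>x\<in>ys_indices. d x * ys a1 c1 (fst x) (snd x)) ~= 0"
        using ys_independent[where d = d, OF infinite_alg_closure[OF inf] x] by blast
      obtain w :: "int => 'm alg_closure" where w: "five_points w" "cross w 0 = a1" "cross w 1 = c1" using five_points_over[OF a1(1)] by blast
      have "cleared_sum d w ~= 0" using five_points.cleared_sum_iff[OF w(1), of d] a1(2) w(2,3) by simp
      then show ?thesis unfolding 3(2) using w(1) polyfun_cleared(1) by blast
    qed
    then obtain w where w: "five_points w" "G w ~= 0" and pf: "polyfun (\<lambda>c. G (tvalues c))" by blast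
    obtain c where "tvalues c = w" using exists_values[OF w(1)] by blast
    then show "\<exists>c. G (tvalues c) ~= 0" using w(2) by blast
    show "polyfun (\<lambda>c. G (tvalues c))" by (rule pf)
  qed
  obtain C where C: "!!G. G : \<F> ==> G (tvalues (C G)) ~= 0" using ex by metis
  have "\<exists>c. \<forall>G\<in>\<F>. G (tvalues (\<lambda>j. if j < 5 then to_ac (c j) else C G j)) ~= 0"
    by (rule exists_base_nonzero[where F = "\<lambda>G c. G (tvalues c)", OF inf fin]) (erule pf, erule C)
  then obtain c where c: "\<forall>G\<in>\<F>. G (tvalues (\<lambda>j. if j < 5 then to_ac (c j) else C G j)) ~= 0" by blast
  define w where "w = tvalues (\<lambda>j. to_ac (c j))"
  have nz: "G w ~= 0" if "G : \<F>" for G proof -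
    have "tvalues (\<lambda>j. if j < 5 then to_ac (c j) else C G j) = w" unfolding w_def tvalues_def by (intro ext sum.cong) auto
    then show ?thesis using c that by metis
  qed
  have "five_points w" proof
    fix k l
    show "w k = w l \<longleftrightarrow> k mod 5 = l mod 5" proof
      assume eq: "w k = w l"
      show "k mod 5 = l mod 5" proof (rule ccontr)
        assume ne: "k mod 5 ~= l mod 5"
        then have "(\<lambda>w. w (k mod 5) - w (l mod 5)) : \<F>" unfolding \<F>_def by (intro UnI1 image_eqI[of _ _ "(k mod 5, l mod 5)"]) simp_all
        from nz[OF this] have "w (k mod 5) - w (l mod 5) ~= 0" .
        then show False using eq values_per[of "k mod 5" k] values_per[of "l mod 5" l] by (simp add: w_def)
      qed
    qed (unfold w_def, rule values_per)
  qed
  moreover have "cleared_norm w ~= 0" by (rule nz[of cleared_norm]) (unfold \<F>_def, blast)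
  moreover have "cleared_sum d w ~= 0" if "d : \<D>" for d by (rule nz[of "cleared_sum d"]) (use that in \<open>unfold \<F>_def, blast\<close>)
  ultimately show ?thesis unfolding Let_def w_def by blast
qed

text \<open>The forms \<delta> are differences of two coordinates and enforce that the ten values
  are distinct; \<D> carries the additional linear conditions of the caller.\<close>

theorem exists_general_position:
  assumes \<D>: "finite \<D>" "!!d. d : \<D> ==> \<exists>x\<in>ys_indices. d x ~= 0"
  shows "\<exists>b' u' v'. quintic_point b' u' v' \<and> tschirnhausen_equiv (f_F20 b) (f_F20 b') \<and>
    inj_on (\<lambda>x. ys u' v' (fst x) (snd x)) ys_indices \<and>
    (\<forall>d\<in>\<D>. (\<Sum>x\<in>ys_indices. d x * ys u' v' (fst x) (snd x)) ~= 0)"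
proof -
  define \<delta> :: "(int \<times> int) \<times> (int \<times> int) => int \<times> int => 'm alg_closure" where
    "\<delta> = (\<lambda>(x, y) z. (if z = x then 1 else 0) - (if z = y then 1 else 0))"
  define \<D>' where "\<D>' = \<D> \<union> \<delta> ` {(x, y) \<in> ys_indices \<times> ys_indices. x ~= y}"
  have fJ: "finite ys_indices" by simp
  have "finite {(x, y) \<in> ys_indices \<times> ys_indices. x ~= y}"
    by (rule finite_subset[of _ "ys_indices \<times> ys_indices"]) (blast, intro finite_cartesian_product fJ)
  then have D1: "finite \<D>'" unfolding \<D>'_def using \<D>(1) by blast
  have D2: "\<exists>x\<in>ys_indices. d x ~= 0" if d: "d : \<D>'" for d proof (cases "d : \<D>")
    case False
    then have "d : \<delta> ` {(x, y) \<in> ys_indices \<times> ys_indices. x ~= y}" using d unfolding \<D>'_def by blast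
    then obtain x y where "x : ys_indices" "x ~= y" "d = \<delta> (x, y)" by blast
    then show ?thesis by (intro bexI[of _ x]) (simp_all add: \<delta>_def)
  qed (rule \<D>(2))
  have "\<exists>c. let w = tvalues (\<lambda>j. to_ac (c j)) in
    five_points w \<and> cleared_norm w ~= 0 \<and> (\<forall>d\<in>\<D>'. cleared_sum d w ~= 0)" by (rule exists_general_values[OF D1]) (rule D2)
  then obtain c where c: "let w = tvalues (\<lambda>j. to_ac (c j)) in
    five_points w \<and> cleared_norm w ~= 0 \<and> (\<forall>d\<in>\<D>'. cleared_sum d w ~= 0)" by (elim exE)
  define w where "w = tvalues (\<lambda>j. to_ac (c j))"
  interpret w: five_points w using c unfolding w_def Let_def by blast
  have sums: "(\<Sum>x\<in>ys_indices. d x * ys w.u w.v (fst x) (snd x)) ~= 0" if "d : \<D>'" for d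
    using c that w.cleared_sum_iff[of d] unfolding w_def[symmetric] Let_def by blast
  have adm': "(pfun w.u w.v)\<^sup>2 + 4 ~= 0" using c w.cleared_norm_iff unfolding w_def[symmetric] Let_def by blast
  have inj: "inj_on (\<lambda>x. ys w.u w.v (fst x) (snd x)) ys_indices" proof (rule inj_onI, rule ccontr)
    fix x y assume x: "x : ys_indices" and y: "y : ys_indices" and eq: "ys w.u w.v (fst x) (snd x) = ys w.u w.v (fst y) (snd y)" and ne: "x ~= y"
    have "(\<Sum>z\<in>ys_indices. \<delta> (x, y) z * ys w.u w.v (fst z) (snd z)) =
      (\<Sum>z\<in>ys_indices. if z = x then ys w.u w.v (fst z) (snd z) else 0) - (\<Sum>z\<in>ys_indices. if z = y then ys w.u w.v (fst z) (snd z) else 0)"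
      unfolding sum_subtractf[symmetric] by (rule sum.cong[OF refl]) (simp add: \<delta>_def left_diff_distrib)
    also have "... = ys w.u w.v (fst x) (snd x) - ys w.u w.v (fst y) (snd y)" unfolding sum.delta[OF fJ] using x y by (simp only: if_True)
    also have "... = 0" using eq by simp
    finally show False using sums[of "\<delta> (x, y)"] x y ne unfolding \<D>'_def by blast
  qed
  have K: "intermediate (splitting_field (f_F20 b))" using galois_splitting_field by (simp add: galois_field_def)
  have zL: "zs u v k : splitting_field (f_F20 b)" for k
    unfolding zs_def using ys_in_splitting_field[of 0 k] by (auto simp: ys_0 intro!: intermediate_intros[OF K])
  have wL: "w k : splitting_field (f_F20 b)" for k unfolding w_def tvalues_def by (intro intermediate_sum[OF K] intermediate_intros[OF K] zL)
  have cL: "cross w k : splitting_field (f_F20 b)" for k unfolding cross_def by (intro intermediate_intros[OF K] wL)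
  have acts: "acts_by \<phi> w.u w.v (code \<phi>)" if \<phi>: "\<phi> : ac_auts" for \<phi>
  proof (rule w.acts_by_cross[OF ac_auts_rhom[OF \<phi>] code(1)[OF \<phi>]])
    note h = ac_auts_rhom[OF \<phi>]
    show "\<phi> (w k) = w (aff (code \<phi>) k)" for k
      unfolding w_def tvalues_def rhom_sum[OF h] rhom_mult[OF h] rhom_power[OF h] ac_auts_base[OF \<phi>] code_zs[OF \<phi>] ..
  qed
  from transfer_point[OF w.pentagon_cross adm' cL cL acts inj]
  obtain b' where "quintic_point b' w.u w.v" "tschirnhausen_equiv (f_F20 b) (f_F20 b')" by blast
  then show ?thesis using inj sums unfolding \<D>'_def by blast
qed

end

text \<open>With the primed point held fixed, a resolvent root is a linear form in the ten unprimed
  values, to which general position applies.\<close>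

lemma resolvent_root_sum:
  assumes "e = 0 \<or> e = 1"
  shows "resolvent_root u v u' v' (e, A) =
    (\<Sum>x\<in>ys_indices. (if fst x = e then ys u' v' (e + snd A) (aff A (snd x)) else 0) * ys u v (fst x) (snd x))"
proof -
  have "(\<Sum>x\<in>ys_indices. (if fst x = e then ys u' v' (e + snd A) (aff A (snd x)) else 0) * ys u v (fst x) (snd x)) =
    (\<Sum>f\<in>{0, 1}. \<Sum>k\<in>{0..<5}. (if f = e then ys u' v' (e + snd A) (aff A k) else 0) * ys u v f k)"
    unfolding sum.cartesian_product by (rule sum.cong[OF refl]) (simp add: case_prod_beta')
  also have "... = (\<Sum>k\<in>{0..<5}. ys u' v' (e + snd A) (aff A k) * ys u v e k)" using assms by auto
  finally show ?thesis by (simp add: resolvent_root_def mult.commute)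
qed

text \<open>The primed point is chosen first, with ten distinct values. Then any two of the forty
  linear forms differ: by disjoint supports if \<open>e\<close> differs, otherwise because distinct
  affine maps differ at 0 or 1. Finitely many nonzero forms remain to be avoided by the unprimed
  point.\<close>

theorem exists_squarefree_position:
  assumes "quintic_point a u v" "quintic_point a' u' v'"
  shows "\<exists>b b' u1 v1 u2 v2. quintic_point b u1 v1 \<and> quintic_point b' u2 v2 \<and>
    tschirnhausen_equiv (f_F20 a) (f_F20 b) \<and> tschirnhausen_equiv (f_F20 a') (f_F20 b') \<and>
    inj_on (resolvent_root u1 v1 u2 v2) indices"
proof -
  interpret A: quintic_point a u v by fact
  interpret B: quintic_point a' u' v' by fact
  have "\<exists>b' u2 v2. quintic_point b' u2 v2 \<and> tschirnhausen_equiv (f_F20 a') (f_F20 b') \<and>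
    inj_on (\<lambda>x. ys u2 v2 (fst x) (snd x)) ys_indices \<and> (\<forall>d\<in>{}. (\<Sum>x\<in>ys_indices. d x * ys u2 v2 (fst x) (snd x)) ~= 0)"
    by (rule B.exists_general_position) simp_all
  then obtain b' u2 v2 where b': "quintic_point b' u2 v2" "tschirnhausen_equiv (f_F20 a') (f_F20 b')"
    and inj: "inj_on (\<lambda>x. ys u2 v2 (fst x) (snd x)) ys_indices" by blast
  interpret C: quintic_point b' u2 v2 by fact
  define D where "D = (\<lambda>((e, A), (f, B)) x. (if fst x = e then ys u2 v2 (e + snd A) (aff A (snd x)) else 0)
    - (if fst x = f then ys u2 v2 (f + snd B) (aff B (snd x)) else 0))"
  define \<D> where "\<D> = D ` {(x, y) \<in> indices \<times> indices. x ~= y}"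
  have "finite {(x, y) \<in> indices \<times> indices. x ~= y}"
    by (rule finite_subset[of _ "indices \<times> indices"]) (blast, intro finite_cartesian_product finite_indices)
  then have D1: "finite \<D>" unfolding \<D>_def by blast
  have ys0: "ys u2 v2 e k ~= 0" for e k using xs_neq_0[OF C.pent, of k] xs_neq_1[OF C.pent, of k] by (simp add: ys_def)
  have ysD: "even e = even f \<and> k = l" if eq: "ys u2 v2 e k = ys u2 v2 f l" and kl: "k : {0..<5}" "l : {0..<5}" for e f k l proof -
    have m: "ys u2 v2 (e mod 2) k = ys u2 v2 e k" for e k by (rule ys_cong) (simp_all add: even_mod2)
    have i: "(e mod 2, k) : ys_indices" if "k : {0..<5}" for e k :: int using mod2_cases[of e] that by blast
    have "(e mod 2, k) = (f mod 2, l)" by (rule inj_onD[OF inj _ i[OF kl(1)] i[OF kl(2)]]) (simp add: m eq)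
    then have "e mod 2 = f mod 2" "k = l" by simp_all
    then show ?thesis using even_mod2 by metis
  qed
  have D2: "\<exists>x\<in>ys_indices. d x ~= 0" if "d : \<D>" for d proof -
    from that obtain x y where xy: "x : indices" "y : indices" "x ~= y" "d = D (x, y)" unfolding \<D>_def by blast
    obtain e A f B where x: "x = (e, A)" and y: "y = (f, B)" by (cases x, cases y)
    have e: "e = 0 \<or> e = 1" "f = 0 \<or> f = 1" "A : \<A>" "B : \<A>" using xy(1,2) by (auto simp: x y indices_def)
    show ?thesis proof (cases "e = f")
      case False
      then have "d (e, 0) = ys u2 v2 (e + snd A) (aff A 0)" by (simp add: xy(4) x y D_def)
      then show ?thesis using ys0 e(1) by (intro bexI[of _ "(e, 0)"]) auto
    next
      case True
      then have ne: "A ~= B" using xy(3) by (simp add: x y)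
      then obtain k where k: "k = 0 \<or> k = 1" "aff A k ~= aff B k" using aff_eqD[OF e(3,4)] by blast
      have "ys u2 v2 (e + snd A) (aff A k) ~= ys u2 v2 (e + snd B) (aff B k)" using ysD[OF _ aff_range aff_range] k(2) by blast
      then have "d (e, k) ~= 0" by (simp add: xy(4) x y D_def True)
      then show ?thesis using e(1) k(1) by (intro bexI[of _ "(e, k)"]) auto
    qed
  qed
  have "\<exists>b u1 v1. quintic_point b u1 v1 \<and> tschirnhausen_equiv (f_F20 a) (f_F20 b) \<and>
    inj_on (\<lambda>x. ys u1 v1 (fst x) (snd x)) ys_indices \<and> (\<forall>d\<in>\<D>. (\<Sum>x\<in>ys_indices. d x * ys u1 v1 (fst x) (snd x)) ~= 0)"
    by (rule A.exists_general_position[OF D1]) (rule D2)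
  then obtain b u1 v1 where b: "quintic_point b u1 v1" "tschirnhausen_equiv (f_F20 a) (f_F20 b)"
    and sums: "\<forall>d\<in>\<D>. (\<Sum>x\<in>ys_indices. d x * ys u1 v1 (fst x) (snd x)) ~= 0" by blast
  have "inj_on (resolvent_root u1 v1 u2 v2) indices" proof (rule inj_onI, rule ccontr)
    fix x y assume x: "x : indices" and y: "y : indices" and eq: "resolvent_root u1 v1 u2 v2 x = resolvent_root u1 v1 u2 v2 y" and ne: "x ~= y"
    obtain e A f B where x': "x = (e, A)" and y': "y = (f, B)" by (cases x, cases y)
    have e: "e = 0 \<or> e = 1" "f = 0 \<or> f = 1" using x y by (auto simp: x' y' indices_def)
    have "D (x, y) : \<D>" unfolding \<D>_def using x y ne by blast
    moreover have "(\<Sum>z\<in>ys_indices. D (x, y) z * ys u1 v1 (fst z) (snd z)) = resolvent_root u1 v1 u2 v2 x - resolvent_root u1 v1 u2 v2 y"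
      unfolding x' y' resolvent_root_sum[OF e(1)] resolvent_root_sum[OF e(2)] sum_subtractf[symmetric]
      by (rule sum.cong[OF refl]) (simp add: D_def left_diff_distrib)
    ultimately show False using sums eq by simp
  qed
  then show ?thesis using b b' by blast
qed

section \<open>Transfer along Tschirnhausen equivalence and separation of the five cases\<close>

section \<open>The main theorem\<close>

text \<open>Inverting an isomorphism out of \<open>G\<close> uses closure of \<open>G\<close> under
  multiplication, which \<open>Gal_mult_closed\<close> supplies for Galois groups.\<close>

lemma iso_common_source:
  assumes "G \<cong> H" "G \<cong> K" and closed: "!!x y. x : carrier G ==> y : carrier G ==> x \<otimes>\<^bsub>G\<^esub> y : carrier G"
  shows "H \<cong> K"
proof -
  obtain f k where f: "f : hom G H" "bij_betw f (carrier G) (carrier H)" and k: "k : hom G K" "bij_betw k (carrier G) (carrier K)"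
    using assms(1,2) unfolding is_iso_def iso_def by blast
  let ?g = "inv_into (carrier G) f"
  have g: "bij_betw ?g (carrier H) (carrier G)" by (rule bij_betw_inv_into[OF f(2)])
  have gc: "?g x : carrier G" "f (?g x) = x" if "x : carrier H" for x
    using that bij_betw_imp_surj_on[OF f(2)] by (auto intro: inv_into_into f_inv_into_f)
  have gm: "?g (x \<otimes>\<^bsub>H\<^esub> y) = ?g x \<otimes>\<^bsub>G\<^esub> ?g y" if "x : carrier H" "y : carrier H" for x y proof -
    have "f (?g x \<otimes>\<^bsub>G\<^esub> ?g y) = x \<otimes>\<^bsub>H\<^esub> y" using hom_mult[OF f(1)] gc that by simp
    then show ?thesis using inv_into_f_f[OF bij_betw_imp_inj_on[OF f(2)] closed[OF gc(1)[OF that(1)] gc(1)[OF that(2)]]] by simp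
  qed
  have "(\<lambda>x. k (?g x)) : hom H K" proof (rule homI)
    show "k (?g x) : carrier K" if "x : carrier H" for x using hom_in_carrier[OF k(1)] gc(1)[OF that] .
    show "k (?g (x \<otimes>\<^bsub>H\<^esub> y)) = k (?g x) \<otimes>\<^bsub>K\<^esub> k (?g y)" if "x : carrier H" "y : carrier H" for x y
      unfolding gm[OF that] by (rule hom_mult[OF k(1) gc(1)[OF that(1)] gc(1)[OF that(2)]])
  qed
  moreover have "bij_betw (\<lambda>x. k (?g x)) (carrier H) (carrier K)" using bij_betw_trans[OF g k(2)] by (simp add: comp_def)
  ultimately show ?thesis unfolding is_iso_def iso_def by blast
qed

lemma Gal_mult_closed:
  assumes x: "x : carrier (Gal f)" and y: "y : carrier (Gal f)"
  shows "x \<otimes>\<^bsub>Gal f\<^esub> y : carrier (Gal f)"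
proof -
  let ?L = "splitting_field f"
  obtain \<phi> \<psi> where \<phi>: "\<phi> : ac_auts" "x = restrict \<phi> ?L" and \<psi>: "\<psi> : ac_auts" "y = restrict \<psi> ?L"
    using x y unfolding carrier_Gal by blast
  have B: "x : Bij ?L" "y : Bij ?L" using x y by (auto simp: Gal_def Let_def)
  have "x \<otimes>\<^bsub>Gal f\<^esub> y = compose ?L x y" using B by (simp add: Gal_def Let_def BijGroup_def)
  also have "... = restrict (\<phi> \<circ> \<psi>) ?L"
    unfolding \<phi>(2) \<psi>(2) compose_def using ac_auts_splitting_field[OF \<psi>(1)] by (auto simp: restrict_def fun_eq_iff)
  finally show ?thesis unfolding carrier_Gal using ac_auts_comp[OF \<phi>(1) \<psi>(1)] by blast
qed

lemma roots_in_splitting_field: "{x. poly (map_poly to_ac f) x = 0} \<subseteq> splitting_field f"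
  unfolding splitting_field_eq by (rule subset_generated)

lemma intermediate_splitting_field: "intermediate (splitting_field f)" unfolding splitting_field_eq by (rule intermediate_generated)

lemma tschirnhausen_splitting_field:
  assumes "tschirnhausen f g" shows "splitting_field g \<subseteq> splitting_field f"
proof -
  obtain U where U: "map_poly to_ac g = (\<Prod>\<alpha>\<in>#proots (map_poly to_ac f). [:- poly (map_poly to_ac U) \<alpha>, 1:])"
    using assms unfolding tschirnhausen_def by blast
  have "{x. poly (map_poly to_ac g) x = 0} \<subseteq> splitting_field f" proof
    fix x assume "x : {x. poly (map_poly to_ac g) x = 0}"
    then have "(\<Prod>\<alpha>\<in>#proots (map_poly to_ac f). poly [:- poly (map_poly to_ac U) \<alpha>, 1:] x) = 0"
      unfolding U by (simp add: poly_prod_mset image_mset.compositionality comp_def)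
    then obtain \<alpha> where \<alpha>: "\<alpha> \<in># proots (map_poly to_ac f)" "x = poly (map_poly to_ac U) \<alpha>"
      by (auto simp: prod_mset_zero_iff)
    have "map_poly to_ac f ~= 0" using \<alpha>(1) by auto
    then have "\<alpha> : splitting_field f" using \<alpha>(1) roots_in_splitting_field[of f] by auto
    then show "x : splitting_field f" unfolding \<alpha>(2)
      using polys_over_poly[OF intermediate_splitting_field polys_over_base[OF intermediate_splitting_field]] by blast
  qed
  then show ?thesis unfolding splitting_field_eq[of g] by (rule generated_minimal[OF intermediate_splitting_field])
qed

lemma tschirnhausen_equiv_splitting_field: "tschirnhausen_equiv f g ==> splitting_field g = splitting_field f"
  unfolding tschirnhausen_equiv_def using tschirnhausen_splitting_field by blast

lemma splitting_field_mult_mono: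
  assumes "splitting_field f \<subseteq> splitting_field f'" "splitting_field g \<subseteq> splitting_field g'"
  shows "splitting_field (f * g) \<subseteq> splitting_field (f' * g')"
proof -
  have m: "map_poly to_ac (p * q) = map_poly to_ac p * map_poly to_ac q" for p q :: "'a poly" by (rule rhom_mult[OF rhom_map_poly[OF rhom_to_ac]])
  have "splitting_field f' \<subseteq> splitting_field (f' * g')" "splitting_field g' \<subseteq> splitting_field (f' * g')"
    unfolding splitting_field_eq[of f'] splitting_field_eq[of g']
    using roots_in_splitting_field[of "f' * g'"] by (auto intro!: generated_minimal[OF intermediate_splitting_field] simp: m)
  then have "{x. poly (map_poly to_ac (f * g)) x = 0} \<subseteq> splitting_field (f' * g')"
    using assms roots_in_splitting_field[of f] roots_in_splitting_field[of g] by (auto simp: m)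
  then show ?thesis unfolding splitting_field_eq[of "f * g"] by (rule generated_minimal[OF intermediate_splitting_field])
qed

text \<open>The decomposition type as a function of the group order alone; both groups of order 100
  give $10^4$. This allows the type to be compared between equivalent parameters without relating
  their codes.\<close>

definition degrees_of_order :: "nat => nat multiset" where
  "degrees_of_order n = (if n = 400 then {#40#} else if n = 200 then replicate_mset 2 20
     else if n = 100 then replicate_mset 4 10 else replicate_mset 3 10 + replicate_mset 2 4 + {#2#})"

lemma degrees_of_order_simps:
  "degrees_of_order 400 = {#40#}" "degrees_of_order 200 = replicate_mset 2 20" "degrees_of_order 100 = replicate_mset 4 10"
  "degrees_of_order 20 = replicate_mset 3 10 + replicate_mset 2 4 + {#2#}" by (simp_all add: degrees_of_order_def)

context quintic_pair
begin

abbreviation "G \<equiv> Gal (f_F20 b * f_F20 b')"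

lemma five_cases:
  "(G \<cong> SmallGroup_400_205 \<and> L \<inter> L' = range to_ac \<and> orbit_type \<G> {#40#}) \<or>
   (G \<cong> SmallGroup_200_42 \<and> extension_degree 2 (L \<inter> L') \<and> orbit_type \<G> (replicate_mset 2 20)) \<or>
   (G \<cong> SmallGroup_100_11 \<and> extension_degree 4 (L \<inter> L') \<and> orbit_type \<G> (replicate_mset 4 10)) \<or>
   (G \<cong> SmallGroup_100_12 \<and> extension_degree 4 (L \<inter> L') \<and> orbit_type \<G> (replicate_mset 4 10)) \<or>
   (G \<cong> SmallGroup_20_3 \<and> L = L' \<and> orbit_type \<G> (replicate_mset 3 10 + replicate_mset 2 4 + {#2#}))"
proof -
  note tr = iso_trans[OF Gal_product]
  have o: "\<e> : \<A>" "snd \<e> = 0" by (simp_all add: one_F20 carrier_F20)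
  have s4: "snd g mod 4 = snd g" if "g : \<A>" for g using fst_snd_F20[OF that] by auto
  have deg4: "extension_degree 4 (L \<inter> L')" if G1: "!!g. (g, \<e>) : \<G> \<longleftrightarrow> g : \<A> \<and> snd g = 0" proof -
    have "(i + j) mod 4 = j \<longleftrightarrow> i = 0" if "i : {0..<4}" "j : {0..<4}" for i j :: int
      using range4_cases[OF that(1)] range4_cases[OF that(2)] by auto
    from intersection_degree[of "\<lambda>i. i", OF this] G1 show ?thesis by simp
  qed
  have deg2: "extension_degree 2 (L \<inter> L')" if G1: "!!g. (g, \<e>) : \<G> \<longleftrightarrow> g : \<A> \<and> even (snd g)" proof -
    have *: "((i + j) mod 4) mod 2 = j mod 2 \<longleftrightarrow> i mod 2 = 0 mod 2" if "i : {0..<4}" "j : {0..<4}" for i j :: int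
      using range4_cases[OF that(1)] range4_cases[OF that(2)] by auto
    have **: "(g, \<e>) : \<G> \<longleftrightarrow> g : \<A> \<and> snd g mod 2 = 0 mod 2" for g unfolding G1 even_iff_mod_2_eq_zero by simp
    have "{0..<4} = {0, 1, 2, 3 :: int}" by auto
    then have "(\<lambda>i :: int. i mod 2) ` {0..<4} = {0, 1}" by auto
    then have card: "card ((\<lambda>i :: int. i mod 2) ` {0..<4}) = 2" by simp
    show ?thesis using intersection_degree[of "\<lambda>i. i mod 2", OF * **] unfolding card .
  qed
  from sd.classification show ?thesis proof (elim disjE)
    assume *: "\<forall>g h. (g, h) : \<G> \<longleftrightarrow> g : \<A> \<and> h : \<A>"
    note * = *[rule_format]
    show ?thesis using tr[OF pair_group_full[OF *]] intersection_base[OF *] orbit_type_full[OF *] by blast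
  next
    assume *: "\<forall>g h. (g, h) : \<G> \<longleftrightarrow> g : \<A> \<and> h : \<A> \<and> (even (snd g) \<longleftrightarrow> even (snd h))"
    note * = *[rule_format]
    have "(g, \<e>) : \<G> \<longleftrightarrow> g : \<A> \<and> even (snd g)" for g unfolding * o(2) using o(1) by simp
    from deg2[OF this] show ?thesis using tr[OF pair_group_even[OF *]] orbit_type_even[OF *] by blast
  next
    assume *: "\<forall>g h. (g, h) : \<G> \<longleftrightarrow> g : \<A> \<and> h : \<A> \<and> snd g = snd h"
    note * = *[rule_format]
    have "(g, \<e>) : \<G> \<longleftrightarrow> g : \<A> \<and> snd g = 0" for g unfolding * o(2) using o(1) by simp
    from deg4[OF this] show ?thesis using tr[OF pair_group_diagonal[OF *]] orbit_type_diagonal[OF *] by blast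
  next
    assume *: "\<forall>g h. (g, h) : \<G> \<longleftrightarrow> g : \<A> \<and> h : \<A> \<and> (snd g + snd h) mod 4 = 0"
    note * = *[rule_format]
    have "(g, \<e>) : \<G> \<longleftrightarrow> g : \<A> \<and> snd g = 0" for g unfolding * o(2) using o(1) s4[of g] by auto
    from deg4[OF this] show ?thesis using tr[OF pair_group_antidiagonal[OF *]] orbit_type_antidiagonal[OF *] by blast
  next
    assume "\<exists>c\<in>\<A>. \<forall>g h. (g, h) : \<G> \<longleftrightarrow> g : \<A> \<and> h : \<A> \<and> h \<cdot> c = c \<cdot> g"
    then obtain c where c: "c : \<A>"
      and c': "\<forall>g h. (g, h) : \<G> \<longleftrightarrow> g : \<A> \<and> h : \<A> \<and> h \<cdot> c = c \<cdot> g" by (elim bexE)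
    note * = c'[rule_format]
    have "g = \<e> \<longleftrightarrow> h = \<e>" if "(g, h) : \<G>" for g h proof -
      have gh: "g : \<A>" "h : \<A>" "h \<cdot> c = c \<cdot> g" using that unfolding * by blast+
      show ?thesis using gh(3) F.l_cancel_one[OF c gh(1)] F.r_cancel_one[OF c gh(2)] c by auto
    qed
    from intersection_all[OF this] show ?thesis using tr[OF pair_group_graph[OF c *]] orbit_type_graph[OF c *] by blast
  qed
qed

lemma orbit_type_order: "orbit_type \<G> (degrees_of_order (card (carrier G)))" using five_cases
  by (elim disjE conjE) (drule iso_card, simp only: card_SmallGroups degrees_of_order_simps)+

end

text \<open>Good parameters exist by general position. At any good parameters the splitting fields,
  and with them the Galois group and its order, are the original ones, so the degrees are the same
  throughout.\<close>

lemma DT_order: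
  fixes \<iota> :: "'k::field => 'm::field"
  assumes \<iota>: "rhom \<iota>" and A: "quintic_point a u v" and B: "quintic_point a' u' v'"
  shows "DT \<iota> a a' (degrees_of_order (card (carrier (Gal (f_F20 a * f_F20 a')))))"
proof -
  interpret A: quintic_point a u v by (rule A)
  interpret B: quintic_point a' u' v' by (rule B)
  have ex: "\<exists>b b'. admissible b \<and> admissible b' \<and> tschirnhausen_equiv (f_F20 a) (f_F20 b) \<and>
    tschirnhausen_equiv (f_F20 a') (f_F20 b') \<and> squarefree (H_spec \<iota> b b')" proof -
    obtain b b' u1 v1 u2 v2 where b: "quintic_point b u1 v1" "quintic_point b' u2 v2"
      and t: "tschirnhausen_equiv (f_F20 a) (f_F20 b)" "tschirnhausen_equiv (f_F20 a') (f_F20 b')"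
      and inj: "inj_on (resolvent_root u1 v1 u2 v2) indices" using exists_squarefree_position[OF A B] by blast
    interpret P: quintic_pair b b' u1 v1 u2 v2 by (rule quintic_pair.intro[OF b])
    have "squarefree (H_spec \<iota> b b')"
      by (rule P.inj_imp_squarefree[OF H_spec_factorization[OF \<iota> A.inf P.A.adm P.B.adm P.A.pt P.B.pt] inj])
    then show ?thesis using t P.A.adm P.B.adm by blast
  qed
  have all: "factor_degrees (H_spec \<iota> b b') (degrees_of_order (card (carrier (Gal (f_F20 a * f_F20 a')))))"
    if ad: "admissible b" "admissible b'" and t: "tschirnhausen_equiv (f_F20 a) (f_F20 b)" "tschirnhausen_equiv (f_F20 a') (f_F20 b')"
      and sf: "squarefree (H_spec \<iota> b b')" for b b' proof -
    have L: "splitting_field (f_F20 b) = splitting_field (f_F20 a)" "splitting_field (f_F20 b') = splitting_field (f_F20 a')"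
      by (rule tschirnhausen_equiv_splitting_field[OF t(1)], rule tschirnhausen_equiv_splitting_field[OF t(2)])
    have N: "splitting_field (f_F20 b * f_F20 b') = splitting_field (f_F20 a * f_F20 a')"
      by (intro subset_antisym splitting_field_mult_mono) (simp_all add: L)
    obtain u1 v1 where p1: "point_over b u1 v1" using exists_point_over[OF ad(1)] .
    obtain u2 v2 where p2: "point_over b' u2 v2" using exists_point_over[OF ad(2)] .
    have "Gal (f_F20 b) = Gal (f_F20 a)" "Gal (f_F20 b') = Gal (f_F20 a')" unfolding Gal_def L by (rule refl)+
    then have "Gal (f_F20 b) \<cong> F20" "Gal (f_F20 b') \<cong> F20" using A.gal B.gal by simp_all
    then have Q: "quintic_point b u1 v1" "quintic_point b' u2 v2" using A.inf ad p1 p2 by (simp_all add: quintic_point_def)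
    interpret P: quintic_pair b b' u1 v1 u2 v2 by (rule quintic_pair.intro[OF Q])
    have "Gal (f_F20 b * f_F20 b') = Gal (f_F20 a * f_F20 a')" unfolding Gal_def N ..
    then show ?thesis using P.factor_degrees_pair[OF H_spec_factorization[OF \<iota> A.inf ad p1 p2] sf P.orbit_type_order] by simp
  qed
  show ?thesis unfolding DT_def Let_def using ex all by blast
qed

text \<open>The coefficient of $X^2$ recovers $q$, and $q$ is an affine function of $r$ with slope
  $-(p^2+4)$, which admissibility makes invertible.\<close>

lemma g_F20_unique:
  fixes a :: "'m::field \<times> 'm"
  assumes two: "(2 :: 'm) ~= 0" and adm: "admissible a"
  shows "\<exists>!r. f_F20 a = g_F20 (fst a, r)"
proof -
  obtain p q where a: "a = (p, q)" by (cases a)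
  have d: "p\<^sup>2 + 4 ~= 0" using adm by (simp add: admissible_def a)
  have "f_F20 (p, q) = f_F20 (p, q') \<longleftrightarrow> q = q'" for q' proof
    assume "f_F20 (p, q) = f_F20 (p, q')"
    then have "coeff (f_F20 (p, q)) 2 = coeff (f_F20 (p, q')) 2" by simp
    then show "q = q'" by (simp add: f_F20_def numeral_2_eq_2)
  qed simp
  moreover have "q = - (5 * p + 8 * r + 2 * p\<^sup>2 * r) / 2 \<longleftrightarrow> r = - (2 * q + 5 * p) / (2 * (p\<^sup>2 + 4))" for r proof -
    have nz: "2 * (p\<^sup>2 + 4) ~= 0" by (rule no_zero_divisors[OF two d])
    have "q = - (5 * p + 8 * r + 2 * p\<^sup>2 * r) / 2 \<longleftrightarrow> q * 2 = - (5 * p + 8 * r + 2 * p\<^sup>2 * r)" by (rule nonzero_eq_divide_eq[OF two])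
    also have "... \<longleftrightarrow> r * (2 * (p\<^sup>2 + 4)) = - (2 * q + 5 * p)" by (rule diff_eq_diff_eq) (simp add: algebra_simps)
    also have "... \<longleftrightarrow> r = - (2 * q + 5 * p) / (2 * (p\<^sup>2 + 4))" by (rule nonzero_eq_divide_eq[OF nz, symmetric])
    finally show ?thesis .
  qed
  ultimately have "f_F20 a = g_F20 (fst a, r) \<longleftrightarrow> r = - (2 * q + 5 * p) / (2 * (p\<^sup>2 + 4))" for r by (simp add: a g_F20_def)
  then show ?thesis by simp
qed

lemma exactly_one_5I:
  assumes "(A \<and> \<not> B \<and> \<not> C \<and> \<not> D \<and> \<not> E) \<or> (\<not> A \<and> B \<and> \<not> C \<and> \<not> D \<and> \<not> E) \<or>
    (\<not> A \<and> \<not> B \<and> C \<and> \<not> D \<and> \<not> E) \<or> (\<not> A \<and> \<not> B \<and> \<not> C \<and> D \<and> \<not> E) \<or> (\<not> A \<and> \<not> B \<and> \<not> C \<and> \<not> D \<and> E)"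
  shows "exactly_one [A, B, C, D, E]"
proof -
  have *: "i < length [A, B, C, D, E] \<and> [A, B, C, D, E] ! i \<longleftrightarrow>
    (i = 0 \<and> A) \<or> (i = 1 \<and> B) \<or> (i = 2 \<and> C) \<or> (i = 3 \<and> D) \<or> (i = 4 \<and> E)" for i proof -
    have "i = 0 \<or> i = 1 \<or> i = 2 \<or> i = 3 \<or> i = 4 \<or> i \<ge> 5" by linarith
    then show ?thesis by (elim disjE) simp_all
  qed
  from assms show ?thesis proof (elim disjE conjE)
    assume "A" "\<not> B" "\<not> C" "\<not> D" "\<not> E"
    then show ?thesis unfolding exactly_one_def * by (intro ex1I[of _ 0]) simp_all
  next
    assume "\<not> A" "B" "\<not> C" "\<not> D" "\<not> E"
    then show ?thesis unfolding exactly_one_def * by (intro ex1I[of _ 1]) simp_all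
  next
    assume "\<not> A" "\<not> B" "C" "\<not> D" "\<not> E"
    then show ?thesis unfolding exactly_one_def * by (intro ex1I[of _ 2]) simp_all
  next
    assume "\<not> A" "\<not> B" "\<not> C" "D" "\<not> E"
    then show ?thesis unfolding exactly_one_def * by (intro ex1I[of _ 3]) simp_all
  next
    assume "\<not> A" "\<not> B" "\<not> C" "\<not> D" "E"
    then show ?thesis unfolding exactly_one_def * by (intro ex1I[of _ 4]) simp_all
  qed
qed

theorem theorem7p19:
  fixes \<iota> :: "'k::field \<Rightarrow> 'm::field"
    and a a' :: "'m \<times> 'm"
  assumes "\<iota> \<in> ring_hom (ring_of_type_algebra :: 'k ring) (ring_of_type_algebra :: 'm ring)"
    and "infinite (UNIV :: 'm set)"
    and "admissible a" and "admissible a'"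
    and "Gal (f_F20 a) \<cong> F20" and "Gal (f_F20 a') \<cong> F20"
  shows "(let G = Gal (f_F20 a * f_F20 a');
              L = splitting_field (f_F20 a);
              L' = splitting_field (f_F20 a')
          in exactly_one
            [G \<cong> SmallGroup_400_205 \<and> L \<inter> L' = base_field
               \<and> DT \<iota> a a' {#40#},
             G \<cong> SmallGroup_200_42 \<and> extension_degree 2 (L \<inter> L')
               \<and> DT \<iota> a a' (replicate_mset 2 20),
             G \<cong> SmallGroup_100_11 \<and> extension_degree 4 (L \<inter> L')
               \<and> DT \<iota> a a' (replicate_mset 4 10),
             G \<cong> SmallGroup_100_12 \<and> extension_degree 4 (L \<inter> L')
               \<and> DT \<iota> a a' (replicate_mset 4 10),
             G \<cong> SmallGroup_20_3 \<and> L = L'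
               \<and> DT \<iota> a a' (replicate_mset 3 10 + replicate_mset 2 4 + {#2#})])
         \<and> (CHAR('k) \<noteq> 2 \<longrightarrow>
              (\<exists>!r. f_F20 a = g_F20 (fst a, r)) \<and> (\<exists>!r'. f_F20 a' = g_F20 (fst a', r')))"
proof -
  have \<iota>: "rhom \<iota>" using ring_hom_one[OF assms(1)] ring_hom_add[OF assms(1)] ring_hom_mult[OF assms(1)]
    by (intro rhomI) (simp_all add: ring_of_type_algebra_def)
  obtain u v where pt: "point_over a u v" using exists_point_over[OF assms(3)] .
  obtain u' v' where pt': "point_over a' u' v'" using exists_point_over[OF assms(4)] .
  have Q: "quintic_point a u v" "quintic_point a' u' v'" using assms(2-6) pt pt' by (simp_all add: quintic_point_def)
  interpret P: quintic_pair a a' u v u' v' by (rule quintic_pair.intro[OF Q])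
  have dt: "DT \<iota> a a' (degrees_of_order n)" if "card (carrier P.G) = n" for n using DT_order[OF \<iota> Q] that by simp
  note card = iso_card[of P.G] and no = iso_common_source[OF _ _ Gal_mult_closed]
  \<comment> \<open>The orders 400, 200, 100, 100, 20 separate all the cases except this one
    pair.\<close>
  have ne: "\<not> (P.G \<cong> SmallGroup_100_11 \<and> P.G \<cong> SmallGroup_100_12)" using no SmallGroup_100_not_iso by blast
  have c: "P.G \<cong> SmallGroup_400_205 ==> card (carrier P.G) = 400" "P.G \<cong> SmallGroup_200_42 ==> card (carrier P.G) = 200"
    "P.G \<cong> SmallGroup_100_11 ==> card (carrier P.G) = 100" "P.G \<cong> SmallGroup_100_12 ==> card (carrier P.G) = 100"
    "P.G \<cong> SmallGroup_20_3 ==> card (carrier P.G) = 20" using iso_card card_SmallGroups by metis+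
  have n: "(400 :: nat) ~= 200" "(400 :: nat) ~= 100" "(400 :: nat) ~= 20" "(200 :: nat) ~= 100" "(200 :: nat) ~= 20" "(100 :: nat) ~= 20" by simp_all
  note dts = dt[OF c(1), unfolded degrees_of_order_simps] dt[OF c(2), unfolded degrees_of_order_simps]
    dt[OF c(3), unfolded degrees_of_order_simps] dt[OF c(4), unfolded degrees_of_order_simps] dt[OF c(5), unfolded degrees_of_order_simps]
  have main: "exactly_one
     [P.G \<cong> SmallGroup_400_205 \<and> P.L \<inter> P.L' = base_field \<and> DT \<iota> a a' {#40#},
      P.G \<cong> SmallGroup_200_42 \<and> extension_degree 2 (P.L \<inter> P.L') \<and> DT \<iota> a a' (replicate_mset 2 20),
      P.G \<cong> SmallGroup_100_11 \<and> extension_degree 4 (P.L \<inter> P.L') \<and> DT \<iota> a a' (replicate_mset 4 10),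
      P.G \<cong> SmallGroup_100_12 \<and> extension_degree 4 (P.L \<inter> P.L') \<and> DT \<iota> a a' (replicate_mset 4 10),
      P.G \<cong> SmallGroup_20_3 \<and> P.L = P.L' \<and> DT \<iota> a a' (replicate_mset 3 10 + replicate_mset 2 4 + {#2#})]"
    (is "exactly_one [?A, ?B, ?C, ?D, ?E]") proof -
    have "(?A \<and> \<not> ?B \<and> \<not> ?C \<and> \<not> ?D \<and> \<not> ?E) \<or> (\<not> ?A \<and> ?B \<and> \<not> ?C \<and> \<not> ?D \<and> \<not> ?E) \<or>
      (\<not> ?A \<and> \<not> ?B \<and> ?C \<and> \<not> ?D \<and> \<not> ?E) \<or> (\<not> ?A \<and> \<not> ?B \<and> \<not> ?C \<and> ?D \<and> \<not> ?E) \<or> (\<not> ?A \<and> \<not> ?B \<and> \<not> ?C \<and> \<not> ?D \<and> ?E)"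
      using P.five_cases proof (elim disjE conjE)
    assume iso: "P.G \<cong> SmallGroup_400_205" and int: "P.L \<inter> P.L' = range to_ac"
    have "\<not> P.G \<cong> SmallGroup_200_42" "\<not> P.G \<cong> SmallGroup_100_11" "\<not> P.G \<cong> SmallGroup_100_12" "\<not> P.G \<cong> SmallGroup_20_3"
      using iso c n ne by metis+
    then show ?thesis using iso int dts(1)[OF iso] by blast
  next
    assume iso: "P.G \<cong> SmallGroup_200_42" and int: "extension_degree 2 (P.L \<inter> P.L')"
    have "\<not> P.G \<cong> SmallGroup_400_205" "\<not> P.G \<cong> SmallGroup_100_11" "\<not> P.G \<cong> SmallGroup_100_12" "\<not> P.G \<cong> SmallGroup_20_3"
      using iso c n ne by metis+
    then show ?thesis using iso int dts(2)[OF iso] by blast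
  next
    assume iso: "P.G \<cong> SmallGroup_100_11" and int: "extension_degree 4 (P.L \<inter> P.L')"
    have "\<not> P.G \<cong> SmallGroup_400_205" "\<not> P.G \<cong> SmallGroup_200_42" "\<not> P.G \<cong> SmallGroup_100_12" "\<not> P.G \<cong> SmallGroup_20_3"
      using iso c n ne by metis+
    then show ?thesis using iso int dts(3)[OF iso] by blast
  next
    assume iso: "P.G \<cong> SmallGroup_100_12" and int: "extension_degree 4 (P.L \<inter> P.L')"
    have "\<not> P.G \<cong> SmallGroup_400_205" "\<not> P.G \<cong> SmallGroup_200_42" "\<not> P.G \<cong> SmallGroup_100_11" "\<not> P.G \<cong> SmallGroup_20_3"
      using iso c n ne by metis+
    then show ?thesis using iso int dts(4)[OF iso] by blast
  next
    assume iso: "P.G \<cong> SmallGroup_20_3" and int: "P.L = P.L'"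
    have "\<not> P.G \<cong> SmallGroup_400_205" "\<not> P.G \<cong> SmallGroup_200_42" "\<not> P.G \<cong> SmallGroup_100_11" "\<not> P.G \<cong> SmallGroup_100_12"
      using iso c n ne by metis+
    then show ?thesis using iso int dts(5)[OF iso] by blast
  qed
    then show ?thesis by (rule exactly_one_5I)
  qed
  have two: "(2 :: 'm) ~= 0" if char: "CHAR('k) ~= 2" proof
    assume "(2 :: 'm) = 0"
    then have "\<iota> 2 = \<iota> 0" by (simp add: rhom_numeral[OF \<iota>] rhom_0[OF \<iota>])
    then have "of_nat 2 = (0 :: 'k)" using rhom_eq_iff[OF \<iota>] by simp
    then have "CHAR('k) dvd 2" by (simp only: of_nat_eq_0_iff_char_dvd)
    then have "CHAR('k) = 1 \<or> CHAR('k) = 2" using prime_nat_iff two_is_prime_nat by blast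
    then show False using char CHAR_not_1'[where 'a = 'k] by auto
  qed
  show ?thesis unfolding Let_def using main two g_F20_unique assms(3,4) by blast
qed

end
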